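(* Let $H$ be a seminormal $v$-noetherian weakly Krull monoid with $\emptyset \ne \mathfrak f = (H : \widehat H) \subsetneq H$ such that $H_{\mathfrak p}$ is finitely primary of rank $s_{\mathfrak p}$ for each $\mathfrak{p}\in\mathfrak{X}(H)$. Let $\pi \colon \mathfrak X(\widehat H) \to \mathfrak X(H)$ be the natural map defined by $\pi(\mathfrak P) = \mathfrak P \cap H$ for all $\mathfrak P \in \mathfrak X(\widehat H)$, and let $\overline \vartheta \colon \mathcal C_v(H) \to \mathcal C_v(\widehat H)$ be the epimorphism given by $\overline\vartheta([\mathfrak a])=[\mathfrak a_{v(\widehat H)}]$ for $\mathfrak a\in\mathcal I_v^*(H)$. 1. (a) If $\pi$ is bijective, then $\mathsf c (\mathcal I_v^* (H)) = 2$. (b) Suppose $\pi$ is not bijective. Then $\mathcal U_k ( \mathcal I_v^* (H) ) = \mathbb N_{\ge 2}$ for all $k \ge 2$, $\Delta ( \mathcal I_v^* (H) ) = \{1\}$, and $\mathsf c ( \mathcal I_v^* (H) ) = \mathsf c_{\mathrm{adj}} ( \mathcal I_v^* (H) ) = 3$. If there is precisely one $\mathfrak p \in \mathfrak X (H)$ with $s_{\mathfrak p} > 1$, then $\mathsf c_{\mathrm{mon}} ( \mathcal I_v^* (H) ) =3$, and otherwise $\mathsf c_{\mathrm{mon}} ( \mathcal I_v^* (H) ) =5$. 2. Suppose that $G = \mathcal C_v (H)$ is finite, and that every class contains a $\mathfrak p \in \mathfrak X (H)$ with $\mathfrak p \not\supset \mathfrak f$. (a) Suppose that $\pi$ is bijective.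 (i) $\mathcal U_k (H)$ is a finite interval for all $k \ge 2$. (ii) Suppose that $\overline{\vartheta}\colon \mathcal{C}_v(H)\rightarrow \mathcal{C}_v(\widehat{H})$ is an isomorphism. Then there is a transfer homomorphism $\theta \colon H \to \mathcal B ( G )$ such that $\mathsf{c}(H,\theta)\leq 2$. Thus $\mathcal L (H) = \mathcal L ( \mathcal B(G) )$, and if $|G| \ge 3$, then $\mathsf c (H) = \mathsf c ( \mathcal B(G) )$ and $\mathsf c_{\mathrm{mon}} (H) = \mathsf c_{\mathrm{mon}} ( \mathcal B(G) )$. (b) Suppose that $\pi$ is not bijective. Then, for all $\ell \ge 2$ and $k\in \{2,3\}$, we have $\ell \in \mathcal U_k (H)$ or $\ell+1 \in \mathcal U_k (H)$ and, for all $k\geq 4$, we have $\mathbb N_{\ge 4} \subset \mathcal U_k (H)\subset\mathbb N_{\ge 2}$.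
   Context: A monoid is a commutative cancellative semigroup with unit element. For a monoid $H$: $H^\times$ is its group of units, $H_{\mathrm{red}}=H/H^\times$, $\mathsf q(H)$ its quotient group, $\mathcal A(H)$ its set of atoms (irreducible elements), $\mathcal F(P)$ the free abelian monoid with basis $P$ (with length function $|\cdot|$). Ideals. An ideal ($s$-ideal) of $H$ is a subset $A\subset H$ with $AH=A$ (possibly empty); prime ideals are defined as usual. $\mathfrak X(H)$ is the set of minimal non-empty prime $s$-ideals. For $A,B\subset \mathsf q(H)$, $(A:B)=\{x\in\mathsf q(H)\mid xB\subset A\}$, $A^{-1}=(H:A)$, $A_v=(A^{-1})^{-1}$; $A\subset H$ is a $v$-ideal if $A=A_v$. $H$ is $v$-noetherian if it satisfies the ascending chain condition on $v$-ideals. $\mathcal I_v^*(H)$ is the monoid of $v$-invertible $v$-ideals $\mathfrak a$ (i.e. $(\mathfrak a\mathfrak a^{-1})_v=H$) with multiplication $(\mathfrak a,\mathfrak b)\mapsto(\mathfrak a\mathfrak b)_v$; $\mathcal C_v(H)$ is $\mathsf q(\mathcal I_v^*(H))$ modulo the subgroup $\{aH\mid a\in\mathsf q(H)\}$, and $[\mathfrak a]$ is the class of $\mathfrak a$. $H_{\mathfrak p}=(H\setminus\mathfrak p)^{-1}H$. $\widehat H=\{x\in\mathsf q(H)\mid \exists c\in H\ \forall n\in\mathbb N:\ cx^n\in H\}$ is the complete integral closure; $\mathfrak a_{v(\widehat H)}=(\widehat H:(\widehat H:\mathfrak a))$. $H$ is seminormal if $x\in\mathsf q(H)$, $x^2,x^3\in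 H$ imply $x\in H$. $H$ is weakly Krull if $H=\bigcap_{\mathfrak p\in\mathfrak X(H)}H_{\mathfrak p}$ and $\{\mathfrak p\in\mathfrak X(H)\mid a\in\mathfrak p\}$ is finite for all $a\in H$. Under the hypotheses of the theorem, each $\mathfrak p\in\mathfrak X(H)$ with $\mathfrak p\not\supset\mathfrak f$ is a $v$-invertible $v$-ideal, so it has a class in $\mathcal C_v(H)$. A monoid $D$ is finitely primary of rank $s$ ($s\in\mathbb N$) if for some $\alpha\in\mathbb N$ it is a submonoid of a factorial monoid $F=F^\times\times[q_1,\ldots,q_s]$ with $s$ pairwise non-associated primes $q_1,\ldots,q_s$ such that $D\setminus D^\times\subset q_1\cdots q_sF$ and $(q_1\cdots q_s)^\alpha F\subset D$. Factorizations ($H$ atomic, i.e. every non-unit is a product of atoms; all monoids in the theorem to which arithmetic invariants are applied are atomic). $\mathsf Z(H)=\mathcal F(\mathcal A(H_{\mathrm{red}}))$, $\mathsf Z(a)\subset\mathsf Z(H)$ is the set of factorizations of $aH^\times$, $\mathsf Z_k(a)$ those of length $k$, $\mathsf L(a)=\{|z|\mid z\in\mathsf Z(a)\}$, $\mathcal L(H)=\{\mathsf L(a)\mid a\in H\}$. For $H\ne H^\times$, $\mathcal U_k(H)$ is the union of all $L\in\mathcal L(H)$ with $k\in L$ (and $\mathcal U_k(H)=\{k\}$ if $H=H^\times$). $\Delta(L)$ is the set of differences of consecutive elements of $L$, $\Delta(H)=\bigcup_{L\in\mathcal L(H)}\Delta(L)$. An interval means a set $\{x\in\mathbb Z\mid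 a\le x\le b\}$. For $z,z'\in\mathsf Z(H)$, $\mathsf d(z,z')=\max\{|z\gcd(z,z')^{-1}|,|z'\gcd(z,z')^{-1}|\}$. A (monotone) $N$-chain in $\mathsf Z(a)$ is a finite sequence $z_0,\ldots,z_k\in\mathsf Z(a)$ with $\mathsf d(z_{i-1},z_i)\le N$ for all $i$ (and $|z_0|\le\cdots\le|z_k|$ or $|z_0|\ge\cdots\ge|z_k|$). $\mathsf c(a)$ (resp. $\mathsf c_{\mathrm{mon}}(a)$) is the smallest $N\in\mathbb N_0\cup\{\infty\}$ such that any two $z,z'\in\mathsf Z(a)$ can be connected by an $N$-chain (resp. monotone $N$-chain); $\mathsf c_{\mathrm{adj}}(a)=\sup\{\mathsf d(\mathsf Z_k(a),\mathsf Z_l(a))\mid k,l\in\mathsf L(a)\text{ consecutive}\}$ where $\mathsf d(X,Y)=\min\{\mathsf d(x,y)\mid x\in X,y\in Y\}$. $\mathsf c(H),\mathsf c_{\mathrm{mon}}(H),\mathsf c_{\mathrm{adj}}(H)$ are the suprema over all $a\in H$. A homomorphism $\theta\colon H\to B$ of atomic monoids is a transfer homomorphism if (T1) $B=\theta(H)B^\times$ and $\theta^{-1}(B^\times)=H^\times$; (T2) if $u\in H$, $b,c\in B$ and $\theta(u)=bc$, then there are $v,w\in H$ with $u=vw$ and $\theta(v)\in bB^\times$, $\theta(w)\in cB^\times$. It induces $\overline\theta\colon\mathsf Z(H)\to\mathsf Z(B)$ with $\overline\theta(uH^\times)=\theta(u)B^\times$ for atoms $u$. $\mathsf c(H,\theta)$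 is the smallest $N\in\mathbb N_0\cup\{\infty\}$ such that for all $a\in H$ any $z,z'\in\mathsf Z(a)$ with $\overline\theta(z)=\overline\theta(z')$ can be connected by an $N$-chain in $\mathsf Z(a)\cap\overline\theta^{-1}(\overline\theta(z))$. For an additive abelian group $G$, $\mathcal B(G)=\{S\in\mathcal F(G)\mid\sigma(S)=0\}$, where $\sigma\colon\mathcal F(G)\to G$ is the homomorphism with $\sigma(g)=g$ for $g\in G$ (monoid of zero-sum sequences). *)

theory Defs
  imports
    "HOL-Algebra.Divisibility"
    "HOL-Algebra.FiniteProduct"
    "HOL-Library.Multiset"
    "HOL-Library.Extended_Nat"
begin

section \<open>Monoids inside their quotient group\<close>

text \<open>
  A (commutative, cancellative) monoid \<open>H\<close> is given as a submonoid of its quotient group \<open>Q\<close>, so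
  that fractional ideals, overmonoids and localizations of \<open>H\<close> are plain subsets of
  \<open>carrier Q\<close>. The monoid \<open>H\<close> as a structure of its own is \<open>submon Q H\<close>.
  Groups are written multiplicatively throughout.
\<close>

abbreviation submon :: "('a, 'b) monoid_scheme \<Rightarrow> 'a set \<Rightarrow> ('a, 'b) monoid_scheme" where
  "submon Q H \<equiv> Q\<lparr>carrier := H\<rparr>"

definition is_quotient_group :: "('a, 'b) monoid_scheme \<Rightarrow> 'a set \<Rightarrow> bool" where
  "is_quotient_group Q H \<longleftrightarrow>
     comm_group Q \<and> submonoid H Q \<and>
     carrier Q = {a \<otimes>\<^bsub>Q\<^esub> inv\<^bsub>Q\<^esub> b | a b. a \<in> H \<and> b \<in> H}"


section \<open>Ideals\<close>

text \<open>The empty set is an ideal, and also a prime ideal.\<close>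

definition s_ideal :: "('a, 'b) monoid_scheme \<Rightarrow> 'a set \<Rightarrow> 'a set \<Rightarrow> bool" where
  "s_ideal Q H A \<longleftrightarrow> A \<subseteq> H \<and> A <#>\<^bsub>Q\<^esub> H = A"

definition prime_s_ideal :: "('a, 'b) monoid_scheme \<Rightarrow> 'a set \<Rightarrow> 'a set \<Rightarrow> bool" where
  "prime_s_ideal Q H P \<longleftrightarrow>
     s_ideal Q H P \<and> P \<noteq> H \<and>
     (\<forall>a\<in>H. \<forall>b\<in>H. a \<otimes>\<^bsub>Q\<^esub> b \<in> P \<longrightarrow> a \<in> P \<or> b \<in> P)"

definition minimal_primes :: "('a, 'b) monoid_scheme \<Rightarrow> 'a set \<Rightarrow> 'a set set" where
  "minimal_primes Q H =
     {P. prime_s_ideal Q H P \<and> P \<noteq> {} \<and>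
         (\<forall>P'. prime_s_ideal Q H P' \<and> P' \<noteq> {} \<and> P' \<subseteq> P \<longrightarrow> P' = P)}"

definition colon :: "('a, 'b) monoid_scheme \<Rightarrow> 'a set \<Rightarrow> 'a set \<Rightarrow> 'a set" where
  "colon Q A B = {x \<in> carrier Q. x <#\<^bsub>Q\<^esub> B \<subseteq> A}"

definition ideal_inv :: "('a, 'b) monoid_scheme \<Rightarrow> 'a set \<Rightarrow> 'a set \<Rightarrow> 'a set" where
  "ideal_inv Q H A = colon Q H A"

definition v_closure :: "('a, 'b) monoid_scheme \<Rightarrow> 'a set \<Rightarrow> 'a set \<Rightarrow> 'a set" where
  "v_closure Q H A = ideal_inv Q H (ideal_inv Q H A)"

definition v_ideal :: "('a, 'b) monoid_scheme \<Rightarrow> 'a set \<Rightarrow> 'a set \<Rightarrow> bool" where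
  "v_ideal Q H A \<longleftrightarrow> A \<subseteq> H \<and> v_closure Q H A = A"

definition v_noetherian :: "('a, 'b) monoid_scheme \<Rightarrow> 'a set \<Rightarrow> bool" where
  "v_noetherian Q H \<longleftrightarrow>
     (\<forall>A :: nat \<Rightarrow> 'a set. (\<forall>n. v_ideal Q H (A n)) \<and> (\<forall>n. A n \<subseteq> A (Suc n)) \<longrightarrow>
        (\<exists>N. \<forall>n\<ge>N. A n = A N))"

definition v_mult :: "('a, 'b) monoid_scheme \<Rightarrow> 'a set \<Rightarrow> 'a set \<Rightarrow> 'a set \<Rightarrow> 'a set" where
  "v_mult Q H A B = v_closure Q H (A <#>\<^bsub>Q\<^esub> B)"

definition inv_v_ideals :: "('a, 'b) monoid_scheme \<Rightarrow> 'a set \<Rightarrow> 'a set monoid" where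
  "inv_v_ideals Q H =
     \<lparr>carrier = {A. v_ideal Q H A \<and> v_mult Q H A (ideal_inv Q H A) = H},
      mult = v_mult Q H, one = H\<rparr>"

text \<open>
  The quotient group of \<open>inv_v_ideals Q H\<close>, realized by the fractional ideals
  \<open>(A B\<^sup>-\<^sup>1)\<^sub>v\<close>; in this form it contains the principal fractional
  ideals \<open>a H\<close> for all \<open>a\<close> in the quotient group of \<open>H\<close>.
\<close>

definition frac_v_ideals :: "('a, 'b) monoid_scheme \<Rightarrow> 'a set \<Rightarrow> 'a set monoid" where
  "frac_v_ideals Q H =
     \<lparr>carrier = {v_mult Q H A (ideal_inv Q H B) | A B.
                  A \<in> carrier (inv_v_ideals Q H) \<and> B \<in> carrier (inv_v_ideals Q H)},
      mult = v_mult Q H, one = H\<rparr>"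

definition principal_ideals :: "('a, 'b) monoid_scheme \<Rightarrow> 'a set \<Rightarrow> 'a set set" where
  "principal_ideals Q H = {a <#\<^bsub>Q\<^esub> H | a. a \<in> carrier Q}"

definition v_class_group :: "('a, 'b) monoid_scheme \<Rightarrow> 'a set \<Rightarrow> 'a set set monoid" where
  "v_class_group Q H = frac_v_ideals Q H Mod principal_ideals Q H"

definition v_class :: "('a, 'b) monoid_scheme \<Rightarrow> 'a set \<Rightarrow> 'a set \<Rightarrow> 'a set set" where
  "v_class Q H A = principal_ideals Q H #>\<^bsub>frac_v_ideals Q H\<^esub> A"


section \<open>Overmonoids and classes of monoids\<close>

definition localization :: "('a, 'b) monoid_scheme \<Rightarrow> 'a set \<Rightarrow> 'a set \<Rightarrow> 'a set" where
  "localization Q H P = {a \<otimes>\<^bsub>Q\<^esub> inv\<^bsub>Q\<^esub> t | a t. a \<in> H \<and> t \<in> H - P}"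

definition complete_int_closure :: "('a, 'b) monoid_scheme \<Rightarrow> 'a set \<Rightarrow> 'a set" where
  "complete_int_closure Q H =
     {x \<in> carrier Q. \<exists>c\<in>H. \<forall>n::nat. c \<otimes>\<^bsub>Q\<^esub> (x [^]\<^bsub>Q\<^esub> n) \<in> H}"

definition conductor :: "('a, 'b) monoid_scheme \<Rightarrow> 'a set \<Rightarrow> 'a set" where
  "conductor Q H = colon Q H (complete_int_closure Q H)"

definition seminormal :: "('a, 'b) monoid_scheme \<Rightarrow> 'a set \<Rightarrow> bool" where
  "seminormal Q H \<longleftrightarrow>
     (\<forall>x\<in>carrier Q. x [^]\<^bsub>Q\<^esub> (2::nat) \<in> H \<and> x [^]\<^bsub>Q\<^esub> (3::nat) \<in> H \<longrightarrow> x \<in> H)"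

text \<open>Intersecting with \<open>carrier Q\<close> only matters if there are no minimal primes.\<close>

definition weakly_Krull :: "('a, 'b) monoid_scheme \<Rightarrow> 'a set \<Rightarrow> bool" where
  "weakly_Krull Q H \<longleftrightarrow>
     H = carrier Q \<inter> (\<Inter>P\<in>minimal_primes Q H. localization Q H P) \<and>
     (\<forall>a\<in>H. finite {P \<in> minimal_primes Q H. a \<in> P})"

text \<open>
  If \<open>p\<^sup>\<alpha> F \<subseteq> D \<subseteq> F\<close> with \<open>p \<in> F\<close> the product of the primes, then
  every \<open>x \<in> F\<close> is the quotient of \<open>p\<^sup>\<alpha> x\<close> and \<open>p\<^sup>\<alpha>\<close>, both in \<open>D\<close>. Hence \<open>F\<close> always lies in the
  quotient group of \<open>D\<close>, and it is no restriction to look for \<open>F\<close> inside \<open>Q\<close>.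
\<close>

definition finitely_primary :: "('a, 'b) monoid_scheme \<Rightarrow> 'a set \<Rightarrow> nat \<Rightarrow> bool" where
  "finitely_primary Q D s \<longleftrightarrow>
     s \<ge> 1 \<and> submonoid D Q \<and>
     (\<exists>F (q :: nat \<Rightarrow> 'a) (\<alpha> :: nat).
        \<alpha> \<ge> 1 \<and> submonoid F Q \<and> D \<subseteq> F \<and>
        factorial_monoid (submon Q F) \<and>
        (\<forall>i<s. q i \<in> F \<and> prime (submon Q F) (q i)) \<and>
        (\<forall>i<s. \<forall>j<s. i \<noteq> j \<longrightarrow> \<not> q i \<sim>\<^bsub>submon Q F\<^esub> q j) \<and>
        (\<forall>x\<in>F. \<exists>u\<in>Units (submon Q F). \<exists>k :: nat \<Rightarrow> nat.
            x = u \<otimes>\<^bsub>Q\<^esub> finprod Q (\<lambda>i. q i [^]\<^bsub>Q\<^esub> k i) {..<s}) \<and>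
        D - Units (submon Q D) \<subseteq> finprod Q q {..<s} <#\<^bsub>Q\<^esub> F \<and>
        (finprod Q q {..<s} [^]\<^bsub>Q\<^esub> \<alpha>) <#\<^bsub>Q\<^esub> F \<subseteq> D)"

text \<open>
  The map \<open>[A] \<mapsto> [A\<^sub>v]\<close>, where the second \<open>v\<close>-closure is taken with respect to the
  complete integral closure. Every class of \<open>v_class_group Q H\<close> has a representative in
  \<open>inv_v_ideals Q H\<close>, and the set to which \<open>the_elem\<close> is applied is a singleton.
\<close>

definition v_class_map :: "('a, 'b) monoid_scheme \<Rightarrow> 'a set \<Rightarrow> 'a set set \<Rightarrow> 'a set set" where
  "v_class_map Q H g =
     the_elem ((\<lambda>A. v_class Q (complete_int_closure Q H) (v_closure Q (complete_int_closure Q H) A))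
        ` {A \<in> carrier (inv_v_ideals Q H). v_class Q H A = g})"


section \<open>Factorizations\<close>

definition atoms :: "('a, 'b) monoid_scheme \<Rightarrow> 'a set" where
  "atoms M = {a \<in> carrier M. irreducible M a}"

definition atomic_monoid :: "('a, 'b) monoid_scheme \<Rightarrow> bool" where
  "atomic_monoid M \<longleftrightarrow>
     comm_monoid_cancel M \<and>
     (\<forall>a \<in> carrier M - Units M. \<exists>as. set as \<subseteq> carrier M \<and> factors M as a)"

definition reduced :: "('a, 'b) monoid_scheme \<Rightarrow> 'a set monoid" where
  "reduced M =
     \<lparr>carrier = {a <#\<^bsub>M\<^esub> Units M | a. a \<in> carrier M},
      mult = (\<lambda>X Y. X <#>\<^bsub>M\<^esub> Y), one = Units M\<rparr>"

text \<open>Elements of free abelian monoids are multisets; \<open>mset_prod M S\<close> is their value in \<open>M\<close>.\<close>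

definition mset_prod :: "('a, 'b) monoid_scheme \<Rightarrow> 'a multiset \<Rightarrow> 'a" where
  "mset_prod M S = finprod M (\<lambda>g. g [^]\<^bsub>M\<^esub> count S g) (set_mset S)"

definition fact_monoid :: "('a, 'b) monoid_scheme \<Rightarrow> 'a set multiset set" where
  "fact_monoid M = {z. set_mset z \<subseteq> atoms (reduced M)}"

definition facts_of :: "('a, 'b) monoid_scheme \<Rightarrow> 'a \<Rightarrow> 'a set multiset set" where
  "facts_of M a = {z \<in> fact_monoid M. mset_prod (reduced M) z = a <#\<^bsub>M\<^esub> Units M}"

definition facts_of_length :: "('a, 'b) monoid_scheme \<Rightarrow> nat \<Rightarrow> 'a \<Rightarrow> 'a set multiset set" where
  "facts_of_length M k a = {z \<in> facts_of M a. size z = k}"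

definition length_set :: "('a, 'b) monoid_scheme \<Rightarrow> 'a \<Rightarrow> nat set" where
  "length_set M a = size ` facts_of M a"

definition length_sets :: "('a, 'b) monoid_scheme \<Rightarrow> nat set set" where
  "length_sets M = length_set M ` carrier M"

definition unions_of_lengths :: "('a, 'b) monoid_scheme \<Rightarrow> nat \<Rightarrow> nat set" where
  "unions_of_lengths M k =
     (if carrier M = Units M then {k} else \<Union>{L \<in> length_sets M. k \<in> L})"

definition consecutive_in :: "nat set \<Rightarrow> nat \<Rightarrow> nat \<Rightarrow> bool" where
  "consecutive_in L k l \<longleftrightarrow> k \<in> L \<and> l \<in> L \<and> k < l \<and> (\<forall>m\<in>L. \<not> (k < m \<and> m < l))"

definition delta_of_set :: "nat set \<Rightarrow> nat set" where
  "delta_of_set L = {l - k | k l. consecutive_in L k l}"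

definition delta_set :: "('a, 'b) monoid_scheme \<Rightarrow> nat set" where
  "delta_set M = (\<Union>L\<in>length_sets M. delta_of_set L)"


section \<open>Distances, chains and catenary degrees\<close>

definition fact_dist :: "'c multiset \<Rightarrow> 'c multiset \<Rightarrow> nat" where
  "fact_dist z z' = max (size (z - (z \<inter># z'))) (size (z' - (z \<inter># z')))"

definition fact_set_dist :: "'c multiset set \<Rightarrow> 'c multiset set \<Rightarrow> enat" where
  "fact_set_dist X Y = (INF x\<in>X. INF y\<in>Y. enat (fact_dist x y))"

definition is_chain :: "enat \<Rightarrow> 'c multiset set \<Rightarrow> 'c multiset list \<Rightarrow> bool" where
  "is_chain N X zs \<longleftrightarrow>
     zs \<noteq> [] \<and> set zs \<subseteq> X \<and>
     (\<forall>i. Suc i < length zs \<longrightarrow> enat (fact_dist (zs ! i) (zs ! Suc i)) \<le> N)"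

definition is_monotone_chain :: "enat \<Rightarrow> 'c multiset set \<Rightarrow> 'c multiset list \<Rightarrow> bool" where
  "is_monotone_chain N X zs \<longleftrightarrow>
     is_chain N X zs \<and> (sorted_wrt (\<le>) (map size zs) \<or> sorted_wrt (\<ge>) (map size zs))"

definition connected_by :: "('c multiset list \<Rightarrow> bool) \<Rightarrow> 'c multiset \<Rightarrow> 'c multiset \<Rightarrow> bool" where
  "connected_by C z z' \<longleftrightarrow> (\<exists>zs. C zs \<and> hd zs = z \<and> last zs = z')"

definition catenary_at :: "('a, 'b) monoid_scheme \<Rightarrow> 'a \<Rightarrow> enat" where
  "catenary_at M a =
     (LEAST N. \<forall>z\<in>facts_of M a. \<forall>z'\<in>facts_of M a. connected_by (is_chain N (facts_of M a)) z z')"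

definition mon_catenary_at :: "('a, 'b) monoid_scheme \<Rightarrow> 'a \<Rightarrow> enat" where
  "mon_catenary_at M a =
     (LEAST N. \<forall>z\<in>facts_of M a. \<forall>z'\<in>facts_of M a.
        connected_by (is_monotone_chain N (facts_of M a)) z z')"

definition adj_catenary_at :: "('a, 'b) monoid_scheme \<Rightarrow> 'a \<Rightarrow> enat" where
  "adj_catenary_at M a =
     Sup {fact_set_dist (facts_of_length M k a) (facts_of_length M l a) | k l.
            consecutive_in (length_set M a) k l}"

definition catenary_degree :: "('a, 'b) monoid_scheme \<Rightarrow> enat" where
  "catenary_degree M = (SUP a\<in>carrier M. catenary_at M a)"

definition mon_catenary_degree :: "('a, 'b) monoid_scheme \<Rightarrow> enat" where
  "mon_catenary_degree M = (SUP a\<in>carrier M. mon_catenary_at M a)"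

definition adj_catenary_degree :: "('a, 'b) monoid_scheme \<Rightarrow> enat" where
  "adj_catenary_degree M = (SUP a\<in>carrier M. adj_catenary_at M a)"


section \<open>Transfer homomorphisms and zero-sum sequences\<close>

definition transfer_hom ::
  "('a, 'b) monoid_scheme \<Rightarrow> ('c, 'd) monoid_scheme \<Rightarrow> ('a \<Rightarrow> 'c) \<Rightarrow> bool" where
  "transfer_hom M B \<theta> \<longleftrightarrow>
     atomic_monoid M \<and> atomic_monoid B \<and> \<theta> \<in> hom M B \<and>
     carrier B = (\<theta> ` carrier M) <#>\<^bsub>B\<^esub> Units B \<and>
     {u \<in> carrier M. \<theta> u \<in> Units B} = Units M \<and>
     (\<forall>u\<in>carrier M. \<forall>b\<in>carrier B. \<forall>c\<in>carrier B. \<theta> u = b \<otimes>\<^bsub>B\<^esub> c \<longrightarrow>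
        (\<exists>v\<in>carrier M. \<exists>w\<in>carrier M.
           u = v \<otimes>\<^bsub>M\<^esub> w \<and> \<theta> v \<in> b <#\<^bsub>B\<^esub> Units B \<and> \<theta> w \<in> c <#\<^bsub>B\<^esub> Units B))"

text \<open>
  The extension of a transfer homomorphism to factorizations: it sends the atom
  \<open>X = u M\<^sup>\<times>\<close> to \<open>\<theta>(X) B\<^sup>\<times> = \<theta>(u) B\<^sup>\<times>\<close>.
\<close>

definition fact_map ::
  "('c, 'd) monoid_scheme \<Rightarrow> ('a \<Rightarrow> 'c) \<Rightarrow> 'a set multiset \<Rightarrow> 'c set multiset" where
  "fact_map B \<theta> z = image_mset (\<lambda>X. (\<theta> ` X) <#>\<^bsub>B\<^esub> Units B) z"

definition catenary_in_fibres ::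
  "('a, 'b) monoid_scheme \<Rightarrow> ('c, 'd) monoid_scheme \<Rightarrow> ('a \<Rightarrow> 'c) \<Rightarrow> enat" where
  "catenary_in_fibres M B \<theta> =
     (LEAST N. \<forall>a\<in>carrier M. \<forall>z\<in>facts_of M a. \<forall>z'\<in>facts_of M a.
        fact_map B \<theta> z = fact_map B \<theta> z' \<longrightarrow>
        connected_by
          (is_chain N {y \<in> facts_of M a. fact_map B \<theta> y = fact_map B \<theta> z}) z z')"

definition zero_sum_sequences :: "('a, 'b) monoid_scheme \<Rightarrow> 'a multiset monoid" where
  "zero_sum_sequences G =
     \<lparr>carrier = {S. set_mset S \<subseteq> carrier G \<and> mset_prod G S = \<one>\<^bsub>G\<^esub>},
      mult = (+), one = {#}\<rparr>"

end

theory Submission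
  imports Defs
begin

text \<open>
  A seminormal finitely primary monoid of rank \<open>s\<close> lies between
  \<open>{x. \<forall>i<s. 1 \<le> w i x}\<close> and \<open>{x. \<forall>i<s. 0 \<le> w i x}\<close> for \<open>s\<close> valuations \<open>w i\<close>, so
  among its elements non-units are exactly those with all valuations positive. By the approximation property of
  the minimal primes, invertible \<open>v\<close>-ideals are the families of local principal ideals that are
  trivial almost everywhere, so \<open>\<I>\<^sub>v\<^sup>*(H)\<close> is a coproduct of reduced monoids of this kind. An atom of a component
  has some valuation equal to 1, an element with all valuations at least 2 splits off a uniformizer, and
  for rank at least 2 every element with this property is a product of two atoms; this determines the
  arithmetic of the coproduct.

  \<open>H\<close> modulo units is the kernel of the class map on \<open>\<I>\<^sub>v\<^sup>*(H)\<close>. Primes not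
  containing the conductor are prime elements of the coproduct, so that every class contains a prime, and
  factorizations in the coproduct can be completed to factorizations in the kernel. The minimal primes of
  the complete integral closure are the centres of the valuations, hence \<open>\<pi>\<close> is bijective iff
  all ranks are 1. If in addition \<open>\<vartheta>\<close> is injective, all atoms at one minimal prime have the same
  class, and mapping an ideal to the sequence of the classes of its atoms is the transfer homomorphism.
\<close>

section \<open>Factorizations in reduced monoids\<close>

text \<open>The obstacle is that valuations do not determine an element up to associates: a unit of
  the factorial overmonoid need not lie in the local monoid. So only strict inequalities between
  valuations give divisibility. The uniformizer is therefore in general not prime, and two atoms at
  the same minimal prime may fail to split it off although three always do. Rank at least 2 produces
  different lengths because the value 1 can be placed at different indices in two factors. The
  constants come from one relation, a product of two atoms that is also a product of three. One such
  exchange costs 3; a monotone chain that has to perform it upwards at one minimal prime and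
  downwards at another moves 2 + 3 atoms at once. In the kernel the two atoms must first be
  completed by primes of inverse classes, and the product of these primes is one additional atom on
  the other side: this is the source of the alternative between \<open>l\<close> and
  \<open>l + 1\<close>. In the transfer to zero-sum sequences the obstruction inside a fibre is
  again a unit of the overmonoid. It is absorbed by a second atom of the same factorization, at
  distance 2.\<close>

context comm_monoid
begin

lemma mset_prod_closed [simp]: "set_mset z \<subseteq> carrier G \<Longrightarrow> mset_prod G z \<in> carrier G"
  unfolding mset_prod_def by (rule finprod_closed) auto

lemma mset_prod_empty [simp]: "mset_prod G {#} = \<one>"
  by (simp add: mset_prod_def)

lemma mset_prod_add_mset [simp]:
  assumes "x \<in> carrier G" "set_mset z \<subseteq> carrier G"
  shows "mset_prod G (add_mset x z) = x \<otimes> mset_prod G z"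
proof -
  let ?A = "set_mset z - {x}"
  let ?f = "\<lambda>y. y [^] count z y"
  have f: "?f \<in> ?A \<rightarrow> carrier G" using assms by auto
  have "mset_prod G (add_mset x z) = finprod G (\<lambda>y. y [^] count (add_mset x z) y) (insert x ?A)"
    unfolding mset_prod_def by (rule arg_cong) auto
  also have "\<dots> = x [^] Suc (count z x) \<otimes> finprod G (\<lambda>y. y [^] count (add_mset x z) y) ?A"
    by (subst finprod_insert) (use assms in auto)
  also have "finprod G (\<lambda>y. y [^] count (add_mset x z) y) ?A = finprod G ?f ?A"
    by (rule finprod_cong') (use f in auto)
  also have "x [^] Suc (count z x) \<otimes> finprod G ?f ?A = x \<otimes> (?f x \<otimes> finprod G ?f ?A)"
    using assms finprod_closed[OF f] by (simp add: m_ac)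
  also have "?f x \<otimes> finprod G ?f ?A = finprod G ?f (insert x ?A)"
    by (subst finprod_insert) (use assms f in auto)
  also have "\<dots> = mset_prod G z"
  proof (cases "x \<in># z")
    case True
    then show ?thesis by (simp add: mset_prod_def insert_absorb)
  next
    case False
    then have "?f x = \<one>" by (simp add: not_in_iff)
    then show ?thesis using False f assms
      by (simp add: mset_prod_def finprod_insert)
  qed
  finally show ?thesis .
qed

lemma mset_prod_union [simp]:
  assumes "set_mset z \<subseteq> carrier G" "set_mset z' \<subseteq> carrier G"
  shows "mset_prod G (z + z') = mset_prod G z \<otimes> mset_prod G z'"
  using assms by (induction z) (simp_all add: m_assoc)

end

lemma mset_prod_hom:
  assumes "comm_monoid M" "comm_monoid N" "h \<in> hom M N" "h \<one>\<^bsub>M\<^esub> = \<one>\<^bsub>N\<^esub>"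
    and "set_mset z \<subseteq> carrier M"
  shows "h (mset_prod M z) = mset_prod N (image_mset h z)"
proof -
  interpret M: comm_monoid M by fact
  interpret N: comm_monoid N by fact
  have h: "h x \<in> carrier N" if "x \<in> carrier M" for x
    using assms(3) that by (auto simp: hom_def)
  have "set_mset z \<subseteq> carrier M \<Longrightarrow> ?thesis"
  proof (induction z)
    case (add x z)
    then have "set_mset (image_mset h z) \<subseteq> carrier N" using h by auto
    with add show ?case using assms(3) h by (simp add: hom_mult)
  qed (use assms in simp)
  then show ?thesis using assms(5) .
qed

locale reduced_monoid = comm_monoid_cancel G for G (structure) +
  assumes Units_eq: "Units G = {\<one>}"
begin

lemma mult_eq_one: "a \<in> carrier G \<Longrightarrow> b \<in> carrier G \<Longrightarrow> a \<otimes> b = \<one> \<Longrightarrow> a = \<one> \<and> b = \<one>"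
proof -
  assume ab: "a \<in> carrier G" "b \<in> carrier G" "a \<otimes> b = \<one>"
  then have "b \<otimes> a = \<one>" by (simp add: m_comm)
  with ab have "a \<in> Units G" "b \<in> Units G" unfolding Units_def by blast+
  then show ?thesis using Units_eq by simp
qed

text \<open>By cancellation and reducedness \<open>b\<close> is a proper factor of
  \<open>b \<otimes> c\<close> exactly if \<open>c\<close> is not the identity, so irreducibility
  can be tested on products of two elements.\<close>

lemma atoms_iff:
  "a \<in> atoms G \<longleftrightarrow> a \<in> carrier G \<and> a \<noteq> \<one> \<and>
     (\<forall>b\<in>carrier G. \<forall>c\<in>carrier G. a = b \<otimes> c \<longrightarrow> b = \<one> \<or> c = \<one>)"
proof -
  have "properfactor G b a \<longleftrightarrow> (\<exists>c\<in>carrier G. a = b \<otimes> c \<and> c \<noteq> \<one>)"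
    if ab: "a \<in> carrier G" "b \<in> carrier G" for b
  proof
    assume "properfactor G b a"
    then obtain c where c: "c \<in> carrier G" "a = b \<otimes> c" and n: "\<not> a divides b"
      by (auto simp: properfactor_def factor_def)
    have "c \<noteq> \<one>" using n c ab by auto
    with c show "\<exists>c\<in>carrier G. a = b \<otimes> c \<and> c \<noteq> \<one>" by blast
  next
    assume "\<exists>c\<in>carrier G. a = b \<otimes> c \<and> c \<noteq> \<one>"
    then obtain c where c: "c \<in> carrier G" "a = b \<otimes> c" "c \<noteq> \<one>" by blast
    have False if dvd: "a divides b"
    proof -
      obtain d where d: "d \<in> carrier G" "b = a \<otimes> d" using dvd by (auto simp: factor_def)
      have "b = b \<otimes> c \<otimes> d" using d(2) unfolding c(2) .
      then have "b \<otimes> \<one> = b \<otimes> (c \<otimes> d)" using c(1) d(1) ab(2) by (simp add: m_assoc)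
      then have "\<one> = c \<otimes> d" using c(1) d(1) ab(2) l_cancel[of b \<one> "c \<otimes> d"] by simp
      with c d mult_eq_one[of c d] show False by simp
    qed
    with c show "properfactor G b a" by (auto simp: properfactor_def factor_def)
  qed
  then have "irreducible G a \<longleftrightarrow> a \<noteq> \<one> \<and>
      (\<forall>b\<in>carrier G. (\<exists>c\<in>carrier G. a = b \<otimes> c \<and> c \<noteq> \<one>) \<longrightarrow> b = \<one>)" if "a \<in> carrier G"
    unfolding irreducible_def using that Units_eq by simp
  then show ?thesis unfolding atoms_def by blast
qed

lemma atoms_closed: "a \<in> atoms G \<Longrightarrow> a \<in> carrier G"
  by (simp add: atoms_iff)

lemma atoms_subset: "atoms G \<subseteq> carrier G"
  using atoms_closed by blast

lemma atom_not_one: "a \<in> atoms G \<Longrightarrow> a \<noteq> \<one>"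
  by (simp add: atoms_iff)

lemma atom_factor: "a \<in> atoms G \<Longrightarrow> a = b \<otimes> c \<Longrightarrow> b \<in> carrier G \<Longrightarrow> c \<in> carrier G \<Longrightarrow> b = \<one> \<or> c = \<one>"
  by (simp add: atoms_iff)

end

text \<open>For a reduced monoid these are the factorizations themselves, without the passage to
  unit cosets in \<open>facts_of\<close>; \<open>facts_of_image\<close> connects the two.\<close>

definition factorizations :: "('a, 'b) monoid_scheme \<Rightarrow> 'a \<Rightarrow> 'a multiset set" where
  "factorizations N a = {z. set_mset z \<subseteq> atoms N \<and> mset_prod N z = a}"

context reduced_monoid
begin

abbreviation "Z \<equiv> factorizations G"

lemma Z_carrier: "z \<in> Z a \<Longrightarrow> set_mset z \<subseteq> carrier G"
  using atoms_subset by (auto simp: factorizations_def)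

lemma Z_closed: "z \<in> Z a \<Longrightarrow> a \<in> carrier G"
  using Z_carrier by (auto simp: factorizations_def)

lemma Z_union: "z \<in> Z a \<Longrightarrow> z' \<in> Z b \<Longrightarrow> z + z' \<in> Z (a \<otimes> b)"
  using Z_carrier[of z a] Z_carrier[of z' b] by (auto simp: factorizations_def)

lemma Z_atom: "x \<in> atoms G \<Longrightarrow> {#x#} \<in> Z x"
  using atoms_closed by (auto simp: factorizations_def)

lemma Z_add_mset: "x \<in> atoms G \<Longrightarrow> z \<in> Z b \<Longrightarrow> add_mset x z \<in> Z (x \<otimes> b)"
  using Z_union[OF Z_atom] by fastforce

lemma Z_one: "{#} \<in> Z \<one>"
  by (auto simp: factorizations_def)

lemma Z_empty_iff: "{#} \<in> Z a \<longleftrightarrow> a = \<one>"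
  by (auto simp: factorizations_def)

lemma Z_union_split:
  assumes "z + z' \<in> Z a"
  shows "z \<in> Z (mset_prod G z)" "z' \<in> Z (mset_prod G z')" "a = mset_prod G z \<otimes> mset_prod G z'"
  using assms Z_carrier[OF assms] by (auto simp: factorizations_def)

lemma Z_add_mset_split:
  assumes "add_mset x z \<in> Z a"
  shows "x \<in> atoms G" "z \<in> Z (mset_prod G z)" "a = x \<otimes> mset_prod G z"
  using Z_union_split[of "{#x#}" z a] assms Z_carrier[OF assms]
  by (auto simp: factorizations_def)

lemma Z_replace:
  assumes "z + r \<in> Z a" "z' \<in> Z (mset_prod G z)"
  shows "z' + r \<in> Z a"
  using Z_union[OF assms(2) Z_union_split(2)[OF assms(1)]] Z_union_split(3)[OF assms(1)] by simp

lemma Z_of_one: "z \<in> Z \<one> \<longleftrightarrow> z = {#}"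
proof
  assume z: "z \<in> Z \<one>"
  show "z = {#}"
  proof (rule ccontr)
    assume "z \<noteq> {#}"
    then obtain x w where w: "z = add_mset x w" by (meson multiset_cases)
    then have "x \<in> atoms G" "\<one> = x \<otimes> mset_prod G w" "mset_prod G w \<in> carrier G"
      using Z_add_mset_split[of x w \<one>] z Z_closed by auto
    then show False using mult_eq_one[of x "mset_prod G w"] by (auto simp: atoms_iff)
  qed
qed (simp add: Z_one)

lemma Z_of_atom:
  assumes "x \<in> atoms G"
  shows "z \<in> Z x \<longleftrightarrow> z = {#x#}"
proof
  assume z: "z \<in> Z x"
  have "z \<noteq> {#}" using z Z_empty_iff assms by (auto simp: atoms_iff)
  then obtain y w where w: "z = add_mset y w" by (meson multiset_cases)
  then have *: "y \<in> atoms G" "x = y \<otimes> mset_prod G w" "mset_prod G w \<in> carrier G" "w \<in> Z (mset_prod G w)"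
    using Z_add_mset_split[of y w x] z Z_closed by auto
  then have "mset_prod G w = \<one>"
    using assms atom_factor atoms_closed atom_not_one by blast
  then have "w = {#}" using *(4) Z_of_one by simp
  then show "z = {#x#}" using * w atoms_closed by simp
qed (simp add: Z_atom[OF assms])

lemma Z_cancel_atom:
  assumes "add_mset x z \<in> Z a" "add_mset x z' \<in> Z a"
  shows "z' \<in> Z (mset_prod G z)"
proof -
  note s = Z_add_mset_split[OF assms(1)] and s' = Z_add_mset_split[OF assms(2)]
  have "x \<otimes> mset_prod G z = x \<otimes> mset_prod G z'" using s s' by simp
  then have "mset_prod G z = mset_prod G z'"
    using s(1,2) s'(2) atoms_closed Z_closed l_cancel by meson
  then show ?thesis using s' by simp
qed

lemma Z_cancel:
  assumes "r + z \<in> Z a" "r + z' \<in> Z a"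
  shows "z' \<in> Z (mset_prod G z)"
  using assms
proof (induction r arbitrary: a)
  case empty
  then show ?case by (auto simp: factorizations_def)
next
  case (add x r)
  then show ?case
    using Z_cancel_atom[of x "r + z" a "r + z'"] Z_add_mset_split(2)[of x "r + z" a] by auto
qed

text \<open>Atomicity from an additive degree that vanishes only at the identity: in a proper
  splitting both factors have smaller degree.\<close>

lemma Z_exists:
  fixes f :: "'a \<Rightarrow> nat"
  assumes add: "\<And>a b. a \<in> carrier G \<Longrightarrow> b \<in> carrier G \<Longrightarrow> f (a \<otimes> b) = f a + f b"
    and pos: "\<And>a. a \<in> carrier G \<Longrightarrow> f a = 0 \<Longrightarrow> a = \<one>"
    and "a \<in> carrier G"
  shows "\<exists>z. z \<in> Z a"
  using assms(3)
proof (induction "f a" arbitrary: a rule: less_induct)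
  case less
  consider "a = \<one>" | "a \<in> atoms G" | "a \<noteq> \<one>" "a \<notin> atoms G" by blast
  then show ?case
  proof cases
    case 3
    then obtain b c where bc: "b \<in> carrier G" "c \<in> carrier G" "a = b \<otimes> c" "b \<noteq> \<one>" "c \<noteq> \<one>"
      using atoms_iff less by blast
    then have "f b > 0" "f c > 0" "f a = f b + f c" using add pos by auto
    then have "\<exists>z. z \<in> Z b" "\<exists>z. z \<in> Z c" using less bc by simp_all
    then show ?thesis using Z_union bc by blast
  qed (use Z_one Z_atom in blast)+
qed

end

section \<open>Chains, distances and catenary degrees for sets of multisets\<close>

lemma chain_iff_rtranclp:
  "R\<^sup>*\<^sup>* z z' \<longleftrightarrow>
     (\<exists>zs. zs \<noteq> [] \<and> hd zs = z \<and> last zs = z' \<and> (\<forall>i. Suc i < length zs \<longrightarrow> R (zs ! i) (zs ! Suc i)))"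
proof
  assume "R\<^sup>*\<^sup>* z z'"
  then show "\<exists>zs. zs \<noteq> [] \<and> hd zs = z \<and> last zs = z' \<and>
      (\<forall>i. Suc i < length zs \<longrightarrow> R (zs ! i) (zs ! Suc i))"
  proof (induction rule: converse_rtranclp_induct)
    case base
    show ?case by (rule exI[of _ "[z']"]) simp
  next
    case (step y z)
    then obtain zs where zs: "zs \<noteq> []" "hd zs = z" "last zs = z'"
      "\<forall>i. Suc i < length zs \<longrightarrow> R (zs ! i) (zs ! Suc i)" by blast
    have "R ((y # zs) ! i) ((y # zs) ! Suc i)" if "Suc i < length (y # zs)" for i
      using that step zs by (cases i) (auto simp: hd_conv_nth)
    then show ?case using zs by (intro exI[of _ "y # zs"]) auto
  qed
next
  assume "\<exists>zs. zs \<noteq> [] \<and> hd zs = z \<and> last zs = z' \<and>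
      (\<forall>i. Suc i < length zs \<longrightarrow> R (zs ! i) (zs ! Suc i))"
  then obtain zs where "zs \<noteq> []" "hd zs = z" "last zs = z'"
      "\<forall>i. Suc i < length zs \<longrightarrow> R (zs ! i) (zs ! Suc i)" by blast
  then show "R\<^sup>*\<^sup>* z z'"
  proof (induction zs arbitrary: z)
    case (Cons y ys)
    show ?case
    proof (cases ys)
      case (Cons y' ys')
      have "R y y'" using Cons.prems(4) Cons by force
      moreover have "R (ys ! i) (ys ! Suc i)" if "Suc i < length ys" for i
        using Cons.prems(4)[rule_format, of "Suc i"] that by simp
      then have "R\<^sup>*\<^sup>* y' z'" using Cons.IH[of y'] Cons.prems Cons by auto
      ultimately show ?thesis using Cons.prems by (simp add: converse_rtranclp_into_rtranclp)
    qed (use Cons.prems in auto)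
  qed simp
qed

text \<open>The flag \<open>up\<close> treats ordinary and monotone chains together. Only increasing
  chains are modelled, since a decreasing chain is an increasing one read backwards.\<close>

definition chain_step :: "bool \<Rightarrow> enat \<Rightarrow> 'c multiset set \<Rightarrow> 'c multiset \<Rightarrow> 'c multiset \<Rightarrow> bool" where
  "chain_step up N X z z' \<longleftrightarrow>
     z \<in> X \<and> z' \<in> X \<and> enat (fact_dist z z') \<le> N \<and> (up \<longrightarrow> size z \<le> size z')"

text \<open>The size condition is vacuous for non-monotone chains, since these may be reversed.\<close>

definition chain_connected :: "bool \<Rightarrow> enat \<Rightarrow> 'c multiset set \<Rightarrow> bool" where
  "chain_connected up N X \<longleftrightarrow>
     (\<forall>z\<in>X. \<forall>z'\<in>X. size z \<le> size z' \<longrightarrow> (chain_step up N X)\<^sup>*\<^sup>* z z')"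

lemma fact_dist_sym: "fact_dist z z' = fact_dist z' z"
  by (simp add: fact_dist_def inf_commute max.commute)

lemma fact_dist_union [simp]: "fact_dist (r + z) (r + z') = fact_dist z z'"
proof -
  have "(r + z) \<inter># (r + z') = r + (z \<inter># z')"
    by (simp add: multiset_eq_iff min_add_distrib_right)
  then show ?thesis by (simp add: fact_dist_def)
qed

lemma fact_dist_le: "fact_dist z z' \<le> max (size z) (size z')"
  unfolding fact_dist_def by (intro max.mono size_mset_mono diff_subset_eq_self)

lemma fact_dist_le_replace: "fact_dist (z + r) (z' + r) \<le> max (size z) (size z')"
  using fact_dist_le[of z z'] fact_dist_union[of r z z'] by (simp add: union_commute)

lemma fact_dist_disjoint: "z \<inter># z' = {#} \<Longrightarrow> fact_dist z z' = max (size z) (size z')"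
  by (simp add: fact_dist_def)

lemma chain_step_up: "up \<Longrightarrow> (chain_step up N X)\<^sup>*\<^sup>* z z' \<Longrightarrow> size z \<le> size z'"
  by (rotate_tac, induction rule: rtranclp_induct) (auto simp: chain_step_def)

lemma chain_step_mono_bound:
  "N \<le> N' \<Longrightarrow> (chain_step up N X)\<^sup>*\<^sup>* z z' \<Longrightarrow> (chain_step up N' X)\<^sup>*\<^sup>* z z'"
  by (rule mono_rtranclp[rule_format]) (auto simp: chain_step_def)

text \<open>A monotone chain whose end is no longer than its start has constant length, and then it
  may be run backwards.\<close>

lemma chain_step_reverse:
  assumes "(chain_step up N X)\<^sup>*\<^sup>* z z'" "up \<Longrightarrow> size z' \<le> size z"
  shows "(chain_step up N X)\<^sup>*\<^sup>* z' z"
  using assms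
proof (induction rule: rtranclp_induct)
  case (step y z')
  have "up \<Longrightarrow> size z \<le> size y" using step(1) chain_step_up by blast
  then have "(chain_step up N X) z' y"
    using step(2,4) by (auto simp: chain_step_def fact_dist_sym)
  moreover have "(chain_step up N X)\<^sup>*\<^sup>* y z"
    using step(2,3,4) by (fastforce simp: chain_step_def)
  ultimately show ?case by (rule converse_rtranclp_into_rtranclp)
qed simp

lemma connected_by_chain_steps:
  assumes C: "\<And>zs. C zs \<longleftrightarrow> zs \<noteq> [] \<and> hd zs \<in> X \<and>
      (\<forall>i. Suc i < length zs \<longrightarrow> chain_step up N X (zs ! i) (zs ! Suc i))"
    and z: "z \<in> X"
  shows "connected_by C z z' \<longleftrightarrow> (chain_step up N X)\<^sup>*\<^sup>* z z'"
  unfolding connected_by_def chain_iff_rtranclp C using z by blast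

lemma is_chain_iff:
  "is_chain N X zs \<longleftrightarrow> zs \<noteq> [] \<and> hd zs \<in> X \<and>
      (\<forall>i. Suc i < length zs \<longrightarrow> chain_step False N X (zs ! i) (zs ! Suc i))" (is "?l \<longleftrightarrow> ?r")
proof
  assume r: ?r
  have "zs ! i \<in> X" if "i < length zs" for i
    using that r by (cases i) (auto simp: chain_step_def hd_conv_nth)
  with r show ?l unfolding is_chain_def by (auto simp: chain_step_def in_set_conv_nth)
qed (auto simp: is_chain_def chain_step_def)

lemma connected_by_is_chain:
  "z \<in> X \<Longrightarrow> connected_by (is_chain N X) z z' \<longleftrightarrow> (chain_step False N X)\<^sup>*\<^sup>* z z'"
  by (rule connected_by_chain_steps[OF is_chain_iff])

lemma connected_by_is_monotone_chain:
  assumes "z \<in> X" "z' \<in> X"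
  shows "connected_by (is_monotone_chain N X) z z' \<longleftrightarrow>
    (chain_step True N X)\<^sup>*\<^sup>* z z' \<or> (chain_step True N X)\<^sup>*\<^sup>* z' z"
proof -
  let ?up = "\<lambda>zs. is_chain N X zs \<and> sorted_wrt (\<le>) (map size zs)"
  let ?down = "\<lambda>zs. is_chain N X zs \<and> sorted_wrt (\<ge>) (map size zs)"
  have "?up zs \<longleftrightarrow> zs \<noteq> [] \<and> hd zs \<in> X \<and>
      (\<forall>i. Suc i < length zs \<longrightarrow> chain_step True N X (zs ! i) (zs ! Suc i))" for zs
    unfolding is_chain_iff by (auto simp: sorted_wrt_iff_nth_Suc_transp chain_step_def)
  from connected_by_chain_steps[OF this]
  have up: "connected_by ?up z z' \<longleftrightarrow> (chain_step True N X)\<^sup>*\<^sup>* z z'" if "z \<in> X" for z z'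
    using that by blast
  have rev: "?up (rev zs) \<longleftrightarrow> ?down zs" for zs
  proof -
    have "is_chain N X (rev zs)" if "is_chain N X zs" for zs :: "'a multiset list"
      unfolding is_chain_def
    proof (intro conjI allI impI)
      fix i assume i: "Suc i < length (rev zs)"
      let ?j = "length zs - Suc (Suc i)"
      have "rev zs ! i = zs ! Suc ?j" "rev zs ! Suc i = zs ! ?j" "Suc ?j < length zs"
        using i by (auto simp: rev_nth Suc_diff_Suc)
      then show "enat (fact_dist (rev zs ! i) (rev zs ! Suc i)) \<le> N"
        using that by (simp add: is_chain_def fact_dist_sym)
    qed (use that in \<open>auto simp: is_chain_def\<close>)
    then have "is_chain N X (rev zs) \<longleftrightarrow> is_chain N X zs" by (metis rev_rev_ident)
    then show ?thesis by (simp add: sorted_wrt_rev flip: rev_map)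
  qed
  have "connected_by ?down z z' \<longleftrightarrow> connected_by ?up z' z"
    unfolding connected_by_def
  proof
    assume "\<exists>zs. ?down zs \<and> hd zs = z \<and> last zs = z'"
    then obtain zs where "?down zs" "hd zs = z" "last zs = z'" by blast
    then show "\<exists>zs. ?up zs \<and> hd zs = z' \<and> last zs = z"
      using rev[of zs] by (intro exI[of _ "rev zs"]) (auto simp: hd_rev last_rev)
  next
    assume "\<exists>zs. ?up zs \<and> hd zs = z' \<and> last zs = z"
    then obtain zs where "?up zs" "hd zs = z'" "last zs = z" by blast
    then show "\<exists>zs. ?down zs \<and> hd zs = z \<and> last zs = z'"
      using rev[of "rev zs"] by (intro exI[of _ "rev zs"]) (auto simp: hd_rev last_rev)
  qed
  moreover have "connected_by (is_monotone_chain N X) z z' \<longleftrightarrow> connected_by ?up z z' \<or> connected_by ?down z z'"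
    unfolding connected_by_def is_monotone_chain_def by blast
  ultimately show ?thesis using up assms by simp
qed

text \<open>Catenary degrees are least bounds of an upward closed property that holds at infinity.
  This turns them into statements of the form \<open>\<le> d\<close>, which pass through suprema and
  are the only form used later.\<close>

lemma Least_enat_le_iff:
  fixes P :: "enat \<Rightarrow> bool"
  assumes "P \<infinity>" "\<And>m n. m \<le> n \<Longrightarrow> P m \<Longrightarrow> P n"
  shows "(LEAST N. P N) \<le> d \<longleftrightarrow> P d"
proof
  assume "(LEAST N. P N) \<le> d"
  then show "P d" using assms(2) LeastI[of P, OF assms(1)] by blast
qed (rule Least_le)

lemma chain_connected_infinity: "chain_connected up \<infinity> X"
  unfolding chain_connected_def by (auto simp: chain_step_def intro!: r_into_rtranclp)

lemma chain_connected_mono: "N \<le> N' \<Longrightarrow> chain_connected up N X \<Longrightarrow> chain_connected up N' X"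
  unfolding chain_connected_def using chain_step_mono_bound by blast

lemma chain_connected_False_iff:
  "chain_connected False N X \<longleftrightarrow> (\<forall>z\<in>X. \<forall>z'\<in>X. (chain_step False N X)\<^sup>*\<^sup>* z z')"
proof
  assume c: "chain_connected False N X"
  show "\<forall>z\<in>X. \<forall>z'\<in>X. (chain_step False N X)\<^sup>*\<^sup>* z z'"
  proof (intro ballI)
    fix z z' assume z: "z \<in> X" "z' \<in> X"
    show "(chain_step False N X)\<^sup>*\<^sup>* z z'"
    proof (cases "size z \<le> size z'")
      case False
      then have "(chain_step False N X)\<^sup>*\<^sup>* z' z" using z c by (simp add: chain_connected_def)
      then show ?thesis by (rule chain_step_reverse) simp
    qed (use z c in \<open>simp add: chain_connected_def\<close>)
  qed
qed (simp add: chain_connected_def)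

lemma chain_connected_True_iff:
  "chain_connected True N X \<longleftrightarrow>
     (\<forall>z\<in>X. \<forall>z'\<in>X. (chain_step True N X)\<^sup>*\<^sup>* z z' \<or> (chain_step True N X)\<^sup>*\<^sup>* z' z)"
proof
  assume "chain_connected True N X"
  then show "\<forall>z\<in>X. \<forall>z'\<in>X. (chain_step True N X)\<^sup>*\<^sup>* z z' \<or> (chain_step True N X)\<^sup>*\<^sup>* z' z"
    unfolding chain_connected_def using nat_le_linear by blast
next
  assume c: "\<forall>z\<in>X. \<forall>z'\<in>X. (chain_step True N X)\<^sup>*\<^sup>* z z' \<or> (chain_step True N X)\<^sup>*\<^sup>* z' z"
  show "chain_connected True N X"
    unfolding chain_connected_def
  proof (intro ballI impI)
    fix z z' assume "z \<in> X" "z' \<in> X" "size z \<le> size z'"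
    then show "(chain_step True N X)\<^sup>*\<^sup>* z z'"
      using c chain_step_reverse[of True N X z' z] by blast
  qed
qed

lemma catenary_at_le_iff: "catenary_at M a \<le> d \<longleftrightarrow> chain_connected False d (facts_of M a)"
proof -
  have *: "(\<forall>z\<in>X. \<forall>z'\<in>X. connected_by (is_chain N X) z z') \<longleftrightarrow> chain_connected False N X"
    for N and X :: "'a set multiset set"
    by (simp add: chain_connected_False_iff connected_by_is_chain)
  show ?thesis unfolding catenary_at_def *
    by (rule Least_enat_le_iff) (auto simp: chain_connected_infinity intro: chain_connected_mono)
qed

lemma mon_catenary_at_le_iff: "mon_catenary_at M a \<le> d \<longleftrightarrow> chain_connected True d (facts_of M a)"
proof -
  have *: "(\<forall>z\<in>X. \<forall>z'\<in>X. connected_by (is_monotone_chain N X) z z') \<longleftrightarrow> chain_connected True N X"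
    for N and X :: "'a set multiset set"
    by (simp add: chain_connected_True_iff connected_by_is_monotone_chain)
  show ?thesis unfolding mon_catenary_at_def *
    by (rule Least_enat_le_iff) (auto simp: chain_connected_infinity intro: chain_connected_mono)
qed

text \<open>The distance only sees the two parts outside the common multiset, and an injective map
  keeps these disjoint.\<close>

lemma fact_dist_image_mset:
  assumes "inj_on h A" "set_mset z \<subseteq> A" "set_mset z' \<subseteq> A"
  shows "fact_dist (image_mset h z) (image_mset h z') = fact_dist z z'"
proof -
  define a b where "a = z - z'" "b = z' - z"
  have z: "z = z \<inter># z' + a" "z' = z \<inter># z' + b"
    by (auto simp: a_b_def multiset_eq_iff)
  have "x \<in># a \<Longrightarrow> x \<notin># b" for x
    by (auto simp: a_b_def in_diff_count)
  moreover have "set_mset a \<subseteq> A" "set_mset b \<subseteq> A" using assms in_diffD by (fastforce simp: a_b_def)+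
  ultimately have "h ` set_mset a \<inter> h ` set_mset b = {}"
    using inj_onD[OF assms(1)] by blast
  then have "image_mset h a \<inter># image_mset h b = {#}"
    by (metis set_image_mset set_mset_eq_empty_iff set_mset_inter)
  moreover have "a \<inter># b = {#}" by (auto simp: a_b_def multiset_eq_iff)
  ultimately have "fact_dist (image_mset h a) (image_mset h b) = fact_dist a b"
    by (simp add: fact_dist_disjoint)
  then show ?thesis
    using fact_dist_union[of "z \<inter># z'" a b] fact_dist_union[of "image_mset h (z \<inter># z')"] z
    by (metis image_mset_union)
qed

lemma chain_connected_image_mset:
  assumes "inj_on h A" "\<And>z. z \<in> X \<Longrightarrow> set_mset z \<subseteq> A"
  shows "chain_connected up N (image_mset h ` X) \<longleftrightarrow> chain_connected up N X"
proof -
  have *: "chain_connected up N (image_mset h ` X)"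
    if conn: "chain_connected up N X" and h: "inj_on h A" and X: "\<And>z. z \<in> X \<Longrightarrow> set_mset z \<subseteq> A"
    for h :: "'c \<Rightarrow> 'd" and X A
  proof -
    have "(chain_step up N (image_mset h ` X))\<^sup>*\<^sup>* (image_mset h z) (image_mset h z')"
      if "(chain_step up N X)\<^sup>*\<^sup>* z z'" for z z'
      using that
    proof (induction rule: rtranclp_induct)
      case (step y z')
      then have "chain_step up N (image_mset h ` X) (image_mset h y) (image_mset h z')"
        using X fact_dist_image_mset[OF h] by (auto simp: chain_step_def)
      with step show ?case by (simp add: rtranclp.rtrancl_into_rtrancl)
    qed simp
    then show ?thesis using conn unfolding chain_connected_def by auto
  qed
  let ?g = "inv_into A h"
  have g: "image_mset ?g (image_mset h z) = z" if "z \<in> X" for z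
  proof -
    have "image_mset (?g \<circ> h) z = image_mset id z"
      by (rule image_mset_cong) (use assms(2)[OF that] assms(1) in \<open>auto simp: inv_into_f_f subset_iff\<close>)
    then show ?thesis by (simp add: multiset.map_comp)
  qed
  have "image_mset ?g ` image_mset h ` X = X" using g by force
  moreover have "inj_on ?g (h ` A)" by (simp add: inj_on_inv_into)
  moreover have "set_mset z \<subseteq> h ` A" if "z \<in> image_mset h ` X" for z
    using that assms(2) by (auto simp: subset_iff)
  ultimately show ?thesis
    using *[of X h A, OF _ assms] *[of "image_mset h ` X" ?g "h ` A"] by auto
qed

text \<open>\<open>enat\<close> is well-ordered, so an infimum over a nonempty set is
  attained.\<close>

lemma enat_INF_le_iff:
  fixes f :: "'c \<Rightarrow> enat"
  assumes "A \<noteq> {}"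
  shows "(INF x\<in>A. f x) \<le> d \<longleftrightarrow> (\<exists>x\<in>A. f x \<le> d)"
proof
  assume le: "(INF x\<in>A. f x) \<le> d"
  obtain x where "x \<in> A" using assms by blast
  then have "(INF x\<in>A. f x) \<in> f ` A" by (intro wellorder_InfI[of "f x"]) simp
  then obtain y where "y \<in> A" "(INF x\<in>A. f x) = f y" by blast
  with le show "\<exists>x\<in>A. f x \<le> d" by (intro bexI[of _ y]) simp_all
next
  assume "\<exists>x\<in>A. f x \<le> d"
  then show "(INF x\<in>A. f x) \<le> d" by (meson INF_lower2)
qed

lemma fact_set_dist_le_iff:
  "X \<noteq> {} \<Longrightarrow> Y \<noteq> {} \<Longrightarrow> fact_set_dist X Y \<le> d \<longleftrightarrow> (\<exists>x\<in>X. \<exists>y\<in>Y. enat (fact_dist x y) \<le> d)"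
  by (simp add: fact_set_dist_def enat_INF_le_iff)

section \<open>Arithmetic invariants and reduction\<close>

text \<open>\<open>N\<close> is a model of \<open>M\<close> modulo units that need not consist of
  cosets. The instances are the identity on a reduced monoid and the map sending \<open>h\<close> to
  the principal ideal \<open>h H\<close>.\<close>

locale monoid_reduction = M: comm_monoid_cancel M + N: reduced_monoid N
  for M :: "('a, 'b) monoid_scheme" and N :: "('c, 'd) monoid_scheme" +
  fixes \<phi> :: "'a \<Rightarrow> 'c"
  assumes hom: "\<phi> \<in> hom M N"
    and surj: "\<phi> ` carrier M = carrier N"
    and eq_iff: "a \<in> carrier M \<Longrightarrow> b \<in> carrier M \<Longrightarrow>
      \<phi> a = \<phi> b \<longleftrightarrow> (\<exists>u\<in>Units M. b = a \<otimes>\<^bsub>M\<^esub> u)"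
begin

abbreviation "R \<equiv> reduced M"

text \<open>Since \<open>\<phi>\<close> is constant on each unit coset, this is the isomorphism from
  the coset monoid onto \<open>N\<close> induced by \<open>\<phi>\<close>.\<close>

definition "red X = the_elem (\<phi> ` X)"

lemma phi_closed: "a \<in> carrier M \<Longrightarrow> \<phi> a \<in> carrier N"
  using surj by blast

lemma phi_mult: "a \<in> carrier M \<Longrightarrow> b \<in> carrier M \<Longrightarrow> \<phi> (a \<otimes>\<^bsub>M\<^esub> b) = \<phi> a \<otimes>\<^bsub>N\<^esub> \<phi> b"
  using hom by (simp add: hom_mult)

lemma phi_one: "\<phi> \<one>\<^bsub>M\<^esub> = \<one>\<^bsub>N\<^esub>"
proof -
  have "\<phi> \<one>\<^bsub>M\<^esub> \<otimes>\<^bsub>N\<^esub> \<phi> \<one>\<^bsub>M\<^esub> = \<phi> \<one>\<^bsub>M\<^esub> \<otimes>\<^bsub>N\<^esub> \<one>\<^bsub>N\<^esub>"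
    using phi_mult[of "\<one>\<^bsub>M\<^esub>" "\<one>\<^bsub>M\<^esub>"] phi_closed[of "\<one>\<^bsub>M\<^esub>"] by simp
  then show ?thesis using N.l_cancel phi_closed[of "\<one>\<^bsub>M\<^esub>"] by blast
qed

lemma coset_iff: "x \<in> a <#\<^bsub>M\<^esub> Units M \<longleftrightarrow> (\<exists>u\<in>Units M. x = a \<otimes>\<^bsub>M\<^esub> u)"
  by (auto simp: l_coset_def)

lemma coset_subset: "a \<in> carrier M \<Longrightarrow> a <#\<^bsub>M\<^esub> Units M \<subseteq> carrier M"
  by (auto simp: l_coset_def)

lemma phi_coset: "a \<in> carrier M \<Longrightarrow> \<phi> ` (a <#\<^bsub>M\<^esub> Units M) = {\<phi> a}"
proof -
  assume a: "a \<in> carrier M"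
  have "\<phi> x = \<phi> a" if "x \<in> a <#\<^bsub>M\<^esub> Units M" for x
  proof -
    have "x \<in> carrier M" "\<exists>u\<in>Units M. x = a \<otimes>\<^bsub>M\<^esub> u" using that coset_iff coset_subset[OF a] by blast+
    then show ?thesis using eq_iff[OF a] by metis
  qed
  moreover have "a = a \<otimes>\<^bsub>M\<^esub> \<one>\<^bsub>M\<^esub>" using a by simp
  then have "a \<in> a <#\<^bsub>M\<^esub> Units M" unfolding coset_iff using M.Units_one_closed by blast
  ultimately show ?thesis by blast
qed

lemma red_coset: "a \<in> carrier M \<Longrightarrow> red (a <#\<^bsub>M\<^esub> Units M) = \<phi> a"
  by (simp add: red_def phi_coset)

lemma coset_eq_iff:
  assumes "a \<in> carrier M" "b \<in> carrier M"
  shows "a <#\<^bsub>M\<^esub> Units M = b <#\<^bsub>M\<^esub> Units M \<longleftrightarrow> \<phi> a = \<phi> b"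
proof
  assume "\<phi> a = \<phi> b"
  moreover have "x \<in> b <#\<^bsub>M\<^esub> Units M" if "x \<in> a <#\<^bsub>M\<^esub> Units M" "\<phi> a = \<phi> b"
    "a \<in> carrier M" "b \<in> carrier M" for a b x
  proof -
    have "x \<in> carrier M" "\<phi> x = \<phi> a" using that coset_subset phi_coset by blast+
    then have "\<exists>u\<in>Units M. x = b \<otimes>\<^bsub>M\<^esub> u" using that eq_iff[of b x] by simp
    then show ?thesis unfolding coset_iff .
  qed
  ultimately show "a <#\<^bsub>M\<^esub> Units M = b <#\<^bsub>M\<^esub> Units M"
    using assms by (intro subset_antisym subsetI) simp_all
next
  assume "a <#\<^bsub>M\<^esub> Units M = b <#\<^bsub>M\<^esub> Units M"
  then show "\<phi> a = \<phi> b" using red_coset[OF assms(1)] red_coset[OF assms(2)] by simp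
qed

lemma coset_mult:
  assumes "a \<in> carrier M" "b \<in> carrier M"
  shows "(a <#\<^bsub>M\<^esub> Units M) <#>\<^bsub>M\<^esub> (b <#\<^bsub>M\<^esub> Units M) = (a \<otimes>\<^bsub>M\<^esub> b) <#\<^bsub>M\<^esub> Units M"
proof (intro subset_antisym subsetI)
  fix x assume "x \<in> (a <#\<^bsub>M\<^esub> Units M) <#>\<^bsub>M\<^esub> (b <#\<^bsub>M\<^esub> Units M)"
  then obtain u v where "u \<in> Units M" "v \<in> Units M" "x = (a \<otimes>\<^bsub>M\<^esub> u) \<otimes>\<^bsub>M\<^esub> (b \<otimes>\<^bsub>M\<^esub> v)"
    by (auto simp: set_mult_def l_coset_def)
  then have "u \<otimes>\<^bsub>M\<^esub> v \<in> Units M" "x = (a \<otimes>\<^bsub>M\<^esub> b) \<otimes>\<^bsub>M\<^esub> (u \<otimes>\<^bsub>M\<^esub> v)"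
    using assms M.Units_closed by (auto simp: M.m_ac)
  then show "x \<in> (a \<otimes>\<^bsub>M\<^esub> b) <#\<^bsub>M\<^esub> Units M" unfolding coset_iff by blast
next
  fix x assume "x \<in> (a \<otimes>\<^bsub>M\<^esub> b) <#\<^bsub>M\<^esub> Units M"
  then obtain u where "u \<in> Units M" "x = (a \<otimes>\<^bsub>M\<^esub> \<one>\<^bsub>M\<^esub>) \<otimes>\<^bsub>M\<^esub> (b \<otimes>\<^bsub>M\<^esub> u)"
    unfolding coset_iff using assms M.Units_closed by (auto simp: M.m_assoc)
  then show "x \<in> (a <#\<^bsub>M\<^esub> Units M) <#>\<^bsub>M\<^esub> (b <#\<^bsub>M\<^esub> Units M)"
    unfolding set_mult_def l_coset_def by blast
qed

lemma R_carrierE: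
  assumes "X \<in> carrier R" obtains a where "a \<in> carrier M" "X = a <#\<^bsub>M\<^esub> Units M"
  using assms by (auto simp: reduced_def)

lemma R_mult: "a \<in> carrier M \<Longrightarrow> b \<in> carrier M \<Longrightarrow>
    (a <#\<^bsub>M\<^esub> Units M) \<otimes>\<^bsub>R\<^esub> (b <#\<^bsub>M\<^esub> Units M) = (a \<otimes>\<^bsub>M\<^esub> b) <#\<^bsub>M\<^esub> Units M"
  by (simp add: reduced_def coset_mult)

lemma coset_in_R: "a \<in> carrier M \<Longrightarrow> a <#\<^bsub>M\<^esub> Units M \<in> carrier R"
  by (auto simp: reduced_def)

lemma R_one: "\<one>\<^bsub>R\<^esub> = \<one>\<^bsub>M\<^esub> <#\<^bsub>M\<^esub> Units M"
  using M.Units_closed by (auto simp: reduced_def l_coset_def)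

lemma comm_monoid_R: "comm_monoid R"
proof (rule comm_monoidI)
  fix X Y Z assume "X \<in> carrier R" "Y \<in> carrier R" "Z \<in> carrier R"
  then obtain a b c where "a \<in> carrier M" "b \<in> carrier M" "c \<in> carrier M"
    "X = a <#\<^bsub>M\<^esub> Units M" "Y = b <#\<^bsub>M\<^esub> Units M" "Z = c <#\<^bsub>M\<^esub> Units M"
    by (metis R_carrierE)
  then show "(X \<otimes>\<^bsub>R\<^esub> Y) \<otimes>\<^bsub>R\<^esub> Z = X \<otimes>\<^bsub>R\<^esub> (Y \<otimes>\<^bsub>R\<^esub> Z)"
    by (simp add: R_mult M.m_assoc)
next
  fix X Y assume "X \<in> carrier R" "Y \<in> carrier R"
  then obtain a b where "a \<in> carrier M" "b \<in> carrier M"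
    "X = a <#\<^bsub>M\<^esub> Units M" "Y = b <#\<^bsub>M\<^esub> Units M" by (metis R_carrierE)
  then show "X \<otimes>\<^bsub>R\<^esub> Y \<in> carrier R" "X \<otimes>\<^bsub>R\<^esub> Y = Y \<otimes>\<^bsub>R\<^esub> X"
    by (simp_all add: R_mult coset_in_R M.m_comm)
next
  fix X assume "X \<in> carrier R"
  then obtain a where "a \<in> carrier M" "X = a <#\<^bsub>M\<^esub> Units M" by (metis R_carrierE)
  then show "\<one>\<^bsub>R\<^esub> \<otimes>\<^bsub>R\<^esub> X = X" by (simp add: R_one R_mult)
qed (simp add: R_one coset_in_R)

lemma red_hom: "red \<in> hom R N"
proof (rule homI)
  fix X Y assume "X \<in> carrier R" "Y \<in> carrier R"
  then obtain a b where "a \<in> carrier M" "b \<in> carrier M"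
    "X = a <#\<^bsub>M\<^esub> Units M" "Y = b <#\<^bsub>M\<^esub> Units M" by (metis R_carrierE)
  then show "red (X \<otimes>\<^bsub>R\<^esub> Y) = red X \<otimes>\<^bsub>N\<^esub> red Y"
    by (simp add: R_mult red_coset phi_mult)
qed (auto elim!: R_carrierE simp: red_coset phi_closed)

lemma red_one: "red \<one>\<^bsub>R\<^esub> = \<one>\<^bsub>N\<^esub>"
  by (simp only: R_one red_coset M.one_closed phi_one)

lemma red_bij: "bij_betw red (carrier R) (carrier N)"
proof (rule bij_betw_imageI)
  show "inj_on red (carrier R)"
  proof (rule inj_onI)
    fix X Y assume "X \<in> carrier R" "Y \<in> carrier R" "red X = red Y"
    moreover from this obtain a b where "a \<in> carrier M" "b \<in> carrier M"
      "X = a <#\<^bsub>M\<^esub> Units M" "Y = b <#\<^bsub>M\<^esub> Units M" by (metis R_carrierE)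
    ultimately show "X = Y" using coset_eq_iff red_coset by simp
  qed
  show "red ` carrier R = carrier N"
  proof (intro subset_antisym subsetI)
    fix y assume "y \<in> carrier N"
    then obtain a where "a \<in> carrier M" "y = \<phi> a" using surj by blast
    then show "y \<in> red ` carrier R" using red_coset coset_in_R by (metis imageI)
  qed (auto elim!: R_carrierE simp: red_coset phi_closed)
qed

lemma red_closed: "X \<in> carrier R \<Longrightarrow> red X \<in> carrier N"
  using red_bij by (auto simp: bij_betw_def)

lemma red_inj: "X \<in> carrier R \<Longrightarrow> Y \<in> carrier R \<Longrightarrow> red X = red Y \<longleftrightarrow> X = Y"
  using red_bij by (auto simp: bij_betw_def inj_on_def)

lemma red_surj: "y \<in> carrier N \<Longrightarrow> \<exists>X\<in>carrier R. red X = y"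
  using red_bij by (metis bij_betw_imp_surj_on imageE)

lemma red_mult: "X \<in> carrier R \<Longrightarrow> Y \<in> carrier R \<Longrightarrow> red (X \<otimes>\<^bsub>R\<^esub> Y) = red X \<otimes>\<^bsub>N\<^esub> red Y"
  using red_hom by (simp add: hom_mult)

sublocale R: reduced_monoid R
proof -
  interpret R: comm_monoid R by (rule comm_monoid_R)
  have cancel: "X = Y" if X: "X \<in> carrier R" "Y \<in> carrier R" "Z \<in> carrier R"
    "Z \<otimes>\<^bsub>R\<^esub> X = Z \<otimes>\<^bsub>R\<^esub> Y" for X Y Z
  proof -
    have "red Z \<otimes>\<^bsub>N\<^esub> red X = red Z \<otimes>\<^bsub>N\<^esub> red Y"
      using X red_mult[of Z X] red_mult[of Z Y] by simp
    then have "red X = red Y" using X red_closed N.l_cancel by blast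
    then show ?thesis using X red_inj by blast
  qed
  have "comm_monoid_cancel R"
  proof (rule comm_monoid_cancelI)
    fix X Y Z assume "X \<otimes>\<^bsub>R\<^esub> Z = Y \<otimes>\<^bsub>R\<^esub> Z" "X \<in> carrier R" "Y \<in> carrier R" "Z \<in> carrier R"
    note XYZ = this
    have "Z \<otimes>\<^bsub>R\<^esub> X = Z \<otimes>\<^bsub>R\<^esub> Y"
      using trans[OF R.m_comm[OF XYZ(4,2)] trans[OF XYZ(1) R.m_comm[OF XYZ(3,4)]]] .
    then show "X = Y" by (rule cancel[OF XYZ(2-4)])
  qed (rule comm_monoid_R)
  moreover have "X = \<one>\<^bsub>R\<^esub>" if X: "X \<in> Units R" for X
  proof -
    obtain Y where "X \<in> carrier R" "Y \<in> carrier R" "X \<otimes>\<^bsub>R\<^esub> Y = \<one>\<^bsub>R\<^esub>"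
      using X unfolding Units_def by blast
    note XY = this
    then have "red X \<otimes>\<^bsub>N\<^esub> red Y = \<one>\<^bsub>N\<^esub>" using red_mult[of X Y] red_one by simp
    then have "red X = \<one>\<^bsub>N\<^esub>"
      using N.mult_eq_one[of "red X" "red Y"] red_closed XY by blast
    then have "red X = red \<one>\<^bsub>R\<^esub>" by (simp only: red_one)
    then show ?thesis using red_inj[of X "\<one>\<^bsub>R\<^esub>"] XY(1) by simp
  qed
  then have "Units R = {\<one>\<^bsub>R\<^esub>}" using R.Units_one_closed by blast
  ultimately show "reduced_monoid R"
    by (intro reduced_monoid.intro reduced_monoid_axioms.intro)
qed

lemma red_atoms: "X \<in> atoms R \<longleftrightarrow> X \<in> carrier R \<and> red X \<in> atoms N"
proof (cases "X \<in> carrier R")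
  case True
  have one: "red B = \<one>\<^bsub>N\<^esub> \<longleftrightarrow> B = \<one>\<^bsub>R\<^esub>" if "B \<in> carrier R" for B
    using red_inj[OF that R.one_closed] red_one by simp
  have mult: "red X = red B \<otimes>\<^bsub>N\<^esub> red C \<longleftrightarrow> X = B \<otimes>\<^bsub>R\<^esub> C" if "B \<in> carrier R" "C \<in> carrier R" for B C
    using red_inj[OF True R.m_closed[OF that]] red_mult[OF that] by simp
  have "(\<forall>b\<in>carrier N. \<forall>c\<in>carrier N. red X = b \<otimes>\<^bsub>N\<^esub> c \<longrightarrow> b = \<one>\<^bsub>N\<^esub> \<or> c = \<one>\<^bsub>N\<^esub>) \<longleftrightarrow>
    (\<forall>B\<in>carrier R. \<forall>C\<in>carrier R. X = B \<otimes>\<^bsub>R\<^esub> C \<longrightarrow> B = \<one>\<^bsub>R\<^esub> \<or> C = \<one>\<^bsub>R\<^esub>)" (is "?l \<longleftrightarrow> ?r")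
  proof
    assume ?l
    then show ?r using red_closed one mult by blast
  next
    assume r: ?r
    show ?l
    proof (intro ballI impI)
      fix b c assume bc: "b \<in> carrier N" "c \<in> carrier N" "red X = b \<otimes>\<^bsub>N\<^esub> c"
      obtain B C where "B \<in> carrier R" "red B = b" "C \<in> carrier R" "red C = c"
        using bc red_surj by meson
      then show "b = \<one>\<^bsub>N\<^esub> \<or> c = \<one>\<^bsub>N\<^esub>" using r mult[of B C] one[of B] one[of C] bc by blast
    qed
  qed
  then show ?thesis
    unfolding R.atoms_iff N.atoms_iff using True red_closed[OF True] one[OF True] by blast
qed (simp add: R.atoms_iff)

text \<open>The induced isomorphism preserves atoms and products, hence factorizations. Being
  injective on atoms it also preserves lengths and distances, so every invariant of \<open>M\<close>
  can be read off from \<open>N.Z\<close>.\<close>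

lemma facts_of_image:
  assumes "a \<in> carrier M"
  shows "image_mset red ` facts_of M a = N.Z (\<phi> a)"
proof (intro subset_antisym subsetI)
  have Z: "z \<in> facts_of M a \<longleftrightarrow> z \<in> R.Z (a <#\<^bsub>M\<^esub> Units M)" for z
    by (auto simp: facts_of_def fact_monoid_def factorizations_def)
  have eq: "red (mset_prod R z) = mset_prod N (image_mset red z)" if "set_mset z \<subseteq> carrier R" for z
    by (rule mset_prod_hom[OF comm_monoid_R N.comm_monoid_axioms red_hom red_one that])
  {
    fix w assume "w \<in> image_mset red ` facts_of M a"
    then obtain z where z: "z \<in> R.Z (a <#\<^bsub>M\<^esub> Units M)" "w = image_mset red z" using Z by auto
    then have "set_mset z \<subseteq> carrier R" using R.Z_carrier by auto
    from eq[OF this] z red_coset[OF assms] red_atoms show "w \<in> N.Z (\<phi> a)"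
      by (auto simp: factorizations_def)
  next
    fix w assume w: "w \<in> N.Z (\<phi> a)"
    let ?g = "inv_into (carrier R) red"
    have g: "?g y \<in> carrier R \<and> red (?g y) = y" if "y \<in># w" for y
    proof -
      have "y \<in> red ` carrier R" using red_bij N.Z_carrier[OF w] that by (auto simp: bij_betw_def)
      then show ?thesis using inv_into_into f_inv_into_f by metis
    qed
    let ?z = "image_mset ?g w"
    have "image_mset (red \<circ> ?g) w = image_mset id w" by (rule image_mset_cong) (use g in auto)
    then have wz: "image_mset red ?z = w" by (simp add: multiset.map_comp)
    have atoms: "set_mset ?z \<subseteq> atoms R" using g w by (auto simp: red_atoms factorizations_def)
    then have c: "set_mset ?z \<subseteq> carrier R" using R.atoms_subset by blast
    have "red (mset_prod R ?z) = red (a <#\<^bsub>M\<^esub> Units M)"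
      using eq[OF c] wz w red_coset[OF assms] by (simp add: factorizations_def)
    then have "mset_prod R ?z = a <#\<^bsub>M\<^esub> Units M"
      using red_inj R.mset_prod_closed[OF c] coset_in_R[OF assms] by blast
    then have "?z \<in> facts_of M a" using Z atoms by (simp add: factorizations_def)
    then show "w \<in> image_mset red ` facts_of M a" using wz by (metis imageI)
  }
qed

lemma facts_of_carrier: "z \<in> facts_of M a \<Longrightarrow> set_mset z \<subseteq> carrier R"
  using R.atoms_subset by (auto simp: facts_of_def fact_monoid_def)

lemma red_inj_on: "inj_on red (carrier R)"
  using red_bij by (simp add: bij_betw_def)

lemma length_set_eq: "a \<in> carrier M \<Longrightarrow> length_set M a = size ` N.Z (\<phi> a)"
  unfolding length_set_def facts_of_image[symmetric] by (simp add: image_image)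

lemma length_sets_eq: "length_sets M = (\<lambda>b. size ` N.Z b) ` carrier N"
  unfolding length_sets_def surj[symmetric] image_image by (rule image_cong) (simp_all add: length_set_eq)

lemma chain_connected_facts_of:
  "a \<in> carrier M \<Longrightarrow> chain_connected up d (facts_of M a) \<longleftrightarrow> chain_connected up d (N.Z (\<phi> a))"
  unfolding facts_of_image[symmetric]
  by (rule chain_connected_image_mset[OF red_inj_on, symmetric]) (rule facts_of_carrier)

lemma catenary_degree_le_iff:
  "catenary_degree M \<le> d \<longleftrightarrow> (\<forall>b\<in>carrier N. chain_connected False d (N.Z b))"
  unfolding catenary_degree_def SUP_le_iff catenary_at_le_iff surj[symmetric]
  by (auto simp: chain_connected_facts_of)

lemma mon_catenary_degree_le_iff:
  "mon_catenary_degree M \<le> d \<longleftrightarrow> (\<forall>b\<in>carrier N. chain_connected True d (N.Z b))"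
  unfolding mon_catenary_degree_def SUP_le_iff mon_catenary_at_le_iff surj[symmetric]
  by (auto simp: chain_connected_facts_of)

text \<open>If all elements of \<open>M\<close> were units, \<open>N\<close> would be trivial; so
  the special case in the definition of \<open>unions_of_lengths\<close> does not arise.\<close>

lemma unions_of_lengths_iff:
  assumes "carrier N \<noteq> {\<one>\<^bsub>N\<^esub>}"
  shows "l \<in> unions_of_lengths M k \<longleftrightarrow> (\<exists>b. \<exists>z\<in>N.Z b. \<exists>z'\<in>N.Z b. size z = k \<and> size z' = l)"
proof -
  have "a \<in> Units M \<Longrightarrow> \<phi> a \<otimes>\<^bsub>N\<^esub> \<phi> (inv\<^bsub>M\<^esub> a) = \<one>\<^bsub>N\<^esub>" for a
    using phi_mult[of a "inv\<^bsub>M\<^esub> a"] phi_one by (simp add: M.Units_closed)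
  then have *: "a \<in> Units M \<Longrightarrow> \<phi> a = \<one>\<^bsub>N\<^esub>" for a
    using N.mult_eq_one[of "\<phi> a" "\<phi> (inv\<^bsub>M\<^esub> a)"] phi_closed by (simp add: M.Units_closed)
  have "carrier M \<noteq> Units M"
  proof
    assume M: "carrier M = Units M"
    have "\<phi> ` carrier M \<subseteq> {\<one>\<^bsub>N\<^esub>}" unfolding M by (intro image_subsetI) (simp add: *)
    with assms show False unfolding surj using N.one_closed by blast
  qed
  then have "l \<in> unions_of_lengths M k \<longleftrightarrow>
      (\<exists>b\<in>carrier N. k \<in> size ` N.Z b \<and> l \<in> size ` N.Z b)"
    unfolding unions_of_lengths_def length_sets_eq by auto
  also have "\<dots> \<longleftrightarrow> (\<exists>b. k \<in> size ` N.Z b \<and> l \<in> size ` N.Z b)"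
    using N.Z_closed by blast
  moreover have "n \<in> size ` A \<longleftrightarrow> (\<exists>z\<in>A. size z = n)" for n and A :: "'c multiset set" by auto
  ultimately show ?thesis by simp
qed

lemma delta_set_iff:
  "n \<in> delta_set M \<longleftrightarrow> (\<exists>b\<in>carrier N. n \<in> delta_of_set (size ` N.Z b))"
  unfolding delta_set_def length_sets_eq by auto

lemma adj_catenary_degree_le_iff:
  "adj_catenary_degree M \<le> d \<longleftrightarrow>
     (\<forall>b\<in>carrier N. \<forall>k l. consecutive_in (size ` N.Z b) k l \<longrightarrow>
        (\<exists>z\<in>N.Z b. \<exists>z'\<in>N.Z b. size z = k \<and> size z' = l \<and> enat (fact_dist z z') \<le> d))"
proof -
  have "adj_catenary_at M a \<le> d \<longleftrightarrow>
     (\<forall>k l. consecutive_in (size ` N.Z (\<phi> a)) k l \<longrightarrow>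
        (\<exists>z\<in>N.Z (\<phi> a). \<exists>z'\<in>N.Z (\<phi> a). size z = k \<and> size z' = l \<and> enat (fact_dist z z') \<le> d))"
    if a: "a \<in> carrier M" for a
  proof -
    have "fact_set_dist (facts_of_length M k a) (facts_of_length M l a) \<le> d \<longleftrightarrow>
       (\<exists>z\<in>N.Z (\<phi> a). \<exists>z'\<in>N.Z (\<phi> a). size z = k \<and> size z' = l \<and> enat (fact_dist z z') \<le> d)"
      if "consecutive_in (size ` N.Z (\<phi> a)) k l" for k l
    proof -
      let ?X = "facts_of_length M k a" and ?Y = "facts_of_length M l a"
      have len: "k \<in> length_set M a" "l \<in> length_set M a"
        using that length_set_eq[OF a] by (auto simp: consecutive_in_def)
      \<comment> \<open>The infimum over an empty set would be infinite; lengths that occur have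
        nonempty sets of factorizations.\<close>
      then have ne: "?X \<noteq> {}" "?Y \<noteq> {}" by (auto simp: length_set_def facts_of_length_def)
      have "fact_set_dist ?X ?Y \<le> d \<longleftrightarrow> (\<exists>x\<in>?X. \<exists>y\<in>?Y. enat (fact_dist x y) \<le> d)"
        by (rule fact_set_dist_le_iff[OF ne])
      also have "\<dots> \<longleftrightarrow> (\<exists>x\<in>facts_of M a. \<exists>y\<in>facts_of M a. size x = k \<and> size y = l \<and>
          enat (fact_dist (image_mset red x) (image_mset red y)) \<le> d)"
        by (auto simp: facts_of_length_def
            fact_dist_image_mset[OF red_inj_on facts_of_carrier facts_of_carrier, of _ a _ a])
      finally show ?thesis by (simp flip: facts_of_image[OF a])
    qed
    moreover have "adj_catenary_at M a \<le> d \<longleftrightarrow> (\<forall>k l. consecutive_in (size ` N.Z (\<phi> a)) k l \<longrightarrow>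
        fact_set_dist (facts_of_length M k a) (facts_of_length M l a) \<le> d)"
      unfolding adj_catenary_at_def Sup_le_iff length_set_eq[OF a] by blast
    ultimately show ?thesis by simp
  qed
  then show ?thesis
    unfolding adj_catenary_degree_def SUP_le_iff surj[symmetric] by auto
qed

end

lemma (in reduced_monoid) monoid_reduction_id: "monoid_reduction G G id"
proof unfold_locales
  show "id a = id b \<longleftrightarrow> (\<exists>u\<in>Units G. b = a \<otimes> u)" if "a \<in> carrier G" "b \<in> carrier G" for a b
    using that by (auto simp: Units_eq)
qed (auto simp: hom_def)

section \<open>Coproducts of primary monoids\<close>

text \<open>An axiomatic coproduct of reduced local monoids, seen through valuations:
  \<open>val p i\<close> is the valuation with index \<open>i\<close> of the component at
  \<open>p\<close>. That the valuations at \<open>p\<close> vanish together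
  (\<open>val_zero_iff\<close>) reflects that a non-unit of a finitely primary monoid is divisible
  by all primes of its overmonoid. In \<open>strict_divides\<close> the inequality is strict because
  equal valuations leave a unit of the overmonoid undetermined.\<close>

locale primary_monoid = reduced_monoid J for J (structure) +
  fixes X :: "'p set" and s :: "'p \<Rightarrow> nat" and val :: "'p \<Rightarrow> nat \<Rightarrow> 'a \<Rightarrow> nat"
  assumes s_pos: "p \<in> X \<Longrightarrow> 0 < s p"
    and val_mult: "p \<in> X \<Longrightarrow> i < s p \<Longrightarrow> a \<in> carrier J \<Longrightarrow> b \<in> carrier J \<Longrightarrow>
      val p i (a \<otimes> b) = val p i a + val p i b"
    and val_zero_iff: "p \<in> X \<Longrightarrow> i < s p \<Longrightarrow> a \<in> carrier J \<Longrightarrow> val p i a = 0 \<longleftrightarrow> val p 0 a = 0"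
    and finite_support: "a \<in> carrier J \<Longrightarrow> finite {p \<in> X. val p 0 a \<noteq> 0}"
    and support_empty: "a \<in> carrier J \<Longrightarrow> (\<And>p. p \<in> X \<Longrightarrow> val p 0 a = 0) \<Longrightarrow> a = \<one>"
    and component: "a \<in> carrier J \<Longrightarrow> p \<in> X \<Longrightarrow> \<exists>e\<in>carrier J. \<exists>f\<in>carrier J. a = e \<otimes> f \<and>
      (\<forall>p'\<in>X. p' \<noteq> p \<longrightarrow> val p' 0 e = 0) \<and> val p 0 f = 0"
    and component_unique: "p \<in> X \<Longrightarrow> e \<in> carrier J \<Longrightarrow> f \<in> carrier J \<Longrightarrow> e' \<in> carrier J \<Longrightarrow> f' \<in> carrier J \<Longrightarrow>
      \<forall>p'\<in>X. p' \<noteq> p \<longrightarrow> val p' 0 e = 0 \<Longrightarrow> \<forall>p'\<in>X. p' \<noteq> p \<longrightarrow> val p' 0 e' = 0 \<Longrightarrow>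
      val p 0 f = 0 \<Longrightarrow> val p 0 f' = 0 \<Longrightarrow> e \<otimes> f = e' \<otimes> f' \<Longrightarrow> e = e'"
    and strict_divides: "p \<in> X \<Longrightarrow> b \<in> carrier J \<Longrightarrow> c \<in> carrier J \<Longrightarrow>
      \<forall>p'\<in>X. p' \<noteq> p \<longrightarrow> val p' 0 b = 0 \<Longrightarrow> \<forall>p'\<in>X. p' \<noteq> p \<longrightarrow> val p' 0 c = 0 \<Longrightarrow>
      \<forall>i<s p. val p i c < val p i b \<Longrightarrow> \<exists>y\<in>carrier J. b = c \<otimes> y"
    and val_surj: "p \<in> X \<Longrightarrow> \<forall>i<s p. 0 < k i \<Longrightarrow>
      \<exists>a\<in>carrier J. (\<forall>p'\<in>X. p' \<noteq> p \<longrightarrow> val p' 0 a = 0) \<and> (\<forall>i<s p. val p i a = k i)"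
begin

text \<open>The component at \<open>p\<close>, realized as a divisor-closed submonoid.\<close>

definition "primary p = {e \<in> carrier J. \<forall>p'\<in>X. p' \<noteq> p \<longrightarrow> val p' 0 e = 0}"

abbreviation "atoms_at p \<equiv> atoms J \<inter> primary p"

lemma primary_closed: "e \<in> primary p \<Longrightarrow> e \<in> carrier J"
  by (simp add: primary_def)

lemma val_one: "p \<in> X \<Longrightarrow> i < s p \<Longrightarrow> val p i \<one> = 0"
  using val_mult[of p i \<one> \<one>] by simp

lemma val_pos: "p \<in> X \<Longrightarrow> i < s p \<Longrightarrow> a \<in> carrier J \<Longrightarrow> 0 < val p i a \<longleftrightarrow> 0 < val p 0 a"
  using val_zero_iff[of p i a] by linarith

lemma one_primary: "\<one> \<in> primary p"
  using val_one s_pos by (simp add: primary_def)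

lemma primary_mult: "e \<in> primary p \<Longrightarrow> e' \<in> primary p \<Longrightarrow> e \<otimes> e' \<in> primary p"
  using val_mult s_pos by (simp add: primary_def)

lemma primary_factor:
  assumes "e \<otimes> e' \<in> primary p" "e \<in> carrier J" "e' \<in> carrier J"
  shows "e \<in> primary p" "e' \<in> primary p"
  using assms val_mult s_pos by (auto simp: primary_def)

lemma primary_eq_one: "p \<in> X \<Longrightarrow> e \<in> primary p \<Longrightarrow> val p 0 e = 0 \<Longrightarrow> e = \<one>"
  by (rule support_empty) (auto simp: primary_def)

lemma primary_val_pos: "p \<in> X \<Longrightarrow> e \<in> primary p \<Longrightarrow> e \<noteq> \<one> \<Longrightarrow> i < s p \<Longrightarrow> 0 < val p i e"
  using primary_eq_one val_pos primary_closed by blast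

lemma primary_component:
  assumes "a \<in> carrier J" "p \<in> X"
  obtains e f where "e \<in> primary p" "f \<in> carrier J" "a = e \<otimes> f" "val p 0 f = 0"
proof -
  obtain e f where *: "e \<in> carrier J" "f \<in> carrier J" "a = e \<otimes> f"
    "\<forall>p'\<in>X. p' \<noteq> p \<longrightarrow> val p' 0 e = 0" "val p 0 f = 0"
    using component[OF assms] by blast
  then have "e \<in> primary p" by (simp add: primary_def)
  then show thesis using * that by blast
qed

lemma primary_component_unique:
  assumes "p \<in> X" "e \<in> primary p" "e' \<in> primary p" "f \<in> carrier J" "f' \<in> carrier J"
    "val p 0 f = 0" "val p 0 f' = 0" "e \<otimes> f = e' \<otimes> f'"
  shows "e = e'"
  by (rule component_unique[of p e f e' f']) (use assms in \<open>simp_all add: primary_def\<close>)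

text \<open>Divisibility by a \<open>p\<close>-primary element only concerns the component at
  \<open>p\<close>, so \<open>strict_divides\<close> extends to arbitrary \<open>b\<close>.\<close>

lemma primary_divides:
  assumes "p \<in> X" "c \<in> primary p" "b \<in> carrier J" "\<forall>i<s p. val p i c < val p i b"
  shows "\<exists>y\<in>carrier J. b = c \<otimes> y"
proof -
  obtain e f where ef: "e \<in> primary p" "f \<in> carrier J" "b = e \<otimes> f" "val p 0 f = 0"
    using primary_component[OF assms(3,1)] .
  have "val p i b = val p i e" if "i < s p" for i
    using that ef assms(1) val_zero_iff[of p i f] by (simp add: val_mult primary_closed)
  then have "\<forall>i<s p. val p i c < val p i e" using assms(4) by simp
  then obtain y where y: "y \<in> carrier J" "e = c \<otimes> y"
    using strict_divides[of p e c] assms(1,2) ef(1) by (auto simp: primary_def)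
  have "b = c \<otimes> (y \<otimes> f)" unfolding ef(3) y(2)
    using y(1) ef(2) assms(2) primary_closed by (simp add: m_assoc)
  then show ?thesis using y(1) ef(2) by blast
qed

text \<open>A substitute for a prime element. Elements of all values 1 may differ by units of the
  overmonoid, so it is in general neither unique nor prime.\<close>

definition "unif p = (SOME t. t \<in> primary p \<and> (\<forall>i<s p. val p i t = 1))"

lemma primary_surj:
  assumes "p \<in> X" "\<forall>i<s p. 0 < k i"
  obtains a where "a \<in> primary p" "\<forall>i<s p. val p i a = k i"
  using val_surj[OF assms] unfolding primary_def by blast

lemma unif:
  assumes "p \<in> X"
  shows "unif p \<in> primary p" "i < s p \<Longrightarrow> val p i (unif p) = 1"
proof -
  obtain t where "t \<in> primary p" "\<forall>i<s p. val p i t = 1"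
    by (rule primary_surj[OF assms, of "\<lambda>_. 1"]) auto
  then have "\<exists>t. t \<in> primary p \<and> (\<forall>i<s p. val p i t = 1)" by blast
  from someI_ex[OF this] have "unif p \<in> primary p \<and> (\<forall>i<s p. val p i (unif p) = 1)"
    unfolding unif_def .
  then show "unif p \<in> primary p" "i < s p \<Longrightarrow> val p i (unif p) = 1" by simp_all
qed

lemma atom_primary:
  assumes "x \<in> atoms J"
  obtains p where "p \<in> X" "x \<in> primary p" "0 < val p 0 x"
proof -
  have x: "x \<in> carrier J" "x \<noteq> \<one>" using assms atoms_closed atom_not_one by blast+
  then obtain p where p: "p \<in> X" "val p 0 x \<noteq> 0" using support_empty by blast
  obtain e f where ef: "e \<in> primary p" "f \<in> carrier J" "x = e \<otimes> f" "val p 0 f = 0"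
    using primary_component[OF x(1) p(1)] .
  have "e \<noteq> \<one>"
  proof
    assume "e = \<one>"
    then have "x = f" using ef by simp
    then show False using p ef(4) by simp
  qed
  then have "f = \<one>" using atom_factor[OF assms ef(3)] ef primary_closed by blast
  then have "x = e" using ef primary_closed by simp
  then show thesis using that p ef(1) by simp
qed

text \<open>Two nontrivial factors would both have positive value at the index \<open>i\<close>,
  which value 1 does not allow.\<close>

lemma atomI:
  assumes "p \<in> X" "x \<in> primary p" "i < s p" "val p i x = 1"
  shows "x \<in> atoms J"
  unfolding atoms_iff
proof (intro conjI ballI impI)
  show "x \<noteq> \<one>" using val_one[OF assms(1,3)] assms(4) by auto
  fix b c assume bc: "b \<in> carrier J" "c \<in> carrier J" "x = b \<otimes> c"
  then have "b \<in> primary p" "c \<in> primary p" using primary_factor[of b c p] assms(2) by simp_all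
  moreover have "val p i b + val p i c = 1" using bc assms val_mult[of p i b c] by simp
  ultimately show "b = \<one> \<or> c = \<one>"
    using primary_val_pos[OF assms(1) _ _ assms(3), of b] primary_val_pos[OF assms(1) _ _ assms(3), of c]
    by fastforce
qed (use assms primary_closed in blast)

text \<open>If all values were at least 2, the uniformizer would divide \<open>x\<close> by strict
  comparison, so \<open>x\<close> would be the uniformizer, of value 1.\<close>

lemma atom_val:
  assumes "p \<in> X" "x \<in> atoms_at p"
  obtains i where "i < s p" "val p i x = 1"
proof (rule ccontr)
  assume no: "\<not> thesis"
  have x: "x \<in> carrier J" "x \<in> primary p" "x \<noteq> \<one>" using assms atoms_closed atom_not_one by blast+
  have ge2: "val p i x > 1" if "i < s p" for i
    using primary_val_pos[OF assms(1) x(2,3) that] no that[THEN \<open>\<And>i. i < s p \<Longrightarrow> val p i x = 1 \<Longrightarrow> thesis\<close>]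
    by linarith
  obtain y where y: "y \<in> carrier J" "x = unif p \<otimes> y"
    using primary_divides[OF assms(1) unif(1)[OF assms(1)] x(1)] unif(2)[OF assms(1)] ge2 by auto
  have u: "unif p \<in> carrier J" "val p 0 (unif p) = 1"
    using unif[OF assms(1)] s_pos[OF assms(1)] primary_closed by blast+
  have "unif p = \<one> \<or> y = \<one>" using assms(2) atom_factor[OF _ y(2) u(1) y(1)] by blast
  moreover have "unif p \<noteq> \<one>" using u(2) val_one[OF assms(1) s_pos[OF assms(1)]] by auto
  ultimately have "x = unif p" using y u by simp
  then show False using ge2[of 0] u(2) s_pos[OF assms(1)] by simp
qed

lemma atom_val_pos: "p \<in> X \<Longrightarrow> x \<in> atoms_at p \<Longrightarrow> i < s p \<Longrightarrow> 0 < val p i x"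
  using primary_val_pos atom_not_one by blast

lemma atom_val_pos_iff: "p \<in> X \<Longrightarrow> x \<in> atoms J \<Longrightarrow> 0 < val p 0 x \<longleftrightarrow> x \<in> primary p"
proof
  assume p: "p \<in> X" "x \<in> atoms J" "0 < val p 0 x"
  obtain p' where "p' \<in> X" "x \<in> primary p'" using atom_primary[OF p(2)] by blast
  then show "x \<in> primary p" using p by (cases "p' = p") (auto simp: primary_def)
qed (use atom_val_pos s_pos in blast)

lemma unif_atom: "p \<in> X \<Longrightarrow> unif p \<in> atoms_at p"
  using atomI[OF _ unif(1) s_pos unif(2)[OF _ s_pos]] unif(1) by blast

text \<open>The factor \<open>x\<close> gets value 1 at index 0 and leaves value 1 for the cofactor
  at every other index. In rank at least 2 the cofactor thus has value 1 at index 1; in rank 1 it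
  has value 1 because \<open>b\<close> has value 2.\<close>

lemma split_two:
  assumes p: "p \<in> X" and b: "b \<in> primary p" and ge: "\<forall>i<s p. 2 \<le> val p i b"
    and or: "2 \<le> s p \<or> val p 0 b = 2"
  obtains x y where "x \<in> atoms_at p" "y \<in> atoms_at p" "b = x \<otimes> y"
proof -
  have ge': "2 \<le> val p i b" if "i < s p" for i using ge that by blast
  have "\<forall>i<s p. 0 < (if i = 0 then 1 else val p i b - 1)"
  proof (intro allI impI)
    fix i assume "i < s p"
    from ge'[OF this] show "0 < (if i = 0 then 1 else val p i b - 1)" by simp
  qed
  then obtain x where x: "x \<in> primary p" "\<forall>i<s p. val p i x = (if i = 0 then 1 else val p i b - 1)"
    by (rule primary_surj[OF p])
  have "\<forall>i<s p. val p i x < val p i b"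
  proof (intro allI impI)
    fix i assume i: "i < s p"
    have "val p i x = (if i = 0 then 1 else val p i b - 1)" using x(2) i by blast
    with ge'[OF i] show "val p i x < val p i b" by (simp split: if_splits)
  qed
  then obtain y where y: "y \<in> carrier J" "b = x \<otimes> y"
    using primary_divides[OF p x(1) primary_closed[OF b]] by blast
  have yp: "y \<in> primary p" using primary_factor(2)[of x y p] y b primary_closed[OF x(1)] by simp
  have vy: "val p i b = val p i x + val p i y" if "i < s p" for i
    using y val_mult[OF p that primary_closed[OF x(1)] y(1)] by simp
  have "x \<in> atoms J" using atomI[OF p x(1), of 0] x(2) s_pos[OF p] by simp
  moreover have "y \<in> atoms J"
  proof (cases "2 \<le> s p")
    case True
    then have "1 < s p" by simp
    with vy[of 1] x(2) ge'[of 1] have "val p 1 y = 1" by simp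
    with \<open>1 < s p\<close> show ?thesis using atomI[OF p yp] by blast
  next
    case False
    then have "val p 0 y = 1" using vy[of 0] x(2) or s_pos[OF p] by simp
    then show ?thesis using atomI[OF p yp s_pos[OF p]] by blast
  qed
  ultimately show thesis using that x(1) yp y(2) by blast
qed

lemma divide_unif:
  assumes p: "p \<in> X" and b: "b \<in> primary p" and ge: "\<forall>i<s p. 2 \<le> val p i b"
  obtains c where "c \<in> primary p" "b = unif p \<otimes> c" "\<forall>i<s p. val p i b = Suc (val p i c)"
proof -
  have u: "unif p \<in> primary p" "\<forall>i<s p. val p i (unif p) = 1" using unif[OF p] by blast+
  have "\<forall>i<s p. val p i (unif p) < val p i b" using u(2) ge by fastforce
  then obtain c where c: "c \<in> carrier J" "b = unif p \<otimes> c"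
    using primary_divides[OF p u(1) primary_closed[OF b]] by blast
  moreover have "c \<in> primary p" using primary_factor(2)[of "unif p" c p] c b primary_closed[OF u(1)] by simp
  moreover have "\<forall>i<s p. val p i b = Suc (val p i c)"
    using c u val_mult[OF p _ primary_closed[OF u(1)] c(1)] by simp
  ultimately show thesis using that by blast
qed

lemma Z_pair: "x \<in> atoms J \<Longrightarrow> y \<in> atoms J \<Longrightarrow> {#x, y#} \<in> Z (x \<otimes> y)"
  using Z_add_mset Z_atom by blast

text \<open>The uniformizer is split off first and kept as a factor, since an atom shared by two
  factorizations is what permits induction by cancellation.\<close>

lemma split_three:
  assumes p: "p \<in> X" and b: "b \<in> primary p" and ge: "\<forall>i<s p. 3 \<le> val p i b"
    and or: "2 \<le> s p \<or> val p 0 b = 3"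
  obtains y where "y \<in> Z b" "size y = 3" "unif p \<in># y"
proof -
  have "\<forall>i<s p. 2 \<le> val p i b" using ge by fastforce
  then obtain c where c: "c \<in> primary p" "b = unif p \<otimes> c" "\<forall>i<s p. val p i b = Suc (val p i c)"
    using divide_unif[OF p b] by blast
  have "\<forall>i<s p. 2 \<le> val p i c" using c(3) ge by fastforce
  moreover have "2 \<le> s p \<or> val p 0 c = 2" using or c(3) s_pos[OF p] by fastforce
  ultimately obtain x y where xy: "x \<in> atoms_at p" "y \<in> atoms_at p" "c = x \<otimes> y"
    using split_two[OF p c(1)] by blast
  then have "{#unif p, x, y#} \<in> Z b" unfolding c(2) xy(3)
    using Z_add_mset[OF _ Z_pair] unif_atom[OF p] by blast
  then show thesis using that[of "{#unif p, x, y#}"] by simp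
qed

text \<open>An atom lies in exactly one component, so this is the length of the part of
  \<open>z\<close> over \<open>p\<close>.\<close>

definition "len p z = size (filter_mset (\<lambda>x. 0 < val p 0 x) z)"

lemma len_empty [simp]: "len p {#} = 0"
  and len_add_mset: "len p (add_mset x z) = (if 0 < val p 0 x then Suc (len p z) else len p z)"
  and len_union: "len p (z + z') = len p z + len p z'"
  by (simp_all add: len_def)

lemma len_eq_0_iff: "len p z = 0 \<longleftrightarrow> (\<forall>x\<in>#z. val p 0 x = 0)"
  by (induction z) (auto simp: len_add_mset)

lemma val_mset_prod:
  assumes "p \<in> X" "i < s p"
  shows "set_mset z \<subseteq> carrier J \<Longrightarrow> val p i (mset_prod J z) = (\<Sum>x\<in>#z. val p i x)"
  by (induction z) (simp_all add: assms val_mult val_one)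

lemma val_ge_size:
  assumes "p \<in> X" "i < s p"
  shows "set_mset z \<subseteq> atoms_at p \<Longrightarrow> size z \<le> val p i (mset_prod J z)"
proof (induction z)
  case (add x z)
  then have c: "x \<in> carrier J" "set_mset z \<subseteq> carrier J" using atoms_subset by auto
  have "0 < val p i x" using add.prems atom_val_pos[OF assms(1) _ assms(2)] by simp
  then show ?case using add c by (simp add: val_mult assms)
qed simp

lemma primary_mset_prod: "set_mset z \<subseteq> primary p \<Longrightarrow> mset_prod J z \<in> primary p"
proof (induction z)
  case (add x z)
  then have "x \<in> carrier J" "set_mset z \<subseteq> carrier J" using primary_closed by auto
  with add show ?case by (simp add: primary_mult)
qed (simp add: one_primary)

lemma part_split:
  assumes "p \<in> X" "z \<in> Z a"
  obtains y r where "z = y + r" "size y = len p z" "set_mset y \<subseteq> atoms_at p" "len p r = 0"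
    "mset_prod J y \<in> primary p" "val p 0 (mset_prod J r) = 0" "y \<in> Z (mset_prod J y)" "r \<in> Z (mset_prod J r)"
    "a = mset_prod J y \<otimes> mset_prod J r"
proof -
  define y r where "y = filter_mset (\<lambda>x. 0 < val p 0 x) z" and "r = filter_mset (\<lambda>x. \<not> 0 < val p 0 x) z"
  have z: "z = y + r" unfolding y_def r_def by (rule multiset_partition)
  have at: "set_mset z \<subseteq> atoms J" using assms(2) by (simp add: factorizations_def)
  then have y: "set_mset y \<subseteq> atoms_at p" using atom_val_pos_iff[OF assms(1)] by (auto simp: y_def)
  have "set_mset r \<subseteq> carrier J" using at atoms_subset by (auto simp: r_def)
  then have v: "val p 0 (mset_prod J r) = 0"
    using val_mset_prod[OF assms(1) s_pos[OF assms(1)], of r] by (simp add: r_def)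
  have l: "len p r = 0" by (simp add: len_def r_def)
  have sz: "size y = len p z" by (simp add: len_def y_def)
  have yr: "y + r \<in> Z a" using assms(2) unfolding z .
  have pp: "mset_prod J y \<in> primary p" by (rule primary_mset_prod) (use y in blast)
  show thesis by (rule that[OF z sz y l pp v Z_union_split[OF yr]])
qed

lemma multiset_split_size:
  assumes "n \<le> size (y :: 'c multiset)"
  obtains u v where "y = u + v" "size u = n"
proof -
  obtain xs where xs: "mset xs = y" using ex_mset by blast
  have "y = mset (take n xs) + mset (drop n xs)"
    unfolding mset_append[symmetric] append_take_drop_id xs ..
  moreover have "size (mset (take n xs)) = n" using assms unfolding xs[symmetric] by simp
  ultimately show thesis by (rule that)
qed

lemma part_extract:
  assumes "p \<in> X" "z \<in> Z a" "n \<le> len p z"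
  obtains y r where "z = y + r" "size y = n" "set_mset y \<subseteq> atoms_at p"
    "mset_prod J y \<in> primary p" "y \<in> Z (mset_prod J y)"
proof -
  obtain y r where yr: "z = y + r" "size y = len p z" "set_mset y \<subseteq> atoms_at p"
    using part_split[OF assms(1,2)] by blast
  obtain u v where uv: "y = u + v" "size u = n" using multiset_split_size[of n y] assms(3) yr(2) by metis
  have "set_mset u \<subseteq> atoms_at p" using yr(3) uv by simp
  moreover have "u \<in> Z (mset_prod J u)"
    using Z_union_split(1)[of u "v + r" a] assms(2) yr(1) uv(1) by (simp add: add.assoc)
  moreover have "mset_prod J u \<in> primary p" by (rule primary_mset_prod) (use calculation in blast)
  moreover have "z = u + (v + r)" using yr(1) uv(1) by (simp add: add.assoc)
  ultimately show thesis using that uv(2) by blast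
qed

text \<open>By uniqueness of components the parts over \<open>p\<close> of two factorizations of
  \<open>a\<close> factor the same element and may replace each other.\<close>

lemma part_prod_eq:
  assumes "p \<in> X" "y + r \<in> Z a" "y' + r' \<in> Z a" "set_mset y \<subseteq> atoms_at p" "set_mset y' \<subseteq> atoms_at p"
    "len p r = 0" "len p r' = 0"
  shows "mset_prod J y = mset_prod J y'"
proof -
  note sp = Z_union_split[OF assms(2)] Z_union_split[OF assms(3)]
  have "val p 0 (mset_prod J r) = 0" if "r \<in> Z b" "len p r = 0" for r b
    using that val_mset_prod[OF assms(1) s_pos[OF assms(1)], of r] Z_carrier by (auto simp: len_def)
  then have "val p 0 (mset_prod J r) = 0" "val p 0 (mset_prod J r') = 0" using sp assms by blast+
  note v = this
  have "mset_prod J y \<in> primary p" "mset_prod J y' \<in> primary p"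
    using assms(4,5) by (auto intro!: primary_mset_prod)
  moreover have "mset_prod J y \<otimes> mset_prod J r = mset_prod J y' \<otimes> mset_prod J r'"
    using trans[OF sp(3)[symmetric] sp(6)] .
  ultimately show ?thesis
    using primary_component_unique[OF assms(1)] v Z_closed[OF sp(2)] Z_closed[OF sp(5)] by blast
qed

lemma size_eq_sum_len:
  assumes "finite S" "S \<subseteq> X"
  shows "set_mset z \<subseteq> atoms J \<Longrightarrow> \<forall>x\<in>#z. \<exists>p\<in>S. 0 < val p 0 x \<Longrightarrow> size z = (\<Sum>p\<in>S. len p z)"
proof (induction z)
  case (add x z)
  then obtain p where p: "p \<in> S" "0 < val p 0 x" by auto
  have x: "x \<in> atoms J" using add by simp
  have "x \<in> primary p" using atom_val_pos_iff[of p x] p assms x by auto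
  then have "0 < val p' 0 x \<longleftrightarrow> p' = p" if "p' \<in> S" for p'
    using that p assms(2) by (auto simp: primary_def)
  then have "(\<Sum>p'\<in>S. len p' (add_mset x z)) = (\<Sum>p'\<in>S. len p' z + (if p' = p then 1 else 0))"
    by (intro sum.cong) (auto simp: len_add_mset)
  also have "\<dots> = Suc (\<Sum>p'\<in>S. len p' z)" using p assms(1) by (simp add: sum.distrib)
  finally show ?case using add by simp
qed simp

text \<open>The length is the sum of the local lengths over the finite support of
  \<open>a\<close>.\<close>

lemma size_le_if_len_le:
  assumes "z \<in> Z a" "z' \<in> Z a" "\<forall>p\<in>X. len p z \<le> len p z'"
  shows "size z \<le> size z'" "p \<in> X \<Longrightarrow> len p z < len p z' \<Longrightarrow> size z < size z'"
proof -
  define S where "S = {p \<in> X. val p 0 a \<noteq> 0}"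
  have S: "finite S" "S \<subseteq> X" using finite_support Z_closed[OF assms(1)] by (auto simp: S_def)
  have sz: "size z = (\<Sum>p\<in>S. len p z)" "p \<in> X \<Longrightarrow> len p z > 0 \<Longrightarrow> p \<in> S" if z: "z \<in> Z a" for z p
  proof -
    have at: "set_mset z \<subseteq> atoms J" using z by (simp add: factorizations_def)
    have *: "p \<in> S" if "x \<in># z" "p \<in> X" "0 < val p 0 x" for x p
    proof -
      have "val p 0 a = (\<Sum>x\<in>#z. val p 0 x)"
        using val_mset_prod[OF that(2) s_pos[OF that(2)] Z_carrier[OF z]] z by (simp add: factorizations_def)
      also obtain w where "z = add_mset x w" using \<open>x \<in># z\<close> by (meson multi_member_split)
      then have "0 < (\<Sum>x\<in>#z. val p 0 x)" using that(3) by simp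
      finally show ?thesis using that(2) by (simp add: S_def)
    qed
    have "\<forall>x\<in>#z. \<exists>p\<in>S. 0 < val p 0 x"
    proof
      fix x assume x: "x \<in># z"
      then have "x \<in> atoms J" using at by blast
      then obtain p where "p \<in> X" "0 < val p 0 x" using atom_primary by blast
      then show "\<exists>p\<in>S. 0 < val p 0 x" using * x by blast
    qed
    then show "size z = (\<Sum>p\<in>S. len p z)" by (rule size_eq_sum_len[OF S at])
    assume "p \<in> X" "len p z > 0"
    then obtain x where "x \<in># z" "0 < val p 0 x" using len_eq_0_iff[of p z] by auto
    then show "p \<in> S" using * \<open>p \<in> X\<close> by blast
  qed
  show "size z \<le> size z'" unfolding sz(1)[OF assms(1)] sz(1)[OF assms(2)]
    using assms(3) S by (intro sum_mono) auto
  assume p: "p \<in> X" "len p z < len p z'"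
  then have "p \<in> S" using sz(2)[OF assms(2)] by simp
  then show "size z < size z'" unfolding sz(1)[OF assms(1)] sz(1)[OF assms(2)]
    using assms(3) S p by (intro sum_strict_mono_ex1) auto
qed

text \<open>In rank 1 every atom at \<open>p\<close> has value exactly 1, so the component is
  half-factorial.\<close>

lemma len_eq_val:
  assumes p: "p \<in> X" "s p = 1" and z: "z \<in> Z a"
  shows "len p z = val p 0 a"
proof -
  have "set_mset w \<subseteq> atoms J \<Longrightarrow> val p 0 (mset_prod J w) = len p w" for w
  proof (induction w)
    case (add x w)
    then have c: "x \<in> carrier J" "set_mset w \<subseteq> carrier J" using atoms_subset by auto
    have "val p 0 x \<le> 1"
    proof (cases "x \<in> primary p")
      case True
      then obtain i where "i < s p" "val p i x = 1" using atom_val[OF p(1), of x] add.prems by auto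
      then show ?thesis using p(2) by simp
    next
      case False
      then show ?thesis using atom_val_pos_iff[OF p(1), of x] add.prems by auto
    qed
    then show ?case using add c val_mult[OF p(1) _ c(1), of 0] p(2) by (simp add: len_add_mset)
  qed (simp add: val_one[OF p(1)] p(2))
  from this[of z] show ?thesis using z by (auto simp: factorizations_def)
qed

lemma chain_step_replace:
  assumes "y + r \<in> Z a" "y' \<in> Z (mset_prod J y)" "enat (max (size y) (size y')) \<le> d" "up \<Longrightarrow> size y \<le> size y'"
  shows "chain_step up d (Z a) (y + r) (y' + r)"
proof -
  have "enat (fact_dist (y + r) (y' + r)) \<le> d"
    using fact_dist_le_replace[of y r y'] assms(3) by (meson enat_ord_simps(1) order_trans)
  then show ?thesis using assms Z_replace[OF assms(1,2)] by (simp add: chain_step_def)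
qed

lemma chain_add_atom:
  assumes "(chain_step up d (Z b))\<^sup>*\<^sup>* w w'" "x \<in> atoms J"
  shows "(chain_step up d (Z (x \<otimes> b)))\<^sup>*\<^sup>* (add_mset x w) (add_mset x w')"
  using assms(1)
proof (induction rule: rtranclp_induct)
  case (step u v)
  then have "u \<in> Z b" "v \<in> Z b" by (simp_all add: chain_step_def)
  then have "add_mset x u \<in> Z (x \<otimes> b)" "add_mset x v \<in> Z (x \<otimes> b)"
    using Z_add_mset[OF assms(2)] by blast+
  then have "chain_step up d (Z (x \<otimes> b)) (add_mset x u) (add_mset x v)"
    using step(2) fact_dist_union[of "{#x#}" u v] by (simp add: chain_step_def)
  with step.IH show ?case by (rule rtranclp.rtrancl_into_rtrancl)
qed simp

text \<open>A product of three atoms at \<open>p\<close> has all values at least 3, so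
  \<open>split_three\<close> rewrites it as three atoms, one of them the uniformizer. In rank 1 two
  atoms suffice: their product has value 2 and the cofactor of the uniformizer has value 1. In
  higher rank that cofactor need not be an atom.\<close>

lemma normalize:
  assumes p: "p \<in> X" and z: "z \<in> Z a" and l: "3 \<le> len p z \<and> 3 \<le> d \<or> 2 \<le> len p z \<and> 2 \<le> d \<and> s p = 1"
  obtains z' where "chain_step up d (Z a) z z'" "chain_step up d (Z a) z' z" "unif p \<in># z'" "size z' = size z"
proof -
  define n :: nat where "n = (if s p = 1 then 2 else 3)"
  have n: "n \<le> len p z" "enat n \<le> d" using l order_trans[of 2 3 d] by (auto simp: n_def numeral_eq_enat)
  obtain y r where yr: "z = y + r" "size y = n" "set_mset y \<subseteq> atoms_at p"
    "mset_prod J y \<in> primary p" "y \<in> Z (mset_prod J y)"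
    using part_extract[OF p z n(1)] by blast
  have ge: "n \<le> val p i (mset_prod J y)" if "i < s p" for i
    using val_ge_size[OF p that yr(3)] yr(2) by simp
  have "\<exists>y'. y' \<in> Z (mset_prod J y) \<and> size y' = n \<and> unif p \<in># y'"
  proof (cases "s p = 1")
    case True
    have "size u \<le> 2 \<Longrightarrow> set_mset u \<subseteq> atoms_at p \<Longrightarrow> val p 0 (mset_prod J u) = size u" for u
    proof (induction u)
      case (add x u)
      then obtain i where "i < s p" "val p i x = 1" using atom_val[OF p, of x] by auto
      then have "val p 0 x = 1" using True by simp
      moreover have "x \<in> carrier J" "set_mset u \<subseteq> carrier J" using add.prems atoms_subset by auto
      ultimately show ?case using add True by (simp add: val_mult[OF p])
    qed (simp add: val_one[OF p] True)
    from this[of y] yr have v: "val p 0 (mset_prod J y) = 2" using True by (simp add: n_def)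
    then have "\<forall>i<s p. 2 \<le> val p i (mset_prod J y)" using True by simp
    then obtain c where c: "c \<in> primary p" "mset_prod J y = unif p \<otimes> c"
      "\<forall>i<s p. val p i (mset_prod J y) = Suc (val p i c)"
      using divide_unif[OF p yr(4)] by blast
    have "val p 0 c = 1" using c(3) v True by simp
    then have "c \<in> atoms J" using atomI[OF p c(1) s_pos[OF p]] by blast
    then have "{#unif p, c#} \<in> Z (mset_prod J y)" unfolding c(2) using Z_pair unif_atom[OF p] by blast
    then show ?thesis using True by (intro exI[of _ "{#unif p, c#}"]) (simp add: n_def)
  next
    case False
    then have "2 \<le> s p" using s_pos[OF p] by simp
    moreover have "\<forall>i<s p. 3 \<le> val p i (mset_prod J y)" using ge False by (simp add: n_def)
    ultimately obtain y' where "y' \<in> Z (mset_prod J y)" "size y' = 3" "unif p \<in># y'"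
      using split_three[OF p yr(4)] by blast
    then show ?thesis using False by (intro exI[of _ y']) (simp add: n_def)
  qed
  then obtain y' where y': "y' \<in> Z (mset_prod J y)" "size y' = n" "unif p \<in># y'" by blast
  have z1: "y' + r \<in> Z a" using Z_replace[of y r a y'] z y'(1) unfolding yr(1) by blast
  have "y \<in> Z (mset_prod J y')" using y'(1) yr(5) by (simp add: factorizations_def)
  then have "chain_step up d (Z a) (y' + r) z"
    unfolding yr(1) using chain_step_replace[OF z1] n(2) yr(2) y'(2) by simp
  moreover have "chain_step up d (Z a) z (y' + r)"
    using chain_step_replace[of y r a y'] n(2) yr(2) y' z unfolding yr(1) by simp
  ultimately show thesis using that[of "y' + r"] y' yr by simp
qed

text \<open>Values at least 3 leave room for three atoms in place of the two at \<open>p\<close>. By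
  \<open>val_ge_len\<close> this applies as soon as some factorization of \<open>a\<close> has three
  atoms at \<open>p\<close>.\<close>

lemma lengthen:
  assumes p: "p \<in> X" "2 \<le> s p" and z: "z \<in> Z a" "len p z = 2" and a: "\<forall>i<s p. 3 \<le> val p i a"
  obtains y r y' where "z = y + r" "size y = 2" "y' \<in> Z (mset_prod J y)" "size y' = 3" "unif p \<in># y'"
    "len p r = 0" "set_mset y \<subseteq> atoms_at p"
proof -
  obtain y r where yr: "z = y + r" "size y = len p z" "set_mset y \<subseteq> atoms_at p" "len p r = 0"
    "mset_prod J y \<in> primary p" "val p 0 (mset_prod J r) = 0" "y \<in> Z (mset_prod J y)" "r \<in> Z (mset_prod J r)"
    "a = mset_prod J y \<otimes> mset_prod J r"
    using part_split[OF p(1) z(1)] by blast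
  have c: "mset_prod J y \<in> carrier J" "mset_prod J r \<in> carrier J" using Z_closed yr(7,8) by blast+
  have "3 \<le> val p i (mset_prod J y)" if i: "i < s p" for i
  proof -
    have "val p i a = val p i (mset_prod J y) + val p i (mset_prod J r)"
      unfolding yr(9) by (rule val_mult[OF p(1) i c])
    moreover have "val p i (mset_prod J r) = 0" using val_zero_iff[OF p(1) i c(2)] yr(6) by simp
    ultimately show ?thesis using a i by fastforce
  qed
  then obtain y' where "y' \<in> Z (mset_prod J y)" "size y' = 3" "unif p \<in># y'"
    using split_three[OF p(1) yr(5)] p(2) by blast
  then show thesis using that[OF yr(1)] yr(2,3,4) z(2) by simp
qed

lemma val_ge_len:
  assumes "p \<in> X" "i < s p" "z \<in> Z a"
  shows "len p z \<le> val p i a"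
proof -
  obtain y r where yr: "z = y + r" "size y = len p z" "set_mset y \<subseteq> atoms_at p"
    "y \<in> Z (mset_prod J y)" "r \<in> Z (mset_prod J r)" "a = mset_prod J y \<otimes> mset_prod J r"
    using part_split[OF assms(1,3)] by blast
  have "val p i a = val p i (mset_prod J y) + val p i (mset_prod J r)"
    unfolding yr(6) by (rule val_mult[OF assms(1,2) Z_closed[OF yr(4)] Z_closed[OF yr(5)]])
  then show ?thesis using val_ge_size[OF assms(1,2) yr(3)] yr(2) by simp
qed

text \<open>Two atoms at \<open>p\<close> become three and three atoms at \<open>p'\<close> become
  two in a single step, so that the total length is unchanged. Five atoms are replaced by five,
  whence the bound 5.\<close>

lemma exchange:
  assumes p: "p \<in> X" "2 \<le> s p" and p': "p' \<in> X" "2 \<le> s p'" "p \<noteq> p'" and d: "5 \<le> d"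
    and z: "z \<in> Z a" "len p z = 2" "3 \<le> len p' z" and a: "\<forall>i<s p. 3 \<le> val p i a"
  obtains z' where "chain_step up d (Z a) z z'" "unif p \<in># z'" "size z' = size z"
proof -
  obtain y r y' where y: "z = y + r" "size y = 2" "y' \<in> Z (mset_prod J y)" "size y' = 3" "unif p \<in># y'"
    "len p r = 0" "set_mset y \<subseteq> atoms_at p"
    using lengthen[OF p z(1,2) a] by blast
  have yrZ: "y + r \<in> Z a" using z(1) unfolding y(1) .
  note sp = Z_union_split[OF yrZ]
  have "len p' y = 0"
  proof -
    have "\<not> 0 < val p' 0 x" if "x \<in># y" for x
      using y(7) that p'(1,3) by (auto simp: primary_def)
    then show ?thesis by (simp add: len_def)
  qed
  then have "3 \<le> len p' r" using z(3) y(1) by (simp add: len_union)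
  then obtain w q where w: "r = w + q" "size w = 3" "set_mset w \<subseteq> atoms_at p'"
    "mset_prod J w \<in> primary p'" "w \<in> Z (mset_prod J w)"
    using part_extract[OF p'(1) sp(2)] by blast
  have "\<forall>i<s p'. 2 \<le> val p' i (mset_prod J w)"
    using val_ge_size[OF p'(1) _ w(3)] w(2) by fastforce
  then obtain b c where bc: "b \<in> atoms_at p'" "c \<in> atoms_at p'" "mset_prod J w = b \<otimes> c"
    using split_two[OF p'(1) w(4)] p'(2) by blast
  then have w': "{#b, c#} \<in> Z (mset_prod J w)" using Z_pair by simp
  have "mset_prod J (y + w) = mset_prod J y \<otimes> mset_prod J w"
    using Z_carrier[OF sp(1)] Z_carrier[OF w(5)] by simp
  then have "y' + {#b, c#} \<in> Z (mset_prod J (y + w))" using Z_union[OF y(3) w'] by simp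
  moreover have "(y + w) + q \<in> Z a" using yrZ unfolding w(1) by (simp add: add.assoc)
  ultimately have step: "chain_step up d (Z a) ((y + w) + q) ((y' + {#b, c#}) + q)"
    using d y(2,4) w(2) by (intro chain_step_replace) (simp_all add: numeral_eq_enat)
  have zeq: "z = (y + w) + q" unfolding y(1) w(1) by (simp add: add.assoc)
  show thesis
  proof (rule that)
    show "chain_step up d (Z a) z ((y' + {#b, c#}) + q)" using step unfolding zeq .
    show "unif p \<in># (y' + {#b, c#}) + q" using y(5) by simp
    show "size ((y' + {#b, c#}) + q) = size z" unfolding zeq using y(2,4) w(2) by simp
  qed
qed

end

section \<open>Chains and adjacent lengths in the coproduct\<close>

context primary_monoid
begin

text \<open>
  Induction on \<open>|z| + |z'|\<close>: modify \<open>z\<close> and \<open>z'\<close> until they have an atom in common, and cancel it. At each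
  \<open>p\<close> with at least three atoms on either side (two if \<open>s p = 1\<close>) the uniformizer can be split off
  without changing the length. What remains are \<open>p\<close> with two atoms on one side and more on the
  other one; a monotone chain has to treat two such \<open>p\<close> simultaneously if they point in
  different directions, which is the step of distance 5.
\<close>
lemma chain_exists:
  assumes d: "(\<forall>p\<in>X. s p = 1) \<and> 2 \<le> d \<or> 3 \<le> d"
    and up: "up \<Longrightarrow> 5 \<le> d \<or> (\<forall>p\<in>X. \<forall>p'\<in>X. 2 \<le> s p \<longrightarrow> 2 \<le> s p' \<longrightarrow> p = p')"
    and "z \<in> Z a" "z' \<in> Z a" "up \<Longrightarrow> size z \<le> size z'"
  shows "(chain_step up d (Z a))\<^sup>*\<^sup>* z z'"
  using assms(3-5)
proof (induction "size z + size z'" arbitrary: a z z' rule: less_induct)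
  case less
  let ?R = "chain_step up d (Z a)"
  \<comment> \<open>\<open>Suc\<close> leaves room for one atom gained by lengthening: cancelling
    the shared atom removes one from both factorizations, so the sum of the lengths still
    decreases.\<close>
  have common: "?R\<^sup>*\<^sup>* z1 z1'"
    if x: "x \<in># z1" "x \<in># z1'" and Z: "z1 \<in> Z a" "z1' \<in> Z a"
      and sz: "size z1 + size z1' \<le> Suc (size z + size z')" "up \<Longrightarrow> size z1 \<le> size z1'" for x z1 z1'
  proof -
    obtain w w' where w: "z1 = add_mset x w" "z1' = add_mset x w'"
      using x by (meson multi_member_split)
    have Z1: "add_mset x w \<in> Z a" "add_mset x w' \<in> Z a" using Z unfolding w by blast+
    note sp = Z_add_mset_split[OF Z1(1)]
    have "(chain_step up d (Z (mset_prod J w)))\<^sup>*\<^sup>* w w'"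
      using less.hyps[of w w' "mset_prod J w"] sp(2) Z_cancel_atom[OF Z1] sz unfolding w by simp
    from chain_add_atom[OF this sp(1)] show ?thesis unfolding w using sp(3) by simp
  qed
  have len0: "len p z1 = 0 \<longleftrightarrow> len p z2 = 0" if "p \<in> X" "z1 \<in> Z a" "z2 \<in> Z a" for p z1 z2
  proof -
    have *: "len p z = 0 \<longleftrightarrow> val p 0 a = 0" if "z \<in> Z a" for z
      using val_mset_prod[OF \<open>p \<in> X\<close> s_pos[OF \<open>p \<in> X\<close>] Z_carrier[OF that]] that
      by (auto simp: factorizations_def len_eq_0_iff)
    show ?thesis using *[OF that(2)] *[OF that(3)] by simp
  qed
  note lens = len_eq_val
  \<comment> \<open>A part over \<open>p\<close> that is a single atom is the same atom in every
    factorization, hence shared.\<close>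
  have single: "?R\<^sup>*\<^sup>* z z'" if p: "p \<in> X" and one: "len p z1 = 1" and z1: "z1 \<in> Z a" "z2 \<in> Z a"
    and eq: "{z1, z2} = {z, z'}" for p z1 z2
  proof -
    obtain y r where yr: "z1 = y + r" "size y = len p z1" "set_mset y \<subseteq> atoms_at p" "len p r = 0"
      "mset_prod J y \<in> primary p" "val p 0 (mset_prod J r) = 0" "y \<in> Z (mset_prod J y)" "r \<in> Z (mset_prod J r)"
      "a = mset_prod J y \<otimes> mset_prod J r"
      by (rule part_split[OF p z1(1)])
    obtain y' r' where yr': "z2 = y' + r'" "size y' = len p z2" "set_mset y' \<subseteq> atoms_at p" "len p r' = 0"
      "mset_prod J y' \<in> primary p" "val p 0 (mset_prod J r') = 0" "y' \<in> Z (mset_prod J y')" "r' \<in> Z (mset_prod J r')"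
      "a = mset_prod J y' \<otimes> mset_prod J r'"
      by (rule part_split[OF p z1(2)])
    obtain x where x: "y = {#x#}" using yr(2) one size_1_singleton_mset by auto
    have Zs: "y + r \<in> Z a" "y' + r' \<in> Z a" using z1 unfolding yr(1) yr'(1) by blast+
    have "mset_prod J y' = x"
      using part_prod_eq[OF p Zs yr(3) yr'(3) yr(4) yr'(4)] x yr(3) atoms_closed by simp
    then have "y' = {#x#}" using yr'(7) Z_of_atom[of x y'] yr(3) x by simp
    then have "x \<in># z1" "x \<in># z2" using yr(1) yr'(1) x by simp_all
    then have "x \<in># z" "x \<in># z'" using eq by (auto simp: doubleton_eq_iff)
    from common[OF this less.prems(1,2) _ less.prems(3)] show ?thesis by simp
  qed
  have three: "?R\<^sup>*\<^sup>* z z'"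
    if p: "p \<in> X" and l: "3 \<le> len p z \<and> 3 \<le> len p z' \<or> s p = 1 \<and> 2 \<le> len p z" for p
  proof -
    have l': "3 \<le> len p z1 \<and> 3 \<le> d \<or> 2 \<le> len p z1 \<and> 2 \<le> d \<and> s p = 1" if "z1 = z \<or> z1 = z'" for z1
    proof (cases "s p = 1")
      case True
      have "2 \<le> d" using d by (auto intro: order_trans[of 2 3 d])
      moreover have "2 \<le> len p z1" using that l True lens[OF p True] less.prems by auto
      ultimately show ?thesis using True by blast
    next
      case False
      then show ?thesis using d l that p by auto
    qed
    obtain z1 where z1: "?R z z1" "unif p \<in># z1" "size z1 = size z"
      using normalize[OF p less.prems(1) l'] by blast
    obtain z2 where z2: "?R z2 z'" "unif p \<in># z2" "size z2 = size z'"
      using normalize[OF p less.prems(2) l'] by blast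
    have "z1 \<in> Z a" "z2 \<in> Z a" using z1(1) z2(1) by (simp_all add: chain_step_def)
    from common[OF z1(2) z2(2) this] have "?R\<^sup>*\<^sup>* z1 z2" using z1(3) z2(3) less.prems(3) by simp
    then show ?thesis using z1(1) z2(1) by (meson converse_rtranclp_into_rtranclp rtranclp.rtrancl_into_rtrancl)
  qed
  \<comment> \<open>The two atoms over \<open>p\<close> are exchanged for those of the other side in
    one step of distance at most 2; afterwards they are shared.\<close>
  have two_two: "?R\<^sup>*\<^sup>* z z'" if p: "p \<in> X" "len p z = 2" "len p z' = 2" for p
  proof -
    have d2: "2 \<le> d" using d by (auto intro: order_trans[of 2 3 d])
    obtain y r where yr: "z = y + r" "size y = len p z" "set_mset y \<subseteq> atoms_at p" "len p r = 0"
      "mset_prod J y \<in> primary p" "val p 0 (mset_prod J r) = 0" "y \<in> Z (mset_prod J y)" "r \<in> Z (mset_prod J r)"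
      "a = mset_prod J y \<otimes> mset_prod J r"
      by (rule part_split[OF p(1) less.prems(1)])
    obtain y' r' where yr': "z' = y' + r'" "size y' = len p z'" "set_mset y' \<subseteq> atoms_at p" "len p r' = 0"
      "mset_prod J y' \<in> primary p" "val p 0 (mset_prod J r') = 0" "y' \<in> Z (mset_prod J y')" "r' \<in> Z (mset_prod J r')"
      "a = mset_prod J y' \<otimes> mset_prod J r'"
      by (rule part_split[OF p(1) less.prems(2)])
    have Zs: "y + r \<in> Z a" "y' + r' \<in> Z a" using less.prems(1,2) unfolding yr(1) yr'(1) by blast+
    have eq: "mset_prod J y = mset_prod J y'" by (rule part_prod_eq[OF p(1) Zs yr(3) yr'(3) yr(4) yr'(4)])
    then have step: "?R (y + r) (y' + r)"
      using chain_step_replace[OF Zs(1), of y' d up] yr'(2,7) yr(2) p d2 by (simp add: numeral_eq_enat)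
    have "y' \<noteq> {#}" using yr'(2) p(3) by auto
    then obtain x where x: "x \<in># y'" by blast
    have "y' + r \<in> Z a" using step by (simp add: chain_step_def)
    then have "?R\<^sup>*\<^sup>* (y' + r) (y' + r')"
      by (rule common[of x, rotated 2]) (use x Zs(2) yr(2) yr'(2) p less.prems(3) yr(1) yr'(1) in simp_all)
    with step show ?thesis unfolding yr(1) yr'(1) by (rule converse_rtranclp_into_rtranclp)
  qed
  \<comment> \<open>The lower side gains an atom, so a monotone chain needs a strict inequality of
    lengths. The other side is normalized, after which both contain the uniformizer.\<close>
  have grow: "?R\<^sup>*\<^sup>* z1 z2"
    if p: "p \<in> X" "len p z1 = 2" "3 \<le> len p z2" and Z12: "z1 \<in> Z a" "z2 \<in> Z a"
      and sz: "size z1 + size z2 = size z + size z'" "up \<Longrightarrow> size z1 < size z2" for p z1 z2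
  proof -
    have s2: "2 \<le> s p" using lens[OF p(1) _ Z12(1)] lens[OF p(1) _ Z12(2)] p(2,3) s_pos[OF p(1)]
      by (cases "s p = 1") auto
    have d3: "3 \<le> d" using d s2 p(1) by auto
    have ge: "\<forall>i<s p. 3 \<le> val p i a" using val_ge_len[OF p(1) _ Z12(2)] p(3) by fastforce
    obtain y r y' where y: "z1 = y + r" "size y = 2" "y' \<in> Z (mset_prod J y)" "size y' = 3" "unif p \<in># y'"
      "len p r = 0" "set_mset y \<subseteq> atoms_at p"
      by (rule lengthen[OF p(1) s2 Z12(1) p(2) ge])
    have Zy: "y + r \<in> Z a" using Z12(1) unfolding y(1) .
    have step: "?R z1 (y' + r)"
      unfolding y(1) using chain_step_replace[OF Zy y(3)] y(2,4) d3 by (simp add: numeral_eq_enat)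
    obtain z3 where z3: "?R z3 z2" "unif p \<in># z3" "size z3 = size z2"
      using normalize[OF p(1) Z12(2), of d up] p(3) d3 by blast
    have "y' + r \<in> Z a" "z3 \<in> Z a" using step z3(1) by (simp_all add: chain_step_def)
    then have "?R\<^sup>*\<^sup>* (y' + r) z3"
      by (rule common[of "unif p", rotated 2]) (use y z3 sz in auto)
    then show ?thesis using step z3(1)
      by (meson converse_rtranclp_into_rtranclp rtranclp.rtrancl_into_rtrancl)
  qed
  let ?P = "\<lambda>p. len p z = 1 \<or> len p z' = 1 \<or>
      (3 \<le> len p z \<and> 3 \<le> len p z' \<or> s p = 1 \<and> 2 \<le> len p z) \<or> len p z = 2 \<and> len p z' = 2"
  show ?case
  proof (cases "\<exists>p\<in>X. ?P p")
    case True
    then obtain p where p: "p \<in> X" "len p z = 1 \<or> len p z' = 1 \<or>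
        (3 \<le> len p z \<and> 3 \<le> len p z' \<or> s p = 1 \<and> 2 \<le> len p z) \<or> len p z = 2 \<and> len p z' = 2"
      by blast
    from p(2) show ?thesis
    proof (elim disjE)
      assume "len p z = 1"
      then show ?thesis by (rule single[OF p(1) _ less.prems(1,2)]) simp
    next
      assume "len p z' = 1"
      then show ?thesis by (rule single[OF p(1) _ less.prems(2,1)]) (rule insert_commute)
    qed (use three[OF p(1)] two_two[OF p(1)] in simp_all)
  next
    case no: False
    have cases: "len p z = 0 \<and> len p z' = 0 \<or> 2 \<le> s p \<and> (len p z = 2 \<and> 3 \<le> len p z' \<or> 3 \<le> len p z \<and> len p z' = 2)"
      if p: "p \<in> X" for p
    proof -
      have "\<not> ?P p"
      proof
        assume "?P p"
        then have "\<exists>p\<in>X. ?P p" using p by (rule bexI)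
        with no show False by (rule notE)
      qed
      then have n: "len p z \<noteq> 1" "len p z' \<noteq> 1" "\<not> (3 \<le> len p z \<and> 3 \<le> len p z')"
        "\<not> (s p = 1 \<and> 2 \<le> len p z)" "\<not> (len p z = 2 \<and> len p z' = 2)"
        by simp_all
      have iff: "len p z = 0 \<longleftrightarrow> len p z' = 0" by (rule len0[OF p less.prems(1,2)])
      show ?thesis
      proof (cases "len p z = 0")
        case True
        then show ?thesis using iff by simp
      next
        case False
        then have ge: "2 \<le> len p z" "2 \<le> len p z'" using iff n(1,2) by linarith+
        then have "s p \<noteq> 1" using n(4) by simp
        then have "2 \<le> s p" using s_pos[OF p] by linarith
        moreover have "len p z = 2 \<and> 3 \<le> len p z' \<or> 3 \<le> len p z \<and> len p z' = 2"
        proof (cases "len p z = 2")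
          case True
          then show ?thesis using ge(2) n(5) by simp
        next
          case False
          then have "3 \<le> len p z" using ge(1) by simp
          then show ?thesis using n(3) ge(2) by simp
        qed
        ultimately show ?thesis by simp
      qed
    qed
    show ?thesis
    proof (cases "\<exists>p\<in>X. len p z = 2 \<and> 3 \<le> len p z'")
      case True
      then obtain p where p: "p \<in> X" "len p z = 2" "3 \<le> len p z'" by blast
      show ?thesis
      proof (cases "up \<and> size z = size z'")
        case False
        show ?thesis
          by (rule grow[OF p less.prems(1,2) refl]) (use False less.prems(3) in linarith)
      next
        case eq: True
        have s2: "2 \<le> s p" using cases[OF p(1)] p by auto
        have ge: "\<forall>i<s p. 3 \<le> val p i a" using val_ge_len[OF p(1) _ less.prems(2)] p(3) by fastforce
        \<comment> \<open>The total lengths agree, so an increase at \<open>p\<close> must be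
          compensated: otherwise all local lengths of \<open>z\<close> would be at most those of
          \<open>z'\<close>, with strict inequality at \<open>p\<close>.\<close>
        have "\<exists>p'\<in>X. 3 \<le> len p' z \<and> len p' z' = 2"
        proof (rule ccontr)
          assume "\<not> ?thesis"
          then have no3: "\<not> (3 \<le> len p' z \<and> len p' z' = 2)" if "p' \<in> X" for p' using that by blast
          have "\<forall>p'\<in>X. len p' z \<le> len p' z'"
          proof
            fix p' assume "p' \<in> X"
            from cases[OF this] no3[OF this] show "len p' z \<le> len p' z'" by auto
          qed
          then have "size z < size z'" using size_le_if_len_le(2)[OF less.prems(1,2) _ p(1)] p by simp
          then show False using eq by simp
        qed
        then obtain p' where p': "p' \<in> X" "3 \<le> len p' z" "len p' z' = 2" by blast
        have ne: "p \<noteq> p'" using p p' by auto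
        have s2': "2 \<le> s p'" using cases[OF p'(1)] p' by auto
        have d5: "5 \<le> d" using up eq p(1) p'(1) ne s2 s2' by blast
        have d3: "3 \<le> d" using d5 by (rule order_trans[rotated]) simp
        obtain z1 where z1: "?R z z1" "unif p \<in># z1" "size z1 = size z"
          using exchange[OF p(1) s2 p'(1) s2' ne d5 less.prems(1) p(2) p'(2) ge] by blast
        obtain z2 where z2: "?R z2 z'" "unif p \<in># z2" "size z2 = size z'"
          using normalize[OF p(1) less.prems(2), of d up] p(3) d3 by blast
        have "z1 \<in> Z a" "z2 \<in> Z a" using z1(1) z2(1) by (simp_all add: chain_step_def)
        then have "?R\<^sup>*\<^sup>* z1 z2"
          by (rule common[of "unif p", rotated 2]) (use z1 z2 less.prems(3) in auto)
        then show ?thesis using z1(1) z2(1)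
          by (meson converse_rtranclp_into_rtranclp rtranclp.rtrancl_into_rtrancl)
      qed
    next
      case no2: False
      show ?thesis
      proof (cases "\<exists>p\<in>X. 3 \<le> len p z \<and> len p z' = 2")
        case True
        then obtain p where p: "p \<in> X" "len p z' = 2" "3 \<le> len p z" by blast
        have no3: "\<not> (len p' z = 2 \<and> 3 \<le> len p' z')" if "p' \<in> X" for p' using no2 that by blast
        have "\<forall>p'\<in>X. len p' z' \<le> len p' z"
        proof
          fix p' assume "p' \<in> X"
          from cases[OF this] no3[OF this] show "len p' z' \<le> len p' z" by auto
        qed
        \<comment> \<open>Only local decreases are left, so the chain cannot be required to be
          monotone; it is built from \<open>z'\<close> to \<open>z\<close> and reversed.\<close>
        then have "size z' < size z" using size_le_if_len_le(2)[OF less.prems(2,1) _ p(1)] p by simp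
        then have "\<not> up" using less.prems(3) by linarith
        then have "?R\<^sup>*\<^sup>* z' z" using grow[OF p less.prems(2,1)] by simp
        then show ?thesis using chain_step_reverse[of up d "Z a" z' z] \<open>\<not> up\<close> by blast
      next
        case False
        have l0: "len p z = 0 \<and> len p z' = 0" if "p \<in> X" for p using cases[OF that] False no2 that by auto
        have "w = {#}" if "w \<in> Z a" "\<forall>p\<in>X. len p w = 0" for w
        proof (rule ccontr)
          assume "w \<noteq> {#}"
          then obtain x where x: "x \<in># w" by blast
          then have "x \<in> atoms J" using that(1) by (auto simp: factorizations_def)
          then obtain p where p: "p \<in> X" "0 < val p 0 x" using atom_primary by blast
          then have "len p w = 0" using that(2) by blast
          then show False using p(2) x unfolding len_eq_0_iff by auto
        qed
        then have "z = {#}" "z' = {#}" using l0 less.prems(1,2) by blast+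
        then show ?thesis by simp
      qed
    qed
  qed
qed

text \<open>An empty part over \<open>p\<close> has value 0, and a single atom has some value 1; as
  values bound local lengths, no longer part is possible. In rank 1 the local length is the
  value.\<close>

lemma len_less_ge_two:
  assumes p: "p \<in> X" and z: "z \<in> Z a" "z' \<in> Z a" and l: "len p z < len p z'"
  shows "2 \<le> len p z" "2 \<le> s p"
proof -
  obtain y r where yr: "z = y + r" "size y = len p z" "set_mset y \<subseteq> atoms_at p" "len p r = 0"
    "mset_prod J y \<in> primary p" "val p 0 (mset_prod J r) = 0" "y \<in> Z (mset_prod J y)" "r \<in> Z (mset_prod J r)"
    "a = mset_prod J y \<otimes> mset_prod J r"
    using part_split[OF p z(1)] by blast
  have c: "mset_prod J y \<in> carrier J" "mset_prod J r \<in> carrier J" using Z_closed yr(7,8) by blast+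
  have val: "val p i a = val p i (mset_prod J y)" if i: "i < s p" for i
  proof -
    have "val p i a = val p i (mset_prod J y) + val p i (mset_prod J r)"
      unfolding yr(9) by (rule val_mult[OF p i c])
    moreover have "val p i (mset_prod J r) = 0" using val_zero_iff[OF p i c(2)] yr(6) by simp
    ultimately show ?thesis by simp
  qed
  have ge: "len p z' \<le> val p i (mset_prod J y)" if "i < s p" for i
    using val_ge_len[OF p that z(2)] val[OF that] by simp
  show "2 \<le> len p z"
  proof (rule ccontr)
    assume "\<not> 2 \<le> len p z"
    then consider "size y = 0" | "size y = 1" using yr(2) by linarith
    then show False
    proof cases
      case 1
      then have "val p 0 (mset_prod J y) = 0" using val_one[OF p s_pos[OF p]] by simp
      then show False using ge[OF s_pos[OF p]] l by simp
    next
      case 2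
      then obtain x where x: "y = {#x#}" using size_1_singleton_mset by blast
      then have "x \<in> atoms_at p" using yr(3) by simp
      then obtain i where i: "i < s p" "val p i x = 1" using atom_val[OF p] by blast
      have "mset_prod J y = x" using x \<open>x \<in> atoms_at p\<close> atoms_closed by simp
      then show False using ge[OF i(1)] i(2) l yr(2) 2 by simp
    qed
  qed
  show "2 \<le> s p"
    using len_eq_val[OF p _ z(1)] len_eq_val[OF p _ z(2)] l s_pos[OF p] by (cases "s p = 1") auto
qed

text \<open>After removing \<open>n\<close> uniformizers all values are still at least 3, so the
  rest is a product both of two and of three atoms. The common part \<open>w\<close> does not count
  for the distance.\<close>

lemma split_adjacent:
  assumes p: "p \<in> X" "2 \<le> s p"
  shows "b \<in> primary p \<Longrightarrow> \<forall>i<s p. n + 3 \<le> val p i b \<Longrightarrow>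
    \<exists>w v v'. w + v \<in> Z b \<and> w + v' \<in> Z b \<and> size w = n \<and> size v = 2 \<and> size v' = 3"
proof (induction n arbitrary: b)
  case 0
  have "\<forall>i<s p. 2 \<le> val p i b" using 0(2) by fastforce
  then obtain x y where xy: "x \<in> atoms_at p" "y \<in> atoms_at p" "b = x \<otimes> y"
    using split_two[OF p(1) 0(1)] p(2) by blast
  have v: "{#x, y#} \<in> Z b" unfolding xy(3) using xy(1,2) Z_pair by blast
  obtain v' where "v' \<in> Z b" "size v' = 3" using split_three[OF p(1) 0(1)] 0(2) p(2) by auto
  then show ?case using v by (intro exI[of _ "{#}"] exI[of _ "{#x, y#}"] exI[of _ v']) simp
next
  case (Suc n)
  have "\<forall>i<s p. 2 \<le> val p i b" using Suc(3) by fastforce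
  then obtain c where c: "c \<in> primary p" "b = unif p \<otimes> c" "\<forall>i<s p. val p i b = Suc (val p i c)"
    using divide_unif[OF p(1) Suc(2)] by blast
  have "\<forall>i<s p. n + 3 \<le> val p i c" using c(3) Suc(3) by fastforce
  from Suc.IH[OF c(1) this] obtain w v v' where w: "w + v \<in> Z c" "w + v' \<in> Z c" "size w = n" "size v = 2" "size v' = 3"
    by blast
  have u: "unif p \<in> atoms J" using unif_atom[OF p(1)] by blast
  have "add_mset (unif p) w + v \<in> Z b" "add_mset (unif p) w + v' \<in> Z b"
    unfolding c(2) using Z_add_mset[OF u w(1)] Z_add_mset[OF u w(2)] by simp_all
  then show ?case using w(3-5) by (intro exI[of _ "add_mset (unif p) w"] exI[of _ v] exI[of _ v']) simp
qed

lemma adjacent: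
  assumes z: "z \<in> Z a" "z' \<in> Z a" and l: "size z < size z'"
  obtains z1 z2 where "z1 \<in> Z a" "z2 \<in> Z a" "size z1 = size z" "size z2 = Suc (size z)" "fact_dist z1 z2 \<le> 3"
proof -
  have "\<exists>p\<in>X. len p z < len p z'"
  proof (rule ccontr)
    assume "\<not> ?thesis"
    then have "\<forall>p\<in>X. len p z' \<le> len p z" by fastforce
    from size_le_if_len_le(1)[OF z(2,1) this] l show False by simp
  qed
  then obtain p where p: "p \<in> X" "len p z < len p z'" by blast
  note ge2 = len_less_ge_two[OF p(1) z p(2)]
  obtain y r where yr: "z = y + r" "size y = len p z" "set_mset y \<subseteq> atoms_at p" "len p r = 0"
    "mset_prod J y \<in> primary p" "val p 0 (mset_prod J r) = 0" "y \<in> Z (mset_prod J y)" "r \<in> Z (mset_prod J r)"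
    "a = mset_prod J y \<otimes> mset_prod J r"
    using part_split[OF p(1) z(1)] by blast
  have c: "mset_prod J y \<in> carrier J" "mset_prod J r \<in> carrier J" using Z_closed yr(7,8) by blast+
  have "(len p z - 2) + 3 \<le> val p i (mset_prod J y)" if i: "i < s p" for i
  proof -
    have "val p i a = val p i (mset_prod J y) + val p i (mset_prod J r)"
      unfolding yr(9) by (rule val_mult[OF p(1) i c])
    moreover have "val p i (mset_prod J r) = 0" using val_zero_iff[OF p(1) i c(2)] yr(6) by simp
    moreover have "len p z' \<le> val p i a" by (rule val_ge_len[OF p(1) i z(2)])
    ultimately show ?thesis using p(2) ge2 by simp
  qed
  then obtain w v v' where w: "w + v \<in> Z (mset_prod J y)" "w + v' \<in> Z (mset_prod J y)"
    "size w = len p z - 2" "size v = 2" "size v' = 3"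
    using split_adjacent[OF p(1) ge2(2) yr(5)] by blast
  have Zy: "y + r \<in> Z a" using z(1) unfolding yr(1) .
  show thesis
  proof (rule that)
    show "(w + v) + r \<in> Z a" "(w + v') + r \<in> Z a" using Z_replace[OF Zy] w(1,2) by blast+
    show "size (w + v + r) = size z" "size (w + v' + r) = Suc (size z)"
      unfolding yr(1) using w yr(2) ge2 by simp_all
    have "fact_dist (w + v + r) (w + v' + r) = fact_dist v v'"
      using fact_dist_union[of "w + r" v v'] by (simp add: ac_simps)
    then show "fact_dist (w + v + r) (w + v' + r) \<le> 3" using fact_dist_le[of v v'] w by simp
  qed
qed

lemma primary_lengths:
  assumes p: "p \<in> X" "2 \<le> s p"
  shows "b \<in> primary p \<Longrightarrow> \<forall>i<s p. n + 2 \<le> val p i b \<Longrightarrow> \<exists>z\<in>Z b. size z = n + 2"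
proof (induction n arbitrary: b)
  case 0
  have "\<forall>i<s p. 2 \<le> val p i b" using 0(2) by (simp add: numeral_2_eq_2)
  then obtain x y where xy: "x \<in> atoms_at p" "y \<in> atoms_at p" "b = x \<otimes> y"
    using split_two[OF p(1) 0(1)] p(2) by blast
  have "{#x, y#} \<in> Z b" unfolding xy(3) using xy(1,2) Z_pair by blast
  then show ?case by (intro bexI[of _ "{#x, y#}"]) simp_all
next
  case (Suc n)
  have "\<forall>i<s p. 2 \<le> val p i b" using Suc(3) by fastforce
  then obtain c where c: "c \<in> primary p" "b = unif p \<otimes> c" "\<forall>i<s p. val p i b = Suc (val p i c)"
    using divide_unif[OF p(1) Suc(2)] by blast
  have "\<forall>i<s p. n + 2 \<le> val p i c" using c(3) Suc(3) by fastforce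
  from Suc.IH[OF c(1) this] obtain z where z: "z \<in> Z c" "size z = n + 2" by blast
  have "add_mset (unif p) z \<in> Z b"
    unfolding c(2) using Z_add_mset[OF _ z(1)] unif_atom[OF p(1)] by blast
  then show ?case using z(2) by (intro bexI[of _ "add_mset (unif p) z"]) simp_all
qed

lemma primary_pow:
  assumes "p \<in> X" "b \<in> primary p"
  shows "b [^] n \<in> primary p" "i < s p \<Longrightarrow> val p i (b [^] (n::nat)) = n * val p i b"
proof -
  show 1: "b [^] n \<in> primary p" for n :: nat
    by (induction n) (simp_all add: one_primary primary_mult assms)
  show "i < s p \<Longrightarrow> val p i (b [^] (n::nat)) = n * val p i b"
    by (induction n) (simp_all add: val_one val_mult assms(1) primary_closed[OF assms(2)])
qed

text \<open>All values of the power equal \<open>n\<close>, which leaves room for every length from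
  2 to \<open>n\<close>.\<close>

lemma unif_pow_lengths:
  assumes p: "p \<in> X" "2 \<le> s p" and n: "2 \<le> k" "k \<le> n"
  obtains z where "z \<in> Z (unif p [^] n)" "size z = k"
proof -
  have "\<forall>i<s p. (k - 2) + 2 \<le> val p i (unif p [^] n)"
  proof (intro allI impI)
    fix i assume "i < s p"
    then have "val p i (unif p [^] n) = n"
      using primary_pow(2)[OF p(1) unif(1)[OF p(1)]] unif(2)[OF p(1)] by simp
    then show "(k - 2) + 2 \<le> val p i (unif p [^] n)" using n by simp
  qed
  from primary_lengths[OF p primary_pow(1)[OF p(1) unif(1)[OF p(1)]] this] n show thesis
    using that by auto
qed

end

section \<open>Lower bounds for distances between factorizations\<close>

context reduced_monoid
begin

lemma size_ge_two:
  assumes "z \<in> Z a" "z' \<in> Z a" "2 \<le> size z"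
  shows "2 \<le> size z'"
proof (rule ccontr)
  assume "\<not> 2 \<le> size z'"
  then consider "size z' = 0" | "size z' = 1" by linarith
  then show False
  proof cases
    case 1
    then have "a = \<one>" using assms(2) Z_empty_iff by simp
    then show False using assms(1,3) Z_of_one by simp
  next
    case 2
    then obtain x where x: "z' = {#x#}" using size_1_singleton_mset by blast
    then have "x \<in> atoms G" "a = x" using assms(2) atoms_closed by (auto simp: factorizations_def)
    then show False using Z_of_atom[of x z] assms(1,3) by simp
  qed
qed

text \<open>Outside the common part remain two distinct factorizations of one element. Neither is
  empty or a single atom, so both have length at least 2, and different lengths force one to be at
  least 3.\<close>

lemma fact_dist_ge:
  assumes "u \<in> Z a" "v \<in> Z a" "u \<noteq> v"
  shows "2 \<le> fact_dist u v" "size u \<noteq> size v \<Longrightarrow> 3 \<le> fact_dist u v"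
proof -
  define e f where "e = u - v" "f = v - u"
  have uv: "u = (u \<inter># v) + e" "v = (u \<inter># v) + f"
    by (auto simp: e_f_def multiset_eq_iff)
  have Zs: "(u \<inter># v) + e \<in> Z a" "(u \<inter># v) + f \<in> Z a" using assms(1,2) uv by simp_all
  have e: "e \<in> Z (mset_prod G e)" by (rule Z_union_split(2)[OF Zs(1)])
  have f: "f \<in> Z (mset_prod G e)" by (rule Z_cancel[OF Zs])
  have dist: "fact_dist u v = max (size e) (size f)"
  proof -
    have "e \<inter># f = {#}" by (auto simp: e_f_def multiset_eq_iff)
    then have "fact_dist e f = max (size e) (size f)" by (rule fact_dist_disjoint)
    then show ?thesis using fact_dist_union[of "u \<inter># v" e f] uv by simp
  qed
  have ef: "e \<noteq> f" using uv assms(3) by metis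
  have "2 \<le> size e"
  proof (rule ccontr)
    assume "\<not> 2 \<le> size e"
    then consider "size e = 0" | "size e = 1" by linarith
    then show False
    proof cases
      case 1
      then show False using e f ef Z_of_one[of f] by simp
    next
      case 2
      then obtain x where x: "e = {#x#}" using size_1_singleton_mset by blast
      then have "x \<in> atoms G" "mset_prod G e = x" using e atoms_closed by (auto simp: factorizations_def)
      then show False using Z_of_atom[of x f] f x ef by simp
    qed
  qed
  moreover from this have "2 \<le> size f" by (rule size_ge_two[OF e f])
  moreover have "size u \<noteq> size v \<Longrightarrow> size e \<noteq> size f" using uv by (metis size_union)
  ultimately show "2 \<le> fact_dist u v" "size u \<noteq> size v \<Longrightarrow> 3 \<le> fact_dist u v"
    unfolding dist by linarith+
qed

lemma chain_bound_two:
  assumes "(chain_step up d (Z a))\<^sup>*\<^sup>* z z'" "z \<noteq> z'"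
  shows "2 \<le> d"
  using assms
proof (induction rule: rtranclp_induct)
  case (step y z')
  show ?case
  proof (cases "y = z'")
    case False
    have y: "y \<in> Z a" "z' \<in> Z a" "enat (fact_dist y z') \<le> d" using step(2) by (simp_all add: chain_step_def)
    have "2 \<le> enat (fact_dist y z')" using fact_dist_ge(1)[OF y(1,2) False] by (simp add: numeral_eq_enat)
    then show ?thesis using y(3) by (rule order_trans)
  qed (use step in blast)
qed simp

lemma chain_bound_three:
  assumes "(chain_step up d (Z a))\<^sup>*\<^sup>* z z'" "size z \<noteq> size z'"
  shows "3 \<le> d"
  using assms
proof (induction rule: rtranclp_induct)
  case (step y z')
  show ?case
  proof (cases "size y = size z'")
    case False
    have y: "y \<in> Z a" "z' \<in> Z a" "enat (fact_dist y z') \<le> d" using step(2) by (simp_all add: chain_step_def)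
    have "y \<noteq> z'" using False by auto
    then have "3 \<le> enat (fact_dist y z')" using fact_dist_ge(2)[OF y(1,2) _ False] by (simp add: numeral_eq_enat)
    then show ?thesis using y(3) by (rule order_trans)
  qed (use step in simp)
qed simp

end

section \<open>The arithmetic invariants of the coproduct\<close>

context primary_monoid
begin

lemma carrier_not_trivial: "p \<in> X \<Longrightarrow> carrier J \<noteq> {\<one>}"
  using unif_atom atom_not_one atoms_closed by blast

text \<open>The lower bound comes from a second atom \<open>x\<close> at \<open>p\<close>: the
  square of \<open>x\<close> has value 2, so it is also the uniformizer times an atom, and this is a
  different factorization.\<close>

lemma catenary_degree_eq_two:
  assumes s1: "\<forall>p\<in>X. s p = 1" and p: "p \<in> X" and x: "x \<in> atoms_at p" "x \<noteq> unif p"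
  shows "catenary_degree J = 2"
proof (rule antisym)
  interpret R: monoid_reduction J J id by (rule monoid_reduction_id)
  show "catenary_degree J \<le> 2"
    unfolding R.catenary_degree_le_iff chain_connected_def
  proof (intro ballI impI)
    fix b z z' assume "z \<in> Z b" "z' \<in> Z b"
    then show "(chain_step False 2 (Z b))\<^sup>*\<^sup>* z z'" by (rule chain_exists[rotated 2]) (use s1 in simp_all)
  qed
  obtain i where "i < s p" "val p i x = 1" using atom_val[OF p x(1)] by blast
  then have v: "val p 0 x = 1" using s1 p by simp
  have xp: "x \<in> primary p" "x \<in> atoms J" using x(1) by blast+
  have xx: "x \<otimes> x \<in> primary p" using primary_mult xp(1) by blast
  have "val p 0 (x \<otimes> x) = 2"
    using val_mult[OF p s_pos[OF p] atoms_closed[OF xp(2)] atoms_closed[OF xp(2)]] v by simp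
  then have v2: "\<forall>i<s p. 2 \<le> val p i (x \<otimes> x)" "val p 0 (x \<otimes> x) = 2" using s1 p by simp_all
  obtain c where c: "c \<in> primary p" "x \<otimes> x = unif p \<otimes> c" "\<forall>i<s p. val p i (x \<otimes> x) = Suc (val p i c)"
    by (rule divide_unif[OF p xx v2(1)])
  then have "val p 0 c = 1" using v2(2) s_pos[OF p] by auto
  then have "c \<in> atoms J" by (rule atomI[OF p c(1) s_pos[OF p]])
  then have "{#unif p, c#} \<in> Z (x \<otimes> x)" unfolding c(2) using unif_atom[OF p] Z_pair by blast
  moreover have "{#x, x#} \<in> Z (x \<otimes> x)" using Z_pair xp(2) by blast
  moreover have "chain_connected False (catenary_degree J) (Z (x \<otimes> x))"
    using R.catenary_degree_le_iff[of "catenary_degree J"] primary_closed[OF xx] by blast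
  ultimately have "(chain_step False (catenary_degree J) (Z (x \<otimes> x)))\<^sup>*\<^sup>* {#x, x#} {#unif p, c#}"
    unfolding chain_connected_def by simp
  moreover have "{#x, x#} \<noteq> {#unif p, c#}"
  proof
    assume eq: "{#x, x#} = {#unif p, c#}"
    have "unif p \<in># {#x, x#}" unfolding eq by simp
    then show False using x(2) by simp
  qed
  ultimately show "2 \<le> catenary_degree J" by (rule chain_bound_two)
qed

lemma unions_of_lengths_eq:
  assumes p: "p \<in> X" "2 \<le> s p" and k: "2 \<le> k"
  shows "unions_of_lengths J k = {2..}"
proof -
  interpret R: monoid_reduction J J id by (rule monoid_reduction_id)
  note iff = R.unions_of_lengths_iff[OF carrier_not_trivial[OF p(1)]]
  show ?thesis
  proof (intro subset_antisym subsetI)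
    fix l assume "l \<in> unions_of_lengths J k"
    then obtain b z z' where "z \<in> Z b" "z' \<in> Z b" "size z = k" "size z' = l" unfolding iff by blast
    then show "l \<in> {2..}" using size_ge_two[of z b z'] k by simp
  next
    fix l :: nat assume l: "l \<in> {2..}"
    obtain z where "z \<in> Z (unif p [^] max k l)" "size z = k"
      by (rule unif_pow_lengths[OF p k, of "max k l"]) simp_all
    moreover obtain z' where "z' \<in> Z (unif p [^] max k l)" "size z' = l"
      by (rule unif_pow_lengths[OF p, of l "max k l"]) (use l in simp_all)
    ultimately show "l \<in> unions_of_lengths J k" unfolding iff by blast
  qed
qed

lemma consecutive_lengths:
  assumes "consecutive_in (size ` Z b) k l"
  obtains z1 z2 where "z1 \<in> Z b" "z2 \<in> Z b" "size z1 = k" "size z2 = l" "l = Suc k" "fact_dist z1 z2 \<le> 3"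
proof -
  obtain z z' where z: "z \<in> Z b" "z' \<in> Z b" "size z = k" "size z' = l" "k < l"
    using assms unfolding consecutive_in_def by blast
  then have "size z < size z'" by simp
  then obtain z1 z2 where z12: "z1 \<in> Z b" "z2 \<in> Z b" "size z1 = size z" "size z2 = Suc (size z)" "fact_dist z1 z2 \<le> 3"
    by (rule adjacent[OF z(1,2)])
  have "Suc k \<in> size ` Z b" using z12(2,4) z(3) by (metis imageI)
  then have "\<not> (k < Suc k \<and> Suc k < l)" using assms unfolding consecutive_in_def by blast
  then have "l = Suc k" using z(5) by simp
  then show thesis using that z12 z(3) by simp
qed

lemma unif_cube_lengths:
  assumes p: "p \<in> X" "2 \<le> s p"
  shows "consecutive_in (size ` Z (unif p [^] (3::nat))) 2 3"
proof -
  obtain z where "z \<in> Z (unif p [^] (3::nat))" "size z = 2" by (rule unif_pow_lengths[OF p, of 2 3]) simp_all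
  moreover obtain z' where "z' \<in> Z (unif p [^] (3::nat))" "size z' = 3" by (rule unif_pow_lengths[OF p, of 3 3]) simp_all
  ultimately have "2 \<in> size ` Z (unif p [^] (3::nat))" "3 \<in> size ` Z (unif p [^] (3::nat))" by (metis imageI)+
  then show ?thesis unfolding consecutive_in_def by simp
qed

lemma delta_set_eq:
  assumes p: "p \<in> X" "2 \<le> s p"
  shows "delta_set J = {1}"
proof -
  interpret R: monoid_reduction J J id by (rule monoid_reduction_id)
  have c: "unif p [^] (3::nat) \<in> carrier J" using unif(1)[OF p(1)] primary_closed by blast
  show ?thesis
  proof (intro subset_antisym subsetI)
    fix n assume "n \<in> delta_set J"
    then obtain b where "n \<in> delta_of_set (size ` Z b)" unfolding R.delta_set_iff by blast
    then obtain k l where n: "n = l - k" and kl: "consecutive_in (size ` Z b) k l" unfolding delta_of_set_def by blast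
    obtain z1 z2 where "z1 \<in> Z b" "z2 \<in> Z b" "size z1 = k" "size z2 = l" "l = Suc k" "fact_dist z1 z2 \<le> 3"
      by (rule consecutive_lengths[OF kl])
    then show "n \<in> {1}" using n by simp
  next
    fix n :: nat assume "n \<in> {1}"
    then have "n = 3 - 2" by simp
    then have "n \<in> delta_of_set (size ` Z (unif p [^] (3::nat)))"
      unfolding delta_of_set_def using unif_cube_lengths[OF p] by blast
    then show "n \<in> delta_set J" unfolding R.delta_set_iff using c by blast
  qed
qed

lemma catenary_degree_ge_three:
  assumes p: "p \<in> X" "2 \<le> s p" and c: "chain_connected up d (Z (unif p [^] (3::nat)))"
  shows "3 \<le> d"
proof -
  obtain z where z: "z \<in> Z (unif p [^] (3::nat))" "size z = 2" by (rule unif_pow_lengths[OF p, of 2 3]) simp_all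
  obtain z' where z': "z' \<in> Z (unif p [^] (3::nat))" "size z' = 3" by (rule unif_pow_lengths[OF p, of 3 3]) simp_all
  have "(chain_step up d (Z (unif p [^] (3::nat))))\<^sup>*\<^sup>* z z'"
    using c z z' unfolding chain_connected_def by simp
  then show ?thesis by (rule chain_bound_three) (use z z' in simp)
qed

lemma catenary_degree_eq_three:
  assumes p: "p \<in> X" "2 \<le> s p"
  shows "catenary_degree J = 3"
proof (rule antisym)
  interpret R: monoid_reduction J J id by (rule monoid_reduction_id)
  show "catenary_degree J \<le> 3"
    unfolding R.catenary_degree_le_iff chain_connected_def
  proof (intro ballI impI)
    fix b z z' assume "z \<in> Z b" "z' \<in> Z b"
    then show "(chain_step False 3 (Z b))\<^sup>*\<^sup>* z z'" by (rule chain_exists[rotated 2]) simp_all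
  qed
  have "unif p [^] (3::nat) \<in> carrier J" using unif(1)[OF p(1)] primary_closed by blast
  then have "chain_connected False (catenary_degree J) (Z (unif p [^] (3::nat)))"
    using R.catenary_degree_le_iff[of "catenary_degree J"] by blast
  then show "3 \<le> catenary_degree J" by (rule catenary_degree_ge_three[OF p])
qed

lemma adj_catenary_degree_eq_three:
  assumes p: "p \<in> X" "2 \<le> s p"
  shows "adj_catenary_degree J = 3"
proof (rule antisym)
  interpret R: monoid_reduction J J id by (rule monoid_reduction_id)
  show "adj_catenary_degree J \<le> 3"
    unfolding R.adj_catenary_degree_le_iff
  proof (intro ballI allI impI)
    fix b k l assume kl: "consecutive_in (size ` Z b) k l"
    obtain z1 z2 where z: "z1 \<in> Z b" "z2 \<in> Z b" "size z1 = k" "size z2 = l" "l = Suc k" "fact_dist z1 z2 \<le> 3"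
      by (rule consecutive_lengths[OF kl])
    then have "enat (fact_dist z1 z2) \<le> 3" by (simp add: numeral_eq_enat)
    then show "\<exists>z\<in>Z b. \<exists>z'\<in>Z b. size z = k \<and> size z' = l \<and> enat (fact_dist z z') \<le> 3" using z by blast
  qed
  have "unif p [^] (3::nat) \<in> carrier J" using unif(1)[OF p(1)] primary_closed by blast
  then obtain z z' where z: "z \<in> Z (unif p [^] (3::nat))" "z' \<in> Z (unif p [^] (3::nat))" "size z = 2" "size z' = 3"
    "enat (fact_dist z z') \<le> adj_catenary_degree J"
    using R.adj_catenary_degree_le_iff[of "adj_catenary_degree J"] unif_cube_lengths[OF p] by blast
  have "z \<noteq> z'" using z by auto
  then have "3 \<le> enat (fact_dist z z')" using fact_dist_ge(2)[OF z(1,2)] z(3,4) by (simp add: numeral_eq_enat)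
  then show "3 \<le> adj_catenary_degree J" using z(5) by (rule order_trans)
qed

lemma mon_catenary_degree_eq_three:
  assumes p: "p \<in> X" "2 \<le> s p" and unique: "\<And>p'. p' \<in> X \<Longrightarrow> 2 \<le> s p' \<Longrightarrow> p' = p"
  shows "mon_catenary_degree J = 3"
proof (rule antisym)
  interpret R: monoid_reduction J J id by (rule monoid_reduction_id)
  have u: "\<forall>p\<in>X. \<forall>p'\<in>X. 2 \<le> s p \<longrightarrow> 2 \<le> s p' \<longrightarrow> p = p'"
  proof (intro ballI impI)
    fix q q' assume "q \<in> X" "q' \<in> X" "2 \<le> s q" "2 \<le> s q'"
    then have "q = p" "q' = p" using unique by blast+
    then show "q = q'" by simp
  qed
  show "mon_catenary_degree J \<le> 3"
    unfolding R.mon_catenary_degree_le_iff chain_connected_def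
  proof (intro ballI impI)
    fix b z z' assume "z \<in> Z b" "z' \<in> Z b" "size z \<le> size z'"
    then show "(chain_step True 3 (Z b))\<^sup>*\<^sup>* z z'" by (rule chain_exists[rotated 2]) (use u in simp_all)
  qed
  have "unif p [^] (3::nat) \<in> carrier J" using unif(1)[OF p(1)] primary_closed by blast
  then have "chain_connected True (mon_catenary_degree J) (Z (unif p [^] (3::nat)))"
    using R.mon_catenary_degree_le_iff[of "mon_catenary_degree J"] by blast
  then show "3 \<le> mon_catenary_degree J" by (rule catenary_degree_ge_three[OF p])
qed

lemma len_primary:
  assumes p: "p \<in> X" and c: "c \<in> primary p" and y: "y \<in> Z c"
  shows "len p y = size y" "p' \<in> X \<Longrightarrow> p' \<noteq> p \<Longrightarrow> len p' y = 0"
proof -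
  have x: "x \<in> primary p" "x \<in> atoms J" if xy: "x \<in># y" for x
  proof -
    obtain w where w: "y = add_mset x w" using multi_member_split[OF xy] by blast
    have "add_mset x w \<in> Z c" using y unfolding w .
    note sp = Z_add_mset_split[OF this]
    show "x \<in> atoms J" by (rule sp(1))
    show "x \<in> primary p"
      by (rule primary_factor(1)[of x "mset_prod J w"])
        (use c sp(3) atoms_closed[OF sp(1)] Z_closed[OF sp(2)] in simp_all)
  qed
  have "len p w = size w" if "\<forall>x\<in>#w. 0 < val p 0 x" for w
    using that by (induction w) (auto simp: len_add_mset)
  then show "len p y = size y" using x atom_val_pos_iff[OF p] by blast
  assume "p' \<in> X" "p' \<noteq> p"
  then show "len p' y = 0" unfolding len_eq_0_iff using x(1) by (auto simp: primary_def)
qed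

text \<open>After the common atom is cancelled, the local lengths still differ, so the shorter one
  is still at least 2.\<close>

lemma common_atom_len:
  assumes p: "p \<in> X" and u: "u \<in> Z b" "v \<in> Z b" and x: "x \<in># u" "x \<in># v" "0 < val p 0 x"
    and l: "len p u < len p v"
  shows "3 \<le> len p u"
proof -
  obtain w where w: "u = add_mset x w" using multi_member_split[OF x(1)] by blast
  obtain w' where w': "v = add_mset x w'" using multi_member_split[OF x(2)] by blast
  have Zs: "add_mset x w \<in> Z b" "add_mset x w' \<in> Z b" using u unfolding w w' by blast+
  have "len p w < len p w'" using l x(3) unfolding w w' by (simp add: len_add_mset)
  from len_less_ge_two(1)[OF p Z_add_mset_split(2)[OF Zs(1)] Z_cancel_atom[OF Zs] this]
  show ?thesis unfolding w using x(3) by (simp add: len_add_mset)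
qed

text \<open>
  On \<open>b = t\<^sub>p\<^sup>3 t\<^sub>q\<^sup>3\<close> a monotone chain between factorizations of length 5 has constant
  length, so it has to pass from lengths \<open>(2, 3)\<close> at \<open>(p, q)\<close> to \<open>(3, 2)\<close> in one step, and
  then no atom is kept.
\<close>
lemma mon_catenary_degree_ge_five:
  assumes p: "p \<in> X" "2 \<le> s p" and q: "q \<in> X" "2 \<le> s q" "p \<noteq> q"
    and conn: "chain_connected True d (Z (unif p [^] (3::nat) \<otimes> unif q [^] (3::nat)))"
  shows "5 \<le> d"
proof -
  define b where "b = unif p [^] (3::nat) \<otimes> unif q [^] (3::nat)"
  have cube: "unif r [^] (3::nat) \<in> primary r" "val r 0 (unif r [^] (3::nat)) = 3" if "r \<in> X" for r
    using primary_pow(1)[OF that unif(1)[OF that]] primary_pow(2)[OF that unif(1)[OF that] s_pos[OF that]]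
      unif(2)[OF that s_pos[OF that]] by simp_all
  have cl: "unif r [^] (3::nat) \<in> carrier J" if "r \<in> X" for r using cube(1)[OF that] primary_closed by blast
  have bc: "b \<in> carrier J" unfolding b_def using cl p(1) q(1) by simp
  have val_other: "val r' 0 (unif r [^] (3::nat)) = 0" if "r \<in> X" "r' \<in> X" "r' \<noteq> r" for r r'
    using cube(1)[OF that(1)] that unfolding primary_def by blast
  have val_b: "val r 0 b = val r 0 (unif p [^] (3::nat)) + val r 0 (unif q [^] (3::nat))" if "r \<in> X" for r
    unfolding b_def by (rule val_mult[OF that s_pos[OF that] cl[OF p(1)] cl[OF q(1)]])
  have vb: "val p 0 b = 3" "val q 0 b = 3"
    using val_b[OF p(1)] val_b[OF q(1)] cube(2)[OF p(1)] cube(2)[OF q(1)]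
      val_other[OF p(1) q(1)] val_other[OF q(1) p(1)] q(3) by simp_all
  have vb0: "val r 0 b = 0" if "r \<in> X" "r \<noteq> p" "r \<noteq> q" for r
    using val_b[OF that(1)] val_other[OF p(1) that(1)] val_other[OF q(1) that(1)] that by simp
  obtain y2 where y2: "y2 \<in> Z (unif p [^] (3::nat))" "size y2 = 2" by (rule unif_pow_lengths[OF p, of 2 3]) simp_all
  obtain y3 where y3: "y3 \<in> Z (unif p [^] (3::nat))" "size y3 = 3" by (rule unif_pow_lengths[OF p, of 3 3]) simp_all
  obtain w2 where w2: "w2 \<in> Z (unif q [^] (3::nat))" "size w2 = 2" by (rule unif_pow_lengths[OF q(1,2), of 2 3]) simp_all
  obtain w3 where w3: "w3 \<in> Z (unif q [^] (3::nat))" "size w3 = 3" by (rule unif_pow_lengths[OF q(1,2), of 3 3]) simp_all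
  define z z' where "z = y2 + w3" and "z' = y3 + w2"
  have z: "z \<in> Z b" "z' \<in> Z b" unfolding z_def z'_def b_def using Z_union y2(1) y3(1) w2(1) w3(1) by blast+
  note lp = len_primary[OF p(1) cube(1)[OF p(1)]] and lq = len_primary[OF q(1) cube(1)[OF q(1)]]
  have lz: "len p z = 2" "len q z = 3" "len p z' = 3" "len q z' = 2"
    unfolding z_def z'_def len_union
    using lp(1)[OF y2(1)] lp(1)[OF y3(1)] lp(2)[OF y2(1) q(1)] lp(2)[OF y3(1) q(1)]
      lq(1)[OF w2(1)] lq(1)[OF w3(1)] lq(2)[OF w2(1) p(1)] lq(2)[OF w3(1) p(1)] y2 y3 w2 w3 q(3) by simp_all
  have size_u: "size u = len p u + len q u" if u: "u \<in> Z b" for u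
  proof -
    have at: "set_mset u \<subseteq> atoms J" using u by (simp add: factorizations_def)
    have ex: "\<forall>x\<in>#u. \<exists>r\<in>{p, q}. 0 < val r 0 x"
    proof
      fix x assume x: "x \<in># u"
      then have "x \<in> atoms J" using at by blast
      then obtain r where r: "r \<in> X" "0 < val r 0 x" using atom_primary by blast
      then have "0 < len r u" using len_eq_0_iff[of r u] x by auto
      then have "0 < val r 0 b" using val_ge_len[OF r(1) s_pos[OF r(1)] u] by linarith
      then have "r = p \<or> r = q" using vb0[OF r(1)] by force
      then show "\<exists>r\<in>{p, q}. 0 < val r 0 x" using r(2) by blast
    qed
    have "size u = (\<Sum>r\<in>{p, q}. len r u)" by (rule size_eq_sum_len[OF _ _ at ex]) (use p q in simp_all)
    then show ?thesis using q(3) by simp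
  qed
  have range: "len r u = 2 \<or> len r u = 3" if r: "r = p \<or> r = q" and u: "u \<in> Z b" for r u
  proof -
    have rX: "r \<in> X" using r p q by blast
    have le: "len r u \<le> 3" using val_ge_len[OF rX s_pos[OF rX] u] r vb by auto
    obtain v where v: "v \<in> Z b" "len r v = 3" using r z lz by blast
    have "2 \<le> len r u" if "len r u < 3" using len_less_ge_two(1)[OF rX u v(1)] that v(2) by simp
    then show ?thesis using le by linarith
  qed
  \<comment> \<open>Local lengths on \<open>b\<close> are 2 or 3 and differ between \<open>u\<close>
    and \<open>v\<close> at both \<open>p\<close> and \<open>q\<close>. A common atom would raise
    the smaller of the two local lengths to 3, so there is none and the distance is the full length
    5.\<close>
  have disj: "5 \<le> fact_dist u v"
    if u: "u \<in> Z b" "v \<in> Z b" "size u = 5" "size v = 5" "len p u \<noteq> len p v" for u v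
  proof -
    have ne: "len q u \<noteq> len q v" using size_u[OF u(1)] size_u[OF u(2)] u(3-5) by simp
    have "x \<notin># u \<inter># v" for x
    proof
      assume "x \<in># u \<inter># v"
      then have x: "x \<in># u" "x \<in># v" by auto
      then have "x \<in> atoms J" using u(1) by (auto simp: factorizations_def)
      then obtain r where r: "r \<in> X" "0 < val r 0 x" using atom_primary by blast
      then have "0 < len r u" using len_eq_0_iff[of r u] x by auto
      then have "0 < val r 0 b" using val_ge_len[OF r(1) s_pos[OF r(1)] u(1)] by linarith
      then have rpq: "r = p \<or> r = q" using vb0[OF r(1)] by force
      then have "len r u \<noteq> len r v" using ne u(5) by auto
      moreover have "3 \<le> len r u" if "len r u < len r v" by (rule common_atom_len[OF r(1) u(1,2) x r(2) that])
      moreover have "3 \<le> len r v" if "len r v < len r u" by (rule common_atom_len[OF r(1) u(2,1) x(2,1) r(2) that])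
      ultimately show False using range[OF rpq u(1)] range[OF rpq u(2)] by linarith
    qed
    then have "u \<inter># v = {#}" by (metis multiset_nonemptyE)
    then have "fact_dist u v = max (size u) (size v)" by (rule fact_dist_disjoint)
    then show ?thesis using u(3,4) by simp
  qed
  have sz: "size z = 5" "size z' = 5" using size_u[OF z(1)] size_u[OF z(2)] lz by simp_all
  have "(chain_step True d (Z b))\<^sup>*\<^sup>* z z'" using conn z sz unfolding chain_connected_def b_def[symmetric] by simp
  moreover have "size v = 5 \<longrightarrow> len p v = len p z \<or> 5 \<le> d" if "(chain_step True d (Z b))\<^sup>*\<^sup>* z v" for v
    using that
  proof (induction rule: rtranclp_induct)
    case (step y v)
    show ?case
    proof
      assume v5: "size v = 5"
      have yv: "y \<in> Z b" "v \<in> Z b" "enat (fact_dist y v) \<le> d" "size y \<le> size v"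
        using step(2) by (simp_all add: chain_step_def)
      have "size z \<le> size y" using chain_step_up[OF _ step(1)] by simp
      then have y5: "size y = 5" using yv(4) v5 sz(1) by simp
      show "len p v = len p z \<or> 5 \<le> d"
      proof (cases "len p y = len p v")
        case True
        then show ?thesis using step.IH y5 by simp
      next
        case False
        have "5 \<le> enat (fact_dist y v)" using disj[OF yv(1,2) y5 v5 False] by (simp add: numeral_eq_enat)
        then have "5 \<le> d" using yv(3) by (rule order_trans)
        then show ?thesis ..
      qed
    qed
  qed simp
  ultimately show ?thesis using lz sz(2) by force
qed

lemma mon_catenary_degree_eq_five:
  assumes p: "p \<in> X" "2 \<le> s p" and q: "q \<in> X" "2 \<le> s q" "p \<noteq> q"
  shows "mon_catenary_degree J = 5"
proof (rule antisym)
  interpret R: monoid_reduction J J id by (rule monoid_reduction_id)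
  show "mon_catenary_degree J \<le> 5"
    unfolding R.mon_catenary_degree_le_iff chain_connected_def
  proof (intro ballI impI)
    fix b z z' assume "z \<in> Z b" "z' \<in> Z b" "size z \<le> size z'"
    then show "(chain_step True 5 (Z b))\<^sup>*\<^sup>* z z'" by (rule chain_exists[rotated 2]) simp_all
  qed
  have "unif r \<in> carrier J" if "r \<in> X" for r using unif(1)[OF that] primary_closed by blast
  then have "unif p [^] (3::nat) \<otimes> unif q [^] (3::nat) \<in> carrier J" using p(1) q(1) by simp
  then have "chain_connected True (mon_catenary_degree J) (Z (unif p [^] (3::nat) \<otimes> unif q [^] (3::nat)))"
    using R.mon_catenary_degree_le_iff[of "mon_catenary_degree J"] by blast
  then show "5 \<le> mon_catenary_degree J" by (rule mon_catenary_degree_ge_five[OF p q])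
qed

end

section \<open>The kernel of the class homomorphism\<close>

context primary_monoid
begin

text \<open>An additive degree; index 0 suffices since the valuations at \<open>p\<close> vanish
  together. With constant weight 1 it proves atomicity and bounds lengths, with weights 1 and 2 it
  is the induction measure for intervals of lengths.\<close>

definition "wt w a = (\<Sum>p | p \<in> X \<and> val p 0 a \<noteq> 0. w p * val p 0 a)" for w :: "'p \<Rightarrow> nat"

lemma wt_superset:
  assumes "finite S" "S \<subseteq> X" "{p \<in> X. val p 0 a \<noteq> 0} \<subseteq> S"
  shows "wt w a = (\<Sum>p\<in>S. w p * val p 0 a)"
  unfolding wt_def by (rule sum.mono_neutral_left) (use assms in auto)

lemma wt_mult:
  assumes "a \<in> carrier J" "b \<in> carrier J"
  shows "wt w (a \<otimes> b) = wt w a + wt w b"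
proof -
  let ?S = "{p \<in> X. val p 0 a \<noteq> 0} \<union> {p \<in> X. val p 0 b \<noteq> 0}"
  have v: "val p 0 (a \<otimes> b) = val p 0 a + val p 0 b" if "p \<in> X" for p
    by (rule val_mult[OF that s_pos[OF that] assms])
  have S: "finite ?S" "?S \<subseteq> X" using finite_support[OF assms(1)] finite_support[OF assms(2)] by auto
  have "wt w (a \<otimes> b) = (\<Sum>p\<in>?S. w p * val p 0 (a \<otimes> b))"
    by (rule wt_superset[OF S]) (use v in auto)
  also have "\<dots> = (\<Sum>p\<in>?S. w p * val p 0 a + w p * val p 0 b)"
    by (rule sum.cong) (use v in \<open>auto simp: distrib_left\<close>)
  also have "\<dots> = (\<Sum>p\<in>?S. w p * val p 0 a) + (\<Sum>p\<in>?S. w p * val p 0 b)" by (rule sum.distrib)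
  also have "(\<Sum>p\<in>?S. w p * val p 0 a) = wt w a" by (rule wt_superset[OF S, symmetric]) blast
  also have "(\<Sum>p\<in>?S. w p * val p 0 b) = wt w b" by (rule wt_superset[OF S, symmetric]) blast
  finally show ?thesis .
qed

lemma wt_eq_zero:
  assumes "a \<in> carrier J" "wt w a = 0" "\<And>p. p \<in> X \<Longrightarrow> 0 < w p"
  shows "a = \<one>"
proof (rule support_empty[OF assms(1)])
  fix p assume p: "p \<in> X"
  have "\<forall>p\<in>{p \<in> X. val p 0 a \<noteq> 0}. w p * val p 0 a = 0"
    using assms(2) finite_support[OF assms(1)] unfolding wt_def by (simp only: sum_eq_0_iff)
  then show "val p 0 a = 0" using assms(3)[OF p] p by fastforce
qed

lemma wt_primary: "p \<in> X \<Longrightarrow> e \<in> primary p \<Longrightarrow> wt w e = w p * val p 0 e"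
  by (subst wt_superset[of "{p}"]) (auto simp: primary_def)

lemma J_Z_exists: "a \<in> carrier J \<Longrightarrow> \<exists>z. z \<in> Z a"
  by (rule Z_exists[of "wt (\<lambda>_. 1)"]) (simp_all add: wt_mult wt_eq_zero)

text \<open>Expresses that the component at \<open>p\<close> is the free monoid on the uniformizer,
  which is then a prime element of \<open>J\<close>; \<open>free_divides_mult\<close> is the form in
  which primeness is used.\<close>

definition "free p \<longleftrightarrow> p \<in> X \<and> s p = 1 \<and> atoms_at p = {unif p}"

lemma free_X: "free p \<Longrightarrow> p \<in> X"
  by (simp add: free_def)

lemma unif_closed: "p \<in> X \<Longrightarrow> unif p \<in> carrier J"
  using unif(1) primary_closed by blast

lemma val_unif: "p \<in> X \<Longrightarrow> val p 0 (unif p) = 1"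
  using unif(2) s_pos by blast

text \<open>For value 1 the component itself is an atom; for larger value the uniformizer divides by
  strict comparison.\<close>

lemma atom_divides_if_val:
  assumes p: "p \<in> X" "s p = 1" and a: "a \<in> carrier J" "0 < val p 0 a"
  obtains x y where "x \<in> atoms_at p" "y \<in> carrier J" "a = x \<otimes> y"
proof (cases "val p 0 a = 1")
  case True
  obtain e f where ef: "e \<in> primary p" "f \<in> carrier J" "a = e \<otimes> f" "val p 0 f = 0"
    by (rule primary_component[OF a(1) p(1)])
  have "val p 0 a = val p 0 e + val p 0 f"
    unfolding ef(3) by (rule val_mult[OF p(1) s_pos[OF p(1)] primary_closed[OF ef(1)] ef(2)])
  then have "val p 0 e = 1" using True ef(4) by simp
  then have "e \<in> atoms J" by (rule atomI[OF p(1) ef(1) s_pos[OF p(1)]])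
  then show thesis using that ef by blast
next
  case False
  then have "\<forall>i<s p. val p i (unif p) < val p i a" using a(2) p val_unif by simp
  then obtain y where "y \<in> carrier J" "a = unif p \<otimes> y"
    using primary_divides[OF p(1) unif(1)[OF p(1)] a(1)] by blast
  then show thesis using that unif_atom[OF p(1)] by blast
qed

lemma free_divides:
  assumes "free p" "a \<in> carrier J" "0 < val p 0 a"
  obtains y where "y \<in> carrier J" "a = unif p \<otimes> y"
proof -
  have p: "p \<in> X" "s p = 1" "atoms_at p = {unif p}" using assms(1) by (simp_all add: free_def)
  obtain x y where xy: "x \<in> atoms_at p" "y \<in> carrier J" "a = x \<otimes> y"
    by (rule atom_divides_if_val[OF p(1,2) assms(2,3)])
  have "x = unif p" using xy(1) unfolding p(3) by simp
  then show thesis using that[OF xy(2)] xy(3) by simp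
qed

lemma free_divides_mult:
  assumes q: "free q" and a: "a \<in> carrier J" "b \<in> carrier J" "w \<in> carrier J" "unif q \<otimes> w = a \<otimes> b"
  obtains a' where "a' \<in> carrier J" "a = unif q \<otimes> a'" "w = a' \<otimes> b"
  | b' where "b' \<in> carrier J" "b = unif q \<otimes> b'" "w = a \<otimes> b'"
proof -
  note qX = free_X[OF q]
  note u = unif_closed[OF qX]
  have "val q 0 a + val q 0 b = val q 0 (unif q) + val q 0 w"
    using val_mult[OF qX s_pos[OF qX]] a u by metis
  then have "0 < val q 0 a \<or> 0 < val q 0 b" using val_unif[OF qX] by linarith
  then show thesis
  proof
    assume "0 < val q 0 a"
    then obtain a' where a': "a' \<in> carrier J" "a = unif q \<otimes> a'" by (rule free_divides[OF q a(1)])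
    have "unif q \<otimes> w = unif q \<otimes> (a' \<otimes> b)" using a(4) unfolding a'(2) using u a' a(2) by (simp add: m_assoc)
    then have "w = a' \<otimes> b" using u a'(1) a(2,3) l_cancel[of "unif q" w "a' \<otimes> b"] by simp
    then show thesis using that(1) a' by blast
  next
    assume "0 < val q 0 b"
    then obtain b' where b': "b' \<in> carrier J" "b = unif q \<otimes> b'" by (rule free_divides[OF q a(2)])
    have "a \<otimes> (unif q \<otimes> b') = unif q \<otimes> (a \<otimes> b')" using u b'(1) a(1) by (rule m_lcomm[rotated])
    then have "unif q \<otimes> w = unif q \<otimes> (a \<otimes> b')" using a(4) unfolding b'(2) by simp
    then have "w = a \<otimes> b'" using u b'(1) a(1,3) l_cancel[of "unif q" w "a \<otimes> b'"] by simp
    then show thesis using that(2) b' by blast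
  qed
qed

end

section \<open>The kernel of the class map and its unions of sets of lengths\<close>

locale class_monoid = primary_monoid J X s val + G: comm_group G
  for J (structure) and X :: "'p set" and s val and G :: "('g, 'h) monoid_scheme" +
  fixes cl :: "'a \<Rightarrow> 'g"
  assumes cl_hom: "cl \<in> hom J G"
    and finite_G: "finite (carrier G)"
    and class_prime: "g \<in> carrier G \<Longrightarrow> \<exists>q. free q \<and> cl (unif q) = g"
begin

lemma cl_closed: "a \<in> carrier J \<Longrightarrow> cl a \<in> carrier G"
  using cl_hom by (auto simp: hom_def)

lemma cl_mult: "a \<in> carrier J \<Longrightarrow> b \<in> carrier J \<Longrightarrow> cl (a \<otimes> b) = cl a \<otimes>\<^bsub>G\<^esub> cl b"
  using cl_hom by (simp add: hom_mult)

lemma cl_one: "cl \<one> = \<one>\<^bsub>G\<^esub>"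
  using cl_mult[of \<one> \<one>] cl_closed[of \<one>] by (simp add: G.l_cancel_one)

abbreviation "K \<equiv> J\<lparr>carrier := {a \<in> carrier J. cl a = \<one>\<^bsub>G\<^esub>}\<rparr>"

text \<open>The inclusion of the kernel is a divisor homomorphism: divisibility between kernel
  elements is the same in \<open>K\<close> and in \<open>J\<close>.\<close>

lemma K_divisor:
  assumes "a \<in> carrier J" "b \<in> carrier J" "cl (a \<otimes> b) = \<one>\<^bsub>G\<^esub>" "cl a = \<one>\<^bsub>G\<^esub>"
  shows "cl b = \<one>\<^bsub>G\<^esub>"
  using cl_mult[OF assms(1,2)] assms(3,4) cl_closed[OF assms(2)] by simp

sublocale K: reduced_monoid K
proof -
  have cm: "comm_monoid K"
    by (rule comm_monoidI) (auto simp: cl_one cl_mult m_ac)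
  have "comm_monoid_cancel K"
  proof (rule comm_monoid_cancelI[OF cm])
    fix a b c assume "a \<otimes>\<^bsub>K\<^esub> c = b \<otimes>\<^bsub>K\<^esub> c" "a \<in> carrier K" "b \<in> carrier K" "c \<in> carrier K"
    then show "a = b" using r_cancel[of a c b] by simp
  qed
  moreover have "Units K = {\<one>\<^bsub>K\<^esub>}"
  proof (intro subset_antisym subsetI)
    fix a assume "a \<in> Units K"
    then obtain b where b: "a \<in> carrier J" "b \<in> carrier J" "a \<otimes> b = \<one>" unfolding Units_def by auto
    then show "a \<in> {\<one>\<^bsub>K\<^esub>}" using mult_eq_one[OF b] by simp
  next
    fix a assume "a \<in> {\<one>\<^bsub>K\<^esub>}"
    then have "a = \<one>" by simp
    then show "a \<in> Units K" unfolding Units_def by (auto simp: cl_one)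
  qed
  ultimately show "reduced_monoid K" by (intro reduced_monoid.intro reduced_monoid_axioms.intro)
qed

lemma K_atoms_iff:
  "a \<in> atoms K \<longleftrightarrow> a \<in> carrier J \<and> cl a = \<one>\<^bsub>G\<^esub> \<and> a \<noteq> \<one> \<and>
    (\<forall>b\<in>carrier J. \<forall>c\<in>carrier J. cl b = \<one>\<^bsub>G\<^esub> \<longrightarrow> cl c = \<one>\<^bsub>G\<^esub> \<longrightarrow> a = b \<otimes> c \<longrightarrow> b = \<one> \<or> c = \<one>)"
  unfolding K.atoms_iff by auto

lemma K_atom_factor:
  assumes "a \<in> atoms K" "a = b \<otimes> c" "b \<in> carrier J" "c \<in> carrier J" "cl b = \<one>\<^bsub>G\<^esub>"
  shows "b = \<one> \<or> c = \<one>"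
proof -
  have "cl c = \<one>\<^bsub>G\<^esub>"
    by (rule K_divisor[OF assms(3,4) _ assms(5)]) (use assms(1,2) in \<open>simp add: K_atoms_iff\<close>)
  then show ?thesis using assms unfolding K_atoms_iff by blast
qed

lemma K_atom_closed: "a \<in> atoms K \<Longrightarrow> a \<in> carrier J" "a \<in> atoms K \<Longrightarrow> cl a = \<one>\<^bsub>G\<^esub>"
  by (simp_all add: K_atoms_iff)

lemma J_atom_in_K: "x \<in> atoms J \<Longrightarrow> cl x = \<one>\<^bsub>G\<^esub> \<Longrightarrow> x \<in> atoms K"
  unfolding K_atoms_iff atoms_iff by blast

lemma K_mset_prod: "set_mset z \<subseteq> carrier K \<Longrightarrow> mset_prod K z = mset_prod J z"
proof (induction z)
  case (add x z)
  then have "x \<in> carrier K" "set_mset z \<subseteq> carrier K" by auto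
  moreover from this have "x \<in> carrier J" "set_mset z \<subseteq> carrier J" by auto
  ultimately show ?case using add.IH by (simp del: partial_object.select_convs)
qed simp

lemma K_Z_closed: "z \<in> K.Z a \<Longrightarrow> a \<in> carrier J" "z \<in> K.Z a \<Longrightarrow> cl a = \<one>\<^bsub>G\<^esub>"
  using K.Z_closed[of z a] by simp_all

lemma K_Z_exists:
  assumes "a \<in> carrier J" "cl a = \<one>\<^bsub>G\<^esub>"
  shows "\<exists>z. z \<in> K.Z a"
proof (rule K.Z_exists[of "wt (\<lambda>_. 1)"])
  show "wt (\<lambda>_. 1) (b \<otimes>\<^bsub>K\<^esub> c) = wt (\<lambda>_. 1) b + wt (\<lambda>_. 1) c"
    if "b \<in> carrier K" "c \<in> carrier K" for b c
    using that by (simp add: wt_mult)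
  show "b = \<one>\<^bsub>K\<^esub>" if "b \<in> carrier K" "wt (\<lambda>_. 1) b = 0" for b
    using that wt_eq_zero[of b "\<lambda>_. 1"] by simp
qed (use assms in simp)

lemma K_Z_pair: "x \<in> atoms K \<Longrightarrow> y \<in> atoms K \<Longrightarrow> {#x, y#} \<in> K.Z (x \<otimes> y)"
  using K.Z_add_mset[OF _ K.Z_atom, of x y] by simp

lemma K_Z_add_mset: "x \<in> atoms K \<Longrightarrow> z \<in> K.Z b \<Longrightarrow> add_mset x z \<in> K.Z (x \<otimes> b)"
  using K.Z_add_mset[of x z b] by simp

lemma K_Z_union: "z \<in> K.Z a \<Longrightarrow> z' \<in> K.Z b \<Longrightarrow> z + z' \<in> K.Z (a \<otimes> b)"
  using K.Z_union[of z a z' b] by simp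

text \<open>Membership of \<open>l\<close> in the union of sets of lengths with index
  \<open>k\<close>, as a relation. It is symmetric, reflexive and additive, so that few relations
  generate all that are needed.\<close>

definition "lengths_meet k l \<longleftrightarrow> (\<exists>b. \<exists>z\<in>K.Z b. \<exists>z'\<in>K.Z b. size z = k \<and> size z' = l)"

lemma lengths_meetI: "z \<in> K.Z b \<Longrightarrow> z' \<in> K.Z b \<Longrightarrow> size z = k \<Longrightarrow> size z' = l \<Longrightarrow> lengths_meet k l"
  unfolding lengths_meet_def by blast

lemma lengths_meet_sym: "lengths_meet k l \<Longrightarrow> lengths_meet l k"
  unfolding lengths_meet_def by blast

lemma lengths_meet_add:
  assumes "lengths_meet k l" "lengths_meet k' l'"
  shows "lengths_meet (k + k') (l + l')"
proof -
  obtain b z z' where z: "z \<in> K.Z b" "z' \<in> K.Z b" "size z = k" "size z' = l"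
    using assms(1) unfolding lengths_meet_def by blast
  obtain c w w' where w: "w \<in> K.Z c" "w' \<in> K.Z c" "size w = k'" "size w' = l'"
    using assms(2) unfolding lengths_meet_def by blast
  show ?thesis
    by (rule lengths_meetI[OF K_Z_union[OF z(1) w(1)] K_Z_union[OF z(2) w(2)]]) (use z w in simp_all)
qed

lemma class_primeE:
  assumes "g \<in> carrier G"
  obtains c q where "free q" "c = unif q" "c \<in> atoms J" "c \<in> carrier J" "cl c = g"
proof -
  obtain q where q: "free q" "cl (unif q) = g" using class_prime[OF assms] by blast
  then have "unif q \<in> atoms J" using unif_atom free_X by blast
  then show thesis using that q atoms_closed by blast
qed

text \<open>A prime in the trivial class is an atom of \<open>K\<close>, and its powers realize
  every length.\<close>

lemma lengths_meet_refl: "lengths_meet k k"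
proof -
  obtain c q where c: "free q" "c = unif q" "c \<in> atoms J" "c \<in> carrier J" "cl c = \<one>\<^bsub>G\<^esub>"
    by (rule class_primeE[OF G.one_closed])
  have cK: "c \<in> atoms K" by (rule J_atom_in_K[OF c(3,5)])
  have "\<exists>b. \<exists>z\<in>K.Z b. size z = k"
  proof (induction k)
    case 0
    have "{#} \<in> K.Z \<one>" using K.Z_one by simp
    then show ?case by (intro exI[of _ \<one>] bexI[of _ "{#}"]) simp_all
  next
    case (Suc k)
    then obtain b z where z: "z \<in> K.Z b" "size z = k" by blast
    show ?case
      by (rule exI[of _ "c \<otimes> b"], rule bexI[OF _ K_Z_add_mset[OF cK z(1)]]) (simp add: z(2))
  qed
  then show ?thesis unfolding lengths_meet_def by blast
qed

lemma lengths_meet_ge_two: "lengths_meet k l \<Longrightarrow> 2 \<le> k \<Longrightarrow> 2 \<le> l"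
  unfolding lengths_meet_def using K.size_ge_two by blast

text \<open>The kernel factor that contains the prime cannot be the prime alone, whose class is
  nontrivial. It therefore takes a nontrivial part of the atom \<open>x\<close>, hence all of
  \<open>x\<close>.\<close>

lemma pair_atom:
  assumes x: "x \<in> atoms J" "cl x \<noteq> \<one>\<^bsub>G\<^esub>" and q: "free q" and cl: "cl (x \<otimes> unif q) = \<one>\<^bsub>G\<^esub>"
  shows "x \<otimes> unif q \<in> atoms K"
proof -
  note u = unif_closed[OF free_X[OF q]] and xc = atoms_closed[OF x(1)]
  have clu: "cl (unif q) \<noteq> \<one>\<^bsub>G\<^esub>"
  proof
    assume "cl (unif q) = \<one>\<^bsub>G\<^esub>"
    then have "cl x = \<one>\<^bsub>G\<^esub>" using cl_mult[OF xc u] cl cl_closed[OF xc] by simp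
    then show False using x(2) by contradiction
  qed
  have aux: "a = \<one> \<or> b = \<one>"
    if a: "a \<in> carrier J" "b \<in> carrier J" "cl a = \<one>\<^bsub>G\<^esub>" and a': "a' \<in> carrier J" "a = unif q \<otimes> a'" "x = a' \<otimes> b" for a b a'
  proof -
    have "a' = \<one> \<or> b = \<one>" by (rule atom_factor[OF x(1) a'(3,1) a(2)])
    moreover have "a' \<noteq> \<one>" using a'(2) a(3) clu u by auto
    ultimately show ?thesis by blast
  qed
  show ?thesis
    unfolding K_atoms_iff
  proof (intro conjI ballI impI)
    show "x \<otimes> unif q \<in> carrier J" using xc u by simp
    show "x \<otimes> unif q \<noteq> \<one>" using mult_eq_one[OF xc u] atom_not_one[OF x(1)] by blast
    fix a b assume ab: "a \<in> carrier J" "b \<in> carrier J" "cl a = \<one>\<^bsub>G\<^esub>" "cl b = \<one>\<^bsub>G\<^esub>" "x \<otimes> unif q = a \<otimes> b"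
    have "unif q \<otimes> x = a \<otimes> b" using ab(5) m_comm[OF xc u] by simp
    then show "a = \<one> \<or> b = \<one>"
    proof (rule free_divides_mult[OF q ab(1,2) xc])
      fix a' assume "a' \<in> carrier J" "a = unif q \<otimes> a'" "x = a' \<otimes> b"
      then show ?thesis by (rule aux[OF ab(1,2,3)])
    next
      fix b' assume b': "b' \<in> carrier J" "b = unif q \<otimes> b'" "x = a \<otimes> b'"
      then have "x = b' \<otimes> a" using m_comm[OF ab(1) b'(1)] by simp
      then show ?thesis using aux[OF ab(2,1,4) b'(1,2)] by blast
    qed
  qed (rule cl)
qed

lemma pair_atom':
  assumes "x \<in> atoms J" "cl x \<noteq> \<one>\<^bsub>G\<^esub>" "free q" "cl (unif q) = inv\<^bsub>G\<^esub> cl x"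
  shows "x \<otimes> unif q \<in> atoms K"
proof (rule pair_atom[OF assms(1-3)])
  show "cl (x \<otimes> unif q) = \<one>\<^bsub>G\<^esub>"
    using cl_mult[OF atoms_closed[OF assms(1)] unif_closed[OF free_X[OF assms(3)]]] assms(4)
      cl_closed[OF atoms_closed[OF assms(1)]] by simp
qed

text \<open>Write \<open>a\<close> as a product of two atoms \<open>x\<close>, \<open>y\<close> of
  \<open>J\<close>, whose classes are inverse to each other. If the classes are nontrivial, take
  primes \<open>c\<close> in the class of \<open>y\<close> and \<open>d\<close> in the class of
  \<open>x\<close>: then \<open>(x \<otimes> c) \<otimes> (y \<otimes> d) = (d \<otimes> c)
  \<otimes> a\<close> is a product of two atoms of \<open>K\<close>, and also of
  \<open>Suc (size z)\<close>.\<close>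

lemma two_lengths:
  assumes p: "p \<in> X" "2 \<le> s p" and a: "a \<in> primary p" "cl a = \<one>\<^bsub>G\<^esub>" "\<forall>i<s p. 2 \<le> val p i a"
    and z: "z \<in> K.Z a"
  shows "lengths_meet 2 (size z) \<or> lengths_meet 2 (Suc (size z))"
proof -
  obtain x y where xy: "x \<in> atoms_at p" "y \<in> atoms_at p" "a = x \<otimes> y"
    by (rule split_two[OF p(1) a(1,3)]) (use p(2) in blast)+
  have at: "x \<in> atoms J" "y \<in> atoms J" "x \<in> carrier J" "y \<in> carrier J" using xy atoms_closed by blast+
  have clxy: "cl x \<otimes>\<^bsub>G\<^esub> cl y = \<one>\<^bsub>G\<^esub>" using a(2) cl_mult[OF at(3,4)] xy(3) by simp
  have g: "cl x \<in> carrier G" "cl y \<in> carrier G" using at cl_closed by blast+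
  have inv: "cl y = inv\<^bsub>G\<^esub> cl x" using G.inv_equality[of "cl y" "cl x"] clxy g G.m_comm by metis
  show ?thesis
  proof (cases "cl x = \<one>\<^bsub>G\<^esub>")
    case True
    then have "cl y = \<one>\<^bsub>G\<^esub>" using inv by simp
    then have "{#x, y#} \<in> K.Z a"
      unfolding xy(3) using K_Z_pair J_atom_in_K[OF at(1) True] J_atom_in_K[OF at(2)] by blast
    then show ?thesis using lengths_meetI[OF _ z, of "{#x, y#}" 2] by simp
  next
    case False
    obtain c q where c: "free q" "c = unif q" "c \<in> atoms J" "c \<in> carrier J" "cl c = inv\<^bsub>G\<^esub> cl x"
      by (rule class_primeE[of "inv\<^bsub>G\<^esub> cl x"]) (use g in simp_all)
    obtain d r where d: "free r" "d = unif r" "d \<in> atoms J" "d \<in> carrier J" "cl d = cl x"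
      by (rule class_primeE[OF g(1)])
    have ny: "cl y \<noteq> \<one>\<^bsub>G\<^esub>" using False inv g by (metis G.inv_inv G.inv_one)
    have xc: "x \<otimes> c \<in> atoms K" unfolding c(2) by (rule pair_atom'[OF at(1) False c(1)]) (use c in simp)
    have yd: "y \<otimes> d \<in> atoms K" unfolding d(2) by (rule pair_atom'[OF at(2) ny d(1)]) (use d inv g in simp)
    have dc: "d \<otimes> c \<in> atoms K" unfolding c(2) by (rule pair_atom'[OF d(3) _ c(1)]) (use c d False in simp_all)
    have "(x \<otimes> c) \<otimes> (y \<otimes> d) = (d \<otimes> c) \<otimes> a" unfolding xy(3) using at c(4) d(4) by (simp add: m_ac)
    then have "{#x \<otimes> c, y \<otimes> d#} \<in> K.Z ((d \<otimes> c) \<otimes> a)" using K_Z_pair[OF xc yd] by simp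
    then have "lengths_meet 2 (Suc (size z))"
      by (rule lengths_meetI[OF _ K_Z_add_mset[OF dc z]]) simp_all
    then show ?thesis ..
  qed
qed

lemma cl_pow: "a \<in> carrier J \<Longrightarrow> cl (a [^] (n::nat)) = cl a [^]\<^bsub>G\<^esub> n"
  by (induction n) (simp_all add: cl_one cl_mult)

text \<open>The uniformizer raised to the order of the class group lies in the kernel, and any atom
  of \<open>K\<close> dividing this power is \<open>p\<close>-primary.\<close>

lemma primary_K_atom:
  assumes p: "p \<in> X"
  obtains t where "t \<in> atoms K" "t \<in> primary p"
proof -
  define n where "n = card (carrier G)"
  have n: "0 < n" unfolding n_def using finite_G G.one_closed card_gt_0_iff by blast
  define a where "a = unif p [^] n"
  have u: "unif p \<in> carrier J" by (rule unif_closed[OF p])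
  have ap: "a \<in> primary p" unfolding a_def by (rule primary_pow(1)[OF p unif(1)[OF p]])
  have cla: "cl a = \<one>\<^bsub>G\<^esub>"
    unfolding a_def cl_pow[OF u] n_def by (rule G.power_order_eq_one[OF finite_G cl_closed[OF u]])
  have "val p 0 a = n" unfolding a_def using primary_pow(2)[OF p unif(1)[OF p] s_pos[OF p]] val_unif[OF p] by simp
  then have "a \<noteq> \<one>" using n val_one[OF p s_pos[OF p]] by auto
  obtain z where z: "z \<in> K.Z a" using K_Z_exists[OF primary_closed[OF ap] cla] by blast
  have "z \<noteq> {#}" using z \<open>a \<noteq> \<one>\<close> K.Z_empty_iff[of a] by auto
  then obtain t w where w: "z = add_mset t w" by (meson multiset_cases)
  have "add_mset t w \<in> K.Z a" using z unfolding w .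
  note sp = K.Z_add_mset_split[OF this]
  have "a = t \<otimes> mset_prod K w" using sp(3) by simp
  moreover have "t \<in> carrier J" "mset_prod K w \<in> carrier J" using K_atom_closed(1)[OF sp(1)] K_Z_closed(1)[OF sp(2)] by blast+
  ultimately have "t \<in> primary p" using primary_factor(1)[of t "mset_prod K w" p] ap by simp
  then show thesis using that sp(1) by blast
qed

text \<open>A power \<open>t [^] l\<close> of a \<open>p\<close>-primary atom \<open>t\<close> of
  \<open>K\<close> has length \<open>l\<close> in \<open>K\<close>, and all its values are at least
  \<open>l\<close>, so that \<open>two_lengths\<close> applies.\<close>

lemma lengths_meet_two:
  assumes p: "p \<in> X" "2 \<le> s p" and l: "2 \<le> l"
  shows "lengths_meet 2 l \<or> lengths_meet 2 (Suc l)"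
proof -
  obtain t where t: "t \<in> atoms K" "t \<in> primary p" by (rule primary_K_atom[OF p(1)])
  have tc: "t \<in> carrier J" "cl t = \<one>\<^bsub>G\<^esub>" using K_atom_closed[OF t(1)] .
  have "t \<noteq> \<one>" using t(1) unfolding K_atoms_iff by blast
  have ex: "\<exists>z\<in>K.Z (t [^] n). size z = n" for n :: nat
  proof (induction n)
    case 0
    show ?case using K.Z_one by (intro bexI[of _ "{#}"]) simp_all
  next
    case (Suc n)
    then obtain z where z: "z \<in> K.Z (t [^] n)" "size z = n" by blast
    have "t [^] Suc n = t \<otimes> t [^] n" using tc(1) m_comm[of t "t [^] n"] by simp
    then have "add_mset t z \<in> K.Z (t [^] Suc n)" using K_Z_add_mset[OF t(1) z(1)] by simp
    then show ?case using z(2) by (intro bexI[of _ "add_mset t z"]) simp_all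
  qed
  obtain z where z: "z \<in> K.Z (t [^] l)" "size z = l" using ex by blast
  have cl: "cl (t [^] l) = \<one>\<^bsub>G\<^esub>" using K_Z_closed(2)[OF z(1)] .
  have "\<forall>i<s p. 2 \<le> val p i (t [^] l)"
  proof (intro allI impI)
    fix i assume i: "i < s p"
    have "0 < val p i t" by (rule primary_val_pos[OF p(1) t(2) \<open>t \<noteq> \<one>\<close> i])
    then have "l * 1 \<le> l * val p i t" by (intro mult_le_mono2) simp
    then show "2 \<le> val p i (t [^] l)" unfolding primary_pow(2)[OF p(1) t(2) i] using l by linarith
  qed
  from two_lengths[OF p primary_pow(1)[OF p(1) t(2)] cl this z(1)] z(2) show ?thesis by simp
qed

text \<open>In a proper splitting one of the two factors would be a single one of the three primes,
  which is not in the kernel.\<close>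

lemma triple_atom:
  assumes q: "free q1" "free q2" "free q3"
    and c: "cl (unif q1) \<noteq> \<one>\<^bsub>G\<^esub>" "cl (unif q2) \<noteq> \<one>\<^bsub>G\<^esub>" "cl (unif q3) \<noteq> \<one>\<^bsub>G\<^esub>"
    and cl: "cl (unif q1 \<otimes> (unif q2 \<otimes> unif q3)) = \<one>\<^bsub>G\<^esub>"
  shows "unif q1 \<otimes> (unif q2 \<otimes> unif q3) \<in> atoms K"
proof -
  have u: "unif q1 \<in> carrier J" "unif q2 \<in> carrier J" "unif q3 \<in> carrier J"
    using unif_closed free_X q by blast+
  have at: "unif q3 \<in> atoms J" using unif_atom[OF free_X[OF q(3)]] by blast
  have aux: "a = \<one> \<or> b = \<one>" if a: "a \<in> carrier J" "b \<in> carrier J" "cl a = \<one>\<^bsub>G\<^esub>" "cl b = \<one>\<^bsub>G\<^esub>"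
    and a': "a' \<in> carrier J" "a = unif q1 \<otimes> a'" "unif q2 \<otimes> unif q3 = a' \<otimes> b" for a b a'
  proof -
    have na: "a' \<noteq> \<one>" using a'(2) a(3) c(1) u by auto
    show ?thesis
      using a'(3)
    proof (rule free_divides_mult[OF q(2) a'(1) a(2) u(3)])
      fix d assume d: "d \<in> carrier J" "a' = unif q2 \<otimes> d" "unif q3 = d \<otimes> b"
      from atom_factor[OF at d(3,1) a(2)] show ?thesis
      proof
        assume "d = \<one>"
        then have "b = unif q3" using d(3) a(2) by simp
        then show ?thesis using a(4) c(3) by simp
      qed simp
    next
      fix d assume d: "d \<in> carrier J" "b = unif q2 \<otimes> d" "unif q3 = a' \<otimes> d"
      from atom_factor[OF at d(3) a'(1) d(1)] have "d = \<one>" using na by blast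
      then have "b = unif q2" using d(2) u by simp
      then show ?thesis using a(4) c(2) by simp
    qed
  qed
  show ?thesis
    unfolding K_atoms_iff
  proof (intro conjI ballI impI)
    show "unif q1 \<otimes> (unif q2 \<otimes> unif q3) \<in> carrier J" using u by simp
    show "unif q1 \<otimes> (unif q2 \<otimes> unif q3) \<noteq> \<one>"
      using mult_eq_one[of "unif q1" "unif q2 \<otimes> unif q3"] u c(1) cl_one by auto
    fix a b assume ab: "a \<in> carrier J" "b \<in> carrier J" "cl a = \<one>\<^bsub>G\<^esub>" "cl b = \<one>\<^bsub>G\<^esub>"
      "unif q1 \<otimes> (unif q2 \<otimes> unif q3) = a \<otimes> b"
    show "a = \<one> \<or> b = \<one>"
      using ab(5)
    proof (rule free_divides_mult[OF q(1) ab(1,2) m_closed[OF u(2,3)]])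
      fix a' assume "a' \<in> carrier J" "a = unif q1 \<otimes> a'" "unif q2 \<otimes> unif q3 = a' \<otimes> b"
      then show ?thesis by (rule aux[OF ab(1-4)])
    next
      fix b' assume b': "b' \<in> carrier J" "b = unif q1 \<otimes> b'" "unif q2 \<otimes> unif q3 = a \<otimes> b'"
      then have "unif q2 \<otimes> unif q3 = b' \<otimes> a" using m_comm[OF ab(1) b'(1)] by simp
      then show ?thesis using aux[OF ab(2,1,4,3) b'(1,2)] by blast
    qed
  qed (rule cl)
qed

text \<open>A minimal zero-sum sequence of three classes times its negative regroups into three
  pairs of opposite classes; primes in these six classes realize this in \<open>K\<close>.\<close>

lemma lengths_meet_two_three_primes:
  assumes g: "g \<in> carrier G" "h \<in> carrier G" "g \<noteq> \<one>\<^bsub>G\<^esub>" "h \<noteq> \<one>\<^bsub>G\<^esub>" "g \<otimes>\<^bsub>G\<^esub> h \<noteq> \<one>\<^bsub>G\<^esub>"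
  shows "lengths_meet 2 3"
proof -
  define k where "k = inv\<^bsub>G\<^esub> (g \<otimes>\<^bsub>G\<^esub> h)"
  have k: "k \<in> carrier G" "k \<noteq> \<one>\<^bsub>G\<^esub>" "g \<otimes>\<^bsub>G\<^esub> (h \<otimes>\<^bsub>G\<^esub> k) = \<one>\<^bsub>G\<^esub>"
    unfolding k_def using g G.inv_eq_1_iff[of "g \<otimes>\<^bsub>G\<^esub> h"] by (simp_all add: G.m_assoc[symmetric])
  have ik: "inv\<^bsub>G\<^esub> g \<otimes>\<^bsub>G\<^esub> (inv\<^bsub>G\<^esub> h \<otimes>\<^bsub>G\<^esub> inv\<^bsub>G\<^esub> k) = \<one>\<^bsub>G\<^esub>"
    using arg_cong[OF k(3), of "\<lambda>x. inv\<^bsub>G\<^esub> x"] g(1,2) k(1) by (simp add: G.inv_mult)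
  obtain c1 q1 where c1: "free q1" "c1 = unif q1" "c1 \<in> atoms J" "c1 \<in> carrier J" "cl c1 = g"
    by (rule class_primeE[OF g(1)])
  obtain c2 q2 where c2: "free q2" "c2 = unif q2" "c2 \<in> atoms J" "c2 \<in> carrier J" "cl c2 = h"
    by (rule class_primeE[OF g(2)])
  obtain c3 q3 where c3: "free q3" "c3 = unif q3" "c3 \<in> atoms J" "c3 \<in> carrier J" "cl c3 = k"
    by (rule class_primeE[OF k(1)])
  obtain d1 r1 where d1: "free r1" "d1 = unif r1" "d1 \<in> atoms J" "d1 \<in> carrier J" "cl d1 = inv\<^bsub>G\<^esub> g"
    by (rule class_primeE[OF G.inv_closed[OF g(1)]])
  obtain d2 r2 where d2: "free r2" "d2 = unif r2" "d2 \<in> atoms J" "d2 \<in> carrier J" "cl d2 = inv\<^bsub>G\<^esub> h"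
    by (rule class_primeE[OF G.inv_closed[OF g(2)]])
  obtain d3 r3 where d3: "free r3" "d3 = unif r3" "d3 \<in> atoms J" "d3 \<in> carrier J" "cl d3 = inv\<^bsub>G\<^esub> k"
    by (rule class_primeE[OF G.inv_closed[OF k(1)]])
  have "cl (c1 \<otimes> (c2 \<otimes> c3)) = \<one>\<^bsub>G\<^esub>" using k(3) c1 c2 c3 by (simp add: cl_mult)
  then have S: "c1 \<otimes> (c2 \<otimes> c3) \<in> atoms K"
    unfolding c1(2) c2(2) c3(2) using triple_atom[OF c1(1) c2(1) c3(1)] c1 c2 c3 g k by simp
  have "cl (d1 \<otimes> (d2 \<otimes> d3)) = \<one>\<^bsub>G\<^esub>" using ik d1 d2 d3 by (simp add: cl_mult)
  then have S': "d1 \<otimes> (d2 \<otimes> d3) \<in> atoms K"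
    unfolding d1(2) d2(2) d3(2) using triple_atom[OF d1(1) d2(1) d3(1)] d1 d2 d3 g k by simp
  have p1: "c1 \<otimes> d1 \<in> atoms K" unfolding d1(2) by (rule pair_atom'[OF c1(3) _ d1(1)]) (use c1 d1 g in simp_all)
  have p2: "c2 \<otimes> d2 \<in> atoms K" unfolding d2(2) by (rule pair_atom'[OF c2(3) _ d2(1)]) (use c2 d2 g in simp_all)
  have p3: "c3 \<otimes> d3 \<in> atoms K" unfolding d3(2) by (rule pair_atom'[OF c3(3) _ d3(1)]) (use c3 d3 k in simp_all)
  have "(c1 \<otimes> (c2 \<otimes> c3)) \<otimes> (d1 \<otimes> (d2 \<otimes> d3)) = (c1 \<otimes> d1) \<otimes> ((c2 \<otimes> d2) \<otimes> (c3 \<otimes> d3))"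
    using c1(4) c2(4) c3(4) d1(4) d2(4) d3(4) by (simp add: m_ac)
  then have "{#c1 \<otimes> d1, c2 \<otimes> d2, c3 \<otimes> d3#} \<in> K.Z ((c1 \<otimes> (c2 \<otimes> c3)) \<otimes> (d1 \<otimes> (d2 \<otimes> d3)))"
    using K_Z_add_mset[OF p1 K_Z_pair[OF p2 p3]] by simp
  then show ?thesis by (rule lengths_meetI[OF K_Z_pair[OF S S']]) simp_all
qed

text \<open>At an index where \<open>x\<close> has value 1 the square has value 2, so the cofactor
  of the uniformizer again has value 1 there.\<close>

lemma square_split:
  assumes p: "p \<in> X" and x: "x \<in> atoms_at p"
  obtains y where "y \<in> atoms_at p" "x \<otimes> x = unif p \<otimes> y"
proof -
  have xp: "x \<in> primary p" "x \<in> carrier J" using x atoms_closed by blast+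
  have v: "val p i (x \<otimes> x) = 2 * val p i x" if "i < s p" for i
    using val_mult[OF p that xp(2) xp(2)] by simp
  have "\<forall>i<s p. 2 \<le> val p i (x \<otimes> x)"
  proof (intro allI impI)
    fix i assume i: "i < s p"
    show "2 \<le> val p i (x \<otimes> x)" using atom_val_pos[OF p x i] v[OF i] by simp
  qed
  then obtain y where y: "y \<in> primary p" "x \<otimes> x = unif p \<otimes> y" "\<forall>i<s p. val p i (x \<otimes> x) = Suc (val p i y)"
    by (rule divide_unif[OF p primary_mult[OF xp(1) xp(1)]])
  obtain i where i: "i < s p" "val p i x = 1" by (rule atom_val[OF p x])
  have "val p i y = 1" using y(3) v[OF i(1)] i by simp
  then have "y \<in> atoms J" by (rule atomI[OF p y(1) i(1)])
  then show thesis using that y by blast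
qed

text \<open>The assumption \<open>two\<close> means that \<open>G\<close> has at most two elements.
  In \<open>x \<otimes> x = unif p \<otimes> y\<close> the atoms on one side have trivial class and
  those on the other have the nontrivial class \<open>h\<close>. Multiplied by the square of a prime
  \<open>c\<close> in \<open>h\<close>, the latter side becomes two atoms of \<open>K\<close> and
  the former three.\<close>

lemma square_lengths:
  assumes p: "p \<in> X" and x: "x \<in> atoms_at p"
    and two: "\<And>g h. g \<in> carrier G \<Longrightarrow> h \<in> carrier G \<Longrightarrow> g \<noteq> \<one>\<^bsub>G\<^esub> \<Longrightarrow> h \<noteq> \<one>\<^bsub>G\<^esub> \<Longrightarrow> g \<otimes>\<^bsub>G\<^esub> h = \<one>\<^bsub>G\<^esub>"
    and ne: "(cl x = \<one>\<^bsub>G\<^esub>) \<noteq> (cl (unif p) = \<one>\<^bsub>G\<^esub>)"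
  shows "lengths_meet 2 3"
proof -
  obtain y where y: "y \<in> atoms_at p" "x \<otimes> x = unif p \<otimes> y" by (rule square_split[OF p x])
  have u: "unif p \<in> atoms J" "unif p \<in> carrier J" using unif_atom[OF p] unif_closed[OF p] by blast+
  have at: "x \<in> atoms J" "y \<in> atoms J" "x \<in> carrier J" "y \<in> carrier J" using x y atoms_closed by blast+
  have g: "cl x \<in> carrier G" "cl y \<in> carrier G" "cl (unif p) \<in> carrier G" using at u cl_closed by blast+
  have eq: "cl x \<otimes>\<^bsub>G\<^esub> cl x = cl (unif p) \<otimes>\<^bsub>G\<^esub> cl y"
    using arg_cong[OF y(2), of cl] cl_mult[OF at(3) at(3)] cl_mult[OF u(2) at(4)] by simp
  define h where "h = (if cl x = \<one>\<^bsub>G\<^esub> then cl (unif p) else cl x)"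
  have h: "h \<in> carrier G" "h \<noteq> \<one>\<^bsub>G\<^esub>" using g ne unfolding h_def by auto
  have hh: "h \<otimes>\<^bsub>G\<^esub> h = \<one>\<^bsub>G\<^esub>" by (rule two[OF h(1) h(1) h(2) h(2)])
  have ih: "inv\<^bsub>G\<^esub> h = h" by (rule G.inv_equality[OF hh h(1) h(1)])
  obtain c q where c: "free q" "c = unif q" "c \<in> atoms J" "c \<in> carrier J" "cl c = h" by (rule class_primeE[OF h(1)])
  have clq: "cl (unif q) = h" using c(5) unfolding c(2) .
  have pair: "w \<otimes> c \<in> atoms K" if "w \<in> atoms J" "cl w = h" for w
    unfolding c(2) by (rule pair_atom'[OF that(1) _ c(1)]) (use that(2) h(2) ih clq in simp_all)
  have cc: "c \<otimes> c \<in> atoms K" by (rule pair[OF c(3,5)])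
  have reassoc: "(a \<otimes> c) \<otimes> (b \<otimes> c) = (c \<otimes> c) \<otimes> (a \<otimes> b)" if "a \<in> carrier J" "b \<in> carrier J" for a b
    using that c(4) by (simp add: m_ac)
  show ?thesis
  proof (cases "cl x = \<one>\<^bsub>G\<^esub>")
    case True
    then have "cl (unif p) = h" by (simp add: h_def)
    moreover from this True eq have "h \<otimes>\<^bsub>G\<^esub> cl y = h \<otimes>\<^bsub>G\<^esub> h" using hh by simp
    then have "cl y = h" using h g(2) by simp
    ultimately have "{#unif p \<otimes> c, y \<otimes> c#} \<in> K.Z ((c \<otimes> c) \<otimes> (x \<otimes> x))"
      using K_Z_pair[OF pair[OF u(1)] pair[OF at(2)]] reassoc[OF u(2) at(4)] y(2) by simp
    moreover have "x \<in> atoms K" by (rule J_atom_in_K[OF at(1) True])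
    then have "{#c \<otimes> c, x, x#} \<in> K.Z ((c \<otimes> c) \<otimes> (x \<otimes> x))" using K_Z_add_mset[OF cc] K_Z_pair by blast
    ultimately show ?thesis by (rule lengths_meetI) simp_all
  next
    case False
    then have xh: "cl x = h" and up: "cl (unif p) = \<one>\<^bsub>G\<^esub>" using ne by (simp_all add: h_def)
    then have "cl y = \<one>\<^bsub>G\<^esub>" using eq hh g(2) by simp
    then have "{#c \<otimes> c, unif p, y#} \<in> K.Z ((c \<otimes> c) \<otimes> (unif p \<otimes> y))"
      using K_Z_add_mset[OF cc K_Z_pair[OF J_atom_in_K[OF u(1) up] J_atom_in_K[OF at(2)]]] by simp
    moreover have "{#x \<otimes> c, x \<otimes> c#} \<in> K.Z ((c \<otimes> c) \<otimes> (unif p \<otimes> y))"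
      using K_Z_pair[OF pair[OF at(1) xh] pair[OF at(1) xh]] reassoc[OF at(3) at(3)] y(2) by simp
    ultimately have "lengths_meet 3 2" by (rule lengths_meetI) simp_all
    then show ?thesis by (rule lengths_meet_sym)
  qed
qed

text \<open>With at least three classes primes suffice. Otherwise choose \<open>x\<close> with
  values 2, 1, 1 and so on, and \<open>y\<close> with \<open>x \<otimes> y\<close> the cube of the
  uniformizer; both are atoms. If the uniformizer and \<open>x\<close> both have trivial class, the
  cube has lengths 2 and 3. If exactly one has, \<open>square_lengths\<close> applies to
  \<open>x\<close>; if none has, then \<open>y\<close> has trivial class and it applies to
  \<open>y\<close>.\<close>

lemma lengths_meet_two_three:
  assumes p: "p \<in> X" "2 \<le> s p"
  shows "lengths_meet 2 3"
proof (cases "\<exists>g\<in>carrier G. \<exists>h\<in>carrier G. g \<noteq> \<one>\<^bsub>G\<^esub> \<and> h \<noteq> \<one>\<^bsub>G\<^esub> \<and> g \<otimes>\<^bsub>G\<^esub> h \<noteq> \<one>\<^bsub>G\<^esub>")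
  case True
  then show ?thesis using lengths_meet_two_three_primes by blast
next
  case False
  then have two: "\<And>g h. g \<in> carrier G \<Longrightarrow> h \<in> carrier G \<Longrightarrow> g \<noteq> \<one>\<^bsub>G\<^esub> \<Longrightarrow> h \<noteq> \<one>\<^bsub>G\<^esub> \<Longrightarrow> g \<otimes>\<^bsub>G\<^esub> h = \<one>\<^bsub>G\<^esub>"
    by blast
  obtain x where x: "x \<in> primary p" "\<forall>i<s p. val p i x = (if i = 0 then 2 else 1)"
    by (rule primary_surj[OF p(1), of "\<lambda>i. if i = 0 then 2 else 1"]) simp_all
  have u: "unif p \<in> atoms J" "unif p \<in> carrier J" "unif p \<in> primary p"
    using unif_atom[OF p(1)] unif_closed[OF p(1)] by blast+
  have xa: "x \<in> atoms J" by (rule atomI[OF p(1) x(1), of 1]) (use x(2) p(2) in simp_all)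
  have xc: "x \<in> carrier J" by (rule atoms_closed[OF xa])
  let ?b = "unif p \<otimes> (unif p \<otimes> unif p)"
  have bp: "?b \<in> primary p" using primary_mult u(3) by simp
  have vb: "val p i ?b = 3" if "i < s p" for i
    using val_mult[OF p(1) that u(2)] u(2) unif(2)[OF p(1) that] by simp
  have "\<forall>i<s p. val p i x < val p i ?b" using x(2) vb by simp
  then obtain y where y: "y \<in> carrier J" "?b = x \<otimes> y"
    using primary_divides[OF p(1) x(1) primary_closed[OF bp]] by blast
  have yp: "y \<in> primary p" by (rule primary_factor(2)[of x y]) (use bp y xc in simp_all)
  have "val p 0 ?b = val p 0 x + val p 0 y" unfolding y(2) by (rule val_mult[OF p(1) s_pos[OF p(1)] xc y(1)])
  then have "val p 0 y = 1" using vb[OF s_pos[OF p(1)]] x(2) s_pos[OF p(1)] by simp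
  then have ya: "y \<in> atoms J" by (rule atomI[OF p(1) yp s_pos[OF p(1)]])
  have g: "cl x \<in> carrier G" "cl y \<in> carrier G" "cl (unif p) \<in> carrier G" using xc y u cl_closed by blast+
  have eq: "cl (unif p) \<otimes>\<^bsub>G\<^esub> (cl (unif p) \<otimes>\<^bsub>G\<^esub> cl (unif p)) = cl x \<otimes>\<^bsub>G\<^esub> cl y"
    using arg_cong[OF y(2), of cl] u(2) xc y(1) by (simp add: cl_mult)
  consider "(cl x = \<one>\<^bsub>G\<^esub>) \<noteq> (cl (unif p) = \<one>\<^bsub>G\<^esub>)"
    | "cl x = \<one>\<^bsub>G\<^esub>" "cl (unif p) = \<one>\<^bsub>G\<^esub>" | "cl x \<noteq> \<one>\<^bsub>G\<^esub>" "cl (unif p) \<noteq> \<one>\<^bsub>G\<^esub>" by blast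
  then show ?thesis
  proof cases
    case 1
    show ?thesis by (rule square_lengths[OF p(1) _ two 1]) (use x xa in simp_all)
  next
    case 2
    then have "cl y = \<one>\<^bsub>G\<^esub>" using eq g by simp
    then have "{#x, y#} \<in> K.Z ?b" unfolding y(2) using K_Z_pair J_atom_in_K xa ya 2(1) by blast
    moreover have "unif p \<in> atoms K" by (rule J_atom_in_K[OF u(1) 2(2)])
    then have "{#unif p, unif p, unif p#} \<in> K.Z ?b" using K_Z_add_mset K_Z_pair by blast
    ultimately show ?thesis by (rule lengths_meetI) simp_all
  next
    case 3
    have uu: "cl (unif p) \<otimes>\<^bsub>G\<^esub> cl (unif p) = \<one>\<^bsub>G\<^esub>" by (rule two[OF g(3) g(3) 3(2) 3(2)])
    have xu: "cl x \<otimes>\<^bsub>G\<^esub> cl (unif p) = \<one>\<^bsub>G\<^esub>" by (rule two[OF g(1) g(3) 3(1) 3(2)])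
    have xeq: "cl x = cl (unif p)"
      using trans[OF xu uu[symmetric]] G.r_cancel[of "cl x" "cl (unif p)" "cl (unif p)"] g by simp
    show ?thesis
    proof (rule square_lengths[OF p(1) _ two])
      have "cl (unif p) = cl x \<otimes>\<^bsub>G\<^esub> cl y" using eq uu g by simp
      then have "cl y = \<one>\<^bsub>G\<^esub>" unfolding xeq using g by (simp add: eq_commute)
      then show "(cl y = \<one>\<^bsub>G\<^esub>) \<noteq> (cl (unif p) = \<one>\<^bsub>G\<^esub>)" using 3(2) by simp
    qed (use yp ya in simp_all)
  qed
qed

text \<open>The alternative in \<open>lengths_meet_two\<close> is absorbed: 2 meets
  \<open>l - 3\<close> or \<open>l - 2\<close>, and adding the relation of 2 with 3, or of 2 with 2,
  shows that 4 meets \<open>l\<close>. Adding \<open>k - 4\<close> to both sides gives the general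
  case.\<close>

lemma lengths_meet_ge_four:
  assumes p: "p \<in> X" "2 \<le> s p" and kl: "4 \<le> k" "4 \<le> l"
  shows "lengths_meet k l"
proof -
  have four: "lengths_meet 4 l" if l: "4 \<le> l" for l
  proof (cases "l = 4")
    case False
    then have "2 \<le> l - 3" using l by simp
    from lengths_meet_two[OF p this] show ?thesis
    proof
      assume "lengths_meet 2 (l - 3)"
      from lengths_meet_add[OF lengths_meet_two_three[OF p] this] have "lengths_meet (2 + 2) (3 + (l - 3))" by simp
      moreover have "3 + (l - 3) = l" using l by simp
      ultimately show ?thesis by simp
    next
      assume "lengths_meet 2 (Suc (l - 3))"
      from lengths_meet_add[OF this lengths_meet_refl[of 2]] have "lengths_meet (2 + 2) (Suc (l - 3) + 2)" .
      moreover have "Suc (l - 3) + 2 = l" using l False by linarith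
      ultimately show ?thesis by simp
    qed
  qed (simp add: lengths_meet_refl)
  have le: "lengths_meet k l" if "4 \<le> k" "k \<le> l" for k l
    using lengths_meet_add[OF four[of "l - (k - 4)"] lengths_meet_refl[of "k - 4"]] that by simp
  show ?thesis
  proof (cases "k \<le> l")
    case False
    then show ?thesis using lengths_meet_sym[OF le[of l k]] kl by simp
  qed (use le kl in blast)
qed

text \<open>For 3, the relation of 2 with \<open>l - 1\<close> or \<open>l\<close> is shifted by one
  on both sides; for \<open>l = 2\<close> the number 3 meets itself.\<close>

lemma lengths_meet_two_or_three:
  assumes p: "p \<in> X" "2 \<le> s p" and l: "2 \<le> l" and k: "k = 2 \<or> k = 3"
  shows "lengths_meet k l \<or> lengths_meet k (Suc l)"
  using k
proof
  assume k3: "k = 3"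
  show ?thesis
  proof (cases "l = 2")
    case True
    then show ?thesis using lengths_meet_refl[of 3] k3 by (simp add: numeral_3_eq_3)
  next
    case False
    then have "2 \<le> l - 1" using l by simp
    from lengths_meet_two[OF p this] show ?thesis
      using lengths_meet_add[OF _ lengths_meet_refl[of 1], of 2 "l - 1"]
        lengths_meet_add[OF _ lengths_meet_refl[of 1], of 2 "Suc (l - 1)"] k3 l by auto
  qed
qed (use lengths_meet_two[OF p l] in simp)

end

section \<open>Rank one: unions of sets of lengths of the kernel are finite intervals\<close>

context class_monoid
begin

lemma K_Z_iff: "z \<in> K.Z a \<longleftrightarrow> set_mset z \<subseteq> atoms K \<and> mset_prod J z = a"
proof -
  have "set_mset z \<subseteq> atoms K \<Longrightarrow> mset_prod K z = mset_prod J z"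
    using K_mset_prod K.atoms_subset by blast
  then show ?thesis unfolding factorizations_def by auto
qed

lemma K_Z_carrier: "z \<in> K.Z a \<Longrightarrow> set_mset z \<subseteq> carrier J"
  unfolding K_Z_iff using K_atom_closed(1) by blast

lemma K_Z_split:
  assumes "z + z' \<in> K.Z a"
  shows "z \<in> K.Z (mset_prod J z)" "z' \<in> K.Z (mset_prod J z')" "a = mset_prod J z \<otimes> mset_prod J z'"
  using assms K_Z_carrier[OF assms] by (simp_all add: K_Z_iff)

lemma K_Z_add_split:
  assumes "add_mset u z \<in> K.Z a"
  shows "u \<in> atoms K" "z \<in> K.Z (mset_prod J z)" "a = u \<otimes> mset_prod J z" "u \<in> carrier J" "mset_prod J z \<in> carrier J"
  using assms K_Z_carrier[OF assms] by (simp_all add: K_Z_iff)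

lemma K_Z_nonempty: "z \<in> K.Z a \<Longrightarrow> a \<noteq> \<one> \<Longrightarrow> 1 \<le> size z"
  using K.Z_empty_iff[of a] by (cases z) auto

lemma val_mset_prod_pos:
  assumes "p \<in> X" "set_mset z \<subseteq> carrier J" "0 < val p 0 (mset_prod J z)"
  obtains x w where "z = add_mset x w" "0 < val p 0 x"
proof -
  have "\<exists>x\<in>#z. 0 < val p 0 x"
  proof (rule ccontr)
    assume "\<not> ?thesis"
    then have "\<forall>x\<in>#z. val p 0 x = 0" by auto
    then have "(\<Sum>x\<in>#z. val p 0 x) = 0" by simp
    with val_mset_prod[OF assms(1) s_pos[OF assms(1)] assms(2)] have "val p 0 (mset_prod J z) = 0" by (rule trans)
    then show False using assms(3) by simp
  qed
  then obtain x where x: "x \<in># z" "0 < val p 0 x" by blast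
  obtain w where "z = add_mset x w" using multi_member_split[OF x(1)] by blast
  then show thesis using that x(2) by blast
qed

text \<open>A kernel factor of the new product that contains the prime becomes a kernel factor of
  the atom \<open>y \<otimes> w\<close> when \<open>y\<close> is put back in place of the
  prime.\<close>

lemma replace_atom:
  assumes u: "y \<otimes> w \<in> atoms K" and y: "y \<in> carrier J" "w \<in> carrier J" "y \<noteq> \<one>"
    and q: "free q" "cl (unif q) = cl y"
  shows "unif q \<otimes> w \<in> atoms K"
proof -
  note uq = unif_closed[OF free_X[OF q(1)]]
  have aux: "a = \<one> \<or> b = \<one>"
    if a: "a \<in> carrier J" "b \<in> carrier J" "cl a = \<one>\<^bsub>G\<^esub>" and a': "a' \<in> carrier J" "a = unif q \<otimes> a'" "w = a' \<otimes> b" for a b a'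
  proof -
    have "cl (y \<otimes> a') = cl (unif q \<otimes> a')" using cl_mult y uq a'(1) q(2) by simp
    then have "cl (y \<otimes> a') = \<one>\<^bsub>G\<^esub>" using a(3) a'(2) by simp
    moreover have "y \<otimes> w = (y \<otimes> a') \<otimes> b" unfolding a'(3) using y a'(1) a(2) by (simp add: m_assoc)
    ultimately have "y \<otimes> a' = \<one> \<or> b = \<one>" using K_atom_factor[OF u] y(1) a'(1) a(2) by simp
    then show ?thesis using mult_eq_one[OF y(1) a'(1)] y(3) by blast
  qed
  have unone: "unif q \<noteq> \<one>" using unif_atom[OF free_X[OF q(1)]] atom_not_one by blast
  show ?thesis
    unfolding K_atoms_iff
  proof (intro conjI ballI impI)
    show "unif q \<otimes> w \<in> carrier J" using uq y by simp
    show "cl (unif q \<otimes> w) = \<one>\<^bsub>G\<^esub>"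
      using K_atom_closed(2)[OF u] cl_mult[OF y(1,2)] cl_mult[OF uq y(2)] q(2) by simp
    show "unif q \<otimes> w \<noteq> \<one>" using mult_eq_one[OF uq y(2)] unone by blast
    fix a b assume ab: "a \<in> carrier J" "b \<in> carrier J" "cl a = \<one>\<^bsub>G\<^esub>" "cl b = \<one>\<^bsub>G\<^esub>" "unif q \<otimes> w = a \<otimes> b"
    show "a = \<one> \<or> b = \<one>"
      using ab(5)
    proof (rule free_divides_mult[OF q(1) ab(1,2) y(2)])
      fix a' assume "a' \<in> carrier J" "a = unif q \<otimes> a'" "w = a' \<otimes> b"
      then show ?thesis by (rule aux[OF ab(1-3)])
    next
      fix b' assume b': "b' \<in> carrier J" "b = unif q \<otimes> b'" "w = a \<otimes> b'"
      then have "w = b' \<otimes> a" using m_comm[OF ab(1) b'(1)] by simp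
      then show ?thesis using aux[OF ab(2,1,4) b'(1,2)] by blast
    qed
  qed
qed

text \<open>On the second factorization the atoms of \<open>zV1\<close> are lost, but
  \<open>unif q \<otimes> v\<close> contributes at least one new atom. If \<open>zV1\<close> has at
  most two atoms, the length drops by at most 1.\<close>

lemma shrink:
  assumes U: "add_mset (y \<otimes> w) zU \<in> K.Z b" and V: "zV1 + zV0 \<in> K.Z b"
    and y: "y \<in> carrier J" "w \<in> carrier J" "y \<noteq> \<one>" and q: "free q" "cl (unif q) = cl y"
    and v: "v \<in> carrier J" "mset_prod J zV1 = y \<otimes> v"
  obtains zV' where "add_mset (unif q \<otimes> w) zU \<in> K.Z (unif q \<otimes> w \<otimes> mset_prod J zU)"
    "zV' \<in> K.Z (unif q \<otimes> w \<otimes> mset_prod J zU)" "Suc (size zV0) \<le> size zV'"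
proof -
  note uq = unif_closed[OF free_X[OF q(1)]]
  note U' = K_Z_add_split[OF U] and V' = K_Z_split[OF V]
  have V0: "mset_prod J zV0 \<in> carrier J" using K_Z_closed(1)[OF V'(2)] .
  have new: "add_mset (unif q \<otimes> w) zU \<in> K.Z (unif q \<otimes> w \<otimes> mset_prod J zU)"
    by (rule K_Z_add_mset[OF replace_atom[OF U'(1) y q] U'(2)])
  have "y \<otimes> (v \<otimes> mset_prod J zV0) = y \<otimes> (w \<otimes> mset_prod J zU)"
    using U'(3) V'(3) v y U'(5) V0 by (simp add: m_assoc)
  then have eq: "v \<otimes> mset_prod J zV0 = w \<otimes> mset_prod J zU"
    using l_cancel[of y "v \<otimes> mset_prod J zV0" "w \<otimes> mset_prod J zU"] y v(1) V0 U'(5) by simp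
  have "cl (unif q \<otimes> v) = cl (y \<otimes> v)" using cl_mult uq y v(1) q(2) by simp
  then have "cl (unif q \<otimes> v) = \<one>\<^bsub>G\<^esub>" using K_Z_closed(2)[OF V'(1)] v(2) by simp
  then obtain z where z: "z \<in> K.Z (unif q \<otimes> v)" using K_Z_exists[of "unif q \<otimes> v"] uq v(1) by auto
  have "unif q \<otimes> v \<noteq> \<one>"
    using mult_eq_one[OF uq v(1)] unif_atom[OF free_X[OF q(1)]] atom_not_one by blast
  from K_Z_nonempty[OF z this] have sz: "1 \<le> size z" .
  have "unif q \<otimes> v \<otimes> mset_prod J zV0 = unif q \<otimes> (w \<otimes> mset_prod J zU)"
    using m_assoc[OF uq v(1) V0] eq by simp
  also have "\<dots> = unif q \<otimes> w \<otimes> mset_prod J zU" by (rule m_assoc[OF uq y(2) U'(5), symmetric])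
  finally have "z + zV0 \<in> K.Z (unif q \<otimes> w \<otimes> mset_prod J zU)" using K_Z_union[OF z V'(2)] by simp
  then show thesis using that[OF new] sz by simp
qed

text \<open>An element of value at least 2 is divisible by \<open>x\<close> by strict comparison,
  and two members of \<open>z\<close> with positive value have such a product. If a single member
  has positive value and that value is 1, its component at \<open>p\<close> is \<open>x\<close> by
  uniqueness.\<close>

lemma atom_divides_at_most_two:
  assumes p: "p \<in> X" "s p = 1" and x: "x \<in> atoms_at p" and z: "set_mset z \<subseteq> carrier J"
    and r: "r \<in> carrier J" "mset_prod J z = x \<otimes> r"
  obtains z1 z0 v where "z = z1 + z0" "size z1 \<le> 2" "v \<in> carrier J" "mset_prod J z1 = x \<otimes> v"
proof -
  have xp: "x \<in> primary p" "x \<in> carrier J" using x atoms_closed by blast+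
  obtain i where "i < s p" "val p i x = 1" by (rule atom_val[OF p(1) x])
  then have vx: "val p 0 x = 1" using p(2) by simp
  have big: "\<exists>v\<in>carrier J. b = x \<otimes> v" if "b \<in> carrier J" "2 \<le> val p 0 b" for b
    by (rule primary_divides[OF p(1) xp(1) that(1)]) (use vx that(2) p(2) in simp)
  have vz: "val p 0 (mset_prod J z) = 1 + val p 0 r"
    unfolding r(2) using val_mult[OF p(1) s_pos[OF p(1)] xp(2) r(1)] vx by simp
  then have "0 < val p 0 (mset_prod J z)" by simp
  then obtain a w where a: "z = add_mset a w" "0 < val p 0 a" by (rule val_mset_prod_pos[OF p(1) z])
  have ac: "a \<in> carrier J" "set_mset w \<subseteq> carrier J" using z a(1) by auto
  have wc: "mset_prod J w \<in> carrier J" using ac(2) by simp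
  consider "2 \<le> val p 0 a" | "val p 0 a = 1" "0 < val p 0 (mset_prod J w)" | "val p 0 a = 1" "val p 0 (mset_prod J w) = 0"
    using a(2) by linarith
  then show thesis
  proof cases
    case 1
    then obtain v where v: "v \<in> carrier J" "a = x \<otimes> v" using big[OF ac(1)] by blast
    show thesis by (rule that[of "{#a#}" w v]) (use a(1) v ac in simp_all)
  next
    case 2
    obtain c u where c: "w = add_mset c u" "0 < val p 0 c" by (rule val_mset_prod_pos[OF p(1) ac(2) 2(2)])
    have cc: "c \<in> carrier J" using ac(2) c(1) by simp
    have "2 \<le> val p 0 (a \<otimes> c)" using val_mult[OF p(1) s_pos[OF p(1)] ac(1) cc] 2(1) c(2) by simp
    then obtain v where v: "v \<in> carrier J" "a \<otimes> c = x \<otimes> v" using big[of "a \<otimes> c"] ac(1) cc by auto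
    show thesis by (rule that[of "{#a, c#}" u v]) (use a(1) c(1) v ac(1) cc in simp_all)
  next
    case 3
    obtain e f where ef: "e \<in> primary p" "f \<in> carrier J" "a = e \<otimes> f" "val p 0 f = 0"
      by (rule primary_component[OF ac(1) p(1)])
    have "val p 0 (mset_prod J z) = val p 0 a + val p 0 (mset_prod J w)"
      unfolding a(1) using val_mult[OF p(1) s_pos[OF p(1)] ac(1) wc] ac by simp
    then have r0: "val p 0 r = 0" using vz 3 by simp
    have f0: "val p 0 (f \<otimes> mset_prod J w) = 0"
      using val_mult[OF p(1) s_pos[OF p(1)] ef(2) wc] ef(4) 3(2) by simp
    have "e \<otimes> (f \<otimes> mset_prod J w) = mset_prod J z"
      unfolding a(1) using ac wc ef(1-3) primary_closed[OF ef(1)] by (simp add: m_assoc)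
    then have "e \<otimes> (f \<otimes> mset_prod J w) = x \<otimes> r" using r(2) by simp
    then have "e = x"
      using primary_component_unique[OF p(1) ef(1) xp(1) _ r(1) f0 r0] ef(2) wc by simp
    then show thesis using that[of "{#a#}" w f] a(1) ef ac by simp
  qed
qed

lemma free_pair_divides_at_most_two:
  assumes p: "free p" "free q" and z: "set_mset z \<subseteq> carrier J"
    and r: "r \<in> carrier J" "mset_prod J z = (unif p \<otimes> unif q) \<otimes> r"
  obtains z1 z0 v where "z = z1 + z0" "size z1 \<le> 2" "v \<in> carrier J" "mset_prod J z1 = (unif p \<otimes> unif q) \<otimes> v"
proof -
  have X: "p \<in> X" "q \<in> X" using p free_X by blast+
  have u: "unif p \<in> carrier J" "unif q \<in> carrier J" using unif_closed X by blast+
  have "val p 0 (mset_prod J z) = val p 0 (unif p) + val p 0 (unif q \<otimes> r)"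
    unfolding r(2) m_assoc[OF u r(1)] by (rule val_mult[OF X(1) s_pos[OF X(1)] u(1)]) (use u r(1) in simp)
  then have "0 < val p 0 (mset_prod J z)" using val_unif[OF X(1)] by simp
  then obtain a w where a: "z = add_mset a w" "0 < val p 0 a" by (rule val_mset_prod_pos[OF X(1) z])
  have ac: "a \<in> carrier J" "set_mset w \<subseteq> carrier J" using z a(1) by auto
  have wc: "mset_prod J w \<in> carrier J" using ac(2) by simp
  obtain a1 where a1: "a1 \<in> carrier J" "a = unif p \<otimes> a1" by (rule free_divides[OF p(1) ac(1) a(2)])
  have "unif p \<otimes> (a1 \<otimes> mset_prod J w) = unif p \<otimes> (unif q \<otimes> r)"
    using r(2) unfolding a(1) using ac a1 u r(1) wc by (simp add: m_assoc)
  then have "unif q \<otimes> r = a1 \<otimes> mset_prod J w"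
    using l_cancel[of "unif p" "unif q \<otimes> r" "a1 \<otimes> mset_prod J w"] u a1(1) wc r(1) by simp
  then show thesis
  proof (rule free_divides_mult[OF p(2) a1(1) wc r(1)])
    fix a' assume a': "a' \<in> carrier J" "a1 = unif q \<otimes> a'"
    show thesis
      by (rule that[of "{#a#}" w a']) (use a(1) a1(2) a' u ac(1) in \<open>simp_all add: m_assoc\<close>)
  next
    fix b' assume b': "b' \<in> carrier J" "mset_prod J w = unif q \<otimes> b'"
    have "0 < val q 0 (mset_prod J w)"
      unfolding b'(2) using val_mult[OF X(2) s_pos[OF X(2)] u(2) b'(1)] val_unif[OF X(2)] by simp
    then obtain c d where c: "w = add_mset c d" "0 < val q 0 c" by (rule val_mset_prod_pos[OF X(2) ac(2)])
    have cc: "c \<in> carrier J" using ac(2) c(1) by simp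
    obtain c1 where c1: "c1 \<in> carrier J" "c = unif q \<otimes> c1" by (rule free_divides[OF p(2) cc c(2)])
    have "a \<otimes> c = (unif p \<otimes> unif q) \<otimes> (a1 \<otimes> c1)"
      unfolding a1(2) c1(2) using u a1(1) c1(1) by (simp add: m_ac)
    then show thesis using that[of "{#a, c#}" d "a1 \<otimes> c1"] a(1) c(1) a1(1) c1(1) ac(1) cc by simp
  qed
qed

lemma wt_one_pos: "a \<in> carrier J \<Longrightarrow> a \<noteq> \<one> \<Longrightarrow> 0 < wt (\<lambda>_. 1) a"
  using wt_eq_zero[of a "\<lambda>_. 1"] by auto

lemma wt_mset_prod: "set_mset z \<subseteq> carrier J \<Longrightarrow> wt w (mset_prod J z) = (\<Sum>x\<in>#z. wt w x)"
proof (induction z)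
  case empty
  then show ?case using wt_mult[of \<one> \<one> w] by simp
qed (simp add: wt_mult)

lemma size_le_wt: "z \<in> K.Z b \<Longrightarrow> size z \<le> wt (\<lambda>_. 1) b"
proof -
  assume z: "z \<in> K.Z b"
  have "size y \<le> (\<Sum>x\<in>#y. wt (\<lambda>_. 1) x)" if "set_mset y \<subseteq> atoms K" for y
    using that
  proof (induction y)
    case (add x y)
    then have "x \<in> atoms K" by simp
    then have "0 < wt (\<lambda>_. 1) x" using wt_one_pos[of x] unfolding K_atoms_iff by blast
    then show ?case using add by simp
  qed simp
  then show ?thesis using z wt_mset_prod[OF K_Z_carrier[OF z], of "\<lambda>_. 1"] unfolding K_Z_iff by auto
qed

lemma atom_wt:
  assumes s1: "\<forall>p\<in>X. s p = 1" and x: "x \<in> atoms J"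
  obtains p where "p \<in> X" "x \<in> atoms_at p" "val p 0 x = 1" "wt w x = w p"
proof -
  obtain p where p: "p \<in> X" "x \<in> primary p" using atom_primary[OF x] by blast
  then have xp: "x \<in> atoms_at p" using x by simp
  obtain i where "i < s p" "val p i x = 1" by (rule atom_val[OF p(1) xp])
  then have v: "val p 0 x = 1" using s1 p(1) by simp
  show thesis by (rule that[OF p(1) xp v]) (simp add: wt_primary[OF p] v)
qed

lemma size_eq_wt:
  assumes s1: "\<forall>p\<in>X. s p = 1" and z: "z \<in> Z b"
  shows "size z = wt (\<lambda>_. 1) b"
proof -
  have "wt (\<lambda>_. 1) x = 1" if "x \<in> atoms J" for x
    by (rule atom_wt[OF s1 that, of "\<lambda>_. 1"])
  then have "size y = (\<Sum>x\<in>#y. wt (\<lambda>_. 1) x)" if "set_mset y \<subseteq> atoms J" for y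
    using that by (induction y) auto
  then show ?thesis using z wt_mset_prod[OF Z_carrier[OF z], of "\<lambda>_. 1"] unfolding factorizations_def by auto
qed

text \<open>
  Induction on a weight of \<open>b\<close>: replacing a non-prime atom of \<open>J\<close>, or a product of two primes, dividing an
  atom in the shorter factorization by a prime of the same class keeps that factorization's length and shortens
  the longer one by at most 1, because the replaced element divides a product of two of its atoms.
\<close>
lemma lengths_meet_between:
  assumes s1: "\<forall>p\<in>X. s p = 1"
  shows "zU \<in> K.Z b \<Longrightarrow> zV \<in> K.Z b \<Longrightarrow> size zU \<le> m \<Longrightarrow> m \<le> size zV \<Longrightarrow> lengths_meet (size zU) m"
proof (induction "wt (\<lambda>p. if free p then 1 else 2) b" arbitrary: b zU zV rule: less_induct)
  case less
  \<comment> \<open>An atom at a \<open>p\<close> that is not free and a product of two free primes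
    both have weight 2, a free prime has weight 1; so each replacement by a prime lowers the weight
    of \<open>b\<close>.\<close>
  let ?W = "\<lambda>p. if free p then 1 else 2 :: nat"
  have shrunk: "lengths_meet (size zU) m"
    if u: "zU = add_mset (y \<otimes> w) zU0" and v1: "zV = zV1 + zV0" "size zV1 \<le> 2"
      and y: "y \<in> carrier J" "w \<in> carrier J" "y \<noteq> \<one>" "2 \<le> wt ?W y"
      and v: "v \<in> carrier J" "mset_prod J zV1 = y \<otimes> v" and lt: "m < size zV" for y w zU0 zV1 zV0 v
  proof -
    obtain c q where q: "free q" "c = unif q" "c \<in> atoms J" "c \<in> carrier J" "cl c = cl y"
      by (rule class_primeE[OF cl_closed[OF y(1)]])
    have cq: "cl (unif q) = cl y" using q(5) unfolding q(2) .
    note uq = unif_closed[OF free_X[OF q(1)]]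
    have U: "add_mset (y \<otimes> w) zU0 \<in> K.Z b" using less.prems(1) unfolding u .
    have V: "zV1 + zV0 \<in> K.Z b" using less.prems(2) unfolding v1(1) .
    note U' = K_Z_add_split[OF U]
    obtain zV' where zV': "add_mset (unif q \<otimes> w) zU0 \<in> K.Z (unif q \<otimes> w \<otimes> mset_prod J zU0)"
      "zV' \<in> K.Z (unif q \<otimes> w \<otimes> mset_prod J zU0)" "Suc (size zV0) \<le> size zV'"
      by (rule shrink[OF U V y(1-3) q(1) cq v])
    have "wt ?W (unif q) = 1" using wt_primary[OF free_X[OF q(1)] unif(1)[OF free_X[OF q(1)]], of ?W]
        val_unif[OF free_X[OF q(1)]] q(1) by simp
    then have "wt ?W (unif q \<otimes> w \<otimes> mset_prod J zU0) = 1 + wt ?W w + wt ?W (mset_prod J zU0)"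
      using uq y U'(5) by (simp add: wt_mult)
    moreover have "wt ?W b = wt ?W y + wt ?W w + wt ?W (mset_prod J zU0)"
      unfolding U'(3) using y U'(5) by (simp add: wt_mult)
    ultimately have "wt ?W (unif q \<otimes> w \<otimes> mset_prod J zU0) < wt ?W b" using y(4) by simp
    from less.hyps[OF this zV'(1,2)] show ?thesis
      using less.prems(3) lt zV'(3) v1 u by simp
  qed
  show ?case
  proof (cases "m = size zV")
    case True
    then show ?thesis using lengths_meetI[OF less.prems(1,2)] by simp
  next
    case False
    then have lt: "m < size zV" using less.prems(4) by simp
    have bU: "mset_prod J zU = b" "mset_prod J zV = b" using less.prems(1,2) unfolding K_Z_iff by blast+
    note cU = K_Z_carrier[OF less.prems(1)] and cV = K_Z_carrier[OF less.prems(2)]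
    show ?thesis
    proof (cases "\<exists>p\<in>X. \<not> free p \<and> 0 < val p 0 b")
      case True
      then obtain p where p: "p \<in> X" "\<not> free p" "0 < val p 0 b" by blast
      then have "0 < val p 0 (mset_prod J zU)" using bU(1) by simp
      then obtain u zU0 where u: "zU = add_mset u zU0" "0 < val p 0 u"
        by (rule val_mset_prod_pos[OF p(1) cU])
      have sp: "s p = 1" using s1 p(1) by simp
      have uc: "u \<in> carrier J" using cU u(1) by simp
      obtain x w where x: "x \<in> atoms_at p" "w \<in> carrier J" "u = x \<otimes> w"
        by (rule atom_divides_if_val[OF p(1) sp uc u(2)])
      have xc: "x \<in> carrier J" "x \<noteq> \<one>" "x \<in> primary p" "x \<in> atoms J" using x(1) atoms_closed atom_not_one by blast+
      obtain i where "i < s p" "val p i x = 1" by (rule atom_val[OF p(1) x(1)])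
      then have "wt ?W x = 2" using wt_primary[OF p(1) xc(3), of ?W] p(2) sp by simp
      have U: "add_mset (x \<otimes> w) zU0 \<in> K.Z b" using less.prems(1) unfolding u(1) x(3) .
      have "mset_prod J zV = x \<otimes> (w \<otimes> mset_prod J zU0)"
        using bU(2) K_Z_add_split(3,5)[OF U] xc(1) x(2) by (simp add: m_assoc)
      moreover have "w \<otimes> mset_prod J zU0 \<in> carrier J" using x(2) K_Z_add_split(5)[OF U] by simp
      ultimately obtain zV1 zV0 v where "zV = zV1 + zV0" "size zV1 \<le> 2" "v \<in> carrier J" "mset_prod J zV1 = x \<otimes> v"
        using atom_divides_at_most_two[OF p(1) sp x(1) cV] by metis
      then show ?thesis
        using shrunk[of x w zU0 zV1 zV0 v] u(1) x(3) xc x(2) \<open>wt ?W x = 2\<close> lt by simp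
    next
      case no: False
      have free: "free p" if "p \<in> X" "0 < val p 0 b" for p using no that by blast
      \<comment> \<open>If \<open>zU\<close> consisted of atoms of \<open>J\<close>, its length
        would be the total value of \<open>b\<close>, which bounds the length of
        \<open>zV\<close>.\<close>
      have "\<exists>u\<in>#zU. u \<notin> atoms J"
      proof (rule ccontr)
        assume "\<not> ?thesis"
        then have "zU \<in> Z b" using bU(1) by (auto simp: factorizations_def)
        then show False using size_eq_wt[OF s1] size_le_wt[OF less.prems(2)] lt less.prems(3) by fastforce
      qed
      then obtain u where u: "u \<in># zU" "u \<notin> atoms J" by blast
      obtain zU0 where zU: "zU = add_mset u zU0" using multi_member_split[OF u(1)] by blast
      have U: "add_mset u zU0 \<in> K.Z b" using less.prems(1) unfolding zU .
      note U' = K_Z_add_split[OF U]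
      have "u \<noteq> \<one>" using U'(1) unfolding K_atoms_iff by blast
      then obtain y w where yw: "y \<in> carrier J" "w \<in> carrier J" "u = y \<otimes> w" "y \<noteq> \<one>" "w \<noteq> \<one>"
        using u(2) U'(4) unfolding atoms_iff by blast
      have prime: "\<exists>p y'. free p \<and> y' \<in> carrier J \<and> y = unif p \<otimes> y'"
        if y: "y \<in> carrier J" "y \<noteq> \<one>" "c \<in> carrier J" "b = y \<otimes> c" for y c
      proof -
        obtain p where p: "p \<in> X" "val p 0 y \<noteq> 0" using support_empty[OF y(1)] y(2) by blast
        have "val p 0 b = val p 0 y + val p 0 c" unfolding y(4) by (rule val_mult[OF p(1) s_pos[OF p(1)] y(1,3)])
        then have fp: "free p" using free[OF p(1)] p(2) by simp
        have "0 < val p 0 y" using p(2) by simp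
        then obtain y' where "y' \<in> carrier J" "y = unif p \<otimes> y'" by (rule free_divides[OF fp y(1)])
        then show ?thesis using fp by blast
      qed
      have "b = y \<otimes> (w \<otimes> mset_prod J zU0)" "b = w \<otimes> (y \<otimes> mset_prod J zU0)"
        using U'(3) yw U'(5) by (simp_all add: m_ac)
      then have "\<exists>p y'. free p \<and> y' \<in> carrier J \<and> y = unif p \<otimes> y'" "\<exists>p w'. free p \<and> w' \<in> carrier J \<and> w = unif p \<otimes> w'"
        using prime[OF yw(1,4), of "w \<otimes> mset_prod J zU0"] prime[OF yw(2,5), of "y \<otimes> mset_prod J zU0"] yw(1,2) U'(5)
        by simp_all
      then obtain p y' q w' where p: "free p" "y' \<in> carrier J" "y = unif p \<otimes> y'"
        and q: "free q" "w' \<in> carrier J" "w = unif q \<otimes> w'" by blast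
      have uc: "unif p \<in> carrier J" "unif q \<in> carrier J" using unif_closed free_X p(1) q(1) by blast+
      let ?y = "unif p \<otimes> unif q" and ?w = "y' \<otimes> w'"
      have ueq: "u = ?y \<otimes> ?w" unfolding yw(3) p(3) q(3) using uc p(2) q(2) by (simp add: m_ac)
      have "?y \<noteq> \<one>"
        using mult_eq_one[OF uc] unif_atom[OF free_X[OF p(1)]] atom_not_one by blast
      have w1: "wt ?W (unif r) = 1" if "free r" for r
        using wt_primary[OF free_X[OF that] unif(1)[OF free_X[OF that]], of ?W] val_unif[OF free_X[OF that]] that by simp
      have "wt ?W ?y = 2" using wt_mult[OF uc, of ?W] w1 p(1) q(1) by simp
      have "mset_prod J zV = ?y \<otimes> (?w \<otimes> mset_prod J zU0)"
        using bU(2) U'(3,5) uc p(2) q(2) unfolding ueq by (simp add: m_assoc)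
      moreover have "?w \<otimes> mset_prod J zU0 \<in> carrier J" using p(2) q(2) U'(5) by simp
      ultimately obtain zV1 zV0 v where "zV = zV1 + zV0" "size zV1 \<le> 2" "v \<in> carrier J" "mset_prod J zV1 = ?y \<otimes> v"
        using free_pair_divides_at_most_two[OF p(1) q(1) cV] by metis
      then show ?thesis
        using shrunk[of ?y ?w zU0 zV1 zV0 v] zU ueq uc p(2) q(2) \<open>?y \<noteq> \<one>\<close> \<open>wt ?W ?y = 2\<close> lt by simp
    qed
  qed
qed

lemma cl_mset_prod: "set_mset z \<subseteq> carrier J \<Longrightarrow> cl (mset_prod J z) = mset_prod G (image_mset cl z)"
  by (rule mset_prod_hom[OF comm_monoid_axioms G.comm_monoid_axioms cl_hom cl_one])

text \<open>The Davenport constant of \<open>G\<close> is at most its order. Among the classes of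
  the initial products of lengths 0 up to the order two agree, and the segment in between is a
  kernel factor. It is proper if the factorization in \<open>J\<close> is longer than the
  order.\<close>

lemma K_atom_wt_le:
  assumes s1: "\<forall>p\<in>X. s p = 1" and u: "u \<in> atoms K"
  shows "wt (\<lambda>_. 1) u \<le> card (carrier G)"
proof (rule ccontr)
  assume no: "\<not> ?thesis"
  obtain z where z: "z \<in> Z u" using J_Z_exists[OF K_atom_closed(1)[OF u]] by blast
  then have big: "card (carrier G) < size z" using no size_eq_wt[OF s1 z] by simp
  obtain xs where xs: "mset xs = z" using ex_mset by blast
  have xc: "set xs \<subseteq> carrier J" "set xs \<subseteq> atoms J" using Z_carrier[OF z] z xs by (auto simp: factorizations_def)
  define f where "f j = cl (mset_prod J (mset (take j xs)))" for j
  have fc: "f j \<in> carrier G" for j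
    unfolding f_def using xc(1) set_take_subset[of j xs] by (intro cl_closed mset_prod_closed) auto
  have "card (f ` {..card (carrier G)}) \<le> card (carrier G)"
    by (rule card_mono[OF finite_G]) (use fc in auto)
  then have "\<not> inj_on f {..card (carrier G)}" using card_image[of f "{..card (carrier G)}"] by auto
  then obtain i j where ij: "i < j" "j \<le> card (carrier G)" "f i = f j"
    unfolding inj_on_def by (metis atMost_iff linorder_neqE_nat)
  define y where "y = drop i (take j xs)"
  define r where "r = take i xs @ drop j xs"
  have tj: "take j xs = take i xs @ y" unfolding y_def using ij(1)
    by (metis append_take_drop_id less_imp_le min.absorb1 take_take)
  have "xs = take j xs @ drop j xs" by simp
  then have zyr: "z = mset y + mset r" unfolding xs[symmetric] r_def using tj
    by (metis (no_types) mset_append union_assoc union_commute)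
  have yr: "mset y + mset r \<in> Z u" using z unfolding zyr .
  note sp = Z_union_split[OF yr]
  have cy: "set y \<subseteq> carrier J" "set (take i xs) \<subseteq> carrier J"
    using xc(1) tj set_take_subset[of j xs] set_take_subset[of i xs] by auto
  have c1: "mset_prod J (mset (take i xs)) \<in> carrier J" "mset_prod J (mset y) \<in> carrier J"
    using cy by (simp_all)
  have "f j = f i \<otimes>\<^bsub>G\<^esub> cl (mset_prod J (mset y))"
    unfolding f_def tj using cy cl_mult[OF c1] by simp
  then have cl1: "cl (mset_prod J (mset y)) = \<one>\<^bsub>G\<^esub>"
    using ij(3) fc[of i] cl_closed[OF c1(2)] by simp
  have "mset_prod J (mset y) = \<one> \<or> mset_prod J (mset r) = \<one>"
    by (rule K_atom_factor[OF u sp(3) Z_closed[OF sp(1)] Z_closed[OF sp(2)] cl1])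
  then have "mset y = {#} \<or> mset r = {#}"
    using sp(1,2) Z_of_one[of "mset y"] Z_of_one[of "mset r"] by auto
  moreover have "length y = j - i" "length r = size z - (j - i)" "j - i < size z" "0 < j - i"
    unfolding y_def r_def using ij big xs[symmetric] by auto
  ultimately show False by auto
qed

lemma lengths_meet_finite:
  assumes s1: "\<forall>p\<in>X. s p = 1" and "lengths_meet k l"
  shows "l \<le> k * card (carrier G)"
proof -
  obtain b z z' where z: "z \<in> K.Z b" "z' \<in> K.Z b" "size z = k" "size z' = l"
    using assms(2) unfolding lengths_meet_def by blast
  have "(\<Sum>x\<in>#y. wt (\<lambda>_. 1) x) \<le> size y * card (carrier G)" if "set_mset y \<subseteq> atoms K" for y
    using that
  proof (induction y)
    case (add x y)
    then have "wt (\<lambda>_. 1) x \<le> card (carrier G)" using K_atom_wt_le[OF s1] by simp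
    then show ?case using add by simp
  qed simp
  from this[of z] have "wt (\<lambda>_. 1) b \<le> k * card (carrier G)"
    using z(1,3) wt_mset_prod[OF K_Z_carrier[OF z(1)], of "\<lambda>_. 1"] unfolding K_Z_iff by auto
  then show ?thesis using size_le_wt[OF z(2)] z(4) by simp
qed

lemma lengths_meet_interval:
  assumes s1: "\<forall>p\<in>X. s p = 1"
  obtains a b where "{l. lengths_meet k l} = {a..b}"
proof -
  let ?S = "{l. lengths_meet k l}"
  have fin: "finite ?S"
    by (rule finite_subset[of _ "{..k * card (carrier G)}"]) (use lengths_meet_finite[OF s1] in auto)
  have kS: "k \<in> ?S" using lengths_meet_refl by simp
  have up: "lengths_meet k' m" if kl: "lengths_meet k' l" and "k' \<le> m" "m \<le> l" for k' l m
  proof -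
    obtain b z z' where z: "z \<in> K.Z b" "z' \<in> K.Z b" "size z = k'" "size z' = l"
      using kl unfolding lengths_meet_def by blast
    show ?thesis using lengths_meet_between[OF s1 z(1,2), of m] that(2,3) z(3,4) by simp
  qed
  \<comment> \<open>By symmetry \<open>l\<close> meets \<open>k\<close>; adding \<open>m - l\<close>
    on both sides shows that \<open>m\<close> meets \<open>k + (m - l)\<close>, and
    \<open>up\<close> lowers the latter to \<open>k\<close>, since \<open>m \<le> k\<close>.\<close>
  have down: "lengths_meet k m" if "lengths_meet k l" "l \<le> m" "m \<le> k" for l m
  proof -
    have "lengths_meet (l + (m - l)) (k + (m - l))"
      by (rule lengths_meet_add[OF lengths_meet_sym[OF that(1)] lengths_meet_refl])
    then have "lengths_meet m (k + (m - l))" using that(2) by simp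
    then have "lengths_meet m k" by (rule up) (use that in simp_all)
    then show ?thesis by (rule lengths_meet_sym)
  qed
  have Min: "lengths_meet k (Min ?S)" using Min_in[OF fin] kS by blast
  have Max: "lengths_meet k (Max ?S)" using Max_in[OF fin] kS by blast
  have "?S = {Min ?S..Max ?S}"
  proof (intro subset_antisym subsetI)
    fix m assume "m \<in> ?S"
    then show "m \<in> {Min ?S..Max ?S}" using fin by simp
  next
    fix m assume m: "m \<in> {Min ?S..Max ?S}"
    have "lengths_meet k m"
    proof (cases "k \<le> m")
      case True
      then show ?thesis using up[OF Max] m by simp
    next
      case False
      then show ?thesis using down[OF Min] m by simp
    qed
    then show "m \<in> ?S" by simp
  qed
  then show thesis by (rule that)
qed

end

section \<open>The sequence of classes of an element and chains inside its fibres\<close>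

locale trivial_unit_classes = class_monoid +
  assumes rank_one: "p \<in> X \<Longrightarrow> s p = 1"
    and class_atoms_at: "p \<in> X \<Longrightarrow> x \<in> atoms_at p \<Longrightarrow> cl x = cl (unif p)"
begin

text \<open>The block homomorphism: the sequence of classes of the atoms in any factorization in
  \<open>J\<close>. In rank 1 the value at \<open>p\<close> counts the atoms at \<open>p\<close>,
  and these share one class, so the sequence depends only on the values.\<close>

definition "shape a = (\<Sum>p | p \<in> X \<and> val p 0 a \<noteq> 0. replicate_mset (val p 0 a) (cl (unif p)))"

lemma shape_superset:
  assumes "finite S" "S \<subseteq> X" "{p \<in> X. val p 0 a \<noteq> 0} \<subseteq> S"
  shows "shape a = (\<Sum>p\<in>S. replicate_mset (val p 0 a) (cl (unif p)))"
  unfolding shape_def by (rule sum.mono_neutral_left) (use assms in auto)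

lemma shape_mult:
  assumes "a \<in> carrier J" "b \<in> carrier J"
  shows "shape (a \<otimes> b) = shape a + shape b"
proof -
  let ?S = "{p \<in> X. val p 0 a \<noteq> 0} \<union> {p \<in> X. val p 0 b \<noteq> 0}"
  let ?r = "\<lambda>p n. replicate_mset n (cl (unif p))"
  have v: "val p 0 (a \<otimes> b) = val p 0 a + val p 0 b" if "p \<in> X" for p
    by (rule val_mult[OF that s_pos[OF that] assms])
  have S: "finite ?S" "?S \<subseteq> X" using finite_support[OF assms(1)] finite_support[OF assms(2)] by auto
  have "shape (a \<otimes> b) = (\<Sum>p\<in>?S. ?r p (val p 0 (a \<otimes> b)))"
    by (rule shape_superset[OF S]) (use v in auto)
  also have "\<dots> = (\<Sum>p\<in>?S. ?r p (val p 0 a) + ?r p (val p 0 b))"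
    by (rule sum.cong) (use v in \<open>auto simp: multiset_eq_iff\<close>)
  also have "\<dots> = (\<Sum>p\<in>?S. ?r p (val p 0 a)) + (\<Sum>p\<in>?S. ?r p (val p 0 b))" by (rule sum.distrib)
  also have "(\<Sum>p\<in>?S. ?r p (val p 0 a)) = shape a" by (rule shape_superset[OF S, symmetric]) blast
  also have "(\<Sum>p\<in>?S. ?r p (val p 0 b)) = shape b" by (rule shape_superset[OF S, symmetric]) blast
  finally show ?thesis .
qed

lemma shape_cong: "(\<And>p. p \<in> X \<Longrightarrow> val p 0 a = val p 0 b) \<Longrightarrow> shape a = shape b"
  unfolding shape_def by (rule sum.cong) auto

lemma shape_one: "shape \<one> = {#}"
  using shape_mult[of \<one> \<one>] by simp

lemma ranks: "\<forall>p\<in>X. s p = 1"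
  using rank_one by blast

lemma size_shape: "size (shape a) = wt (\<lambda>_. 1) a"
proof -
  have "size (sum f A) = (\<Sum>a\<in>A. size (f a))" for f :: "'p \<Rightarrow> 'g multiset" and A
    by (induction A rule: infinite_finite_induct) simp_all
  then show ?thesis unfolding shape_def wt_def by simp
qed

lemma shape_atom:
  assumes "x \<in> atoms J"
  shows "shape x = {#cl x#}"
proof -
  obtain p where p: "p \<in> X" "x \<in> atoms_at p" "val p 0 x = 1" by (rule atom_wt[OF ranks assms])
  have "{p \<in> X. val p 0 x \<noteq> 0} \<subseteq> {p}" using p(2) by (auto simp: primary_def)
  then have "shape x = replicate_mset (val p 0 x) (cl (unif p))"
    using shape_superset[of "{p}" x] p(1) by simp
  then show ?thesis using p(3) class_atoms_at[OF p(1,2)] by simp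
qed

lemma shape_mset_prod: "set_mset z \<subseteq> carrier J \<Longrightarrow> shape (mset_prod J z) = (\<Sum>x\<in>#z. shape x)"
  by (induction z) (simp_all add: shape_one shape_mult)

lemma shape_Z:
  assumes "z \<in> Z a"
  shows "shape a = image_mset cl z"
proof -
  have "set_mset y \<subseteq> atoms J \<Longrightarrow> (\<Sum>x\<in>#y. shape x) = image_mset cl y" for y
    by (induction y) (simp_all add: shape_atom)
  then show ?thesis using assms shape_mset_prod[OF Z_carrier[OF assms]] by (simp add: factorizations_def)
qed

lemma shape_carrier:
  assumes "a \<in> carrier J"
  shows "set_mset (shape a) \<subseteq> carrier G"
proof -
  obtain z where z: "z \<in> Z a" using J_Z_exists[OF assms] by blast
  show ?thesis unfolding shape_Z[OF z] using Z_carrier[OF z] cl_closed by auto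
qed

lemma cl_shape:
  assumes "a \<in> carrier J"
  shows "cl a = mset_prod G (shape a)"
proof -
  obtain z where z: "z \<in> Z a" using J_Z_exists[OF assms] by blast
  then have "a = mset_prod J z" by (simp add: factorizations_def)
  then have "cl a = mset_prod G (image_mset cl z)" using cl_mset_prod[OF Z_carrier[OF z]] by simp
  then show ?thesis unfolding shape_Z[OF z] .
qed

lemma shape_empty: "a \<in> carrier J \<Longrightarrow> shape a = {#} \<longleftrightarrow> a = \<one>"
  using size_shape[of a] wt_one_pos[of a] shape_one by (cases "a = \<one>") auto

abbreviation "B \<equiv> zero_sum_sequences G"

lemma B_simps: "S \<in> carrier B \<longleftrightarrow> set_mset S \<subseteq> carrier G \<and> mset_prod G S = \<one>\<^bsub>G\<^esub>"
  "S \<otimes>\<^bsub>B\<^esub> S' = S + S'" "\<one>\<^bsub>B\<^esub> = {#}"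
  by (simp_all add: zero_sum_sequences_def)

sublocale B: reduced_monoid B
proof -
  have cm: "comm_monoid B"
  proof (rule comm_monoidI)
    show "\<one>\<^bsub>B\<^esub> \<in> carrier B" unfolding B_simps by simp
    show "x \<otimes>\<^bsub>B\<^esub> y \<in> carrier B" if "x \<in> carrier B" "y \<in> carrier B" for x y
      using that unfolding B_simps by simp
  qed (simp_all only: B_simps(2,3) ac_simps add_0 add_0_right)
  have cc: "comm_monoid_cancel B"
  proof (rule comm_monoid_cancelI[OF cm])
    fix a b c assume "a \<otimes>\<^bsub>B\<^esub> c = b \<otimes>\<^bsub>B\<^esub> c"
    then show "a = b" unfolding B_simps by simp
  qed
  have "Units B = {\<one>\<^bsub>B\<^esub>}"
  proof (intro subset_antisym subsetI)
    fix a assume "a \<in> Units B"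
    then obtain b where "b \<otimes>\<^bsub>B\<^esub> a = \<one>\<^bsub>B\<^esub>" unfolding Units_def by blast
    then show "a \<in> {\<one>\<^bsub>B\<^esub>}" unfolding B_simps by simp
  next
    fix a assume "a \<in> {\<one>\<^bsub>B\<^esub>}"
    then show "a \<in> Units B" using monoid.Units_one_closed[OF comm_monoid.axioms(1)[OF cm]] by simp
  qed
  with cc show "reduced_monoid B" by (intro reduced_monoid.intro reduced_monoid_axioms.intro)
qed

lemma shape_in_B: "a \<in> carrier J \<Longrightarrow> shape a \<in> carrier B \<longleftrightarrow> cl a = \<one>\<^bsub>G\<^esub>"
  using shape_carrier cl_shape by (simp add: B_simps)

text \<open>Any factorization of \<open>u\<close> in \<open>J\<close> has the classes of
  \<open>b + c\<close> as its image, and its atoms can be distributed accordingly. This is the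
  lifting property of a transfer homomorphism.\<close>

lemma shape_split:
  assumes "u \<in> carrier J" "shape u = b + c"
  obtains v w where "v \<in> carrier J" "w \<in> carrier J" "u = v \<otimes> w" "shape v = b" "shape w = c"
proof -
  obtain z where z: "z \<in> Z u" using J_Z_exists[OF assms(1)] by blast
  have "image_mset cl z = b + c" using shape_Z[OF z] assms(2) by (rule trans[OF sym])
  from image_mset_eq_plusD[OF this] obtain y y' where y: "z = y + y'" "b = image_mset cl y" "c = image_mset cl y'"
    by blast
  have "y + y' \<in> Z u" using z unfolding y(1) .
  note sp = Z_union_split[OF this]
  show thesis
    by (rule that[OF Z_closed[OF sp(1)] Z_closed[OF sp(2)] sp(3)])
      (simp_all only: y(2,3) shape_Z[OF sp(1)] shape_Z[OF sp(2)])
qed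

lemma shape_surj:
  assumes "set_mset S \<subseteq> carrier G"
  obtains a where "a \<in> carrier J" "shape a = S"
proof -
  have "\<exists>a\<in>carrier J. shape a = S" using assms
  proof (induction S)
    case empty
    show ?case using shape_one by blast
  next
    case (add g S)
    then obtain a where a: "a \<in> carrier J" "shape a = S" by auto
    have "g \<in> carrier G" using add.prems by simp
    then obtain c q where c: "free q" "c = unif q" "c \<in> atoms J" "c \<in> carrier J" "cl c = g"
      by (rule class_primeE)
    have "shape (c \<otimes> a) = add_mset g S" using shape_mult[OF c(4) a(1)] shape_atom[OF c(3)] a(2) c(5) by simp
    then show ?case using c(4) a(1) by blast
  qed
  then show thesis using that by blast
qed

lemma shape_atoms_iff:
  assumes u: "u \<in> carrier J"
  shows "u \<in> atoms K \<longleftrightarrow> shape u \<in> atoms B"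
proof
  assume uK: "u \<in> atoms K"
  then have clu: "cl u = \<one>\<^bsub>G\<^esub>" "u \<noteq> \<one>" unfolding K_atoms_iff by blast+
  show "shape u \<in> atoms B"
    unfolding B.atoms_iff
  proof (intro conjI ballI impI)
    show "shape u \<in> carrier B" using shape_in_B[OF u] clu(1) by blast
    show "shape u \<noteq> \<one>\<^bsub>B\<^esub>" unfolding B_simps shape_empty[OF u] by (rule clu(2))
    fix b c assume bc: "b \<in> carrier B" "c \<in> carrier B" "shape u = b \<otimes>\<^bsub>B\<^esub> c"
    obtain v w where vw: "v \<in> carrier J" "w \<in> carrier J" "u = v \<otimes> w" "shape v = b" "shape w = c"
      by (rule shape_split[OF u bc(3)[unfolded B_simps]])
    have "cl v = \<one>\<^bsub>G\<^esub>" using shape_in_B[OF vw(1)] vw(4) bc(1) by blast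
    from K_atom_factor[OF uK vw(3,1,2) this] show "b = \<one>\<^bsub>B\<^esub> \<or> c = \<one>\<^bsub>B\<^esub>"
      unfolding B_simps using vw(4,5) shape_one by auto
  qed
next
  assume uB: "shape u \<in> atoms B"
  have ne: "u \<noteq> \<one>" using B.atom_not_one[OF uB] shape_one unfolding B_simps by auto
  have clu: "cl u = \<one>\<^bsub>G\<^esub>" using shape_in_B[OF u] B.atoms_closed[OF uB] by blast
  show "u \<in> atoms K"
    unfolding K_atoms_iff
  proof (intro conjI ballI impI)
    fix b c assume bc: "b \<in> carrier J" "c \<in> carrier J" "cl b = \<one>\<^bsub>G\<^esub>" "cl c = \<one>\<^bsub>G\<^esub>" "u = b \<otimes> c"
    have "shape u = shape b \<otimes>\<^bsub>B\<^esub> shape c" unfolding bc(5) B_simps by (rule shape_mult[OF bc(1,2)])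
    from B.atom_factor[OF uB this] show "b = \<one> \<or> c = \<one>"
      using shape_in_B[OF bc(1)] shape_in_B[OF bc(2)] bc(3,4) shape_empty[OF bc(1)] shape_empty[OF bc(2)]
      unfolding B_simps(3) by blast
  qed (use u ne clu in simp_all)
qed

lemma mset_prod_B: "set_mset z \<subseteq> carrier B \<Longrightarrow> mset_prod B z = \<Sum>\<^sub># z"
proof (induction z)
  case empty
  then show ?case by (simp add: B_simps)
next
  case (add x z)
  then have "x \<in> carrier B" "set_mset z \<subseteq> carrier B" by auto
  then show ?case using add.IH by (simp add: B_simps(2))
qed

lemma B_Z_iff: "y \<in> B.Z S \<longleftrightarrow> set_mset y \<subseteq> atoms B \<and> \<Sum>\<^sub># y = S"
  unfolding factorizations_def using mset_prod_B[of y] B.atoms_subset by auto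

lemma shape_K_Z:
  assumes "z \<in> K.Z a"
  shows "image_mset shape z \<in> B.Z (shape a)"
  using assms K_Z_carrier[OF assms] shape_mset_prod[OF K_Z_carrier[OF assms]] shape_atoms_iff
  unfolding B_Z_iff K_Z_iff by auto

lemma lift_Z: "a \<in> carrier J \<Longrightarrow> y \<in> B.Z (shape a) \<Longrightarrow> \<exists>z\<in>K.Z a. image_mset shape z = y"
proof (induction y arbitrary: a)
  case empty
  then have "shape a = {#}" unfolding B_Z_iff by simp
  then have "a = \<one>" using shape_empty[OF empty(1)] by blast
  then have "{#} \<in> K.Z a" unfolding K_Z_iff by simp
  then show ?case by (intro bexI[of _ "{#}"]) simp_all
next
  case (add S y)
  have S: "S \<in> atoms B" "set_mset y \<subseteq> atoms B" "shape a = S + \<Sum>\<^sub># y" using add.prems(2) unfolding B_Z_iff by simp_all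
  obtain v w where vw: "v \<in> carrier J" "w \<in> carrier J" "a = v \<otimes> w" "shape v = S" "shape w = \<Sum>\<^sub># y"
    by (rule shape_split[OF add.prems(1) S(3)])
  have "y \<in> B.Z (shape w)" unfolding B_Z_iff vw(5) using S(2) by simp
  from add.IH[OF vw(2) this] obtain z where z: "z \<in> K.Z w" "image_mset shape z = y" by blast
  have "v \<in> atoms K" unfolding shape_atoms_iff[OF vw(1)] vw(4) by (rule S(1))
  then have "add_mset v z \<in> K.Z a" unfolding vw(3) using K_Z_add_mset z(1) by blast
  then show ?case using z(2) vw(4) by (intro bexI[of _ "add_mset v z"]) simp_all
qed

lemma image_K_Z: "a \<in> carrier J \<Longrightarrow> image_mset shape ` K.Z a = B.Z (shape a)"
  using shape_K_Z lift_Z by blast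

definition "fibre a T = {y \<in> K.Z a. image_mset shape y = T}"

text \<open>The move from which all chains inside a fibre are built; it touches two atoms of
  \<open>K\<close> and so costs at most 2.\<close>

lemma fibre_swap:
  assumes F: "add_mset u (add_mset w r) \<in> fibre a T"
    and u': "u' \<in> carrier J" "w' \<in> carrier J" "u' \<otimes> w' = u \<otimes> w" "shape u' = shape u" "shape w' = shape w"
  shows "chain_step True 2 (fibre a T) (add_mset u (add_mset w r)) (add_mset u' (add_mset w' r))"
    "add_mset u' (add_mset w' r) \<in> fibre a T"
proof -
  have Z: "add_mset u (add_mset w r) \<in> K.Z a" using F by (simp add: fibre_def)
  note s1 = K_Z_add_split[OF Z]
  note s2 = K_Z_add_split[OF s1(2)]
  have at: "u' \<in> atoms K" "w' \<in> atoms K"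
    using shape_atoms_iff[OF u'(1)] shape_atoms_iff[OF u'(2)] shape_atoms_iff[OF s1(4)] shape_atoms_iff[OF s2(4)] s1(1) s2(1) u'(4,5)
    by simp_all
  have "a = u \<otimes> w \<otimes> mset_prod J r" using s1(3,4) s2(3,4,5) by (simp add: m_assoc)
  also have "\<dots> = u' \<otimes> (w' \<otimes> mset_prod J r)" unfolding u'(3)[symmetric] by (rule m_assoc[OF u'(1,2) s2(5)])
  finally have a: "a = u' \<otimes> (w' \<otimes> mset_prod J r)" .
  have Z': "add_mset u' (add_mset w' r) \<in> K.Z a"
    unfolding a by (rule K_Z_add_mset[OF at(1) K_Z_add_mset[OF at(2) s2(2)]])
  then show F': "add_mset u' (add_mset w' r) \<in> fibre a T" using F u'(4,5) by (simp add: fibre_def)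
  have "fact_dist (add_mset u (add_mset w r)) (add_mset u' (add_mset w' r)) \<le> 2"
    using fact_dist_le_replace[of "{#u, w#}" r "{#u', w'#}"] by simp
  then show "chain_step True 2 (fibre a T) (add_mset u (add_mset w r)) (add_mset u' (add_mset w' r))"
    unfolding chain_step_def using F F' by (simp add: numeral_eq_enat)
qed

lemma shape_count:
  assumes "finite S" "S \<subseteq> X" "{p \<in> X. val p 0 a \<noteq> 0} \<subseteq> S"
  shows "count (shape a) g = (\<Sum>p\<in>{p \<in> S. cl (unif p) = g}. val p 0 a)"
proof -
  have "count (shape a) g = (\<Sum>p\<in>S. if cl (unif p) = g then val p 0 a else 0)"
    unfolding shape_superset[OF assms] count_sum by (rule sum.cong) auto
  also have "\<dots> = (\<Sum>p\<in>{p \<in> S. cl (unif p) = g}. val p 0 a)"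
    using assms(1) by (simp add: sum.inter_filter)
  finally show ?thesis .
qed

text \<open>A shape records values summed over all \<open>p\<close> with the same class, so a
  deficit at \<open>p\<close> is compensated by an excess at some \<open>q\<close> of the same
  class.\<close>

lemma shape_excess:
  assumes u: "u \<in> carrier J" "v \<in> carrier J" "shape u = shape v" and p: "p \<in> X" "val p 0 u < val p 0 v"
  obtains q where "q \<in> X" "cl (unif q) = cl (unif p)" "val q 0 v < val q 0 u"
proof -
  let ?S = "{p \<in> X. val p 0 u \<noteq> 0} \<union> {p \<in> X. val p 0 v \<noteq> 0}"
  have S: "finite ?S" "?S \<subseteq> X" using finite_support u by auto
  let ?T = "{q \<in> ?S. cl (unif q) = cl (unif p)}"
  have eq: "(\<Sum>q\<in>?T. val q 0 u) = (\<Sum>q\<in>?T. val q 0 v)"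
    using shape_count[OF S, of u "cl (unif p)"] shape_count[OF S, of v "cl (unif p)"] u(3) by auto
  have pT: "p \<in> ?T" using p by simp
  have "\<exists>q\<in>?T. val q 0 v < val q 0 u"
  proof (rule ccontr)
    assume "\<not> ?thesis"
    then have "\<forall>q\<in>?T. val q 0 u \<le> val q 0 v" using not_less by blast
    moreover have "finite ?T" using S(1) by simp
    ultimately have "(\<Sum>q\<in>?T. val q 0 u) < (\<Sum>q\<in>?T. val q 0 v)"
      using pT p(2) by (intro sum_strict_mono_ex1) auto
    then show False using eq by simp
  qed
  then show thesis using that S(2) by blast
qed

text \<open>First align the valuations of \<open>u\<close> with those of \<open>v\<close>, swapping atoms of the same class.\<close>
lemma fibre_align_val:
  assumes v: "add_mset v z' \<in> K.Z a"
  shows "add_mset u z0 \<in> fibre a T \<Longrightarrow> shape u = shape v \<Longrightarrow>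
    \<exists>u' z0'. (chain_step True 2 (fibre a T))\<^sup>*\<^sup>* (add_mset u z0) (add_mset u' z0') \<and>
      add_mset u' z0' \<in> fibre a T \<and> shape u' = shape v \<and> (\<forall>p\<in>X. val p 0 u' = val p 0 v)"
proof (induction "\<Sum>p | p \<in> X \<and> val p 0 v \<noteq> 0. val p 0 v - val p 0 u" arbitrary: u z0 rule: less_induct)
  case less
  note v' = K_Z_add_split[OF v]
  have Zu: "add_mset u z0 \<in> K.Z a" using less.prems(1) by (simp add: fibre_def)
  note u' = K_Z_add_split[OF Zu]
  show ?case
  proof (cases "\<exists>p\<in>X. val p 0 u < val p 0 v")
    case False
    have "val p 0 u = val p 0 v" if "p \<in> X" for p
    proof (rule ccontr)
      assume "val p 0 u \<noteq> val p 0 v"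
      then have "val p 0 v < val p 0 u" using False that by force
      then show False using shape_excess[OF v'(4) u'(4) less.prems(2)[symmetric] that] False by metis
    qed
    then show ?thesis using less.prems by blast
  next
    case True
    then obtain p where p: "p \<in> X" "val p 0 u < val p 0 v" by blast
    obtain q where q: "q \<in> X" "cl (unif q) = cl (unif p)" "val q 0 v < val q 0 u"
      by (rule shape_excess[OF u'(4) v'(4) less.prems(2) p])
    have pq: "p \<noteq> q" using p q by auto
    note vm = val_mult[OF p(1) s_pos[OF p(1)]]
    \<comment> \<open>Both sides are the value of \<open>a\<close> at \<open>p\<close>. The value
      that \<open>u\<close> lacks there must sit in another atom \<open>w\<close> of its
      factorization, and an atom of \<open>J\<close> at \<open>p\<close> taken from \<open>w\<close>
      is traded for one at \<open>q\<close> taken from \<open>u\<close>.\<close>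
    have "val p 0 u + val p 0 (mset_prod J z0) = val p 0 v + val p 0 (mset_prod J z')"
      using vm[OF u'(4,5)] vm[OF v'(4,5)] u'(3) v'(3) by simp
    then have "0 < val p 0 (mset_prod J z0)" using p(2) by simp
    then obtain w r where w: "z0 = add_mset w r" "0 < val p 0 w"
      by (rule val_mset_prod_pos[OF p(1) K_Z_carrier[OF u'(2)]])
    have wc: "w \<in> carrier J" using K_Z_carrier[OF u'(2)] w(1) by simp
    obtain x w1 where x: "x \<in> atoms_at p" "w1 \<in> carrier J" "w = x \<otimes> w1"
      by (rule atom_divides_if_val[OF p(1) rank_one[OF p(1)] wc w(2)])
    have "0 < val q 0 u" using q(3) by simp
    then obtain y u1 where y: "y \<in> atoms_at q" "u1 \<in> carrier J" "u = y \<otimes> u1"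
      by (rule atom_divides_if_val[OF q(1) rank_one[OF q(1)] u'(4)])
    have xy: "x \<in> carrier J" "y \<in> carrier J" "x \<in> atoms J" "y \<in> atoms J" using x(1) y(1) atoms_closed by blast+
    have "shape x = shape y"
      using shape_atom[OF xy(3)] shape_atom[OF xy(4)] class_atoms_at[OF p(1) x(1)] class_atoms_at[OF q(1) y(1)] q(2) by simp
    then have ty: "shape (x \<otimes> u1) = shape u" "shape (y \<otimes> w1) = shape w"
      unfolding x(3) y(3) using shape_mult xy(1,2) x(2) y(2) by simp_all
    have eq: "(x \<otimes> u1) \<otimes> (y \<otimes> w1) = u \<otimes> w" unfolding x(3) y(3) using xy x(2) y(2) by (simp add: m_ac)
    have F: "add_mset u (add_mset w r) \<in> fibre a T" using less.prems(1) unfolding w(1) .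
    note sw = fibre_swap[OF F m_closed[OF xy(1) y(2)] m_closed[OF xy(2) x(2)] eq ty]
    have vx: "val r 0 x = (if r = p then 1 else 0)" "val r 0 y = (if r = q then 1 else 0)" if "r \<in> X" for r
    proof -
      have one: "val r 0 t = 1" if t: "t \<in> atoms_at r" and r: "r \<in> X" for t r
      proof -
        obtain i where "i < s r" "val r i t = 1" by (rule atom_val[OF r t])
        then show ?thesis using rank_one[OF r] by simp
      qed
      show "val r 0 x = (if r = p then 1 else 0)" using one[OF x(1) p(1)] x(1) that by (auto simp: primary_def)
      show "val r 0 y = (if r = q then 1 else 0)" using one[OF y(1) q(1)] y(1) that by (auto simp: primary_def)
    qed
    have val_new: "val r 0 (x \<otimes> u1) = (if r = p then 1 else 0) + val r 0 u1"
      and val_old: "val r 0 u = (if r = q then 1 else 0) + val r 0 u1" if "r \<in> X" for r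
      using val_mult[OF that s_pos[OF that] xy(1) y(2)] val_mult[OF that s_pos[OF that] xy(2) y(2)] vx[OF that] y(3)
      by simp_all
    let ?S = "{p \<in> X. val p 0 v \<noteq> 0}"
    have fin: "finite ?S" by (rule finite_support[OF v'(4)])
    have "(\<Sum>r\<in>?S. val r 0 v - val r 0 (x \<otimes> u1)) < (\<Sum>r\<in>?S. val r 0 v - val r 0 u)"
    proof (rule sum_strict_mono_ex1[OF fin])
      show "\<forall>r\<in>?S. val r 0 v - val r 0 (x \<otimes> u1) \<le> val r 0 v - val r 0 u"
      proof
        fix r assume "r \<in> ?S"
        then show "val r 0 v - val r 0 (x \<otimes> u1) \<le> val r 0 v - val r 0 u"
          using val_new[of r] val_old[of r] q(3) by (cases "r = q") auto
      qed
      show "\<exists>r\<in>?S. val r 0 v - val r 0 (x \<otimes> u1) < val r 0 v - val r 0 u"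
        by (rule bexI[of _ p]) (use val_new[OF p(1)] val_old[OF p(1)] p pq in auto)
    qed
    from less.hyps[OF this sw(2)] ty(1) less.prems(2)
    obtain u2 z2 where "(chain_step True 2 (fibre a T))\<^sup>*\<^sup>* (add_mset (x \<otimes> u1) (add_mset (y \<otimes> w1) r)) (add_mset u2 z2)"
      "add_mset u2 z2 \<in> fibre a T" "shape u2 = shape v" "\<forall>p\<in>X. val p 0 u2 = val p 0 v"
      by auto
    then show ?thesis using sw(1) unfolding w(1) by (meson converse_rtranclp_into_rtranclp)
  qed
qed

text \<open>Then align the components one by one; \<open>c\<close> is the part that is already aligned.\<close>
lemma fibre_align_unit:
  assumes v: "add_mset (c \<otimes> v1) z' \<in> K.Z a"
  shows "add_mset (c \<otimes> u1) z0 \<in> fibre a T \<Longrightarrow> c \<in> carrier J \<Longrightarrow> u1 \<in> carrier J \<Longrightarrow> v1 \<in> carrier J \<Longrightarrow>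
    \<forall>p\<in>X. val p 0 u1 = val p 0 v1 \<Longrightarrow>
    \<exists>z0'. (chain_step True 2 (fibre a T))\<^sup>*\<^sup>* (add_mset (c \<otimes> u1) z0) (add_mset (c \<otimes> v1) z0') \<and>
      add_mset (c \<otimes> v1) z0' \<in> fibre a T"
  using v
proof (induction "wt (\<lambda>_. 1) u1" arbitrary: c u1 v1 z0 rule: less_induct)
  case less
  note prem = less.prems
  have Zu: "add_mset (c \<otimes> u1) z0 \<in> K.Z a" using prem(1) by (simp add: fibre_def)
  note u' = K_Z_add_split[OF Zu] and v' = K_Z_add_split[OF prem(6)]
  show ?case
  proof (cases "u1 = \<one>")
    case True
    then have "v1 = \<one>" using prem(5) val_one s_pos by (intro support_empty[OF prem(4)]) simp
    then show ?thesis using True prem(1) by blast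
  next
    case False
    then obtain p where p: "p \<in> X" "val p 0 u1 \<noteq> 0" using support_empty[OF prem(3)] by blast
    note vm = val_mult[OF p(1) s_pos[OF p(1)]]
    obtain e f where ef: "e \<in> primary p" "f \<in> carrier J" "u1 = e \<otimes> f" "val p 0 f = 0"
      by (rule primary_component[OF prem(3) p(1)])
    obtain e' f' where ef': "e' \<in> primary p" "f' \<in> carrier J" "v1 = e' \<otimes> f'" "val p 0 f' = 0"
      by (rule primary_component[OF prem(4) p(1)])
    have ec: "e \<in> carrier J" "e' \<in> carrier J" using ef ef' primary_closed by blast+
    have ve: "val p 0 e = val p 0 u1" "val p 0 e' = val p 0 u1"
      using vm[OF ec(1) ef(2)] vm[OF ec(2) ef'(2)] ef(3,4) ef'(3,4) prem(5) p(1) by simp_all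
    have vee: "val r 0 e = val r 0 e'" if "r \<in> X" for r
      using ve ef(1) ef'(1) that by (cases "r = p") (auto simp: primary_def)
    then have te: "shape e = shape e'" by (rule shape_cong)
    have vff: "\<forall>r\<in>X. val r 0 f = val r 0 f'"
    proof
      fix r assume r: "r \<in> X"
      show "val r 0 f = val r 0 f'"
        using val_mult[OF r s_pos[OF r] ec(1) ef(2)] val_mult[OF r s_pos[OF r] ec(2) ef'(2)] vee[OF r] prem(5) r ef(3) ef'(3)
        by simp
    qed
    have "wt (\<lambda>_. 1) u1 = wt (\<lambda>_. 1) e + wt (\<lambda>_. 1) f" unfolding ef(3) by (rule wt_mult[OF ec(1) ef(2)])
    moreover have "wt (\<lambda>_. 1) e = val p 0 e" using wt_primary[OF p(1) ef(1), of "\<lambda>_. 1"] by simp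
    ultimately have lt: "wt (\<lambda>_. 1) f < wt (\<lambda>_. 1) u1" using ve(1) p(2) by simp
    have cv: "c \<otimes> v1 = (c \<otimes> e') \<otimes> f'" unfolding ef'(3) using prem(2) ec(2) ef'(2) by (simp add: m_assoc)
    have V: "add_mset ((c \<otimes> e') \<otimes> f') z' \<in> K.Z a" using prem(6) unfolding cv .
    have ce: "c \<otimes> e' \<in> carrier J" using prem(2) ec(2) by simp
    have "\<exists>z1. (chain_step True 2 (fibre a T))\<^sup>*\<^sup>* (add_mset (c \<otimes> u1) z0) (add_mset ((c \<otimes> e') \<otimes> f) z1) \<and>
        add_mset ((c \<otimes> e') \<otimes> f) z1 \<in> fibre a T"
    \<comment> \<open>If another atom of the factorization has a nontrivial component
      \<open>h\<close> at \<open>p\<close>, then \<open>e \<otimes> h\<close> has larger value than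
      \<open>e'\<close> and is divisible by it, so \<open>h\<close> absorbs the discrepancy by a
      unit. Otherwise neither rest has value at \<open>p\<close>, and after cancelling
      \<open>c\<close> uniqueness of components gives \<open>e = e'\<close>.\<close>
    proof (cases "0 < val p 0 (mset_prod J z0)")
      case True
      then obtain w r where w: "z0 = add_mset w r" "0 < val p 0 w"
        by (rule val_mset_prod_pos[OF p(1) K_Z_carrier[OF u'(2)]])
      have wc: "w \<in> carrier J" using K_Z_carrier[OF u'(2)] w(1) by simp
      obtain h k where hk: "h \<in> primary p" "k \<in> carrier J" "w = h \<otimes> k" "val p 0 k = 0"
        by (rule primary_component[OF wc p(1)])
      have hc: "h \<in> carrier J" by (rule primary_closed[OF hk(1)])
      have "0 < val p 0 h" using vm[OF hc hk(2)] w(2) hk(3,4) by simp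
      then have "\<forall>i<s p. val p i e' < val p i (e \<otimes> h)" using vm[OF ec(1) hc] ve rank_one[OF p(1)] by simp
      then obtain h' where h': "h' \<in> carrier J" "e \<otimes> h = e' \<otimes> h'"
        using primary_divides[OF p(1) ef'(1) m_closed[OF ec(1) hc]] by blast
      have "shape e + shape h = shape e' + shape h'"
        using arg_cong[OF h'(2), of shape] shape_mult[OF ec(1) hc] shape_mult[OF ec(2) h'(1)] by simp
      then have th: "shape h' = shape h" using te by simp
      have t1: "shape ((c \<otimes> e') \<otimes> f) = shape (c \<otimes> u1)" and t2: "shape (h' \<otimes> k) = shape w"
        unfolding ef(3) hk(3) using prem(2) ec ef(2) te th h'(1) hc hk(2) by (simp_all add: shape_mult)
      have "(c \<otimes> e') \<otimes> f \<otimes> (h' \<otimes> k) = c \<otimes> (f \<otimes> (k \<otimes> (e' \<otimes> h')))"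
        using prem(2) ec ef(2) h'(1) hk(2) by (simp add: m_ac)
      also have "\<dots> = (c \<otimes> u1) \<otimes> w"
        unfolding h'(2)[symmetric] ef(3) hk(3) using prem(2) ec ef(2) hc hk(2) by (simp add: m_ac)
      finally have eq: "(c \<otimes> e') \<otimes> f \<otimes> (h' \<otimes> k) = (c \<otimes> u1) \<otimes> w" .
      have F: "add_mset (c \<otimes> u1) (add_mset w r) \<in> fibre a T" using prem(1) unfolding w(1) .
      note sw = fibre_swap[OF F m_closed[OF ce ef(2)] m_closed[OF h'(1) hk(2)] eq t1 t2]
      show ?thesis unfolding w(1) using r_into_rtranclp[of "chain_step True 2 (fibre a T)", OF sw(1)] sw(2) by blast
    next
      case no: False
      then have z0: "val p 0 (mset_prod J z0) = 0" by simp
      have "val p 0 (c \<otimes> u1) + val p 0 (mset_prod J z0) = val p 0 (c \<otimes> v1) + val p 0 (mset_prod J z')"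
        using vm[OF u'(4,5)] vm[OF v'(4,5)] u'(3) v'(3) by simp
      then have z'0: "val p 0 (mset_prod J z') = 0"
        using vm[OF prem(2,3)] vm[OF prem(2,4)] prem(5) p(1) z0 by simp
      have "c \<otimes> (e \<otimes> (f \<otimes> mset_prod J z0)) = c \<otimes> (e' \<otimes> (f' \<otimes> mset_prod J z'))"
        using u'(3) v'(3) prem(2) ec ef(2) ef'(2) u'(5) v'(5) unfolding ef(3) ef'(3) by (simp add: m_assoc)
      then have eq: "e \<otimes> (f \<otimes> mset_prod J z0) = e' \<otimes> (f' \<otimes> mset_prod J z')"
        using l_cancel[of c "e \<otimes> (f \<otimes> mset_prod J z0)" "e' \<otimes> (f' \<otimes> mset_prod J z')"] prem(2) ec ef(2) ef'(2) u'(5) v'(5) by simp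
      have "val p 0 (f \<otimes> mset_prod J z0) = 0" "val p 0 (f' \<otimes> mset_prod J z') = 0"
        using vm[OF ef(2) u'(5)] vm[OF ef'(2) v'(5)] ef(4) ef'(4) z0 z'0 by simp_all
      then have "e = e'"
        by (rule primary_component_unique[OF p(1) ef(1) ef'(1) m_closed[OF ef(2) u'(5)] m_closed[OF ef'(2) v'(5)] _ _ eq])
      then have "c \<otimes> u1 = (c \<otimes> e') \<otimes> f" unfolding ef(3) using prem(2) ec ef(2) by (simp add: m_assoc)
      then show ?thesis using prem(1) by auto
    qed
    then obtain z1 where z1: "(chain_step True 2 (fibre a T))\<^sup>*\<^sup>* (add_mset (c \<otimes> u1) z0) (add_mset ((c \<otimes> e') \<otimes> f) z1)"
      "add_mset ((c \<otimes> e') \<otimes> f) z1 \<in> fibre a T" by blast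
    obtain z2 where z2: "(chain_step True 2 (fibre a T))\<^sup>*\<^sup>* (add_mset ((c \<otimes> e') \<otimes> f) z1) (add_mset ((c \<otimes> e') \<otimes> f') z2)"
      "add_mset ((c \<otimes> e') \<otimes> f') z2 \<in> fibre a T"
      using less.hyps[OF lt z1(2) ce ef(2) ef'(2) vff V] by blast
    show ?thesis unfolding cv using rtranclp_trans[OF z1(1) z2(1)] z2(2) by blast
  qed
qed

lemma fibre_add_atom:
  assumes "(chain_step True 2 (fibre b T))\<^sup>*\<^sup>* w w'" "v \<in> atoms K"
  shows "(chain_step True 2 (fibre (v \<otimes> b) (add_mset (shape v) T)))\<^sup>*\<^sup>* (add_mset v w) (add_mset v w')"
  using assms(1)
proof (induction rule: rtranclp_induct)
  case (step x y)
  then have "x \<in> K.Z b" "y \<in> K.Z b" "image_mset shape x = T" "image_mset shape y = T"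
    by (simp_all add: chain_step_def fibre_def)
  then have "add_mset v x \<in> fibre (v \<otimes> b) (add_mset (shape v) T)" "add_mset v y \<in> fibre (v \<otimes> b) (add_mset (shape v) T)"
    using K_Z_add_mset[OF assms(2)] by (simp_all add: fibre_def)
  then have "chain_step True 2 (fibre (v \<otimes> b) (add_mset (shape v) T)) (add_mset v x) (add_mset v y)"
    using step(2) fact_dist_union[of "{#v#}" x y] by (simp add: chain_step_def)
  with step.IH show ?case by (rule rtranclp.rtrancl_into_rtrancl)
qed simp

text \<open>One atom \<open>v\<close> of the target is produced exactly, first in its values and
  then in its components, and is cancelled. Members of a fibre have equal lengths, so the chain is
  monotone and serves both catenary degrees.\<close>

lemma fibre_connected:
  "z \<in> fibre a T \<Longrightarrow> z' \<in> fibre a T \<Longrightarrow> (chain_step True 2 (fibre a T))\<^sup>*\<^sup>* z z'"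
proof (induction z' arbitrary: z a T)
  case empty
  then have "image_mset shape z = {#}" by (simp add: fibre_def)
  then show ?case by simp
next
  case (add v z')
  have Zv: "add_mset v z' \<in> K.Z a" and T: "T = add_mset (shape v) (image_mset shape z')"
    using add.prems(2) by (auto simp: fibre_def)
  note v' = K_Z_add_split[OF Zv]
  have im: "image_mset shape z = add_mset (shape v) (image_mset shape z')" using add.prems(1) T by (simp add: fibre_def)
  then obtain u where u: "u \<in># z" "shape u = shape v" by (metis image_iff set_image_mset union_single_eq_member)
  obtain z0 where z0: "z = add_mset u z0" using multi_member_split[OF u(1)] by blast
  have F: "add_mset u z0 \<in> fibre a T" using add.prems(1) unfolding z0 .
  obtain u2 z2 where s1: "(chain_step True 2 (fibre a T))\<^sup>*\<^sup>* (add_mset u z0) (add_mset u2 z2)"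
    "add_mset u2 z2 \<in> fibre a T" "shape u2 = shape v" "\<forall>p\<in>X. val p 0 u2 = val p 0 v"
    using fibre_align_val[OF Zv F u(2)] by blast
  have "add_mset u2 z2 \<in> K.Z a" using s1(2) by (simp add: fibre_def)
  then have u2c: "u2 \<in> carrier J" by (rule K_Z_add_split)
  have one: "\<one> \<otimes> u2 = u2" "\<one> \<otimes> v = v" using u2c v'(4) by simp_all
  have "\<exists>z0'. (chain_step True 2 (fibre a T))\<^sup>*\<^sup>* (add_mset (\<one> \<otimes> u2) z2) (add_mset (\<one> \<otimes> v) z0') \<and>
      add_mset (\<one> \<otimes> v) z0' \<in> fibre a T"
    by (rule fibre_align_unit) (use one Zv s1(2,4) u2c v'(4) in simp_all)
  then obtain z3 where s2: "(chain_step True 2 (fibre a T))\<^sup>*\<^sup>* (add_mset u2 z2) (add_mset v z3)" "add_mset v z3 \<in> fibre a T"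
    unfolding one by blast
  have Z3: "add_mset v z3 \<in> K.Z a" using s2(2) by (simp add: fibre_def)
  note v3 = K_Z_add_split[OF Z3]
  have "v \<otimes> mset_prod J z3 = v \<otimes> mset_prod J z'" using v3(3) v'(3) by simp
  then have eq: "mset_prod J z3 = mset_prod J z'" using l_cancel[of v "mset_prod J z3" "mset_prod J z'"] v3(5) v'(4,5) by simp
  have "image_mset shape z3 = image_mset shape z'" using s2(2) T by (simp add: fibre_def)
  then have "z3 \<in> fibre (mset_prod J z') (image_mset shape z')" "z' \<in> fibre (mset_prod J z') (image_mset shape z')"
    using v3(2) v'(2) eq by (simp_all add: fibre_def)
  from add.IH[OF this] have "(chain_step True 2 (fibre (mset_prod J z') (image_mset shape z')))\<^sup>*\<^sup>* z3 z'" .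
  from fibre_add_atom[OF this v'(1)] have "(chain_step True 2 (fibre a T))\<^sup>*\<^sup>* (add_mset v z3) (add_mset v z')"
    unfolding T v'(3)[symmetric] .
  with s1(1) s2(1) show ?case unfolding z0 by (meson rtranclp_trans)
qed

end

section \<open>Transfer to zero-sum sequences\<close>

lemma atomic_monoidI:
  fixes f :: "'a \<Rightarrow> nat"
  assumes M: "comm_monoid_cancel M"
    and add: "\<And>a b. a \<in> carrier M \<Longrightarrow> b \<in> carrier M \<Longrightarrow> f (a \<otimes>\<^bsub>M\<^esub> b) = f a + f b"
    and unit: "\<And>a. a \<in> carrier M \<Longrightarrow> f a = 0 \<Longrightarrow> a \<in> Units M"
  shows "atomic_monoid M"
proof -
  interpret comm_monoid_cancel M by (rule M)
  have "\<exists>as. set as \<subseteq> carrier M \<and> factors M as a" if "a \<in> carrier M" "a \<notin> Units M" for a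
    using that
  proof (induction "f a" arbitrary: a rule: less_induct)
    case less
    show ?case
    proof (cases "irreducible M a")
      case True
      then have "factors M [a] a" using less.prems(1) unfolding factors_def by simp
      then show ?thesis using less.prems(1) by (intro exI[of _ "[a]"]) simp
    next
      case False
      then obtain b where b: "b \<in> carrier M" "properfactor M b a" "b \<notin> Units M"
        using less.prems(2) unfolding irreducible_def by blast
      then obtain c where c: "c \<in> carrier M" "a = b \<otimes>\<^bsub>M\<^esub> c" and nd: "\<not> a divides\<^bsub>M\<^esub> b"
        unfolding properfactor_def factor_def by blast
      have cu: "c \<notin> Units M"
      proof
        assume cU: "c \<in> Units M"
        have "b = a \<otimes>\<^bsub>M\<^esub> inv\<^bsub>M\<^esub> c" unfolding c(2) using b(1) c(1) cU by (simp add: m_assoc)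
        then show False using nd Units_inv_closed[OF cU] by (auto simp: factor_def)
      qed
      have "f b \<noteq> 0" "f c \<noteq> 0" using unit[OF b(1)] unit[OF c(1)] b(3) cu by blast+
      then have lt: "f b < f a" "f c < f a" unfolding c(2) using add[OF b(1) c(1)] by simp_all
      obtain bs where bs: "set bs \<subseteq> carrier M" "factors M bs b" using less.hyps[OF lt(1) b(1,3)] by blast
      obtain cs where cs: "set cs \<subseteq> carrier M" "factors M cs c" using less.hyps[OF lt(2) c(1) cu] by blast
      have "factors M (bs @ cs) a" unfolding c(2) by (rule factors_mult[OF bs(2) cs(2) bs(1) cs(1)])
      then show ?thesis using bs(1) cs(1) by (intro exI[of _ "bs @ cs"]) simp
    qed
  qed
  then show ?thesis unfolding atomic_monoid_def using M by blast
qed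

lemma (in monoid_reduction) phi_eq_one_iff: "a \<in> carrier M \<Longrightarrow> \<phi> a = \<one>\<^bsub>N\<^esub> \<longleftrightarrow> a \<in> Units M"
proof -
  assume a: "a \<in> carrier M"
  have "\<phi> \<one>\<^bsub>M\<^esub> = \<phi> a \<longleftrightarrow> (\<exists>u\<in>Units M. a = \<one>\<^bsub>M\<^esub> \<otimes>\<^bsub>M\<^esub> u)" by (rule eq_iff[OF M.one_closed a])
  also have "\<dots> \<longleftrightarrow> a \<in> Units M" using M.Units_closed by auto
  finally show ?thesis unfolding phi_one by (simp only: eq_commute)
qed

lemma (in class_monoid) unions_of_lengths_reduction:
  assumes "monoid_reduction M K \<phi>"
  shows "unions_of_lengths M k = {l. lengths_meet k l}"
proof -
  interpret R: monoid_reduction M K \<phi> by (rule assms)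
  obtain c q where c: "free q" "c = unif q" "c \<in> atoms J" "c \<in> carrier J" "cl c = \<one>\<^bsub>G\<^esub>"
    by (rule class_primeE[OF G.one_closed])
  have "c \<in> carrier K" "c \<noteq> \<one>\<^bsub>K\<^esub>" using c(4,5) atom_not_one[OF c(3)] by simp_all
  then have "carrier K \<noteq> {\<one>\<^bsub>K\<^esub>}" by blast
  from R.unions_of_lengths_iff[OF this] show ?thesis unfolding lengths_meet_def by blast
qed

lemma fact_dist_image_le: "fact_dist (image_mset f z) (image_mset f z') \<le> fact_dist z z'"
proof -
  define e g where "e = z - z'" and "g = z' - z"
  have z: "z = z \<inter># z' + e" "z' = z \<inter># z' + g"
    by (auto simp: e_def g_def multiset_eq_iff)
  have "e \<inter># g = {#}" by (auto simp: e_def g_def multiset_eq_iff)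
  then have "fact_dist e g = max (size e) (size g)" by (rule fact_dist_disjoint)
  moreover have "fact_dist (image_mset f e) (image_mset f g) \<le> max (size e) (size g)"
    using fact_dist_le[of "image_mset f e" "image_mset f g"] by simp
  moreover have "fact_dist (image_mset f z) (image_mset f z') = fact_dist (image_mset f e) (image_mset f g)"
    using arg_cong[OF z(1), of "image_mset f"] arg_cong[OF z(2), of "image_mset f"]
      fact_dist_union[of "image_mset f (z \<inter># z')" "image_mset f e" "image_mset f g"] by simp
  moreover have "fact_dist z z' = fact_dist e g" using z fact_dist_union[of "z \<inter># z'" e g] by simp
  ultimately show ?thesis by simp
qed

lemma image_mset_singleton_eq_iff: "image_mset (\<lambda>S. {S}) u = image_mset (\<lambda>S. {S}) v \<longleftrightarrow> u = v"
proof
  assume "image_mset (\<lambda>S. {S}) u = image_mset (\<lambda>S. {S}) v"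
  then have "image_mset the_elem (image_mset (\<lambda>S. {S}) u) = image_mset the_elem (image_mset (\<lambda>S. {S}) v)" by simp
  then show "u = v" by (simp add: multiset.map_comp comp_def)
qed simp

section \<open>Lengths and catenary degrees along the transfer homomorphism\<close>

context trivial_unit_classes
begin

lemma shape_image_K: "shape ` carrier K = carrier B"
proof (intro subset_antisym subsetI)
  fix S assume "S \<in> shape ` carrier K"
  then obtain a where "a \<in> carrier J" "cl a = \<one>\<^bsub>G\<^esub>" "S = shape a" by auto
  then show "S \<in> carrier B" using shape_in_B by blast
next
  fix S assume S: "S \<in> carrier B"
  then have "set_mset S \<subseteq> carrier G" unfolding B_simps by blast
  then obtain a where a: "a \<in> carrier J" "shape a = S" by (rule shape_surj)
  then have "a \<in> carrier K" using shape_in_B[OF a(1)] S by simp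
  then show "S \<in> shape ` carrier K" using a(2) by blast
qed

lemma transfer_hom_shape:
  assumes "monoid_reduction M K \<phi>"
  shows "transfer_hom M B (\<lambda>a. shape (\<phi> a))"
proof -
  interpret R: monoid_reduction M K \<phi> by (rule assms)
  have phi: "\<phi> a \<in> carrier J" "cl (\<phi> a) = \<one>\<^bsub>G\<^esub>" if "a \<in> carrier M" for a
    using R.phi_closed[OF that] by simp_all
  have mult: "\<phi> (a \<otimes>\<^bsub>M\<^esub> b) = \<phi> a \<otimes> \<phi> b" if "a \<in> carrier M" "b \<in> carrier M" for a b
    using R.phi_mult[OF that] by simp
  have unit: "a \<in> Units M" if "a \<in> carrier M" "\<phi> a = \<one>" for a
    using R.phi_eq_one_iff[OF that(1)] that(2) by simp
  have UB: "Units B = {{#}}" using B.Units_eq unfolding B_simps .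
  have cosetB: "b <#\<^bsub>B\<^esub> Units B = {b}" for b unfolding UB l_coset_def B_simps by simp
  have setB: "S <#>\<^bsub>B\<^esub> Units B = S" for S unfolding UB set_mult_def B_simps by simp
  have emptyU: "shape (\<phi> a) = {#} \<longleftrightarrow> a \<in> Units M" if "a \<in> carrier M" for a
    using shape_empty[OF phi(1)[OF that]] R.phi_eq_one_iff[OF that] by simp
  have "atomic_monoid M"
    by (rule atomic_monoidI[OF R.M.comm_monoid_cancel_axioms, of "\<lambda>a. wt (\<lambda>_. 1) (\<phi> a)"])
      (use mult phi wt_mult wt_eq_zero[of _ "\<lambda>_. 1"] unit in simp_all)
  moreover have "atomic_monoid B"
  proof (rule atomic_monoidI[OF B.comm_monoid_cancel_axioms, of size])
    show "a \<in> Units B" if "size a = 0" for a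
      using that unfolding UB by simp
  qed (simp add: B_simps)
  moreover have "(\<lambda>a. shape (\<phi> a)) \<in> hom M B"
  proof (rule homI)
    fix a assume "a \<in> carrier M"
    then show "shape (\<phi> a) \<in> carrier B" using shape_in_B phi by blast
  next
    fix a b assume "a \<in> carrier M" "b \<in> carrier M"
    then show "shape (\<phi> (a \<otimes>\<^bsub>M\<^esub> b)) = shape (\<phi> a) \<otimes>\<^bsub>B\<^esub> shape (\<phi> b)"
      unfolding B_simps using mult shape_mult phi by simp
  qed
  moreover have "carrier B = (\<lambda>a. shape (\<phi> a)) ` carrier M <#>\<^bsub>B\<^esub> Units B"
    unfolding setB shape_image_K[symmetric] R.surj[symmetric] image_image ..
  moreover have "{u \<in> carrier M. shape (\<phi> u) \<in> Units B} = Units M"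
    unfolding UB using emptyU R.M.Units_closed by auto
  moreover have "\<exists>v\<in>carrier M. \<exists>w\<in>carrier M. u = v \<otimes>\<^bsub>M\<^esub> w \<and>
      shape (\<phi> v) \<in> b <#\<^bsub>B\<^esub> Units B \<and> shape (\<phi> w) \<in> c <#\<^bsub>B\<^esub> Units B"
    if u: "u \<in> carrier M" and bc: "b \<in> carrier B" "c \<in> carrier B" "shape (\<phi> u) = b \<otimes>\<^bsub>B\<^esub> c" for u b c
  proof -
    obtain v w where vw: "v \<in> carrier J" "w \<in> carrier J" "\<phi> u = v \<otimes> w" "shape v = b" "shape w = c"
      by (rule shape_split[OF phi(1)[OF u] bc(3)[unfolded B_simps]])
    have "v \<in> carrier K" "w \<in> carrier K" using shape_in_B[OF vw(1)] shape_in_B[OF vw(2)] vw bc by simp_all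
    then have "v \<in> \<phi> ` carrier M" "w \<in> \<phi> ` carrier M" unfolding R.surj .
    then obtain v0 w0 where v0: "v0 \<in> carrier M" "v = \<phi> v0" and w0: "w0 \<in> carrier M" "w = \<phi> w0" by blast
    have "\<phi> (v0 \<otimes>\<^bsub>M\<^esub> w0) = \<phi> u" using mult[OF v0(1) w0(1)] vw(3) v0(2) w0(2) by simp
    \<comment> \<open>The lifted factors determine \<open>u\<close> only up to a unit, which is
      moved into the second factor.\<close>
    then obtain e where e: "e \<in> Units M" "u = (v0 \<otimes>\<^bsub>M\<^esub> w0) \<otimes>\<^bsub>M\<^esub> e"
      using R.eq_iff[OF R.M.m_closed[OF v0(1) w0(1)] u] by blast
    have ec: "e \<in> carrier M" using e(1) by (rule R.M.Units_closed)
    have "u = v0 \<otimes>\<^bsub>M\<^esub> (w0 \<otimes>\<^bsub>M\<^esub> e)" unfolding e(2) by (rule R.M.m_assoc[OF v0(1) w0(1) ec])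
    moreover have "\<phi> w0 = \<phi> (w0 \<otimes>\<^bsub>M\<^esub> e)"
      using R.eq_iff[OF w0(1) R.M.m_closed[OF w0(1) ec]] e(1) by blast
    then have "shape (\<phi> (w0 \<otimes>\<^bsub>M\<^esub> e)) = c" using vw(5) w0(2) by simp
    moreover have "shape (\<phi> v0) = b" using vw(4) v0(2) by simp
    ultimately show ?thesis unfolding cosetB
      by (intro bexI[of _ v0] bexI[of _ "w0 \<otimes>\<^bsub>M\<^esub> e"]) (use v0 w0 ec in simp_all)
  qed
  ultimately show ?thesis unfolding transfer_hom_def by blast
qed

lemma chain_connected_fibre:
  assumes "2 \<le> d"
  shows "chain_connected up d (fibre a T)"
  unfolding chain_connected_def
proof (intro ballI impI)
  fix z z' assume "z \<in> fibre a T" "z' \<in> fibre a T"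
  then have "(chain_step True 2 (fibre a T))\<^sup>*\<^sup>* z z'" by (rule fibre_connected)
  then show "(chain_step up d (fibre a T))\<^sup>*\<^sup>* z z'"
    by (rule mono_rtranclp[rule_format, rotated]) (use assms in \<open>auto simp: chain_step_def intro: order_trans\<close>)
qed

lemma catenary_in_fibres_le:
  assumes "monoid_reduction M K \<phi>"
  shows "catenary_in_fibres M B (\<lambda>a. shape (\<phi> a)) \<le> 2"
  unfolding catenary_in_fibres_def
proof (rule Least_le, intro ballI impI)
  interpret R: monoid_reduction M K \<phi> by (rule assms)
  let ?\<theta> = "\<lambda>a. shape (\<phi> a)"
  fix a z z' assume a: "a \<in> carrier M" and z: "z \<in> facts_of M a" "z' \<in> facts_of M a"
    and eq: "fact_map B ?\<theta> z = fact_map B ?\<theta> z'"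
  have UB: "Units B = {{#}}" using B.Units_eq unfolding B_simps .
  \<comment> \<open>\<open>B\<close> is reduced, so its unit cosets are singletons, and equality of
    extended images means equality of the multisets of shapes.\<close>
  have fm: "fact_map B ?\<theta> y = image_mset (\<lambda>S. {S}) (image_mset shape (image_mset R.red y))"
    if y: "y \<in> facts_of M a" for y
  proof -
    have "image_mset (\<lambda>X. ?\<theta> ` X <#>\<^bsub>B\<^esub> Units B) y = image_mset (\<lambda>X. {shape (R.red X)}) y"
    proof (rule image_mset_cong)
      fix X assume "X \<in># y"
      then have "X \<in> carrier (reduced M)" using R.facts_of_carrier[OF y] by blast
      then obtain b where b: "b \<in> carrier M" "X = b <#\<^bsub>M\<^esub> Units M" by (rule R.R_carrierE)
      have "?\<theta> ` X = shape ` (\<phi> ` X)" by (simp only: image_image)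
      also have "\<dots> = {shape (\<phi> b)}" unfolding b(2) R.phi_coset[OF b(1)] by simp
      finally have im: "?\<theta> ` X = {shape (\<phi> b)}" .
      have "R.red X = \<phi> b" unfolding b(2) by (rule R.red_coset[OF b(1)])
      then show "?\<theta> ` X <#>\<^bsub>B\<^esub> Units B = {shape (R.red X)}"
        unfolding im UB set_mult_def B_simps by simp
    qed
    then show ?thesis unfolding fact_map_def by (simp add: multiset.map_comp comp_def)
  qed
  let ?F = "{y \<in> facts_of M a. fact_map B ?\<theta> y = fact_map B ?\<theta> z}"
  let ?T = "image_mset shape (image_mset R.red z)"
  have F: "y \<in> ?F \<longleftrightarrow> y \<in> facts_of M a \<and> image_mset shape (image_mset R.red y) = ?T" for y
  proof -
    have "fact_map B ?\<theta> y = fact_map B ?\<theta> z \<longleftrightarrow> image_mset shape (image_mset R.red y) = ?T" if "y \<in> facts_of M a"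
      unfolding fm[OF that] fm[OF z(1)] by (rule image_mset_singleton_eq_iff)
    then show ?thesis by blast
  qed
  have "image_mset R.red ` ?F = fibre (\<phi> a) ?T"
    unfolding fibre_def R.facts_of_image[OF a, symmetric] using F by auto
  then have "chain_connected False 2 (image_mset R.red ` ?F)" using chain_connected_fibre by simp
  moreover have "set_mset y \<subseteq> carrier R.R" if "y \<in> ?F" for y using that R.facts_of_carrier by blast
  ultimately have "chain_connected False 2 ?F"
    using chain_connected_image_mset[OF R.red_inj_on, of ?F] by blast
  then have "(chain_step False 2 ?F)\<^sup>*\<^sup>* z z'"
    unfolding chain_connected_False_iff using z eq by simp
  then show "connected_by (is_chain 2 ?F) z z'"
    using connected_by_is_chain[of z ?F] z(1) by simp
qed

lemma length_sets_B_eq: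
  assumes "monoid_reduction M K \<phi>"
  shows "length_sets M = length_sets B"
proof -
  interpret R: monoid_reduction M K \<phi> by (rule assms)
  interpret RB: monoid_reduction B B id by (rule B.monoid_reduction_id)
  have "length_sets B = (\<lambda>a. size ` B.Z (shape a)) ` carrier K"
    unfolding RB.length_sets_eq shape_image_K[symmetric] image_image ..
  also have "\<dots> = (\<lambda>a. size ` K.Z a) ` carrier K"
  proof (rule image_cong[OF refl])
    fix a assume "a \<in> carrier K"
    then have "a \<in> carrier J" by simp
    from image_K_Z[OF this] show "size ` B.Z (shape a) = size ` K.Z a"
      by (metis (no_types, lifting) image_cong image_image size_image_mset)
  qed
  finally show ?thesis unfolding R.length_sets_eq by simp
qed

lemma lift_step:
  assumes z: "z \<in> K.Z a" and step: "chain_step up d (B.Z (shape a)) (image_mset shape z) y"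
  obtains z1 where "chain_step up d (K.Z a) z z1" "image_mset shape z1 = y"
proof -
  define x where "x = image_mset shape z"
  define e f where "e = x - y" and "f = y - x"
  have xy: "x = x \<inter># y + e" "y = x \<inter># y + f"
    by (auto simp: e_def f_def multiset_eq_iff)
  have "e \<inter># f = {#}" by (auto simp: e_def f_def multiset_eq_iff)
  then have "fact_dist e f = max (size e) (size f)" by (rule fact_dist_disjoint)
  then have dist: "fact_dist x y = max (size e) (size f)" using xy fact_dist_union[of "x \<inter># y" e f] by simp
  have "image_mset shape z = x \<inter># y + e" using xy(1) unfolding x_def[symmetric] .
  from image_mset_eq_plusD[OF this] obtain zr ze where zz: "z = zr + ze" "x \<inter># y = image_mset shape zr" "e = image_mset shape ze"
    by blast
  have Z: "zr + ze \<in> K.Z a" using z unfolding zz(1) .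
  note sp = K_Z_split[OF Z]
  have bc: "mset_prod J ze \<in> carrier J" by (rule K_Z_closed(1)[OF sp(2)])
  have "x \<in> B.Z (shape a)" "y \<in> B.Z (shape a)" using step unfolding x_def chain_step_def by blast+
  then have xyB: "x \<inter># y + e \<in> B.Z (shape a)" "x \<inter># y + f \<in> B.Z (shape a)" using xy by simp_all
  have "f \<in> B.Z (mset_prod B e)" by (rule B.Z_cancel[OF xyB])
  moreover have "e \<in> B.Z (shape (mset_prod J ze))" unfolding zz(3) by (rule shape_K_Z[OF sp(2)])
  then have "mset_prod B e = shape (mset_prod J ze)" unfolding factorizations_def by blast
  ultimately obtain zf where zf: "zf \<in> K.Z (mset_prod J ze)" "image_mset shape zf = f"
    using lift_Z[OF bc, of f] by auto
  have Z1: "zr + zf \<in> K.Z a" unfolding sp(3) by (rule K_Z_union[OF sp(1) zf(1)])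
  have sz: "size ze = size e" "size zf = size f" unfolding zz(3) zf(2)[symmetric] by simp_all
  have "fact_dist z (zr + zf) \<le> fact_dist x y"
    unfolding dist zz(1) using fact_dist_union[of zr ze zf] fact_dist_le[of ze zf] sz by simp
  moreover have "enat (fact_dist x y) \<le> d" "up \<longrightarrow> size x \<le> size y" using step unfolding chain_step_def x_def by blast+
  moreover have "size z = size x" unfolding x_def by simp
  moreover have im: "image_mset shape (zr + zf) = y" using xy(2) zz(2) zf(2) by simp
  then have "size (zr + zf) = size y" by (metis size_image_mset)
  ultimately have "chain_step up d (K.Z a) z (zr + zf)"
    unfolding chain_step_def using z Z1 by (auto intro: order_trans[of _ "enat (fact_dist x y)"])
  then show thesis using that im by blast
qed

lemma lift_chain:
  assumes z: "z \<in> K.Z a" and chain: "(chain_step up d (B.Z (shape a)))\<^sup>*\<^sup>* (image_mset shape z) y"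
  shows "\<exists>z1. (chain_step up d (K.Z a))\<^sup>*\<^sup>* z z1 \<and> z1 \<in> K.Z a \<and> image_mset shape z1 = y"
  using chain
proof (induction rule: rtranclp_induct)
  case base
  show ?case using z by blast
next
  case (step y y')
  then obtain z1 where z1: "(chain_step up d (K.Z a))\<^sup>*\<^sup>* z z1" "z1 \<in> K.Z a" "image_mset shape z1 = y" by blast
  have "chain_step up d (B.Z (shape a)) (image_mset shape z1) y'" using step(2) z1(3) by simp
  then obtain z2 where z2: "chain_step up d (K.Z a) z1 z2" "image_mset shape z2 = y'" by (rule lift_step[OF z1(2)])
  then have "z2 \<in> K.Z a" by (simp add: chain_step_def)
  then show ?case using rtranclp.rtrancl_into_rtrancl[OF z1(1) z2(1)] z2(2) by blast
qed

text \<open>Taking shapes does not increase distances. Conversely a lifted chain ends at a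
  factorization with the right shapes but possibly the wrong atoms; the remaining path runs inside a
  fibre and costs 2, hence \<open>2 \<le> d\<close>.\<close>

lemma chain_connected_transfer:
  assumes a: "a \<in> carrier J" and d: "2 \<le> d"
  shows "chain_connected up d (K.Z a) \<longleftrightarrow> chain_connected up d (B.Z (shape a))"
proof
  assume conn: "chain_connected up d (K.Z a)"
  have map: "(chain_step up d (B.Z (shape a)))\<^sup>*\<^sup>* (image_mset shape z) (image_mset shape z')"
    if "(chain_step up d (K.Z a))\<^sup>*\<^sup>* z z'" for z z'
    using that
  proof (induction rule: rtranclp_induct)
    case (step y y')
    have y: "y \<in> K.Z a" "y' \<in> K.Z a" "enat (fact_dist y y') \<le> d" "up \<longrightarrow> size y \<le> size y'"
      using step(2) by (simp_all add: chain_step_def)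
    have "enat (fact_dist (image_mset shape y) (image_mset shape y')) \<le> enat (fact_dist y y')"
      using fact_dist_image_le by simp
    then have "enat (fact_dist (image_mset shape y) (image_mset shape y')) \<le> d" using y(3) by (rule order_trans)
    then have "chain_step up d (B.Z (shape a)) (image_mset shape y) (image_mset shape y')"
      using y(4) shape_K_Z[OF y(1)] shape_K_Z[OF y(2)] by (simp add: chain_step_def)
    with step.IH show ?case by (rule rtranclp.rtrancl_into_rtrancl)
  qed simp
  show "chain_connected up d (B.Z (shape a))"
    unfolding chain_connected_def image_K_Z[OF a, symmetric]
  proof (intro ballI impI)
    fix x x' assume "x \<in> image_mset shape ` K.Z a" "x' \<in> image_mset shape ` K.Z a" "size x \<le> size x'"
    then obtain z z' where z: "z \<in> K.Z a" "z' \<in> K.Z a" "x = image_mset shape z" "x' = image_mset shape z'" "size z \<le> size z'"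
      by auto
    then have "(chain_step up d (K.Z a))\<^sup>*\<^sup>* z z'" using conn unfolding chain_connected_def by blast
    from map[OF this] show "(chain_step up d (image_mset shape ` K.Z a))\<^sup>*\<^sup>* x x'"
      unfolding z(3,4) image_K_Z[OF a] .
  qed
next
  assume conn: "chain_connected up d (B.Z (shape a))"
  show "chain_connected up d (K.Z a)"
    unfolding chain_connected_def
  proof (intro ballI impI)
    fix z z' assume z: "z \<in> K.Z a" "z' \<in> K.Z a" "size z \<le> size z'"
    have "(chain_step up d (B.Z (shape a)))\<^sup>*\<^sup>* (image_mset shape z) (image_mset shape z')"
      using conn shape_K_Z[OF z(1)] shape_K_Z[OF z(2)] z(3) unfolding chain_connected_def by simp
    from lift_chain[OF z(1) this] obtain z1 where z1: "(chain_step up d (K.Z a))\<^sup>*\<^sup>* z z1" "z1 \<in> K.Z a"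
      "image_mset shape z1 = image_mset shape z'" by blast
    have F: "z1 \<in> fibre a (image_mset shape z')" "z' \<in> fibre a (image_mset shape z')"
      using z1 z(2) by (simp_all add: fibre_def)
    have "(chain_step True 2 (fibre a (image_mset shape z')))\<^sup>*\<^sup>* z1 z'" by (rule fibre_connected[OF F])
    then have "(chain_step up d (K.Z a))\<^sup>*\<^sup>* z1 z'"
      by (rule mono_rtranclp[rule_format, rotated])
        (use d in \<open>auto simp: chain_step_def fibre_def intro: order_trans\<close>)
    with z1(1) show "(chain_step up d (K.Z a))\<^sup>*\<^sup>* z z'" by (rule rtranclp_trans)
  qed
qed

text \<open>With at least three classes some element has factorizations of lengths 2 and 3, so
  either side forces \<open>3 \<le> d\<close>, and the bound required by
  \<open>chain_connected_transfer\<close> is available.\<close>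

lemma chain_connected_all_transfer:
  assumes card: "3 \<le> card (carrier G)"
  shows "(\<forall>a\<in>carrier K. chain_connected up d (K.Z a)) \<longleftrightarrow> (\<forall>S\<in>carrier B. chain_connected up d (B.Z S))"
proof -
  have iff: "(\<forall>S\<in>carrier B. chain_connected up d (B.Z S)) \<longleftrightarrow> (\<forall>a\<in>carrier K. chain_connected up d (B.Z (shape a)))"
    unfolding shape_image_K[symmetric] by simp
  have "\<not> carrier G \<subseteq> {\<one>\<^bsub>G\<^esub>}" using card card_mono[of "{\<one>\<^bsub>G\<^esub>}" "carrier G"] by auto
  then obtain g where g: "g \<in> carrier G" "g \<noteq> \<one>\<^bsub>G\<^esub>" by blast
  have "card {\<one>\<^bsub>G\<^esub>, inv\<^bsub>G\<^esub> g} \<le> 2" by (simp add: card_insert_le_m1)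
  then have "\<not> carrier G \<subseteq> {\<one>\<^bsub>G\<^esub>, inv\<^bsub>G\<^esub> g}" using card card_mono[of "{\<one>\<^bsub>G\<^esub>, inv\<^bsub>G\<^esub> g}" "carrier G"] by fastforce
  then obtain h where h: "h \<in> carrier G" "h \<noteq> \<one>\<^bsub>G\<^esub>" "h \<noteq> inv\<^bsub>G\<^esub> g" by blast
  have "g \<otimes>\<^bsub>G\<^esub> h \<noteq> \<one>\<^bsub>G\<^esub>" using G.inv_equality[of h g] G.m_comm[of g h] g h by auto
  from lengths_meet_two_three_primes[OF g(1) h(1) g(2) h(2) this]
  obtain b z z' where z: "z \<in> K.Z b" "z' \<in> K.Z b" "size z = 2" "size z' = 3" unfolding lengths_meet_def by blast
  have bK: "b \<in> carrier K" by (rule K.Z_closed[OF z(1)])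
  have three: "3 \<le> d" if "chain_connected up d (K.Z b)"
  proof -
    have "(chain_step up d (K.Z b))\<^sup>*\<^sup>* z z'" using that z unfolding chain_connected_def by simp
    then show ?thesis by (rule K.chain_bound_three) (use z in simp)
  qed
  have threeB: "3 \<le> d" if "chain_connected up d (B.Z (shape b))"
  proof -
    have "(chain_step up d (B.Z (shape b)))\<^sup>*\<^sup>* (image_mset shape z) (image_mset shape z')"
      using that z shape_K_Z[OF z(1)] shape_K_Z[OF z(2)] unfolding chain_connected_def by simp
    then show ?thesis by (rule B.chain_bound_three) (use z in simp)
  qed
  have two: "2 \<le> d" if "3 \<le> d" using that by (rule order_trans[rotated]) simp
  show ?thesis
    unfolding iff
  proof
    assume "\<forall>a\<in>carrier K. chain_connected up d (K.Z a)"
    moreover from this have "2 \<le> d" using bK three two by blast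
    ultimately show "\<forall>a\<in>carrier K. chain_connected up d (B.Z (shape a))" using chain_connected_transfer by simp
  next
    assume "\<forall>a\<in>carrier K. chain_connected up d (B.Z (shape a))"
    moreover from this have "2 \<le> d" using bK threeB two by blast
    ultimately show "\<forall>a\<in>carrier K. chain_connected up d (K.Z a)" using chain_connected_transfer by simp
  qed
qed

lemma catenary_degree_B_eq:
  assumes "monoid_reduction M K \<phi>" and card: "3 \<le> card (carrier G)"
  shows "catenary_degree M = catenary_degree B" "mon_catenary_degree M = mon_catenary_degree B"
proof -
  interpret R: monoid_reduction M K \<phi> by (rule assms)
  interpret RB: monoid_reduction B B id by (rule B.monoid_reduction_id)
  have "catenary_degree M \<le> d \<longleftrightarrow> catenary_degree B \<le> d" for d
    unfolding R.catenary_degree_le_iff RB.catenary_degree_le_iff by (rule chain_connected_all_transfer[OF card])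
  then show "catenary_degree M = catenary_degree B" by (meson antisym order_refl)
  have "mon_catenary_degree M \<le> d \<longleftrightarrow> mon_catenary_degree B \<le> d" for d
    unfolding R.mon_catenary_degree_le_iff RB.mon_catenary_degree_le_iff by (rule chain_connected_all_transfer[OF card])
  then show "mon_catenary_degree M = mon_catenary_degree B" by (meson antisym order_refl)
qed

end

section \<open>Seminormal finitely primary monoids\<close>

text \<open>
  A seminormal finitely primary monoid of rank \<open>s\<close> lies between
  \<open>{x. \<forall>i<s. 1 \<le> w i x}\<close> and \<open>{x. \<forall>i<s. 0 \<le> w i x}\<close> for the \<open>s\<close> valuations \<open>w i\<close> of
  its factorial overmonoid, and its non-units satisfy \<open>1 \<le> w i x\<close>.
\<close>
definition primary_valuations :: "('a, 'b) monoid_scheme \<Rightarrow> 'a set \<Rightarrow> nat \<Rightarrow> (nat \<Rightarrow> 'a \<Rightarrow> int) \<Rightarrow> bool" where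
  "primary_valuations Q D s w \<longleftrightarrow>
     (\<forall>i<s. \<forall>x\<in>carrier Q. \<forall>y\<in>carrier Q. w i (x \<otimes>\<^bsub>Q\<^esub> y) = w i x + w i y) \<and>
     (\<forall>k. \<exists>x\<in>carrier Q. \<forall>i<s. w i x = k i) \<and>
     (\<forall>x\<in>D. \<forall>i<s. 0 \<le> w i x) \<and>
     (\<forall>x\<in>carrier Q. (\<forall>i<s. 1 \<le> w i x) \<longrightarrow> x \<in> D) \<and>
     (\<forall>x\<in>D. inv\<^bsub>Q\<^esub> x \<notin> D \<longrightarrow> (\<forall>i<s. 1 \<le> w i x))"

text \<open>Descent on the exponent: the square and the cube of \<open>x [^] Suc m\<close> have
  exponents above \<open>Suc m\<close>, so seminormality adds one more power at a time.\<close>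

lemma (in comm_group) seminormal_power:
  assumes D: "seminormal G D" and x: "x \<in> carrier G"
  shows "\<forall>n\<ge>Suc m. x [^] (n::nat) \<in> D \<Longrightarrow> x \<in> D"
proof (induction m)
  case 0
  then have "x [^] Suc 0 \<in> D" by blast
  then show ?case using x by simp
next
  case (Suc m)
  have "x [^] n \<in> D" if "Suc m \<le> n" for n :: nat
  proof (cases "n = Suc m")
    case True
    have "(x [^] Suc m) [^] (2::nat) = x [^] (Suc m * 2)" "(x [^] Suc m) [^] (3::nat) = x [^] (Suc m * 3)"
      using x by (simp_all only: nat_pow_pow)
    moreover have "x [^] (Suc m * 2) \<in> D" by (rule Suc.prems[rule_format]) simp
    moreover have "x [^] (Suc m * 3) \<in> D" by (rule Suc.prems[rule_format]) simp
    ultimately have "x [^] Suc m \<in> D" using D x unfolding seminormal_def by (metis nat_pow_closed)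
    then show ?thesis using True by simp
  next
    case False
    then show ?thesis using Suc.prems that by simp
  qed
  then show ?case using Suc.IH by blast
qed

section \<open>Valuations of a factorial monoid with finitely many primes\<close>

locale factorial_in_group = comm_group Q + F: comm_monoid_cancel "Q\<lparr>carrier := F\<rparr>"
  for Q (structure) and F :: "'a set" +
  fixes s :: nat and q :: "nat \<Rightarrow> 'a"
  assumes F_sub: "F \<subseteq> carrier Q"
    and q_F: "i < s \<Longrightarrow> q i \<in> F"
    and q_prime: "i < s \<Longrightarrow> prime (Q\<lparr>carrier := F\<rparr>) (q i)"
    and q_assoc: "i < s \<Longrightarrow> j < s \<Longrightarrow> i \<noteq> j \<Longrightarrow> \<not> q i \<sim>\<^bsub>Q\<lparr>carrier := F\<rparr>\<^esub> q j"
    and F_rep: "x \<in> F \<Longrightarrow> \<exists>u\<in>Units (Q\<lparr>carrier := F\<rparr>). \<exists>k :: nat \<Rightarrow> nat.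
      x = u \<otimes> finprod Q (\<lambda>i. q i [^] k i) {..<s}"
    and Q_rep: "x \<in> carrier Q \<Longrightarrow> \<exists>a\<in>F. \<exists>b\<in>F. x = a \<otimes> inv b"
begin

abbreviation "FU \<equiv> Units (Q\<lparr>carrier := F\<rparr>)"

definition "P k = finprod Q (\<lambda>i. q i [^] (k i :: int)) {..<s}"

lemma F_mult: "x \<in> F \<Longrightarrow> y \<in> F \<Longrightarrow> x \<otimes> y \<in> F"
  using F.m_closed by simp

lemma F_one: "\<one> \<in> F"
  using F.one_closed by simp

lemma q_carrier: "i < s \<Longrightarrow> q i \<in> carrier Q"
  using q_F F_sub by blast

lemma FU_iff: "u \<in> FU \<longleftrightarrow> u \<in> F \<and> inv u \<in> F"
proof
  assume "u \<in> FU"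
  then obtain v where v: "u \<in> F" "v \<in> F" "u \<otimes> v = \<one>" unfolding Units_def by auto
  have uv: "u \<in> carrier Q" "v \<in> carrier Q" using v F_sub by blast+
  have "v \<otimes> u = \<one>" using v(3) m_comm[OF uv] by simp
  then have "inv u = v" by (rule inv_equality[OF _ uv])
  then show "u \<in> F \<and> inv u \<in> F" using v by simp
next
  assume u: "u \<in> F \<and> inv u \<in> F"
  then have uc: "u \<in> carrier Q" using F_sub by blast
  have "inv u \<otimes> u = \<one>" "u \<otimes> inv u = \<one>" using uc by simp_all
  then show "u \<in> FU" using u unfolding Units_def by auto
qed

lemma FU_carrier: "u \<in> FU \<Longrightarrow> u \<in> carrier Q"
  using FU_iff F_sub by blast

lemma FU_mult: "u \<in> FU \<Longrightarrow> v \<in> FU \<Longrightarrow> u \<otimes> v \<in> FU"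
  using F_mult[of u v] F_mult[of "inv u" "inv v"] inv_mult[of u v] FU_carrier[of u] FU_carrier[of v]
  unfolding FU_iff by simp

lemma FU_inv: "u \<in> FU \<Longrightarrow> inv u \<in> FU"
  unfolding FU_iff using F_sub by auto

lemma P_closed: "P k \<in> carrier Q"
  unfolding P_def by (rule finprod_closed) (auto simp: q_carrier)

lemma P_add: "P (\<lambda>i. k i + l i) = P k \<otimes> P l"
proof -
  have "P (\<lambda>i. k i + l i) = finprod Q (\<lambda>i. q i [^] k i \<otimes> q i [^] l i) {..<s}"
    unfolding P_def by (rule finprod_cong') (auto simp: q_carrier int_pow_mult)
  also have "\<dots> = P k \<otimes> P l" unfolding P_def by (rule finprod_multf) (auto simp: q_carrier)
  finally show ?thesis .
qed

lemma P_zero: "P (\<lambda>_. 0) = \<one>"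
  unfolding P_def by simp

lemma P_nat: "P (\<lambda>i. int (k i)) = finprod Q (\<lambda>i. q i [^] k i) {..<s}"
  unfolding P_def by (simp add: int_pow_int)

lemma P_F: "P (\<lambda>i. int (k i)) \<in> F"
proof -
  have pow: "x [^] (n::nat) \<in> F" if "x \<in> F" for x n
    by (induction n) (use that F_one F_mult in auto)
  have "finprod Q (\<lambda>i. q i [^] k i) A \<in> F" if "finite A" "A \<subseteq> {..<s}" for A
    using that
  proof (induction A rule: finite_induct)
    case (insert j A)
    then have "q j \<in> F" using q_F by simp
    moreover have "(\<lambda>i. q i [^] k i) \<in> A \<rightarrow> carrier Q" using insert.prems q_carrier by auto
    ultimately show ?case using insert pow F_mult F_sub by (auto simp: finprod_insert)
  qed (simp add: F_one)
  then show ?thesis unfolding P_nat by simp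
qed

text \<open>A prime dividing a unit times a monomial divides one of the occurring
  \<open>q j\<close>, and non-associated primes do not divide each other. This is what makes
  exponents unique.\<close>

lemma prime_divides_P:
  assumes i: "i < s" and v: "v \<in> FU" and A: "finite A" "A \<subseteq> {..<s}"
    and c: "c \<in> F" "v \<otimes> finprod Q (\<lambda>j. q j [^] (n j :: nat)) A = q i \<otimes> c"
  shows "i \<in> A \<and> 0 < n i"
proof -
  let ?F = "Q\<lparr>carrier := F\<rparr>"
  have prime: "q i \<notin> FU" "\<And>a b c. a \<in> F \<Longrightarrow> b \<in> F \<Longrightarrow> c \<in> F \<Longrightarrow> a \<otimes> b = q i \<otimes> c \<Longrightarrow>
    (\<exists>c\<in>F. a = q i \<otimes> c) \<or> (\<exists>c\<in>F. b = q i \<otimes> c)"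
    using q_prime[OF i] unfolding prime_def factor_def by auto
  have ass: "j = i" if j: "j < s" "d \<in> F" "q j = q i \<otimes> d" for j d
  proof (rule ccontr)
    assume ne: "j \<noteq> i"
    have irr: "irreducible ?F (q j)"
      by (rule F.prime_irreducible[OF q_prime[OF j(1)]])
    have div: "q i divides\<^bsub>?F\<^esub> q j" using j unfolding factor_def by auto
    have "q j divides\<^bsub>?F\<^esub> q i"
    proof (rule ccontr)
      assume "\<not> q j divides\<^bsub>?F\<^esub> q i"
      with div have "properfactor ?F (q i) (q j)" unfolding properfactor_def by blast
      then have "q i \<in> FU" using irr q_F[OF i] unfolding irreducible_def by simp
      then show False using prime(1) by blast
    qed
    with div have "q i \<sim>\<^bsub>?F\<^esub> q j" unfolding associated_def by blast
    then show False using q_assoc[OF i j(1)] ne by blast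
  qed
  have pow: "x [^] (m::nat) \<in> F" if "x \<in> F" for x m
    by (induction m) (use that F_one F_mult in auto)
  have powdiv: "\<exists>c\<in>F. x = q i \<otimes> c" if x: "x \<in> F" and c: "\<exists>c\<in>F. x [^] (m::nat) = q i \<otimes> c" for x m
    using c
  proof (induction m)
    case 0
    then obtain c where c: "c \<in> F" "\<one> = q i \<otimes> c" by auto
    have "inv (q i) = c" by (rule inv_equality) (use c i q_carrier F_sub m_comm[of "q i" c] in auto)
    then have "q i \<in> FU" unfolding FU_iff using c(1) q_F[OF i] by simp
    then show ?case using prime(1) by blast
  next
    case (Suc m)
    then obtain c where "c \<in> F" "x [^] m \<otimes> x = q i \<otimes> c" by auto
    from prime(2)[OF pow[OF x] x this] show ?case using Suc.IH by blast
  qed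
  have vF: "v \<in> F" "inv v \<in> F" using v unfolding FU_iff by blast+
  show ?thesis
    using A c
  proof (induction A arbitrary: c rule: finite_induct)
    case empty
    have c: "c \<in> carrier Q" "c \<in> F" using empty F_sub by auto
    have "v = q i \<otimes> c" using empty v FU_carrier by simp
    then have "\<one> = q i \<otimes> (c \<otimes> inv v)"
      using c(1) vF F_sub i q_carrier by (metis FU_carrier inv_closed m_assoc r_inv v)
    then have "inv (q i) = c \<otimes> inv v"
      by (intro inv_equality) (use c(1) i q_carrier vF F_sub m_comm[of "q i" "c \<otimes> inv v"] in auto)
    then have "q i \<in> FU" unfolding FU_iff using q_F[OF i] F_mult[OF c(2) vF(2)] by simp
    then show ?case using prime(1) by blast
  next
    case (insert j A)
    have jF: "q j \<in> F" "j < s" using insert.prems q_F by simp_all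
    have fc: "(\<lambda>j. q j [^] n j) \<in> A \<rightarrow> carrier Q" using insert.prems q_carrier by auto
    have AF: "finprod Q (\<lambda>j. q j [^] n j) A \<in> F"
    proof -
      have "finprod Q (\<lambda>j. q j [^] n j) B \<in> F" if "finite B" "B \<subseteq> {..<s}" for B
        using that
      proof (induction B rule: finite_induct)
        case (insert j B)
        then have "(\<lambda>j. q j [^] n j) \<in> B \<rightarrow> carrier Q" "q j [^] n j \<in> F" using q_carrier pow q_F by auto
        then show ?case using insert F_mult F_sub by (auto simp: finprod_insert)
      qed (simp add: F_one)
      then show ?thesis using insert by simp
    qed
    have qc: "q j [^] n j \<in> F" "q j [^] n j \<in> carrier Q" using pow[OF jF(1)] F_sub by auto
    have "v \<otimes> finprod Q (\<lambda>j. q j [^] n j) (insert j A) = q j [^] n j \<otimes> (v \<otimes> finprod Q (\<lambda>j. q j [^] n j) A)"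
      using insert.hyps fc qc(2) FU_carrier[OF v] by (simp add: finprod_insert m_lcomm)
    then have eq: "q j [^] n j \<otimes> (v \<otimes> finprod Q (\<lambda>j. q j [^] n j) A) = q i \<otimes> c" using insert.prems(3) by simp
    from prime(2)[OF qc(1) F_mult[OF vF(1) AF] insert.prems(2) eq] show ?case
    proof
      assume d: "\<exists>c\<in>F. q j [^] n j = q i \<otimes> c"
      obtain e where "e \<in> F" "q j = q i \<otimes> e" using powdiv[OF jF(1) d] by blast
      then have "j = i" by (rule ass[OF jF(2)])
      moreover have "0 < n j"
      proof (rule ccontr)
        assume "\<not> 0 < n j"
        then have "\<exists>c\<in>F. (\<one> [^] (0::nat)) = q i \<otimes> c" using d by simp
        then obtain c where c: "c \<in> F" "\<one> = q i \<otimes> c" by auto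
        have "inv (q i) = c" by (rule inv_equality) (use c i q_carrier F_sub m_comm[of "q i" c] in auto)
        then have "q i \<in> FU" unfolding FU_iff using c(1) q_F[OF i] by simp
        then show False using prime(1) by blast
      qed
      ultimately show ?case by simp
    next
      assume "\<exists>c\<in>F. v \<otimes> finprod Q (\<lambda>j. q j [^] n j) A = q i \<otimes> c"
      then show ?case using insert.IH insert.prems(1) by auto
    qed
  qed
qed

text \<open>Split \<open>k\<close> into positive part \<open>m\<close> and negative part
  \<open>n\<close>, so that the monomial of \<open>m\<close> is the unit times the monomial of
  \<open>n\<close>. If \<open>k i\<close> is positive, \<open>q i\<close> divides the left side and
  hence occurs in \<open>n\<close> too, which the splitting excludes.\<close>

lemma P_unit_pos:
  assumes k: "P k \<in> FU" and i: "i < s"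
  shows "k i \<le> 0"
proof (rule ccontr)
  assume "\<not> k i \<le> 0"
  define m where "m j = nat (k j)" for j
  define n where "n j = nat (- k j)" for j
  define m' where "m' j = (if j = i then m i - 1 else m j)" for j
  have mi: "0 < m i" using \<open>\<not> k i \<le> 0\<close> by (simp add: m_def)
  have "P (\<lambda>j. int (m j)) = P (\<lambda>j. k j + int (n j))"
    by (rule arg_cong[of _ _ P]) (auto simp: m_def n_def)
  then have 1: "P (\<lambda>j. int (m j)) = P k \<otimes> P (\<lambda>j. int (n j))" by (simp only: P_add)
  have "P (\<lambda>j. int (m j)) = P (\<lambda>j. (if j = i then 1 else 0) + int (m' j))"
    by (rule arg_cong[of _ _ P]) (use mi in \<open>auto simp: m'_def\<close>)
  then have 2: "P (\<lambda>j. int (m j)) = P (\<lambda>j. if j = i then 1 else 0) \<otimes> P (\<lambda>j. int (m' j))" by (simp only: P_add)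
  have "P (\<lambda>j. if j = i then 1 else 0) = finprod Q (\<lambda>j. if i = j then q j else \<one>) {..<s}"
    unfolding P_def by (rule finprod_cong') (auto simp: q_carrier)
  also have "\<dots> = q i" using i q_carrier by (intro finprod_singleton) auto
  finally have "P k \<otimes> P (\<lambda>j. int (n j)) = q i \<otimes> P (\<lambda>j. int (m' j))" using 1 2 by simp
  then have "i \<in> {..<s} \<and> 0 < n i"
    using prime_divides_P[OF i k, of "{..<s}" "P (\<lambda>j. int (m' j))" n] P_F unfolding P_nat by simp
  then show False using \<open>\<not> k i \<le> 0\<close> by (simp add: n_def)
qed

lemma P_uminus: "P (\<lambda>i. - k i) = inv (P k)"
proof (rule inv_equality[symmetric])
  show "P (\<lambda>i. - k i) \<otimes> P k = \<one>" unfolding P_add[symmetric] by (simp add: P_zero)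
qed (rule P_closed)+

lemma P_unit: "P k \<in> FU \<Longrightarrow> i < s \<Longrightarrow> k i = 0"
  using P_unit_pos[of k i] P_unit_pos[of "\<lambda>i. - k i" i] FU_inv P_uminus by fastforce

lemma rep_exists:
  assumes "x \<in> carrier Q"
  shows "\<exists>k. \<exists>u\<in>FU. x = u \<otimes> P k"
proof -
  obtain a b where ab: "a \<in> F" "b \<in> F" "x = a \<otimes> inv b" using Q_rep[OF assms] by blast
  obtain u k where u: "u \<in> FU" "a = u \<otimes> P (\<lambda>i. int (k i))" using F_rep[OF ab(1)] unfolding P_nat by blast
  obtain v l where v: "v \<in> FU" "b = v \<otimes> P (\<lambda>i. int (l i))" using F_rep[OF ab(2)] unfolding P_nat by blast
  note c = FU_carrier[OF u(1)] FU_carrier[OF v(1)] P_closed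
  have "inv b = inv v \<otimes> P (\<lambda>i. - int (l i))" unfolding v(2) P_uminus using c by (simp add: inv_mult)
  then have "x = (u \<otimes> inv v) \<otimes> (P (\<lambda>i. int (k i)) \<otimes> P (\<lambda>i. - int (l i)))"
    unfolding ab(3) u(2) using c by (simp add: m_ac)
  then have "x = (u \<otimes> inv v) \<otimes> P (\<lambda>i. int (k i) + - int (l i))" by (simp only: P_add)
  then show ?thesis using FU_mult[OF u(1) FU_inv[OF v(1)]] by blast
qed

text \<open>The exponent of \<open>q i\<close> in \<open>x\<close>. The chosen exponent function is
  determined by \<open>x\<close> only at indices below \<open>s\<close>; \<open>w_eq\<close> proves
  this.\<close>

definition "w i x = (SOME k. \<exists>u\<in>FU. x = u \<otimes> P k) i"

lemma w_eq:
  assumes u: "u \<in> FU" "x = u \<otimes> P k" and i: "i < s"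
  shows "w i x = k i"
proof -
  define l where "l = (SOME k. \<exists>u\<in>FU. x = u \<otimes> P k)"
  have "\<exists>k. \<exists>u\<in>FU. x = u \<otimes> P k" using u by blast
  from someI_ex[OF this] obtain v where v: "v \<in> FU" "x = v \<otimes> P l" unfolding l_def[symmetric] by blast
  note c = FU_carrier[OF u(1)] FU_carrier[OF v(1)] P_closed
  have "P (\<lambda>i. k i + - l i) = P k \<otimes> inv (P l)" by (simp only: P_add P_uminus)
  also have "\<dots> = inv u \<otimes> (u \<otimes> P k) \<otimes> inv (P l)" using c by (simp add: m_assoc[symmetric])
  also have "\<dots> = inv u \<otimes> (v \<otimes> P l) \<otimes> inv (P l)" using u(2) v(2) by simp
  also have "\<dots> = inv u \<otimes> v" using c by (simp add: m_assoc)
  finally have "P (\<lambda>i. k i + - l i) \<in> FU" using FU_mult[OF FU_inv[OF u(1)] v(1)] by simp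
  from P_unit[OF this i] have "l i = k i" by simp
  then show ?thesis by (simp add: w_def l_def)
qed

lemma one_FU: "\<one> \<in> FU"
  unfolding FU_iff using F_one by simp

lemma w_P: "i < s \<Longrightarrow> w i (P k) = k i"
  by (rule w_eq[OF one_FU]) (simp_all add: P_closed)

lemma w_mult:
  assumes "x \<in> carrier Q" "y \<in> carrier Q" "i < s"
  shows "w i (x \<otimes> y) = w i x + w i y"
proof -
  obtain u k where u: "u \<in> FU" "x = u \<otimes> P k" using rep_exists[OF assms(1)] by blast
  obtain v l where v: "v \<in> FU" "y = v \<otimes> P l" using rep_exists[OF assms(2)] by blast
  note c = FU_carrier[OF u(1)] FU_carrier[OF v(1)] P_closed
  have "x \<otimes> y = (u \<otimes> v) \<otimes> P (\<lambda>i. k i + l i)" unfolding u(2) v(2) P_add using c by (simp add: m_ac)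
  from w_eq[OF FU_mult[OF u(1) v(1)] this assms(3)] show ?thesis
    using w_eq[OF u assms(3)] w_eq[OF v assms(3)] by simp
qed

lemma F_iff: "x \<in> carrier Q \<Longrightarrow> x \<in> F \<longleftrightarrow> (\<forall>i<s. 0 \<le> w i x)"
proof
  assume "x \<in> F"
  then obtain u k where u: "u \<in> FU" "x = u \<otimes> P (\<lambda>i. int (k i))" using F_rep unfolding P_nat by blast
  then show "\<forall>i<s. 0 \<le> w i x" using w_eq[OF u] by simp
next
  assume x: "x \<in> carrier Q" "\<forall>i<s. 0 \<le> w i x"
  then obtain u k where u: "u \<in> FU" "x = u \<otimes> P k" using rep_exists by blast
  have "P k = P (\<lambda>i. int (nat (k i)))"
    unfolding P_def by (rule finprod_cong') (use x(2) w_eq[OF u] q_carrier in auto)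
  with u(2) have "x = u \<otimes> P (\<lambda>i. int (nat (k i)))" by (rule trans[OF _ arg_cong[of _ _ "(\<otimes>) u"]])
  moreover have "u \<in> F" using u(1) FU_iff by blast
  from F_mult[OF this P_F[of "\<lambda>i. nat (k i)"]] have "u \<otimes> P (\<lambda>i. int (nat (k i))) \<in> F" .
  ultimately show "x \<in> F" by (rule ssubst)
qed

lemma primary_valuations_w:
  assumes D: "D \<subseteq> F" "D - Units (Q\<lparr>carrier := D\<rparr>) \<subseteq> finprod Q q {..<s} <# F"
    and a: "(finprod Q q {..<s} [^] (\<alpha>::nat)) <# F \<subseteq> D" and sn: "seminormal Q D"
  shows "primary_valuations Q D s w"
proof -
  define t where "t = finprod Q q {..<s}"
  have "t = P (\<lambda>_. 1)" unfolding t_def P_def by (rule finprod_cong') (auto simp: q_carrier)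
  then have t: "t \<in> carrier Q" "\<And>i. i < s \<Longrightarrow> w i t = 1" using P_closed w_P by simp_all
  have wpow: "w i (x [^] (n::nat)) = int n * w i x" if "x \<in> carrier Q" "i < s" for x n i
  proof (induction n)
    case 0
    have "w i (P (\<lambda>_. 0)) = 0" using w_P[OF that(2)] by simp
    then show ?case by (simp add: P_zero)
  next
    case (Suc n)
    then show ?case using w_mult[OF nat_pow_closed[OF that(1)] that(1,2)] by (simp add: algebra_simps)
  qed
  have winv: "w i (inv x) = - w i x" if "x \<in> carrier Q" "i < s" for x i
    using w_mult[OF that(1) inv_closed[OF that(1)] that(2)] wpow[OF that, of 0] that(1) by simp
  have Dc: "D \<subseteq> carrier Q" using D(1) F_sub by blast
  have nonunit: "1 \<le> w i x" if x: "x \<in> D" "inv x \<notin> D" "i < s" for x i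
  proof -
    have "x \<notin> Units (Q\<lparr>carrier := D\<rparr>)"
    proof
      assume "x \<in> Units (Q\<lparr>carrier := D\<rparr>)"
      then obtain y where y: "y \<in> D" "y \<otimes> x = \<one>" unfolding Units_def by auto
      have "inv x = y" by (rule inv_equality) (use y x Dc in auto)
      then show False using x(2) y(1) by simp
    qed
    then obtain f where f: "f \<in> F" "x = t \<otimes> f" using D(2) x(1) unfolding t_def[symmetric] l_coset_def by auto
    have fc: "f \<in> carrier Q" using f(1) F_sub by blast
    have "w i x = 1 + w i f" unfolding f(2) using w_mult[OF t(1) fc x(3)] t(2)[OF x(3)] by simp
    then show ?thesis using F_iff[OF fc] f(1) x(3) by simp
  qed
  \<comment> \<open>For large \<open>n\<close> the power of \<open>x\<close> is
    \<open>t [^] \<alpha>\<close> times an element of \<open>F\<close>, since its values are at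
    least \<open>n\<close>; so it lies in \<open>D\<close>, and seminormality descends to
    \<open>x\<close>.\<close>
  have upper: "x \<in> D" if x: "x \<in> carrier Q" "\<forall>i<s. 1 \<le> w i x" for x
  proof -
    have "x [^] n \<in> D" if n: "Suc \<alpha> \<le> n" for n :: nat
    proof -
      define f where "f = x [^] n \<otimes> inv (t [^] \<alpha>)"
      have c: "x [^] n \<in> carrier Q" "t [^] \<alpha> \<in> carrier Q" "f \<in> carrier Q" unfolding f_def using x(1) t(1) by simp_all
      have "0 \<le> w i f" if i: "i < s" for i
      proof -
        have "w i f = int n * w i x - int \<alpha>"
          unfolding f_def using w_mult[OF c(1) inv_closed[OF c(2)] i] winv[OF c(2) i] wpow[OF x(1) i] wpow[OF t(1) i] t(2)[OF i]
          by simp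
        moreover have "int n * 1 \<le> int n * w i x" using x(2) i by (intro mult_left_mono) auto
        ultimately show ?thesis using n by linarith
      qed
      then have "f \<in> F" using F_iff[OF c(3)] by blast
      moreover have "x [^] n = t [^] \<alpha> \<otimes> f" unfolding f_def by (subst m_lcomm) (use c in simp_all)
      ultimately have "x [^] n \<in> t [^] \<alpha> <# F" unfolding l_coset_def by blast
      then show ?thesis using a unfolding t_def by blast
    qed
    then show ?thesis using seminormal_power[OF sn x(1), of \<alpha>] by blast
  qed
  show ?thesis
    unfolding primary_valuations_def
  proof (intro conjI allI ballI impI)
    show "\<exists>x\<in>carrier Q. \<forall>i<s. w i x = k i" for k
      by (rule bexI[of _ "P k"]) (use w_P P_closed in auto)
    show "0 \<le> w i x" if "x \<in> D" "i < s" for x i using F_iff[of x] that D(1) F_sub by blast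
  qed (use w_mult upper nonunit in blast)+
qed

end

lemma finitely_primary_valuations:
  assumes Q: "comm_group Q" and D: "finitely_primary Q D s" "seminormal Q D"
    and quot: "\<And>x. x \<in> carrier Q \<Longrightarrow> \<exists>a\<in>D. \<exists>b\<in>D. x = a \<otimes>\<^bsub>Q\<^esub> inv\<^bsub>Q\<^esub> b"
  shows "\<exists>w. primary_valuations Q D s w"
proof -
  interpret comm_group Q by (rule Q)
  obtain F q \<alpha> where F: "submonoid F Q" "D \<subseteq> F" "factorial_monoid (submon Q F)"
    "\<forall>i<s. q i \<in> F \<and> prime (submon Q F) (q i)"
    "\<forall>i<s. \<forall>j<s. i \<noteq> j \<longrightarrow> \<not> q i \<sim>\<^bsub>submon Q F\<^esub> q j"
    "\<forall>x\<in>F. \<exists>u\<in>Units (submon Q F). \<exists>k :: nat \<Rightarrow> nat. x = u \<otimes>\<^bsub>Q\<^esub> finprod Q (\<lambda>i. q i [^]\<^bsub>Q\<^esub> k i) {..<s}"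
    "D - Units (submon Q D) \<subseteq> finprod Q q {..<s} <#\<^bsub>Q\<^esub> F"
    "(finprod Q q {..<s} [^]\<^bsub>Q\<^esub> (\<alpha>::nat)) <#\<^bsub>Q\<^esub> F \<subseteq> D"
    using D(1) unfolding finitely_primary_def by blast
  interpret F: factorial_monoid "submon Q F" by (rule F(3))
  interpret factorial_in_group Q F s q
  proof unfold_locales
    show "F \<subseteq> carrier Q" using F(1) by (rule submonoid.subset)
    show "\<exists>a\<in>F. \<exists>b\<in>F. x = a \<otimes>\<^bsub>Q\<^esub> inv\<^bsub>Q\<^esub> b" if "x \<in> carrier Q" for x using quot[OF that] F(2) by blast
  qed (use F in blast)+
  from primary_valuations_w[OF F(2,7,8) D(2)] show ?thesis by blast
qed

section \<open>Invertible ideals of a weakly Krull monoid\<close>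

context comm_group
begin

lemma cancel_right: "a \<in> carrier G \<Longrightarrow> b \<in> carrier G \<Longrightarrow> x \<in> carrier G \<Longrightarrow> (a \<otimes> x) \<otimes> (b \<otimes> inv x) = a \<otimes> b"
proof -
  assume c: "a \<in> carrier G" "b \<in> carrier G" "x \<in> carrier G"
  have "(a \<otimes> x) \<otimes> (b \<otimes> inv x) = a \<otimes> (b \<otimes> (x \<otimes> inv x))" using c by (simp add: m_ac del: r_inv)
  then show ?thesis using c by simp
qed

lemma cancel_cross:
  assumes "t \<in> carrier G" "x \<in> carrier G" "y \<in> carrier G"
  shows "(t \<otimes> inv y) \<otimes> (x \<otimes> inv t) = x \<otimes> inv y"
proof -
  have "(t \<otimes> inv y) \<otimes> (x \<otimes> inv t) = (inv y \<otimes> t) \<otimes> (x \<otimes> inv t)"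
    by (rule arg_cong[OF m_comm[OF assms(1) inv_closed[OF assms(3)]]])
  also have "\<dots> = inv y \<otimes> x" by (rule cancel_right) (use assms in auto)
  also have "\<dots> = x \<otimes> inv y" by (rule m_comm) (use assms in auto)
  finally show ?thesis .
qed

lemma mult_div: "a \<in> carrier G \<Longrightarrow> b \<in> carrier G \<Longrightarrow> (a \<otimes> b) \<otimes> inv b = a"
  by (simp add: m_assoc)

lemma div_mult: "a \<in> carrier G \<Longrightarrow> b \<in> carrier G \<Longrightarrow> (a \<otimes> inv b) \<otimes> b = a"
  by (simp add: m_assoc)

lemma div_mult_div: "a \<in> carrier G \<Longrightarrow> b \<in> carrier G \<Longrightarrow> c \<in> carrier G \<Longrightarrow> d \<in> carrier G \<Longrightarrow>
    (a \<otimes> inv b) \<otimes> (c \<otimes> inv d) = (a \<otimes> c) \<otimes> inv (b \<otimes> d)"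
  by (simp add: inv_mult m_ac)

lemma inv_div: "a \<in> carrier G \<Longrightarrow> b \<in> carrier G \<Longrightarrow> inv (a \<otimes> inv b) = b \<otimes> inv a"
  by (simp add: inv_mult m_comm)

lemma div_eq_iff: "x \<in> carrier G \<Longrightarrow> a \<in> carrier G \<Longrightarrow> t \<in> carrier G \<Longrightarrow> x = a \<otimes> inv t \<longleftrightarrow> x \<otimes> t = a"
  using mult_div[of x t] div_mult[of a t] by auto

end

section \<open>Fractional ideals as families of local generators\<close>

locale weakly_krull = comm_group Q for Q :: "('a, 'b) monoid_scheme" (structure) +
  fixes H :: "'a set" and s :: "'a set \<Rightarrow> nat" and w :: "'a set \<Rightarrow> nat \<Rightarrow> 'a \<Rightarrow> int"
  assumes H_sub: "submonoid H Q"
    and quotients: "x \<in> carrier Q \<Longrightarrow> \<exists>a\<in>H. \<exists>b\<in>H. x = a \<otimes> inv b"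
    and weakly_Krull: "weakly_Krull Q H"
    and s_pos: "P \<in> minimal_primes Q H \<Longrightarrow> 0 < s P"
    and valuations: "P \<in> minimal_primes Q H \<Longrightarrow> primary_valuations Q (localization Q H P) (s P) (w P)"
    and conductor_nonempty: "conductor Q H \<noteq> {}"
    and conductor_proper: "conductor Q H \<subset> H"
begin

abbreviation "X \<equiv> minimal_primes Q H"
abbreviation "D \<equiv> localization Q H"
definition "DU P = {x \<in> D P. inv x \<in> D P}"

lemma H_carrier: "x \<in> H \<Longrightarrow> x \<in> carrier Q"
  using submonoid.subset[OF H_sub] by blast

lemma H_mult: "x \<in> H \<Longrightarrow> y \<in> H \<Longrightarrow> x \<otimes> y \<in> H"
  using submonoid.m_closed[OF H_sub] .

lemma H_one: "\<one> \<in> H"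
  using submonoid.one_closed[OF H_sub] .

lemma s_idealD: "s_ideal Q H A \<Longrightarrow> a \<in> A \<Longrightarrow> h \<in> H \<Longrightarrow> a \<otimes> h \<in> A"
  unfolding s_ideal_def set_mult_def by blast

lemma primeD:
  assumes "P \<in> X"
  shows "P \<subseteq> H" "a \<in> P \<Longrightarrow> h \<in> H \<Longrightarrow> a \<otimes> h \<in> P" "a \<in> H \<Longrightarrow> b \<in> H \<Longrightarrow> a \<otimes> b \<in> P \<Longrightarrow> a \<in> P \<or> b \<in> P"
    "\<one> \<notin> P" "P \<noteq> {}"
proof -
  have P: "prime_s_ideal Q H P" "P \<noteq> {}" using assms unfolding minimal_primes_def by blast+
  then have id: "s_ideal Q H P" "P \<noteq> H" "\<And>a b. a \<in> H \<Longrightarrow> b \<in> H \<Longrightarrow> a \<otimes> b \<in> P \<Longrightarrow> a \<in> P \<or> b \<in> P"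
    unfolding prime_s_ideal_def by blast+
  show sub: "P \<subseteq> H" using id(1) unfolding s_ideal_def by blast
  show "a \<in> P \<Longrightarrow> h \<in> H \<Longrightarrow> a \<otimes> h \<in> P" using s_idealD[OF id(1)] .
  show "a \<in> H \<Longrightarrow> b \<in> H \<Longrightarrow> a \<otimes> b \<in> P \<Longrightarrow> a \<in> P \<or> b \<in> P" by (rule id(3))
  show "P \<noteq> {}" by (rule P(2))
  show "\<one> \<notin> P"
  proof
    assume "\<one> \<in> P"
    then have "h \<in> P" if "h \<in> H" for h using s_idealD[OF id(1) _ that, of \<one>] H_carrier[OF that] by simp
    then show False using id(2) sub by blast
  qed
qed

lemma D_iff: "x \<in> D P \<longleftrightarrow> (\<exists>a\<in>H. \<exists>t\<in>H - P. x = a \<otimes> inv t)"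
  unfolding localization_def by blast

lemma D_carrier: "x \<in> D P \<Longrightarrow> x \<in> carrier Q"
  unfolding D_iff using H_carrier by auto

lemma H_D: "P \<in> X \<Longrightarrow> h \<in> H \<Longrightarrow> h \<in> D P"
  unfolding D_iff using primeD(4)[of P] H_one H_carrier[of h] by (intro bexI[of _ h] bexI[of _ \<one>]) auto

lemma D_mult:
  assumes P: "P \<in> X" and x: "x \<in> D P" "y \<in> D P"
  shows "x \<otimes> y \<in> D P"
proof -
  obtain a t b u where ab: "a \<in> H" "t \<in> H - P" "x = a \<otimes> inv t" "b \<in> H" "u \<in> H - P" "y = b \<otimes> inv u"
    using x unfolding D_iff by blast
  have "x \<otimes> y = (a \<otimes> b) \<otimes> inv (t \<otimes> u)" unfolding ab(3,6) using ab H_carrier by (intro div_mult_div) auto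
  moreover have "t \<otimes> u \<in> H - P" using ab(2,5) primeD(3)[OF P, of t u] H_mult by blast
  ultimately show ?thesis unfolding D_iff using H_mult[OF ab(1,4)] by blast
qed

lemma DU_D: "x \<in> DU P \<Longrightarrow> x \<in> D P"
  by (simp add: DU_def)

lemma DU_carrier: "x \<in> DU P \<Longrightarrow> x \<in> carrier Q"
  using DU_D D_carrier by blast

lemma DU_one: "P \<in> X \<Longrightarrow> \<one> \<in> DU P"
  using H_D[OF _ H_one] by (simp add: DU_def)

lemma DU_mult: "P \<in> X \<Longrightarrow> x \<in> DU P \<Longrightarrow> y \<in> DU P \<Longrightarrow> x \<otimes> y \<in> DU P"
  using D_mult[of P] D_carrier[of _ P] by (simp add: DU_def inv_mult)

lemma DU_inv: "x \<in> DU P \<Longrightarrow> inv x \<in> DU P"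
  using D_carrier[of x P] by (simp add: DU_def)

lemma DU_factor:
  assumes "P \<in> X" "x \<in> D P" "y \<in> D P" "x \<otimes> y \<in> DU P"
  shows "x \<in> DU P"
proof -
  have c: "x \<in> carrier Q" "y \<in> carrier Q" using D_carrier assms by blast+
  have "y \<otimes> inv (x \<otimes> y) \<in> D P" by (rule D_mult[OF assms(1,3)]) (use assms(4) in \<open>simp add: DU_def\<close>)
  moreover have "y \<otimes> inv (x \<otimes> y) = inv x"
    using mult_div[of "inv x" y] c by (simp only: inv_mult m_lcomm[of y "inv x" "inv y"] m_assoc inv_closed m_closed)
  ultimately show ?thesis using assms(2) by (simp add: DU_def)
qed

lemma H_DU_iff:
  assumes "P \<in> X" "h \<in> H"
  shows "h \<in> DU P \<longleftrightarrow> h \<notin> P"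
proof
  assume "h \<notin> P"
  then have "inv h \<in> D P" unfolding D_iff using assms(2) H_one H_carrier[OF assms(2)]
    by (intro bexI[of _ \<one>] bexI[of _ h]) auto
  then show "h \<in> DU P" using H_D[OF assms] by (simp add: DU_def)
next
  assume "h \<in> DU P"
  then obtain a t where at: "a \<in> H" "t \<in> H" "t \<notin> P" "inv h = a \<otimes> inv t" unfolding DU_def D_iff by blast
  note c = H_carrier[OF at(1)] H_carrier[OF at(2)] H_carrier[OF assms(2)]
  have "inv h \<otimes> t = a" using at(4) div_eq_iff[of "inv h" a t] c by simp
  then have "h \<otimes> a = t" using c by (simp add: m_assoc[symmetric] flip: \<open>inv h \<otimes> t = a\<close>)
  then show "h \<notin> P" using primeD(2)[OF assms(1), of h a] at by blast
qed

lemma H_iff: "x \<in> H \<longleftrightarrow> x \<in> carrier Q \<and> (\<forall>P\<in>X. x \<in> D P)"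
  using weakly_Krull unfolding weakly_Krull_def by blast

lemma finite_not_DU:
  assumes "x \<in> carrier Q"
  shows "finite {P \<in> X. x \<notin> DU P}"
proof -
  obtain a b where ab: "a \<in> H" "b \<in> H" "x = a \<otimes> inv b" using quotients[OF assms] by blast
  have "{P \<in> X. x \<notin> DU P} \<subseteq> {P \<in> X. a \<in> P} \<union> {P \<in> X. b \<in> P}"
    using H_DU_iff ab DU_mult DU_inv by blast
  moreover have "finite {P \<in> X. a \<in> P}" "finite {P \<in> X. b \<in> P}"
    using weakly_Krull ab(1,2) unfolding weakly_Krull_def by blast+
  ultimately show ?thesis using finite_subset by blast
qed

lemma w_mult: "P \<in> X \<Longrightarrow> i < s P \<Longrightarrow> x \<in> carrier Q \<Longrightarrow> y \<in> carrier Q \<Longrightarrow> w P i (x \<otimes> y) = w P i x + w P i y"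
  using valuations[of P] unfolding primary_valuations_def by blast

lemma w_surj: "P \<in> X \<Longrightarrow> \<exists>x\<in>carrier Q. \<forall>i<s P. w P i x = k i"
  using valuations[of P] unfolding primary_valuations_def by blast

lemma w_ge_one_D: "P \<in> X \<Longrightarrow> x \<in> carrier Q \<Longrightarrow> \<forall>i<s P. 1 \<le> w P i x \<Longrightarrow> x \<in> D P"
  using valuations[of P] unfolding primary_valuations_def by blast

lemma w_D: "P \<in> X \<Longrightarrow> x \<in> D P \<Longrightarrow> i < s P \<Longrightarrow> 0 \<le> w P i x"
  using valuations[of P] unfolding primary_valuations_def by blast

lemma w_nonunit: "P \<in> X \<Longrightarrow> x \<in> D P \<Longrightarrow> x \<notin> DU P \<Longrightarrow> i < s P \<Longrightarrow> 1 \<le> w P i x"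
  using valuations[of P] unfolding primary_valuations_def DU_def by blast

lemma w_one: "P \<in> X \<Longrightarrow> i < s P \<Longrightarrow> w P i \<one> = 0"
  using w_mult[of P i \<one> \<one>] by simp

lemma w_inv: "P \<in> X \<Longrightarrow> i < s P \<Longrightarrow> x \<in> carrier Q \<Longrightarrow> w P i (inv x) = - w P i x"
  using w_mult[of P i x "inv x"] w_one[of P i] by simp

lemma w_DU: "P \<in> X \<Longrightarrow> x \<in> DU P \<Longrightarrow> i < s P \<Longrightarrow> w P i x = 0"
  using w_D[of P x i] w_D[of P "inv x" i] w_inv[of P i x] DU_carrier[of x P] by (simp add: DU_def)

lemma w_pow: "P \<in> X \<Longrightarrow> i < s P \<Longrightarrow> x \<in> carrier Q \<Longrightarrow> w P i (x [^] (n::nat)) = int n * w P i x"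
  by (induction n) (simp_all add: w_one w_mult algebra_simps)

lemma D_unit_or_pos: "P \<in> X \<Longrightarrow> x \<in> D P \<Longrightarrow> x \<in> DU P \<longleftrightarrow> w P 0 x = 0"
  using w_DU[of P x 0] w_nonunit[of P x 0] s_pos[of P] by fastforce

lemma prime_not_subset:
  assumes "P \<in> X" "P' \<in> X" "P \<noteq> P'"
  obtains c where "c \<in> P" "c \<notin> P'"
proof -
  have "\<not> P \<subseteq> P'" using assms unfolding minimal_primes_def by blast
  then show thesis using that by blast
qed

text \<open>A choice of local generators that is trivial at almost all minimal primes. Up to
  \<open>DU P\<close> these families form the coproduct of the local quotient groups.\<close>

definition "fam x \<longleftrightarrow> (\<forall>P\<in>X. x P \<in> carrier Q) \<and> finite {P \<in> X. x P \<notin> DU P}"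

lemma fam_const: "x \<in> carrier Q \<Longrightarrow> fam (\<lambda>_. x)"
  unfolding fam_def using finite_not_DU by simp

lemma fam_carrier: "fam x \<Longrightarrow> P \<in> X \<Longrightarrow> x P \<in> carrier Q"
  unfolding fam_def by blast

lemma fam_mult:
  assumes "fam x" "fam y"
  shows "fam (\<lambda>P. x P \<otimes> y P)"
proof -
  have "{P \<in> X. x P \<otimes> y P \<notin> DU P} \<subseteq> {P \<in> X. x P \<notin> DU P} \<union> {P \<in> X. y P \<notin> DU P}" using DU_mult by blast
  then show ?thesis using assms unfolding fam_def by (auto intro: finite_subset)
qed

lemma fam_inv:
  assumes "fam x"
  shows "fam (\<lambda>P. inv (x P))"
proof -
  have "{P \<in> X. inv (x P) \<notin> DU P} \<subseteq> {P \<in> X. x P \<notin> DU P}" using DU_inv by blast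
  then show ?thesis using assms unfolding fam_def by (auto intro: finite_subset)
qed

lemma fam_single: "x \<in> carrier Q \<Longrightarrow> fam (\<lambda>P'. if P' = P then x else \<one>)"
proof -
  assume x: "x \<in> carrier Q"
  have "{P' \<in> X. (if P' = P then x else \<one>) \<notin> DU P'} \<subseteq> {P}" using DU_one by auto
  then have "finite {P' \<in> X. (if P' = P then x else \<one>) \<notin> DU P'}" by (rule finite_subset) simp
  then show ?thesis unfolding fam_def using x by simp
qed

text \<open>The element is \<open>x P0\<close> times some \<open>c\<close> in \<open>H\<close> that
  is a unit at \<open>P0\<close> and highly divisible at the finitely many other minimal primes
  where \<open>x P0\<close> is not already associated to \<open>x P\<close>. Such a \<open>c\<close>
  exists because distinct minimal primes are incomparable.\<close>

lemma approximation:
  assumes x: "fam x" and P0: "P0 \<in> X"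
  obtains y where "y \<in> carrier Q" "y \<otimes> inv (x P0) \<in> DU P0" "\<forall>P\<in>X. y \<otimes> inv (x P) \<in> D P"
proof -
  define a where "a = x P0"
  have a: "a \<in> carrier Q" unfolding a_def by (rule fam_carrier[OF x P0])
  have one: "\<exists>c\<in>H. c \<in> DU P0 \<and> a \<otimes> c \<otimes> inv (x P) \<in> D P" if P: "P \<in> X" "P \<noteq> P0" for P
  proof -
    obtain c where c: "c \<in> P" "c \<notin> P0" by (rule prime_not_subset[OF P(1) P0 P(2)])
    have cH: "c \<in> H" using c(1) primeD(1)[OF P(1)] by blast
    note cc = H_carrier[OF cH] and xc = fam_carrier[OF x P(1)]
    \<comment> \<open>Each value of \<open>c\<close> at \<open>P\<close> is at least 1, so this
      exponent outweighs every value of \<open>a \<otimes> inv (x P)\<close> and leaves at least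
      1.\<close>
    define n where "n = nat (1 + (\<Sum>i<s P. \<bar>w P i (a \<otimes> inv (x P))\<bar>))"
    have pow: "c [^] n \<in> H \<and> c [^] n \<in> DU P0"
      by (induction n) (use H_one H_mult cH DU_one[OF P0] DU_mult[OF P0] H_DU_iff[OF P0 cH] c(2) in auto)
    have "1 \<le> w P i (a \<otimes> c [^] n \<otimes> inv (x P))" if i: "i < s P" for i
    proof -
      have "a \<otimes> c [^] n \<otimes> inv (x P) = (a \<otimes> inv (x P)) \<otimes> c [^] n"
        using a cc xc by (simp add: m_ac)
      then have eq: "w P i (a \<otimes> c [^] n \<otimes> inv (x P)) = w P i (a \<otimes> inv (x P)) + int n * w P i c"
        using w_mult[OF P(1) i, of "a \<otimes> inv (x P)" "c [^] n"] w_pow[OF P(1) i cc] a cc xc by simp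
      have "1 \<le> w P i c" using w_nonunit[OF P(1) H_D[OF P(1) cH] _ i] H_DU_iff[OF P(1) cH] c(1) by blast
      then have "int n * 1 \<le> int n * w P i c" by (intro mult_left_mono) auto
      moreover have "\<bar>w P i (a \<otimes> inv (x P))\<bar> \<le> (\<Sum>i<s P. \<bar>w P i (a \<otimes> inv (x P))\<bar>)"
        using i by (intro member_le_sum) auto
      moreover have "0 \<le> (\<Sum>i<s P. \<bar>w P i (a \<otimes> inv (x P))\<bar>)" by (intro sum_nonneg) auto
      moreover from this have "int n = 1 + (\<Sum>i<s P. \<bar>w P i (a \<otimes> inv (x P))\<bar>)" unfolding n_def by linarith
      ultimately show ?thesis unfolding eq by linarith
    qed
    then have "a \<otimes> c [^] n \<otimes> inv (x P) \<in> D P" using a cc xc by (intro w_ge_one_D[OF P(1)]) auto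
    then show ?thesis using pow by blast
  qed
  have many: "\<exists>c\<in>H. c \<in> DU P0 \<and> (\<forall>P\<in>E. a \<otimes> c \<otimes> inv (x P) \<in> D P)" if "finite E" "E \<subseteq> X - {P0}" for E
    using that
  proof (induction E rule: finite_induct)
    case empty
    show ?case using H_one DU_one[OF P0] by blast
  next
    case (insert P E)
    then obtain c where c: "c \<in> H" "c \<in> DU P0" "\<forall>P\<in>E. a \<otimes> c \<otimes> inv (x P) \<in> D P" by auto
    obtain d where d: "d \<in> H" "d \<in> DU P0" "a \<otimes> d \<otimes> inv (x P) \<in> D P" using one[of P] insert.prems by auto
    note cd = H_carrier[OF c(1)] H_carrier[OF d(1)]
    have "a \<otimes> (c \<otimes> d) \<otimes> inv (x P') \<in> D P'" if "P' \<in> insert P E" for P'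
    proof -
      have P': "P' \<in> X" using that insert.prems by blast
      note xc = fam_carrier[OF x P']
      have e1: "a \<otimes> (c \<otimes> d) \<otimes> inv (x P') = (a \<otimes> c \<otimes> inv (x P')) \<otimes> d" using a cd xc by (simp add: m_ac)
      have e2: "a \<otimes> (c \<otimes> d) \<otimes> inv (x P') = (a \<otimes> d \<otimes> inv (x P')) \<otimes> c" using a cd xc by (simp add: m_ac)
      show ?thesis
      proof (cases "P' = P")
        case True
        then show ?thesis unfolding e2 using D_mult[OF P' _ H_D[OF P' c(1)]] d(3) by blast
      next
        case False
        then show ?thesis unfolding e1 using D_mult[OF P' _ H_D[OF P' d(1)]] c(3) that by blast
      qed
    qed
    then show ?case using H_mult[OF c(1) d(1)] DU_mult[OF P0 c(2) d(2)] by blast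
  qed
  define E where "E = {P \<in> X. P \<noteq> P0 \<and> a \<otimes> inv (x P) \<notin> DU P}"
  have "fam (\<lambda>P. a \<otimes> inv (x P))" by (rule fam_mult[OF fam_const[OF a] fam_inv[OF x]])
  then have "finite E" unfolding fam_def E_def by (auto intro: finite_subset[rotated])
  moreover have "E \<subseteq> X - {P0}" unfolding E_def by blast
  ultimately obtain c where c: "c \<in> H" "c \<in> DU P0" "\<forall>P\<in>E. a \<otimes> c \<otimes> inv (x P) \<in> D P" using many by blast
  note cc = H_carrier[OF c(1)]
  show thesis
  proof (rule that[of "a \<otimes> c"])
    show "a \<otimes> c \<in> carrier Q" using a cc by simp
    have "a \<otimes> c \<otimes> inv a = c" using a cc by (simp add: m_comm m_assoc[symmetric])
    then show "a \<otimes> c \<otimes> inv (x P0) \<in> DU P0" using c(2) unfolding a_def by simp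
    show "\<forall>P\<in>X. a \<otimes> c \<otimes> inv (x P) \<in> D P"
    proof
      fix P assume P: "P \<in> X"
      note xc = fam_carrier[OF x P]
      show "a \<otimes> c \<otimes> inv (x P) \<in> D P"
      proof (cases "P \<in> E")
        case False
        have "a \<otimes> inv (x P) \<in> D P"
        proof (cases "P = P0")
          case True
          then have "a \<otimes> inv (x P) = \<one>" using a unfolding a_def by simp
          then show ?thesis using DU_D[OF DU_one[OF P]] by simp
        qed (use False P DU_D in \<open>auto simp: E_def\<close>)
        moreover have "a \<otimes> c \<otimes> inv (x P) = (a \<otimes> inv (x P)) \<otimes> c" using a cc xc by (simp add: m_ac)
        ultimately show ?thesis using D_mult[OF P _ H_D[OF P c(1)]] by simp
      qed (use c(3) in blast)
    qed
  qed
qed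

text \<open>The intersection of the local principal fractional ideals generated by
  \<open>x P\<close> over \<open>D P\<close>.\<close>

definition "idl x = {y \<in> carrier Q. \<forall>P\<in>X. y \<otimes> inv (x P) \<in> D P}"

text \<open>\<open>S\<close> generates the principal fractional ideal \<open>x P D P\<close> locally at every \<open>P\<close>.\<close>
definition "gen S x \<longleftrightarrow> S \<subseteq> carrier Q \<and> (\<forall>t\<in>S. \<forall>P\<in>X. t \<otimes> inv (x P) \<in> D P) \<and>
   (\<forall>P\<in>X. \<exists>t\<in>S. t \<otimes> inv (x P) \<in> DU P)"

lemma gen_idl: "fam x \<Longrightarrow> gen (idl x) x"
  unfolding gen_def
proof (intro conjI ballI)
  fix P assume x: "fam x" and P: "P \<in> X"
  obtain y where "y \<in> carrier Q" "y \<otimes> inv (x P) \<in> DU P" "\<forall>P\<in>X. y \<otimes> inv (x P) \<in> D P" by (rule approximation[OF x P])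
  then show "\<exists>t\<in>idl x. t \<otimes> inv (x P) \<in> DU P" unfolding idl_def by blast
qed (auto simp: idl_def)

lemma gen_mult:
  assumes x: "fam x" "gen S x" and y: "fam y" "gen T y"
  shows "gen (S <#> T) (\<lambda>P. x P \<otimes> y P)"
  unfolding gen_def
proof (intro conjI ballI)
  have c: "S \<subseteq> carrier Q" "T \<subseteq> carrier Q" using x y unfolding gen_def by blast+
  show "S <#> T \<subseteq> carrier Q" using c unfolding set_mult_def by auto
  have eq: "a \<otimes> b \<otimes> inv (x P \<otimes> y P) = (a \<otimes> inv (x P)) \<otimes> (b \<otimes> inv (y P))"
    if "a \<in> S" "b \<in> T" "P \<in> X" for a b P
    by (rule div_mult_div[symmetric]) (use that c fam_carrier x(1) y(1) in auto)
  show "t \<otimes> inv (x P \<otimes> y P) \<in> D P" if "t \<in> S <#> T" and P: "P \<in> X" for t P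
  proof -
    obtain a b where ab: "a \<in> S" "b \<in> T" "t = a \<otimes> b" using \<open>t \<in> S <#> T\<close> unfolding set_mult_def by blast
    show ?thesis unfolding ab(3) eq[OF ab(1,2) P] using D_mult[OF P] ab x(2) y(2) P unfolding gen_def by blast
  qed
  fix P assume P: "P \<in> X"
  obtain a where a: "a \<in> S" "a \<otimes> inv (x P) \<in> DU P" using x(2) P unfolding gen_def by blast
  obtain b where b: "b \<in> T" "b \<otimes> inv (y P) \<in> DU P" using y(2) P unfolding gen_def by blast
  have "a \<otimes> b \<otimes> inv (x P \<otimes> y P) \<in> DU P" unfolding eq[OF a(1) b(1) P] by (rule DU_mult[OF P a(2) b(2)])
  then show "\<exists>t\<in>S <#> T. t \<otimes> inv (x P \<otimes> y P) \<in> DU P" using a(1) b(1) unfolding set_mult_def by blast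
qed

lemma H_idl: "H = idl (\<lambda>_. \<one>)"
  unfolding idl_def using H_iff D_carrier by auto

lemma fam_one: "fam (\<lambda>_. \<one>)"
  by (rule fam_const) simp

text \<open>At each \<open>P\<close> the inverse is tested on one element of \<open>S\<close> that
  is a local generator. So the inverse depends only on the local generators, and
  \<open>v\<close>-closure and \<open>v\<close>-multiplication become componentwise.\<close>

lemma ideal_inv_gen:
  assumes x: "fam x" "gen S x"
  shows "ideal_inv Q H S = idl (\<lambda>P. inv (x P))"
proof (intro subset_antisym subsetI)
  have c: "S \<subseteq> carrier Q" using x(2) unfolding gen_def by blast
  fix y assume "y \<in> ideal_inv Q H S"
  then have y: "y \<in> carrier Q" "\<And>t. t \<in> S \<Longrightarrow> y \<otimes> t \<in> H" unfolding ideal_inv_def colon_def l_coset_def by blast+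
  have "y \<otimes> inv (inv (x P)) \<in> D P" if P: "P \<in> X" for P
  proof -
    note xc = fam_carrier[OF x(1) P]
    obtain t where t: "t \<in> S" "t \<otimes> inv (x P) \<in> DU P" using x(2) P unfolding gen_def by blast
    have tc: "t \<in> carrier Q" using t(1) c by blast
    have "(y \<otimes> t) \<otimes> inv (t \<otimes> inv (x P)) \<in> D P"
      by (rule D_mult[OF P H_D[OF P y(2)[OF t(1)]] DU_D[OF DU_inv[OF t(2)]]])
    moreover have "(y \<otimes> t) \<otimes> inv (t \<otimes> inv (x P)) = y \<otimes> x P"
      unfolding inv_div[OF tc xc] by (rule cancel_right[OF y(1) xc tc])
    ultimately show ?thesis using xc by simp
  qed
  then show "y \<in> idl (\<lambda>P. inv (x P))" unfolding idl_def using y(1) by blast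
next
  have c: "S \<subseteq> carrier Q" using x(2) unfolding gen_def by blast
  fix y assume y: "y \<in> idl (\<lambda>P. inv (x P))"
  then have yc: "y \<in> carrier Q" unfolding idl_def by blast
  have "y \<otimes> t \<in> H" if t: "t \<in> S" for t
    unfolding H_iff
  proof (intro conjI ballI)
    show "y \<otimes> t \<in> carrier Q" using yc t c by auto
    fix P assume P: "P \<in> X"
    note xc = fam_carrier[OF x(1) P]
    have tc: "t \<in> carrier Q" using t c by blast
    have "(y \<otimes> inv (inv (x P))) \<otimes> (t \<otimes> inv (x P)) \<in> D P"
      using D_mult[OF P] y t x(2) P unfolding idl_def gen_def by blast
    then show "y \<otimes> t \<in> D P" using cancel_right[OF yc tc xc] xc by simp
  qed
  then show "y \<in> ideal_inv Q H S" unfolding ideal_inv_def colon_def l_coset_def using yc by blast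
qed

lemma idl_cong: "(\<And>P. P \<in> X \<Longrightarrow> x P = y P) \<Longrightarrow> idl x = idl y"
  unfolding idl_def by auto

lemma v_closure_gen:
  assumes "fam x" "gen S x"
  shows "v_closure Q H S = idl x"
proof -
  have "v_closure Q H S = ideal_inv Q H (idl (\<lambda>P. inv (x P)))" unfolding v_closure_def ideal_inv_gen[OF assms] ..
  also have "\<dots> = idl (\<lambda>P. inv (inv (x P)))" by (rule ideal_inv_gen[OF fam_inv[OF assms(1)] gen_idl[OF fam_inv[OF assms(1)]]])
  also have "\<dots> = idl x" by (rule idl_cong) (simp add: fam_carrier[OF assms(1)])
  finally show ?thesis .
qed

lemma ideal_inv_idl: "fam x \<Longrightarrow> ideal_inv Q H (idl x) = idl (\<lambda>P. inv (x P))"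
  using ideal_inv_gen gen_idl by blast

lemma v_mult_idl: "fam x \<Longrightarrow> fam y \<Longrightarrow> v_mult Q H (idl x) (idl y) = idl (\<lambda>P. x P \<otimes> y P)"
  unfolding v_mult_def by (rule v_closure_gen[OF fam_mult gen_mult]) (simp_all add: gen_idl)

lemma idl_subset_iff:
  assumes "fam x" "fam y"
  shows "idl x \<subseteq> idl y \<longleftrightarrow> (\<forall>P\<in>X. x P \<otimes> inv (y P) \<in> D P)"
proof
  assume sub: "idl x \<subseteq> idl y"
  show "\<forall>P\<in>X. x P \<otimes> inv (y P) \<in> D P"
  proof
    fix P assume P: "P \<in> X"
    note xc = fam_carrier[OF assms(1) P] and yc = fam_carrier[OF assms(2) P]
    obtain t where t: "t \<in> idl x" "t \<otimes> inv (x P) \<in> DU P" using gen_idl[OF assms(1)] P unfolding gen_def by blast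
    have tc: "t \<in> carrier Q" using t(1) unfolding idl_def by blast
    have "(t \<otimes> inv (y P)) \<otimes> inv (t \<otimes> inv (x P)) \<in> D P"
      by (rule D_mult[OF P _ DU_D[OF DU_inv[OF t(2)]]]) (use subsetD[OF sub t(1)] P in \<open>simp add: idl_def\<close>)
    moreover have "(t \<otimes> inv (y P)) \<otimes> inv (t \<otimes> inv (x P)) = x P \<otimes> inv (y P)"
      unfolding inv_div[OF tc xc] by (rule cancel_cross[OF tc xc yc])
    ultimately show "x P \<otimes> inv (y P) \<in> D P" by simp
  qed
next
  assume D: "\<forall>P\<in>X. x P \<otimes> inv (y P) \<in> D P"
  show "idl x \<subseteq> idl y"
  proof
    fix t assume t: "t \<in> idl x"
    then have tc: "t \<in> carrier Q" unfolding idl_def by blast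
    have "t \<otimes> inv (y P) \<in> D P" if P: "P \<in> X" for P
    proof -
      note xc = fam_carrier[OF assms(1) P] and yc = fam_carrier[OF assms(2) P]
      have "(t \<otimes> inv (x P)) \<otimes> (x P \<otimes> inv (y P)) \<in> D P"
        using D_mult[OF P] t D P unfolding idl_def by blast
      moreover have "(t \<otimes> inv (x P)) \<otimes> (x P \<otimes> inv (y P)) = t \<otimes> inv (y P)"
        using tc xc yc by (simp add: m_assoc[symmetric] div_mult)
      ultimately show ?thesis by simp
    qed
    then show "t \<in> idl y" unfolding idl_def using tc by blast
  qed
qed

lemma idl_eq_iff:
  assumes "fam x" "fam y"
  shows "idl x = idl y \<longleftrightarrow> (\<forall>P\<in>X. x P \<otimes> inv (y P) \<in> DU P)"
proof -
  have DU: "x P \<otimes> inv (y P) \<in> DU P \<longleftrightarrow> x P \<otimes> inv (y P) \<in> D P \<and> y P \<otimes> inv (x P) \<in> D P" if "P \<in> X" for P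
    unfolding DU_def by (simp add: inv_div[OF fam_carrier[OF assms(1) that] fam_carrier[OF assms(2) that]])
  have "idl x = idl y \<longleftrightarrow> idl x \<subseteq> idl y \<and> idl y \<subseteq> idl x" by (rule set_eq_subset)
  also have "\<dots> \<longleftrightarrow> (\<forall>P\<in>X. x P \<otimes> inv (y P) \<in> DU P)"
    unfolding idl_subset_iff[OF assms] idl_subset_iff[OF assms(2,1)] using DU by blast
  finally show ?thesis .
qed

lemma idl_in_H_iff: "fam x \<Longrightarrow> idl x \<subseteq> H \<longleftrightarrow> (\<forall>P\<in>X. x P \<in> D P)"
  using idl_subset_iff[OF _ fam_one] fam_carrier unfolding H_idl[symmetric] by simp

abbreviation "J \<equiv> inv_v_ideals Q H"

lemma J_carrier: "A \<in> carrier J \<longleftrightarrow> v_ideal Q H A \<and> v_mult Q H A (ideal_inv Q H A) = H"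
  by (simp add: inv_v_ideals_def)

lemma idl_in_J:
  assumes "fam x" "\<forall>P\<in>X. x P \<in> D P"
  shows "idl x \<in> carrier J"
  unfolding J_carrier v_ideal_def
proof (intro conjI)
  show "idl x \<subseteq> H" using idl_in_H_iff assms by blast
  show "v_closure Q H (idl x) = idl x" by (rule v_closure_gen[OF assms(1) gen_idl[OF assms(1)]])
  have "v_mult Q H (idl x) (idl (\<lambda>P. inv (x P))) = idl (\<lambda>P. x P \<otimes> inv (x P))" by (rule v_mult_idl[OF assms(1) fam_inv[OF assms(1)]])
  also have "\<dots> = idl (\<lambda>_. \<one>)" by (rule idl_cong) (simp add: fam_carrier[OF assms(1)])
  also have "\<dots> = H" by (rule H_idl[symmetric])
  finally show "v_mult Q H (idl x) (ideal_inv Q H (idl x)) = H" unfolding ideal_inv_idl[OF assms(1)] .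
qed

text \<open>The inverse of a minimal prime is strictly larger than \<open>H\<close>. Consequently
  the product of a \<open>v\<close>-invertible ideal and its inverse is not contained in any minimal
  prime.\<close>

lemma prime_inverse:
  assumes P: "P \<in> X"
  obtains z where "z \<in> carrier Q" "z \<notin> H" "\<And>p. p \<in> P \<Longrightarrow> z \<otimes> p \<in> H"
proof -
  \<comment> \<open>Local version: \<open>u\<close> is outside \<open>D P\<close> but multiplies
    non-units into \<open>D P\<close>. In rank at least 2 take values 0, 1, 1 and so on, which occur
    neither for units nor for non-units of \<open>D P\<close>, while a non-unit raises all of them
    to at least 1. In rank 1 take an element of value 0 outside \<open>D P\<close> if there is one;
    otherwise \<open>D P\<close> contains every element of nonnegative value and value -1
    works.\<close>
  obtain u where u: "u \<in> carrier Q" "u \<notin> D P" "\<And>n. n \<in> D P \<Longrightarrow> n \<notin> DU P \<Longrightarrow> u \<otimes> n \<in> D P"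
  proof -
    show thesis
    proof (cases "s P = 1")
      case False
      then have s2: "1 < s P" using s_pos[OF P] by simp
      obtain u where u: "u \<in> carrier Q" "\<forall>i<s P. w P i u = (if i = 0 then 0 else 1)"
        using w_surj[OF P, of "\<lambda>i. if i = 0 then 0 else 1"] by blast
      have "u \<notin> D P"
      proof
        assume uD: "u \<in> D P"
        then have "u \<in> DU P" using D_unit_or_pos[OF P uD] u(2) s_pos[OF P] by simp
        then have "w P 1 u = 0" by (rule w_DU[OF P _ s2])
        moreover have "w P 1 u = 1" using u(2) s2 by simp
        ultimately show False by simp
      qed
      moreover have "u \<otimes> n \<in> D P" if n: "n \<in> D P" "n \<notin> DU P" for n
      proof -
        have "1 \<le> w P i (u \<otimes> n)" if "i < s P" for i
          using w_mult[OF P that u(1) D_carrier[OF n(1)]] w_nonunit[OF P n that] u(2) that by auto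
        then show ?thesis using u(1) D_carrier[OF n(1)] by (intro w_ge_one_D[OF P]) auto
      qed
      ultimately show thesis using that u(1) by blast
    next
      case s1: True
      show thesis
      proof (cases "\<exists>e\<in>carrier Q. w P 0 e = 0 \<and> e \<notin> D P")
        case True
        then obtain e where e: "e \<in> carrier Q" "w P 0 e = 0" "e \<notin> D P" by blast
        have "e \<otimes> n \<in> D P" if n: "n \<in> D P" "n \<notin> DU P" for n
        proof -
          have "1 \<le> w P i (e \<otimes> n)" if "i < s P" for i
            using w_mult[OF P that e(1) D_carrier[OF n(1)]] w_nonunit[OF P n that] e(2) that s1 by simp
          then show ?thesis using e(1) D_carrier[OF n(1)] by (intro w_ge_one_D[OF P]) auto
        qed
        then show thesis using that e by blast
      next
        case no: False
        obtain u where u: "u \<in> carrier Q" "\<forall>i<s P. w P i u = - 1" using w_surj[OF P, of "\<lambda>_. - 1"] by blast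
        have "u \<notin> D P" using w_D[OF P _ s_pos[OF P], of u] u(2) s_pos[OF P] by fastforce
        moreover have "u \<otimes> n \<in> D P" if n: "n \<in> D P" "n \<notin> DU P" for n
        proof -
          have c: "u \<otimes> n \<in> carrier Q" using u(1) D_carrier[OF n(1)] by simp
          have "0 \<le> w P 0 (u \<otimes> n)"
            using w_mult[OF P s_pos[OF P] u(1) D_carrier[OF n(1)]] w_nonunit[OF P n s_pos[OF P]] u(2) s_pos[OF P] by simp
          then consider "w P 0 (u \<otimes> n) = 0" | "1 \<le> w P 0 (u \<otimes> n)" by linarith
          then show ?thesis
          proof cases
            case 2
            then show ?thesis using s1 by (intro w_ge_one_D[OF P c]) simp
          qed (use no c in blast)
        qed
        ultimately show thesis using that u(1) by blast
      qed
    qed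
  qed
  obtain y where y: "y \<in> carrier Q" "y \<otimes> inv u \<in> DU P" "\<forall>P'\<in>X. y \<otimes> inv (if P' = P then u else \<one>) \<in> D P'"
    using approximation[OF fam_single[OF u(1), of P] P] by auto
  have other: "y \<in> D P'" if "P' \<in> X" "P' \<noteq> P" for P' using bspec[OF y(3) that(1)] y(1) that(2) by simp
  have yn: "y \<notin> D P"
  proof
    assume "y \<in> D P"
    then have "y \<otimes> inv (y \<otimes> inv u) \<in> D P" using D_mult[OF P _ DU_D[OF DU_inv[OF y(2)]]] by blast
    moreover have "y \<otimes> inv (y \<otimes> inv u) = u"
      unfolding inv_div[OF y(1) u(1)] using mult_div[of u y] y(1) u(1) by (simp only: m_lcomm[of y u "inv y"] m_assoc inv_closed)
    ultimately show False using u(2) by simp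
  qed
  show thesis
  proof (rule that[OF y(1)])
    show "y \<notin> H" using yn H_D[OF P] by blast
    fix p assume p: "p \<in> P"
    have pH: "p \<in> H" using p primeD(1)[OF P] by blast
    note pc = H_carrier[OF pH]
    show "y \<otimes> p \<in> H"
      unfolding H_iff
    proof (intro conjI ballI)
      show "y \<otimes> p \<in> carrier Q" using y(1) pc by simp
      fix P' assume P': "P' \<in> X"
      show "y \<otimes> p \<in> D P'"
      proof (cases "P' = P")
        case True
        have "u \<otimes> p \<in> D P" by (rule u(3)[OF H_D[OF P pH]]) (use H_DU_iff[OF P pH] p in blast)
        then have "(y \<otimes> inv u) \<otimes> (u \<otimes> p) \<in> D P" using D_mult[OF P DU_D[OF y(2)]] by blast
        moreover have "(y \<otimes> inv u) \<otimes> (u \<otimes> p) = y \<otimes> p" using y(1) u(1) pc by (simp add: m_assoc[symmetric] div_mult)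
        ultimately show ?thesis using True by simp
      next
        case False
        then show ?thesis using D_mult[OF P' other[OF P' False] H_D[OF P' pH]] by blast
      qed
    qed
  qed
qed

lemma X_nonempty: "X \<noteq> {}"
proof
  assume "X = {}"
  then have "H = carrier Q" using H_iff by blast
  then have "conductor Q H = H" unfolding conductor_def colon_def l_coset_def complete_int_closure_def by auto
  then show False using conductor_proper by blast
qed

text \<open>By \<open>prime_inverse\<close> some product of an element of \<open>A\<close> with an
  element of its inverse is a unit at \<open>P\<close>, and its factor in \<open>A\<close> generates
  \<open>A\<close> locally. Where a fixed element \<open>a0\<close> of \<open>A\<close> is a unit,
  the inverse lies in \<open>D P\<close>, so the chosen generator is a unit too; this gives
  finiteness.\<close>

lemma J_idl:
  assumes A: "A \<in> carrier J"
  obtains x where "fam x" "\<forall>P\<in>X. x P \<in> D P" "A = idl x"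
proof -
  have AH: "A \<subseteq> H" "v_closure Q H A = A" "v_mult Q H A (ideal_inv Q H A) = H"
    using A unfolding J_carrier v_ideal_def by blast+
  define B where "B = ideal_inv Q H A"
  have B: "b \<in> carrier Q \<and> (\<forall>a\<in>A. b \<otimes> a \<in> H)" if "b \<in> B" for b
    using that unfolding B_def ideal_inv_def colon_def l_coset_def by blast
  have ex: "\<exists>a\<in>A. \<exists>b\<in>B. a \<otimes> b \<in> DU P" if P: "P \<in> X" for P
  proof (rule ccontr)
    assume no: "\<not> ?thesis"
    obtain z where z: "z \<in> carrier Q" "z \<notin> H" "\<And>p. p \<in> P \<Longrightarrow> z \<otimes> p \<in> H" by (rule prime_inverse[OF P]) blast
    have "z \<otimes> t \<in> H" if t: "t \<in> A <#> B" for t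
    proof -
      obtain a b where ab: "a \<in> A" "b \<in> B" "t = a \<otimes> b" using t unfolding set_mult_def by blast
      have "b \<otimes> a \<in> H" using B[OF ab(2)] ab(1) by blast
      then have "a \<otimes> b \<in> H" using m_comm[of a b] B[OF ab(2)] H_carrier subsetD[OF AH(1) ab(1)] by simp
      moreover have "a \<otimes> b \<notin> DU P" using no ab by blast
      ultimately show ?thesis using z(3) H_DU_iff[OF P] ab(3) by blast
    qed
    then have zi: "z \<in> ideal_inv Q H (A <#> B)" unfolding ideal_inv_def colon_def l_coset_def using z(1) by blast
    have "\<one> \<in> v_closure Q H (A <#> B)" using AH(3) H_one unfolding v_mult_def B_def by simp
    then have "\<one> \<otimes> z \<in> H" using zi unfolding v_closure_def ideal_inv_def[of Q H "ideal_inv Q H (A <#> B)"] colon_def l_coset_def by blast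
    then show False using z(1,2) by simp
  qed
  obtain P1 where P1: "P1 \<in> X" using X_nonempty by blast
  obtain a0 where a0: "a0 \<in> A" using ex[OF P1] by blast
  define a where "a P = (SOME a. a \<in> A \<and> (\<exists>b\<in>B. a \<otimes> b \<in> DU P))" for P
  have a: "a P \<in> A \<and> (\<exists>b\<in>B. a P \<otimes> b \<in> DU P)" if "P \<in> X" for P
    unfolding a_def by (rule someI_ex) (use ex[OF that] in blast)
  have aH: "a P \<in> H" if "P \<in> X" for P using a[OF that] AH(1) by blast
  have fin: "a P \<in> DU P" if P: "P \<in> X" "a0 \<in> DU P" for P
  proof -
    obtain b where b: "b \<in> B" "a P \<otimes> b \<in> DU P" using a[OF P(1)] by blast
    note bc = B[OF b(1)]
    have c: "a0 \<in> carrier Q" using a0 AH(1) H_carrier by blast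
    have "(b \<otimes> a0) \<otimes> inv a0 \<in> D P"
      by (rule D_mult[OF P(1) H_D[OF P(1)] DU_D[OF DU_inv[OF P(2)]]]) (use bc a0 in blast)
    then have "b \<in> D P" using mult_div[of b a0] bc c by simp
    then show ?thesis using DU_factor[OF P(1) H_D[OF P(1) aH[OF P(1)]] _ b(2)] by blast
  qed
  have "{P \<in> X. a P \<notin> DU P} \<subseteq> {P \<in> X. a0 \<notin> DU P}" using fin by blast
  then have fam: "fam a" unfolding fam_def using aH H_carrier finite_subset[OF _ finite_not_DU[of a0]] a0 AH(1) by blast
  have "gen A a" unfolding gen_def
  proof (intro conjI ballI)
    show "A \<subseteq> carrier Q" using AH(1) H_carrier by blast
    fix t P assume t: "t \<in> A" and P: "P \<in> X"
    obtain b where b: "b \<in> B" "a P \<otimes> b \<in> DU P" using a[OF P] by blast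
    note bc = B[OF b(1)] and ac = H_carrier[OF aH[OF P]]
    have tc: "t \<in> carrier Q" using t AH(1) H_carrier by blast
    have "(b \<otimes> t) \<otimes> inv (a P \<otimes> b) \<in> D P"
      by (rule D_mult[OF P H_D[OF P] DU_D[OF DU_inv[OF b(2)]]]) (use bc t in blast)
    moreover have "(b \<otimes> t) \<otimes> inv (a P \<otimes> b) = t \<otimes> inv (a P)"
    proof -
      have "(b \<otimes> t) \<otimes> inv (a P \<otimes> b) = (t \<otimes> b) \<otimes> (inv (a P) \<otimes> inv b)"
        using bc ac tc by (simp add: inv_mult m_comm[of b t])
      also have "\<dots> = t \<otimes> inv (a P)" by (rule cancel_right) (use bc ac tc in auto)
      finally show ?thesis .
    qed
    ultimately show "t \<otimes> inv (a P) \<in> D P" by simp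
  next
    fix P assume P: "P \<in> X"
    have "a P \<otimes> inv (a P) \<in> DU P" using DU_one[OF P] H_carrier[OF aH[OF P]] by simp
    then show "\<exists>t\<in>A. t \<otimes> inv (a P) \<in> DU P" using a[OF P] by blast
  qed
  then have "A = idl a" using v_closure_gen[OF fam] AH(2) by blast
  then show thesis using that[OF fam] aH H_D by blast
qed

end

lemma (in comm_group) div_cancel:
  assumes "a \<in> carrier G" "b \<in> carrier G" "c \<in> carrier G"
  shows "(a \<otimes> c) \<otimes> inv (b \<otimes> c) = a \<otimes> inv b"
proof -
  have "(a \<otimes> c) \<otimes> inv (b \<otimes> c) = (a \<otimes> inv b) \<otimes> (c \<otimes> inv c)"
    by (rule div_mult_div[symmetric]) (use assms in auto)
  then show ?thesis using assms by simp
qed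

section \<open>The invertible ideals as a coproduct of local monoids\<close>

context weakly_krull
begin

text \<open>The integral families, which describe the ideals contained in \<open>H\<close>.\<close>

definition "ifam x \<longleftrightarrow> fam x \<and> (\<forall>P\<in>X. x P \<in> D P)"

lemma ifamD: "ifam x \<Longrightarrow> fam x" "ifam x \<Longrightarrow> P \<in> X \<Longrightarrow> x P \<in> D P" "ifam x \<Longrightarrow> P \<in> X \<Longrightarrow> x P \<in> carrier Q"
  using fam_carrier unfolding ifam_def by blast+

lemma ifam_one: "ifam (\<lambda>_. \<one>)"
  unfolding ifam_def using fam_one DU_D[OF DU_one] by blast

lemma ifam_mult: "ifam x \<Longrightarrow> ifam y \<Longrightarrow> ifam (\<lambda>P. x P \<otimes> y P)"
  unfolding ifam_def using fam_mult D_mult by blast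

lemma ifam_single: "P \<in> X \<Longrightarrow> x \<in> D P \<Longrightarrow> ifam (\<lambda>P'. if P' = P then x else \<one>)"
  unfolding ifam_def using fam_single[OF D_carrier] DU_D[OF DU_one] by auto

lemma fam_if:
  assumes "fam x"
  shows "fam (\<lambda>P'. if P' \<in> S then x P' else \<one>)"
proof -
  have "{P' \<in> X. (if P' \<in> S then x P' else \<one>) \<notin> DU P'} \<subseteq> {P' \<in> X. x P' \<notin> DU P'}" using DU_one by auto
  then have "finite {P' \<in> X. (if P' \<in> S then x P' else \<one>) \<notin> DU P'}"
    by (rule finite_subset) (use assms in \<open>simp add: fam_def\<close>)
  then show ?thesis using assms unfolding fam_def by simp
qed

lemma ifam_if: "ifam x \<Longrightarrow> ifam (\<lambda>P'. if P' \<in> S then x P' else \<one>)"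
  unfolding ifam_def using fam_if DU_D[OF DU_one] by auto

lemma J_cases:
  assumes "A \<in> carrier J"
  obtains x where "ifam x" "A = idl x"
proof -
  obtain x where "fam x" "\<forall>P\<in>X. x P \<in> D P" "A = idl x" by (rule J_idl[OF assms])
  then show thesis using that unfolding ifam_def by blast
qed

lemma idl_J: "ifam x \<Longrightarrow> idl x \<in> carrier J"
  using idl_in_J unfolding ifam_def by blast

lemma idl_DU: "ifam x \<Longrightarrow> ifam y \<Longrightarrow> idl x = idl y \<Longrightarrow> P \<in> X \<Longrightarrow> x P \<otimes> inv (y P) \<in> DU P"
  using idl_eq_iff[of x y] ifamD(1) by blast

lemma idl_eqI: "ifam x \<Longrightarrow> ifam y \<Longrightarrow> (\<And>P. P \<in> X \<Longrightarrow> x P \<otimes> inv (y P) \<in> DU P) \<Longrightarrow> idl x = idl y"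
  using idl_eq_iff[of x y] ifamD(1) by blast

lemma idl_eq_H:
  assumes "ifam x"
  shows "idl x = H \<longleftrightarrow> (\<forall>P\<in>X. x P \<in> DU P)"
proof -
  have "idl x = idl (\<lambda>_. \<one>) \<longleftrightarrow> (\<forall>P\<in>X. x P \<in> DU P)"
    using idl_eq_iff[OF ifamD(1)[OF assms] fam_one] ifamD(3)[OF assms] by simp
  then show ?thesis unfolding H_idl[symmetric] .
qed

lemma J_mult: "ifam x \<Longrightarrow> ifam y \<Longrightarrow> idl x \<otimes>\<^bsub>J\<^esub> idl y = idl (\<lambda>P. x P \<otimes> y P)"
  using v_mult_idl ifamD(1) by (simp add: inv_v_ideals_def)

lemma J_one: "\<one>\<^bsub>J\<^esub> = H"
  by (simp add: inv_v_ideals_def)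

lemma w_DU_eq:
  assumes "P \<in> X" "i < s P" "a \<in> carrier Q" "b \<in> carrier Q" "a \<otimes> inv b \<in> DU P"
  shows "w P i a = w P i b"
  using w_DU[OF assms(1,5,2)] w_mult[OF assms(1,2,3), of "inv b"] w_inv[OF assms(1,2,4)] assms(4) by simp

text \<open>An ideal determines its family only up to local units; \<open>val_idl\<close> shows that
  the values do not depend on this choice.\<close>

definition "rep A = (SOME x. ifam x \<and> A = idl x)"
definition "val P i A = nat (w P i (rep A P))"

lemma val_idl:
  assumes x: "ifam x" and P: "P \<in> X" "i < s P"
  shows "int (val P i (idl x)) = w P i (x P)"
proof -
  have "ifam (rep (idl x)) \<and> idl x = idl (rep (idl x))"
    unfolding rep_def by (rule someI_ex[of "\<lambda>x'. ifam x' \<and> idl x = idl x'"]) (use x in blast)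
  then have r: "ifam (rep (idl x))" "idl (rep (idl x)) = idl x" by simp_all
  have "w P i (rep (idl x) P) = w P i (x P)"
    using w_DU_eq[OF P ifamD(3)[OF r(1) P(1)] ifamD(3)[OF x P(1)] idl_DU[OF r(1) x r(2) P(1)]] .
  then show ?thesis unfolding val_def using w_D[OF P(1) ifamD(2)[OF x P(1)] P(2)] by simp
qed

lemma val_idl_zero:
  assumes x: "ifam x" and P: "P \<in> X" "i < s P"
  shows "val P i (idl x) = 0 \<longleftrightarrow> x P \<in> DU P"
proof (cases "x P \<in> DU P")
  case True
  then show ?thesis using val_idl[OF assms] w_DU[OF P(1) True P(2)] by linarith
next
  case False
  then show ?thesis using val_idl[OF assms] w_nonunit[OF P(1) ifamD(2)[OF x P(1)] False P(2)] by linarith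
qed

lemma val_zero: "ifam x \<Longrightarrow> P \<in> X \<Longrightarrow> val P 0 (idl x) = 0 \<longleftrightarrow> x P \<in> DU P"
  using val_idl_zero s_pos by blast

lemma J_reduced: "reduced_monoid J"
proof (intro reduced_monoid.intro reduced_monoid_axioms.intro comm_monoid_cancelI comm_monoidI)
  fix A B assume c: "A \<in> carrier J" "B \<in> carrier J"
  obtain x where x: "ifam x" "A = idl x" by (rule J_cases[OF c(1)])
  obtain y where y: "ifam y" "B = idl y" by (rule J_cases[OF c(2)])
  note xy = x y
  show "A \<otimes>\<^bsub>J\<^esub> B \<in> carrier J" unfolding xy J_mult[OF xy(1,3)] by (rule idl_J[OF ifam_mult[OF xy(1,3)]])
  show "A \<otimes>\<^bsub>J\<^esub> B = B \<otimes>\<^bsub>J\<^esub> A"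
    unfolding xy J_mult[OF xy(1,3)] J_mult[OF xy(3,1)] by (rule idl_cong) (rule m_comm[OF ifamD(3)[OF xy(1)] ifamD(3)[OF xy(3)]])
next
  fix A B C assume c: "A \<in> carrier J" "B \<in> carrier J" "C \<in> carrier J"
  obtain x where x: "ifam x" "A = idl x" by (rule J_cases[OF c(1)])
  obtain y where y: "ifam y" "B = idl y" by (rule J_cases[OF c(2)])
  obtain z where z: "ifam z" "C = idl z" by (rule J_cases[OF c(3)])
  note xy = x y z
  note xc = ifamD(3)[OF xy(1)] ifamD(3)[OF xy(3)] ifamD(3)[OF xy(5)]
  show "A \<otimes>\<^bsub>J\<^esub> B \<otimes>\<^bsub>J\<^esub> C = A \<otimes>\<^bsub>J\<^esub> (B \<otimes>\<^bsub>J\<^esub> C)"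
    unfolding xy J_mult[OF xy(1,3)] J_mult[OF xy(3,5)] J_mult[OF ifam_mult[OF xy(1,3)] xy(5)] J_mult[OF xy(1) ifam_mult[OF xy(3,5)]]
    by (rule idl_cong) (rule m_assoc[OF xc])
  assume eq: "A \<otimes>\<^bsub>J\<^esub> C = B \<otimes>\<^bsub>J\<^esub> C"
  show "A = B" unfolding xy
  proof (rule idl_eqI[OF xy(1,3)])
    fix P assume P: "P \<in> X"
    have "idl (\<lambda>P. x P \<otimes> z P) = idl (\<lambda>P. y P \<otimes> z P)"
      using eq unfolding xy J_mult[OF xy(1,5)] J_mult[OF xy(3,5)] .
    then have "(x P \<otimes> z P) \<otimes> inv (y P \<otimes> z P) \<in> DU P"
      by (rule idl_DU[OF ifam_mult[OF xy(1,5)] ifam_mult[OF xy(3,5)] _ P])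
    then show "x P \<otimes> inv (y P) \<in> DU P" unfolding div_cancel[OF xc(1)[OF P] xc(2)[OF P] xc(3)[OF P]] .
  qed
next
  show "\<one>\<^bsub>J\<^esub> \<in> carrier J" unfolding J_one using idl_J[OF ifam_one] H_idl by simp
next
  fix A assume A: "A \<in> carrier J"
  obtain x where x: "ifam x" "A = idl x" by (rule J_cases[OF A])
  have "idl (\<lambda>_. \<one>) \<otimes>\<^bsub>J\<^esub> idl x = idl x"
    unfolding J_mult[OF ifam_one x(1)] by (rule idl_cong) (simp add: ifamD(3)[OF x(1)])
  then show "\<one>\<^bsub>J\<^esub> \<otimes>\<^bsub>J\<^esub> A = A" unfolding x(2) J_one H_idl[symmetric] .
next
  have one: "\<one>\<^bsub>J\<^esub> \<in> Units J"
  proof -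
    have "idl (\<lambda>_. \<one>) \<otimes>\<^bsub>J\<^esub> idl (\<lambda>_. \<one>) = idl (\<lambda>_. \<one>)"
      unfolding J_mult[OF ifam_one ifam_one] by (rule idl_cong) simp
    then show ?thesis using idl_J[OF ifam_one] unfolding Units_def J_one H_idl[symmetric] by blast
  qed
  have "A = \<one>\<^bsub>J\<^esub>" if A: "A \<in> Units J" for A
  proof -
    obtain B where B: "A \<in> carrier J" "B \<in> carrier J" "A \<otimes>\<^bsub>J\<^esub> B = \<one>\<^bsub>J\<^esub>" using A unfolding Units_def by blast
    obtain x where x: "ifam x" "A = idl x" by (rule J_cases[OF B(1)])
    obtain y where y: "ifam y" "B = idl y" by (rule J_cases[OF B(2)])
    have "\<forall>P\<in>X. x P \<otimes> y P \<in> DU P"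
      using B(3) idl_eq_H[OF ifam_mult[OF x(1) y(1)]] unfolding x y J_mult[OF x(1) y(1)] J_one by blast
    then have "\<forall>P\<in>X. x P \<in> DU P" using DU_factor ifamD(2)[OF x(1)] ifamD(2)[OF y(1)] by blast
    then show ?thesis unfolding x(2) J_one using idl_eq_H[OF x(1)] by blast
  qed
  then show "Units J = {\<one>\<^bsub>J\<^esub>}" using one by blast
qed

text \<open>Every element of \<open>J\<close> is determined by its localizations, which can be prescribed freely.\<close>
lemma J_primary: "primary_monoid J X s val"
proof (intro primary_monoid.intro primary_monoid_axioms.intro J_reduced s_pos)
  fix P i A B assume P: "P \<in> X" "i < s P" and c: "A \<in> carrier J" "B \<in> carrier J"
  obtain x where x: "ifam x" "A = idl x" by (rule J_cases[OF c(1)])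
  obtain y where y: "ifam y" "B = idl y" by (rule J_cases[OF c(2)])
  note xy = x y
  show "val P i (A \<otimes>\<^bsub>J\<^esub> B) = val P i A + val P i B"
    using val_idl[OF ifam_mult[OF xy(1,3)] P] val_idl[OF xy(1) P] val_idl[OF xy(3) P]
      w_mult[OF P ifamD(3)[OF xy(1) P(1)] ifamD(3)[OF xy(3) P(1)]]
    unfolding xy J_mult[OF xy(1,3)] by linarith
next
  fix P i A assume P: "P \<in> X" "i < s P" and A: "A \<in> carrier J"
  obtain x where x: "ifam x" "A = idl x" by (rule J_cases[OF A])
  show "val P i A = 0 \<longleftrightarrow> val P 0 A = 0"
    unfolding x(2) val_idl_zero[OF x(1) P] val_idl_zero[OF x(1) P(1) s_pos[OF P(1)]] ..
next
  fix A assume A: "A \<in> carrier J"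
  obtain x where x: "ifam x" "A = idl x" by (rule J_cases[OF A])
  have "{P \<in> X. val P 0 A \<noteq> 0} = {P \<in> X. x P \<notin> DU P}"
    unfolding x(2) by (rule Collect_cong) (simp add: val_zero[OF x(1)] cong: conj_cong)
  then show "finite {P \<in> X. val P 0 A \<noteq> 0}" using ifamD(1)[OF x(1)] unfolding fam_def by simp
next
  fix A assume A: "A \<in> carrier J" "\<And>P. P \<in> X \<Longrightarrow> val P 0 A = 0"
  obtain x where x: "ifam x" "A = idl x" by (rule J_cases[OF A(1)])
  have "\<forall>P\<in>X. x P \<in> DU P" using A(2) val_zero[OF x(1)] unfolding x(2) by simp
  then show "A = \<one>\<^bsub>J\<^esub>" unfolding x(2) J_one using idl_eq_H[OF x(1)] by blast
next
  fix A P assume A: "A \<in> carrier J" and P: "P \<in> X"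
  obtain x where x: "ifam x" "A = idl x" by (rule J_cases[OF A])
  define e where "e = (\<lambda>P'. if P' \<in> {P} then x P' else \<one>)"
  define f where "f = (\<lambda>P'. if P' \<in> - {P} then x P' else \<one>)"
  have ef: "ifam e" "ifam f" unfolding e_def f_def by (rule ifam_if[OF x(1)])+
  have "A = idl e \<otimes>\<^bsub>J\<^esub> idl f"
    unfolding x(2) J_mult[OF ef] by (rule idl_cong) (simp add: e_def f_def ifamD(3)[OF x(1)] ifamD(3)[OF x(1) P])
  moreover have "val P' 0 (idl e) = 0" if "P' \<in> X" "P' \<noteq> P" for P'
    using val_zero[OF ef(1) that(1)] DU_one[OF that(1)] that(2) by (simp add: e_def)
  moreover have "val P 0 (idl f) = 0"
    using val_zero[OF ef(2) P] DU_one[OF P] by (simp add: f_def)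
  ultimately show "\<exists>e\<in>carrier J. \<exists>f\<in>carrier J. A = e \<otimes>\<^bsub>J\<^esub> f \<and> (\<forall>p'\<in>X. p' \<noteq> P \<longrightarrow> val p' 0 e = 0) \<and> val P 0 f = 0"
    using idl_J[OF ef(1)] idl_J[OF ef(2)] by blast
next
  fix P e f e' f' assume P: "P \<in> X" and c: "e \<in> carrier J" "f \<in> carrier J" "e' \<in> carrier J" "f' \<in> carrier J"
    and e: "\<forall>p'\<in>X. p' \<noteq> P \<longrightarrow> val p' 0 e = 0" "\<forall>p'\<in>X. p' \<noteq> P \<longrightarrow> val p' 0 e' = 0"
    and f: "val P 0 f = 0" "val P 0 f' = 0" and eq: "e \<otimes>\<^bsub>J\<^esub> f = e' \<otimes>\<^bsub>J\<^esub> f'"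
  obtain x where x: "ifam x" "e = idl x" by (rule J_cases[OF c(1)])
  obtain y where y: "ifam y" "f = idl y" by (rule J_cases[OF c(2)])
  obtain x' where x': "ifam x'" "e' = idl x'" by (rule J_cases[OF c(3)])
  obtain y' where y': "ifam y'" "f' = idl y'" by (rule J_cases[OF c(4)])
  have "idl (\<lambda>P. x P \<otimes> y P) = idl (\<lambda>P. x' P \<otimes> y' P)"
    using eq unfolding x(2) y(2) x'(2) y'(2) J_mult[OF x(1) y(1)] J_mult[OF x'(1) y'(1)] .
  note DU = idl_DU[OF ifam_mult[OF x(1) y(1)] ifam_mult[OF x'(1) y'(1)] this P]
  note cc = ifamD(3)[OF x(1) P] ifamD(3)[OF y(1) P] ifamD(3)[OF x'(1) P] ifamD(3)[OF y'(1) P]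
  have yU: "y P \<in> DU P" "y' P \<in> DU P"
    using f val_zero[OF y(1) P] val_zero[OF y'(1) P] unfolding y(2) y'(2) by blast+
  show "e = e'" unfolding x(2) x'(2)
  proof (rule idl_eqI[OF x(1) x'(1)])
    fix P' assume P': "P' \<in> X"
    show "x P' \<otimes> inv (x' P') \<in> DU P'"
    proof (cases "P' = P")
      case False
      then have "x P' \<in> DU P'" "x' P' \<in> DU P'"
        using bspec[OF e(1) P'] bspec[OF e(2) P'] unfolding x(2) x'(2) val_zero[OF x(1) P'] val_zero[OF x'(1) P'] by simp_all
      then show ?thesis by (intro DU_mult[OF P' _ DU_inv])
    next
      case True
      have "((x P \<otimes> y P) \<otimes> inv (x' P \<otimes> y' P)) \<otimes> (y' P \<otimes> inv (y P)) \<in> DU P"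
        using DU_mult[OF P DU DU_mult[OF P yU(2) DU_inv[OF yU(1)]]] .
      moreover have "((x P \<otimes> y P) \<otimes> inv (x' P \<otimes> y' P)) \<otimes> (y' P \<otimes> inv (y P)) = x P \<otimes> inv (x' P)"
      proof -
        have "((x P \<otimes> y P) \<otimes> inv (x' P \<otimes> y' P)) \<otimes> (y' P \<otimes> inv (y P))
            = ((x P \<otimes> inv (x' P)) \<otimes> (y P \<otimes> inv (y' P))) \<otimes> inv (y P \<otimes> inv (y' P))"
          unfolding inv_div[OF cc(2,4)] using div_mult_div[OF cc(1,3,2,4)] by simp
        also have "\<dots> = x P \<otimes> inv (x' P)" by (rule mult_div) (use cc in auto)
        finally show ?thesis .
      qed
      ultimately show ?thesis using True by simp
    qed
  qed
next
  fix P B C assume P: "P \<in> X" and c: "B \<in> carrier J" "C \<in> carrier J"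
    and e: "\<forall>p'\<in>X. p' \<noteq> P \<longrightarrow> val p' 0 B = 0" "\<forall>p'\<in>X. p' \<noteq> P \<longrightarrow> val p' 0 C = 0"
    and lt: "\<forall>i<s P. val P i C < val P i B"
  obtain b where b: "ifam b" "B = idl b" by (rule J_cases[OF c(1)])
  obtain c where c: "ifam c" "C = idl c" by (rule J_cases[OF c(2)])
  note cc = ifamD(3)[OF b(1) P] ifamD(3)[OF c(1) P]
  \<comment> \<open>The strict inequalities give \<open>d\<close> all values at least 1, which is
    enough for \<open>d \<in> D P\<close>; values at least 0 would not be.\<close>
  define d where "d = b P \<otimes> inv (c P)"
  have "1 \<le> w P i d" if i: "i < s P" for i
  proof -
    have "val P i (idl c) < val P i (idl b)" using lt i unfolding b(2) c(2) by blast
    then show ?thesis using val_idl[OF b(1) P i] val_idl[OF c(1) P i] w_mult[OF P i cc(1) inv_closed[OF cc(2)]] w_inv[OF P i cc(2)]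
      unfolding d_def by linarith
  qed
  then have "d \<in> D P" by (intro w_ge_one_D[OF P]) (use cc in \<open>auto simp: d_def\<close>)
  note y = ifam_single[OF P this]
  have "B = C \<otimes>\<^bsub>J\<^esub> idl (\<lambda>P'. if P' = P then d else \<one>)"
    unfolding b(2) c(2) J_mult[OF c(1) y]
  proof (rule idl_eqI[OF b(1) ifam_mult[OF c(1) y]])
    fix P' assume P': "P' \<in> X"
    note cc' = ifamD(3)[OF b(1) P'] ifamD(3)[OF c(1) P']
    show "b P' \<otimes> inv (c P' \<otimes> (if P' = P then d else \<one>)) \<in> DU P'"
    proof (cases "P' = P")
      case True
      have "c P \<otimes> d = b P" unfolding d_def using div_mult[OF cc] m_comm[of "b P \<otimes> inv (c P)" "c P"] cc by simp
      then show ?thesis using True DU_one[OF P] cc by simp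
    next
      case False
      then have "b P' \<in> DU P'" "c P' \<in> DU P'"
        using bspec[OF e(1) P'] bspec[OF e(2) P'] unfolding b(2) c(2) val_zero[OF b(1) P'] val_zero[OF c(1) P'] by simp_all
      then have "b P' \<otimes> inv (c P') \<in> DU P'" by (intro DU_mult[OF P' _ DU_inv])
      then show ?thesis using False cc' by simp
    qed
  qed
  then show "\<exists>y\<in>carrier J. B = C \<otimes>\<^bsub>J\<^esub> y" using idl_J[OF y] by blast
next
  fix P and k :: "nat \<Rightarrow> nat" assume P: "P \<in> X" and k: "\<forall>i<s P. 0 < k i"
  obtain x where x: "x \<in> carrier Q" "\<forall>i<s P. w P i x = int (k i)" using w_surj[OF P, of "\<lambda>i. int (k i)"] by blast
  have "x \<in> D P" by (rule w_ge_one_D[OF P x(1)]) (use k x(2) in fastforce)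
  note i = ifam_single[OF P this]
  have "val P' 0 (idl (\<lambda>P'. if P' = P then x else \<one>)) = 0" if "P' \<in> X" "P' \<noteq> P" for P'
    using val_zero[OF i that(1)] DU_one[OF that(1)] that(2) by simp
  moreover have "val P j (idl (\<lambda>P'. if P' = P then x else \<one>)) = k j" if "j < s P" for j
    using val_idl[OF i P that] x(2) that by simp
  ultimately show "\<exists>a\<in>carrier J. (\<forall>p'\<in>X. p' \<noteq> P \<longrightarrow> val p' 0 a = 0) \<and> (\<forall>i<s P. val P i a = k i)"
    using idl_J[OF i] by blast
qed

sublocale J: primary_monoid "inv_v_ideals Q H" "minimal_primes Q H" s val
  by (rule J_primary)

end

section \<open>The class group and the monoid of integral principal ideals\<close>

context weakly_krull
begin

abbreviation "F \<equiv> frac_v_ideals Q H"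
abbreviation "N \<equiv> principal_ideals Q H"

lemma F_carrier: "carrier F = idl ` {x. fam x}"
proof (intro subset_antisym subsetI)
  fix C assume "C \<in> carrier F"
  then obtain A B where AB: "A \<in> carrier J" "B \<in> carrier J" "C = v_mult Q H A (ideal_inv Q H B)"
    unfolding frac_v_ideals_def by auto
  obtain x where x: "ifam x" "A = idl x" by (rule J_cases[OF AB(1)])
  obtain y where y: "ifam y" "B = idl y" by (rule J_cases[OF AB(2)])
  have "C = idl (\<lambda>P. x P \<otimes> inv (y P))"
    unfolding AB(3) x(2) y(2) ideal_inv_idl[OF ifamD(1)[OF y(1)]]
    by (rule v_mult_idl[OF ifamD(1)[OF x(1)] fam_inv[OF ifamD(1)[OF y(1)]]])
  moreover have "fam (\<lambda>P. x P \<otimes> inv (y P))" by (rule fam_mult[OF ifamD(1)[OF x(1)] fam_inv[OF ifamD(1)[OF y(1)]]])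
  ultimately show "C \<in> idl ` {x. fam x}" by blast
next
  fix C assume "C \<in> idl ` {x. fam x}"
  then obtain x where x: "fam x" "C = idl x" by blast
  \<comment> \<open>A numerator and a denominator are chosen at each \<open>P\<close>. The pair
    \<open>(x P, \<one>)\<close> wherever \<open>x P\<close> is a unit keeps both resulting families
    trivial almost everywhere.\<close>
  have "\<exists>c. fst c \<in> D P \<and> snd c \<in> D P \<and> fst c \<otimes> inv (snd c) = x P \<and> (x P \<in> DU P \<longrightarrow> c = (x P, \<one>))"
    if P: "P \<in> X" for P
  proof (cases "x P \<in> DU P")
    case True
    then show ?thesis using DU_D[OF True] DU_D[OF DU_one[OF P]] DU_carrier[OF True] by (intro exI[of _ "(x P, \<one>)"]) simp
  next
    case False
    obtain a b where "a \<in> H" "b \<in> H" "x P = a \<otimes> inv b" using quotients[OF fam_carrier[OF x(1) P]] by blast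
    then show ?thesis using False H_D[OF P] by (intro exI[of _ "(a, b)"]) simp
  qed
  then have "\<forall>P\<in>X. \<exists>c. fst c \<in> D P \<and> snd c \<in> D P \<and> fst c \<otimes> inv (snd c) = x P \<and> (x P \<in> DU P \<longrightarrow> c = (x P, \<one>))" by blast
  from bchoice[OF this] obtain c where c: "\<forall>P\<in>X. fst (c P) \<in> D P \<and> snd (c P) \<in> D P \<and> fst (c P) \<otimes> inv (snd (c P)) = x P \<and>
      (x P \<in> DU P \<longrightarrow> c P = (x P, \<one>))" by blast
  have fin: "finite {P \<in> X. x P \<notin> DU P}" using x(1) unfolding fam_def by blast
  have c12: "\<And>P. P \<in> X \<Longrightarrow> fst (c P) \<in> D P" "\<And>P. P \<in> X \<Longrightarrow> snd (c P) \<in> D P"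
    and c3: "\<And>P. P \<in> X \<Longrightarrow> fst (c P) \<otimes> inv (snd (c P)) = x P"
    and c4: "\<And>P. P \<in> X \<Longrightarrow> x P \<in> DU P \<Longrightarrow> c P = (x P, \<one>)"
    using c by blast+
  have fams: "ifam (\<lambda>P. fst (c P))" "ifam (\<lambda>P. snd (c P))"
  proof -
    have "{P \<in> X. fst (c P) \<notin> DU P} \<subseteq> {P \<in> X. x P \<notin> DU P}" "{P \<in> X. snd (c P) \<notin> DU P} \<subseteq> {P \<in> X. x P \<notin> DU P}"
      using c4 DU_one by force+
    then show "ifam (\<lambda>P. fst (c P))" "ifam (\<lambda>P. snd (c P))"
      using c12 D_carrier finite_subset[OF _ fin] unfolding ifam_def fam_def by blast+
  qed
  have "v_mult Q H (idl (\<lambda>P. fst (c P))) (ideal_inv Q H (idl (\<lambda>P. snd (c P)))) = idl (\<lambda>P. fst (c P) \<otimes> inv (snd (c P)))"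
    unfolding ideal_inv_idl[OF ifamD(1)[OF fams(2)]] by (rule v_mult_idl[OF ifamD(1)[OF fams(1)] fam_inv[OF ifamD(1)[OF fams(2)]]])
  also have "\<dots> = idl x" by (rule idl_cong) (rule c3)
  finally have "C = v_mult Q H (idl (\<lambda>P. fst (c P))) (ideal_inv Q H (idl (\<lambda>P. snd (c P))))" using x(2) by simp
  then show "C \<in> carrier F" unfolding frac_v_ideals_def using idl_J[OF fams(1)] idl_J[OF fams(2)] by auto
qed

lemma idl_F: "fam x \<Longrightarrow> idl x \<in> carrier F"
  unfolding F_carrier by blast

lemma F_cases:
  assumes "A \<in> carrier F"
  obtains x where "fam x" "A = idl x"
  using assms unfolding F_carrier by (elim imageE) simp

lemma F_mult: "fam x \<Longrightarrow> fam y \<Longrightarrow> idl x \<otimes>\<^bsub>F\<^esub> idl y = idl (\<lambda>P. x P \<otimes> y P)"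
  using v_mult_idl by (simp add: frac_v_ideals_def)

lemma F_one: "\<one>\<^bsub>F\<^esub> = H"
  by (simp add: frac_v_ideals_def)

lemma F_one_idl: "\<one>\<^bsub>F\<^esub> = idl (\<lambda>_. \<one>)"
  by (rule trans[OF F_one H_idl])

lemma F_left_inverse: "fam x \<Longrightarrow> idl (\<lambda>P. inv (x P)) \<otimes>\<^bsub>F\<^esub> idl x = \<one>\<^bsub>F\<^esub>"
  unfolding F_one_idl F_mult[OF fam_inv] by (rule idl_cong) (simp add: fam_carrier)

lemma F_group: "comm_group F"
proof (rule comm_groupI)
  fix A B assume c: "A \<in> carrier F" "B \<in> carrier F"
  obtain x where x: "fam x" "A = idl x" by (rule F_cases[OF c(1)])
  obtain y where y: "fam y" "B = idl y" by (rule F_cases[OF c(2)])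
  show "A \<otimes>\<^bsub>F\<^esub> B \<in> carrier F" unfolding x(2) y(2) F_mult[OF x(1) y(1)] by (rule idl_F[OF fam_mult[OF x(1) y(1)]])
  show "A \<otimes>\<^bsub>F\<^esub> B = B \<otimes>\<^bsub>F\<^esub> A"
    unfolding x(2) y(2) F_mult[OF x(1) y(1)] F_mult[OF y(1) x(1)]
    by (rule idl_cong) (rule m_comm[OF fam_carrier[OF x(1)] fam_carrier[OF y(1)]])
next
  fix A B C assume c: "A \<in> carrier F" "B \<in> carrier F" "C \<in> carrier F"
  obtain x where x: "fam x" "A = idl x" by (rule F_cases[OF c(1)])
  obtain y where y: "fam y" "B = idl y" by (rule F_cases[OF c(2)])
  obtain z where z: "fam z" "C = idl z" by (rule F_cases[OF c(3)])
  show "A \<otimes>\<^bsub>F\<^esub> B \<otimes>\<^bsub>F\<^esub> C = A \<otimes>\<^bsub>F\<^esub> (B \<otimes>\<^bsub>F\<^esub> C)"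
    unfolding x(2) y(2) z(2) F_mult[OF x(1) y(1)] F_mult[OF y(1) z(1)]
      F_mult[OF fam_mult[OF x(1) y(1)] z(1)] F_mult[OF x(1) fam_mult[OF y(1) z(1)]]
    by (rule idl_cong) (rule m_assoc[OF fam_carrier[OF x(1)] fam_carrier[OF y(1)] fam_carrier[OF z(1)]])
next
  show "\<one>\<^bsub>F\<^esub> \<in> carrier F" unfolding F_one_idl by (rule idl_F[OF fam_one])
next
  fix A assume c: "A \<in> carrier F"
  obtain x where x: "fam x" "A = idl x" by (rule F_cases[OF c])
  show "\<one>\<^bsub>F\<^esub> \<otimes>\<^bsub>F\<^esub> A = A"
    unfolding x(2) F_one_idl F_mult[OF fam_one x(1)] by (rule idl_cong) (simp add: fam_carrier[OF x(1)])
  show "\<exists>B\<in>carrier F. B \<otimes>\<^bsub>F\<^esub> A = \<one>\<^bsub>F\<^esub>"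
    unfolding x(2) using F_left_inverse[OF x(1)] idl_F[OF fam_inv[OF x(1)]] by blast
qed

sublocale F: comm_group "frac_v_ideals Q H"
  by (rule F_group)

lemma l_coset_H: "a \<in> carrier Q \<Longrightarrow> a <# H = idl (\<lambda>_. a)"
proof (intro subset_antisym subsetI)
  fix y assume a: "a \<in> carrier Q" and y: "y \<in> a <# H"
  obtain h where h: "h \<in> H" "y = a \<otimes> h" using y unfolding l_coset_def by blast
  have "y \<otimes> inv a = h" using mult_div[of h a] m_comm[of a h] a H_carrier[OF h(1)] h(2) by simp
  then show "y \<in> idl (\<lambda>_. a)" unfolding idl_def using h a H_carrier[OF h(1)] H_D by simp
next
  fix y assume a: "a \<in> carrier Q" and y: "y \<in> idl (\<lambda>_. a)"
  then have yc: "y \<in> carrier Q" and "y \<otimes> inv a \<in> H" unfolding idl_def H_iff using D_carrier by auto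
  moreover have "y = a \<otimes> (y \<otimes> inv a)" using div_mult[of y a] m_comm[of "y \<otimes> inv a" a] a yc by simp
  ultimately show "y \<in> a <# H" unfolding l_coset_def by blast
qed

lemma N_iff: "A \<in> N \<longleftrightarrow> (\<exists>a\<in>carrier Q. A = idl (\<lambda>_. a))"
  unfolding principal_ideals_def using l_coset_H by blast

lemma N_subgroup: "subgroup N F"
proof
  show "N \<subseteq> carrier F" using N_iff idl_F[OF fam_const] by auto
  show "\<one>\<^bsub>F\<^esub> \<in> N" unfolding N_iff F_one_idl by blast
  fix A assume "A \<in> N"
  then obtain a where a: "a \<in> carrier Q" "A = idl (\<lambda>_. a)" unfolding N_iff by blast
  note fa = fam_const[OF a(1)] and fi = fam_const[OF inv_closed[OF a(1)]]
  have "inv\<^bsub>F\<^esub> A = idl (\<lambda>_. inv a)"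
    using F.inv_equality[OF F_left_inverse[OF fa] idl_F[OF fa] idl_F[OF fi]] unfolding a(2) .
  then show "inv\<^bsub>F\<^esub> A \<in> N" unfolding N_iff using a(1) by blast
  fix B assume "B \<in> N"
  then obtain b where b: "b \<in> carrier Q" "B = idl (\<lambda>_. b)" unfolding N_iff by blast
  have "A \<otimes>\<^bsub>F\<^esub> B = idl (\<lambda>_. a \<otimes> b)" unfolding a(2) b(2) by (rule F_mult[OF fa fam_const[OF b(1)]])
  then show "A \<otimes>\<^bsub>F\<^esub> B \<in> N" unfolding N_iff using a(1) b(1) by blast
qed

abbreviation "G \<equiv> v_class_group Q H"

lemma G_group: "comm_group G"
  unfolding v_class_group_def by (rule F.abelian_FactGroup[OF N_subgroup])

lemma G_one: "\<one>\<^bsub>G\<^esub> = N"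
  unfolding v_class_group_def by simp

lemma J_sub_F: "A \<in> carrier J \<Longrightarrow> A \<in> carrier F"
  using J_cases[of A] idl_F[OF ifamD(1)] by metis

lemma v_class_hom: "v_class Q H \<in> hom F G"
proof -
  have "(\<lambda>a. N #>\<^bsub>F\<^esub> a) \<in> hom F (F Mod N)"
    using normal.r_coset_hom_Mod[OF F.subgroup_imp_normal[OF N_subgroup]] .
  then show ?thesis unfolding v_class_group_def v_class_def[abs_def] .
qed

lemma cl_hom: "v_class Q H \<in> hom J G"
proof (rule homI)
  show "v_class Q H A \<in> carrier G" if "A \<in> carrier J" for A using v_class_hom J_sub_F[OF that] unfolding hom_def by blast
  fix A B assume AB: "A \<in> carrier J" "B \<in> carrier J"
  have "A \<otimes>\<^bsub>J\<^esub> B = A \<otimes>\<^bsub>F\<^esub> B" by (simp add: inv_v_ideals_def frac_v_ideals_def)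
  then show "v_class Q H (A \<otimes>\<^bsub>J\<^esub> B) = v_class Q H A \<otimes>\<^bsub>G\<^esub> v_class Q H B"
    using hom_mult[OF v_class_hom J_sub_F[OF AB(1)] J_sub_F[OF AB(2)]] by simp
qed

lemma cl_eq_one_iff: "A \<in> carrier J \<Longrightarrow> v_class Q H A = \<one>\<^bsub>G\<^esub> \<longleftrightarrow> A \<in> N"
  unfolding v_class_def G_one
  using F.coset_join1[OF _ J_sub_F N_subgroup] F.coset_join2[OF J_sub_F N_subgroup] by blast

lemma class_memD:
  assumes "g \<in> carrier G" "A \<in> g"
  shows "v_class Q H A = g"
proof -
  obtain B where B: "B \<in> carrier F" "g = N #>\<^bsub>F\<^esub> B"
    using assms(1) unfolding v_class_group_def FactGroup_def RCOSETS_def by auto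
  show ?thesis using F.repr_independence[OF _ B(1) N_subgroup, of A] assms(2) unfolding v_class_def B(2) by simp
qed

abbreviation "K \<equiv> J\<lparr>carrier := {A \<in> carrier J. v_class Q H A = \<one>\<^bsub>G\<^esub>}\<rparr>"

lemma H_cancel: "comm_monoid_cancel (submon Q H)"
  by (intro comm_monoid_cancelI comm_monoidI) (auto simp: H_mult H_one H_carrier m_assoc intro: m_comm[OF H_carrier H_carrier])

text \<open>The kernel of the class map consists of the principal ideals contained in
  \<open>H\<close>, and \<open>h <# H\<close> determines \<open>h\<close> up to a unit of
  \<open>H\<close>. So \<open>K\<close> is the reduced monoid of \<open>H\<close>.\<close>

lemma principal_reduction:
  assumes "reduced_monoid K"
  shows "monoid_reduction (submon Q H) K (\<lambda>h. h <# H)"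
proof (intro monoid_reduction.intro monoid_reduction_axioms.intro H_cancel assms)
  have ifam: "ifam (\<lambda>_. h)" if "h \<in> H" for h
    unfolding ifam_def using fam_const[OF H_carrier[OF that]] H_D that by blast
  have K: "h <# H \<in> carrier K" if "h \<in> H" for h
    using idl_J[OF ifam[OF that]] cl_eq_one_iff[of "h <# H"] N_iff H_carrier[OF that] l_coset_H[OF H_carrier[OF that]] by auto
  show "(\<lambda>h. h <# H) \<in> hom (submon Q H) K"
  proof (rule homI)
    fix h assume "h \<in> carrier (submon Q H)"
    then show "h <# H \<in> carrier K" using K by simp
    fix k assume "k \<in> carrier (submon Q H)"
    then have hk: "h \<in> H" "k \<in> H" using \<open>h \<in> carrier (submon Q H)\<close> by simp_all
    show "(h \<otimes>\<^bsub>submon Q H\<^esub> k) <# H = (h <# H) \<otimes>\<^bsub>K\<^esub> (k <# H)"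
      using l_coset_H H_carrier[OF hk(1)] H_carrier[OF hk(2)] J_mult[OF ifam[OF hk(1)] ifam[OF hk(2)]] by simp
  qed
  show "(\<lambda>h. h <# H) ` carrier (submon Q H) = carrier K"
  proof (intro subset_antisym subsetI)
    fix A assume "A \<in> carrier K"
    then have A: "A \<in> carrier J" "v_class Q H A = \<one>\<^bsub>G\<^esub>" by simp_all
    have "A \<in> N" using A cl_eq_one_iff by blast
    then obtain a where a: "a \<in> carrier Q" "A = a <# H" unfolding principal_ideals_def by blast
    have "A \<subseteq> H" using A(1) unfolding J_carrier v_ideal_def by blast
    moreover have "a \<otimes> \<one> \<in> A" unfolding a(2) l_coset_def using H_one by blast
    ultimately have "a \<in> H" using a(1) by auto
    then show "A \<in> (\<lambda>h. h <# H) ` carrier (submon Q H)" using a(2) by simp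
  qed (use K in auto)
  fix h k assume "h \<in> carrier (submon Q H)" "k \<in> carrier (submon Q H)"
  then have hk: "h \<in> H" "k \<in> H" by simp_all
  note c = H_carrier[OF hk(1)] H_carrier[OF hk(2)]
  show "h <# H = k <# H \<longleftrightarrow> (\<exists>u\<in>Units (submon Q H). k = h \<otimes>\<^bsub>submon Q H\<^esub> u)"
  proof
    assume eq: "h <# H = k <# H"
    have self: "x \<in> x <# H" if "x \<in> carrier Q" for x
      unfolding l_coset_def using H_one r_one[OF that] by force
    have "k \<in> h <# H" "h \<in> k <# H" using self[OF c(1)] self[OF c(2)] eq by simp_all
    then obtain u v where uv: "u \<in> H" "v \<in> H" "k = h \<otimes> u" "h = k \<otimes> v" unfolding l_coset_def by blast
    note uc = H_carrier[OF uv(1)] H_carrier[OF uv(2)]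
    have "h \<otimes> (u \<otimes> v) = h" unfolding m_assoc[OF c(1) uc, symmetric] uv(3)[symmetric] by (rule uv(4)[symmetric])
    then have "h \<otimes> (u \<otimes> v) = h \<otimes> \<one>" using c(1) by simp
    then have "u \<otimes> v = \<one>" by (rule l_cancel[OF _ _ _ c(1)]) (use uc in auto)
    then have "u \<in> Units (submon Q H)" unfolding Units_def using uv(1,2) uc m_comm[of u v] by auto
    then show "\<exists>u\<in>Units (submon Q H). k = h \<otimes>\<^bsub>submon Q H\<^esub> u" using uv(3) by (intro bexI[of _ u]) simp
  next
    assume "\<exists>u\<in>Units (submon Q H). k = h \<otimes>\<^bsub>submon Q H\<^esub> u"
    then obtain u v where uv: "u \<in> H" "v \<in> H" "u \<otimes> v = \<one>" "k = h \<otimes> u" unfolding Units_def by auto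
    note uc = H_carrier[OF uv(1)] H_carrier[OF uv(2)]
    have kv: "k \<otimes> v = h" unfolding uv(4) using m_assoc[OF c(1) uc] uv(3) c by simp
    show "h <# H = k <# H"
    proof (intro subset_antisym subsetI)
      fix y assume "y \<in> h <# H"
      then obtain z where z: "z \<in> H" "y = h \<otimes> z" unfolding l_coset_def by blast
      have "y = k \<otimes> (v \<otimes> z)" using m_assoc[OF c(2) uc(2) H_carrier[OF z(1)]] kv z(2) by simp
      then show "y \<in> k <# H" unfolding l_coset_def using H_mult[OF uv(2) z(1)] by blast
    next
      fix y assume "y \<in> k <# H"
      then obtain z where z: "z \<in> H" "y = k \<otimes> z" unfolding l_coset_def by blast
      have "y = h \<otimes> (u \<otimes> z)" using m_assoc[OF c(1) uc(1) H_carrier[OF z(1)]] uv(4) z(2) by simp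
      then show "y \<in> h <# H" unfolding l_coset_def using H_mult[OF uv(1) z(1)] by blast
    qed
  qed
qed

end

section \<open>The complete integral closure\<close>

context weakly_krull
begin

abbreviation "Hh \<equiv> complete_int_closure Q H"

lemma prime_iff_not_DU: "P \<in> X \<Longrightarrow> h \<in> H \<Longrightarrow> h \<in> P \<longleftrightarrow> h \<notin> DU P"
  using H_DU_iff by blast

lemma prime_w: "P \<in> X \<Longrightarrow> c \<in> P \<Longrightarrow> i < s P \<Longrightarrow> 1 \<le> w P i c"
  using w_nonunit[of P c i] prime_iff_not_DU[of P c] primeD(1)[of P] H_D[of P c] by blast

lemma DU_pow: "P \<in> X \<Longrightarrow> x \<in> DU P \<Longrightarrow> x [^] (n::nat) \<in> DU P"
  by (induction n) (simp_all add: DU_one DU_mult)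

lemma prime_intersection: "finite E \<Longrightarrow> E \<subseteq> X \<Longrightarrow> \<exists>c\<in>H. \<forall>P\<in>E. c \<in> P"
proof (induction E rule: finite_induct)
  case empty
  then show ?case using H_one by blast
next
  case (insert P E)
  then obtain c where c: "c \<in> H" "\<forall>P\<in>E. c \<in> P" by auto
  have P: "P \<in> X" using insert.prems by blast
  obtain p where p: "p \<in> P" using primeD(5)[OF P] by blast
  have pH: "p \<in> H" using primeD(1)[OF P] p by blast
  have "c \<otimes> p \<in> P'" if P': "P' \<in> insert P E" for P'
  proof (cases "P' = P")
    case True
    then show ?thesis using primeD(2)[OF P p c(1)] m_comm[OF H_carrier[OF c(1)] H_carrier[OF pH]] by simp
  next
    case False
    then show ?thesis using P' insert.prems c(2) primeD(2)[of P' c p] pH by blast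
  qed
  then show ?case using H_mult[OF c(1) pH] by blast
qed

text \<open>A negative value of \<open>x\<close> would outweigh the value of \<open>c\<close> for a
  large exponent. Conversely take \<open>c\<close> in all of the finitely many minimal primes at
  which \<open>x\<close> is not a unit: there every \<open>c \<otimes> x [^] n\<close> has values at
  least 1, whatever \<open>n\<close> is.\<close>

lemma Hh_iff: "x \<in> Hh \<longleftrightarrow> x \<in> carrier Q \<and> (\<forall>P\<in>X. \<forall>i<s P. 0 \<le> w P i x)"
proof
  assume "x \<in> Hh"
  then obtain c where c: "x \<in> carrier Q" "c \<in> H" "\<And>n::nat. c \<otimes> (x [^] n) \<in> H"
    unfolding complete_int_closure_def by blast
  have "0 \<le> w P i x" if P: "P \<in> X" "i < s P" for P i
  proof (rule ccontr)
    assume neg: "\<not> 0 \<le> w P i x"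
    define n where "n = nat (w P i c + 1)"
    have wc: "0 \<le> w P i c" by (rule w_D[OF P(1) H_D[OF P(1) c(2)] P(2)])
    then have n: "int n = w P i c + 1" unfolding n_def by simp
    have "w P i (c \<otimes> (x [^] n)) = w P i c + int n * w P i x"
      using w_mult[OF P H_carrier[OF c(2)], of "x [^] n"] w_pow[OF P c(1)] c(1) by simp
    moreover have "0 \<le> w P i (c \<otimes> (x [^] n))" by (rule w_D[OF P(1) H_D[OF P(1) c(3)] P(2)])
    moreover have "int n * w P i x \<le> int n * (- 1)" using neg by (intro mult_left_mono) auto
    ultimately show False using n by linarith
  qed
  then show "x \<in> carrier Q \<and> (\<forall>P\<in>X. \<forall>i<s P. 0 \<le> w P i x)" using c(1) by blast
next
  assume x: "x \<in> carrier Q \<and> (\<forall>P\<in>X. \<forall>i<s P. 0 \<le> w P i x)"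
  then have xc: "x \<in> carrier Q" by blast
  obtain c where c: "c \<in> H" "\<forall>P\<in>{P \<in> X. x \<notin> DU P}. c \<in> P"
    using prime_intersection[OF finite_not_DU[OF xc]] by blast
  have "c \<otimes> x [^] n \<in> H" for n :: nat
    unfolding H_iff
  proof (intro conjI ballI)
    show "c \<otimes> x [^] n \<in> carrier Q" using H_carrier[OF c(1)] xc by simp
    fix P assume P: "P \<in> X"
    show "c \<otimes> x [^] n \<in> D P"
    proof (cases "x \<in> DU P")
      case True
      show ?thesis by (rule D_mult[OF P H_D[OF P c(1)] DU_D[OF DU_pow[OF P True]]])
    next
      case False
      then have cP: "c \<in> P" using c(2) P by blast
      show ?thesis
      proof (rule w_ge_one_D[OF P], use H_carrier[OF c(1)] xc in simp, intro allI impI)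
        fix i assume i: "i < s P"
        have "w P i (c \<otimes> x [^] n) = w P i c + int n * w P i x"
          using w_mult[OF P i H_carrier[OF c(1)], of "x [^] n"] w_pow[OF P i xc] xc by simp
        moreover have "0 \<le> int n * w P i x" using x P i by simp
        ultimately show "1 \<le> w P i (c \<otimes> x [^] n)" using prime_w[OF P cP i] by linarith
      qed
    qed
  qed
  then show "x \<in> Hh" unfolding complete_int_closure_def using xc c(1) by blast
qed

lemma H_sub_Hh: "H \<subseteq> Hh"
  using Hh_iff H_carrier w_D H_D by blast

lemma Hh_mult: "x \<in> Hh \<Longrightarrow> y \<in> Hh \<Longrightarrow> x \<otimes> y \<in> Hh"
  unfolding Hh_iff by (simp add: w_mult)

lemma Hh_carrier: "x \<in> Hh \<Longrightarrow> x \<in> carrier Q"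
  unfolding Hh_iff by blast

lemma Hh_one: "\<one> \<in> Hh"
  using H_sub_Hh H_one by blast

lemma Hh_primeD:
  assumes P: "prime_s_ideal Q Hh P"
  shows "P \<subseteq> Hh" "a \<in> P \<Longrightarrow> h \<in> Hh \<Longrightarrow> a \<otimes> h \<in> P" "a \<in> Hh \<Longrightarrow> b \<in> Hh \<Longrightarrow> a \<otimes> b \<in> P \<Longrightarrow> a \<in> P \<or> b \<in> P" "\<one> \<notin> P"
proof -
  have id: "P \<subseteq> Hh" "P <#> Hh = P" "P \<noteq> Hh" "\<And>a b. a \<in> Hh \<Longrightarrow> b \<in> Hh \<Longrightarrow> a \<otimes> b \<in> P \<Longrightarrow> a \<in> P \<or> b \<in> P"
    using P unfolding prime_s_ideal_def s_ideal_def by blast+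
  show "P \<subseteq> Hh" by (rule id(1))
  show mult: "a \<otimes> h \<in> P" if "a \<in> P" "h \<in> Hh" for a h using id(2) that unfolding set_mult_def by blast
  show "a \<in> Hh \<Longrightarrow> b \<in> Hh \<Longrightarrow> a \<otimes> b \<in> P \<Longrightarrow> a \<in> P \<or> b \<in> P" by (rule id(4))
  show "\<one> \<notin> P"
  proof
    assume "\<one> \<in> P"
    then have "h \<in> P" if "h \<in> Hh" for h using mult[OF _ that, of \<one>] Hh_carrier[OF that] by simp
    then show False using id(1,3) by blast
  qed
qed

section \<open>The minimal primes of the complete integral closure\<close>

definition "PP P i = {x \<in> Hh. 0 < w P i x}"

lemma PP_prime:
  assumes P: "P \<in> X" "i < s P"
  shows "prime_s_ideal Q Hh (PP P i)"
proof -
  have nn: "0 \<le> w P i x" if "x \<in> Hh" for x using that P unfolding Hh_iff by blast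
  have mult: "w P i (x \<otimes> y) = w P i x + w P i y" if "x \<in> Hh" "y \<in> Hh" for x y
    using w_mult[OF P Hh_carrier Hh_carrier] that .
  have ideal: "x \<otimes> y \<in> PP P i" if xy: "x \<in> PP P i" "y \<in> Hh" for x y
  proof -
    have x: "x \<in> Hh" "0 < w P i x" using xy(1) unfolding PP_def by blast+
    show ?thesis unfolding PP_def using Hh_mult[OF x(1) xy(2)] mult[OF x(1) xy(2)] nn[OF xy(2)] x(2) by simp
  qed
  have sub: "PP P i \<subseteq> Hh" unfolding PP_def by blast
  have "PP P i <#> Hh = PP P i"
  proof (intro subset_antisym subsetI)
    fix z assume "z \<in> PP P i <#> Hh"
    then obtain x y where "x \<in> PP P i" "y \<in> Hh" "z = x \<otimes> y" unfolding set_mult_def by blast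
    then show "z \<in> PP P i" using ideal by simp
  next
    fix x assume x: "x \<in> PP P i"
    have "x \<otimes> \<one> \<in> PP P i <#> Hh" unfolding set_mult_def using x Hh_one by blast
    then show "x \<in> PP P i <#> Hh" using Hh_carrier[OF subsetD[OF sub x]] by simp
  qed
  moreover have "\<one> \<notin> PP P i" unfolding PP_def using w_one[OF P] by simp
  moreover have "x \<in> PP P i \<or> y \<in> PP P i" if xy: "x \<in> Hh" "y \<in> Hh" "x \<otimes> y \<in> PP P i" for x y
  proof -
    have "0 < w P i x + w P i y" using xy(3) mult[OF xy(1,2)] unfolding PP_def by simp
    then have "0 < w P i x \<or> 0 < w P i y" by linarith
    then show ?thesis unfolding PP_def using xy(1,2) by blast
  qed
  ultimately show ?thesis unfolding prime_s_ideal_def s_ideal_def using sub Hh_one by blast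
qed

lemma PP_Int_H:
  assumes P: "P \<in> X" "i < s P"
  shows "PP P i \<inter> H = P"
proof (intro subset_antisym subsetI)
  fix x assume "x \<in> PP P i \<inter> H"
  then have x: "x \<in> H" "0 < w P i x" unfolding PP_def by blast+
  then show "x \<in> P" using prime_iff_not_DU[OF P(1) x(1)] w_DU[OF P(1) _ P(2), of x] by auto
next
  fix x assume x: "x \<in> P"
  have "x \<in> H" using primeD(1)[OF P(1)] x by blast
  then show "x \<in> PP P i \<inter> H" unfolding PP_def using prime_w[OF P(1) x P(2)] H_sub_Hh by auto
qed

lemma PP_nonempty: "P \<in> X \<Longrightarrow> i < s P \<Longrightarrow> PP P i \<noteq> {}"
  using PP_Int_H[of P i] primeD(5)[of P] by blast

text \<open>Fix \<open>y\<close> in \<open>P'\<close>; only finitely many valuations are nonzero on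
  it. If \<open>P'\<close> contained no centre, a product \<open>c\<close> of elements outside
  \<open>P'\<close> would be positive at all of these valuations. A high power of \<open>c\<close>
  is then divisible by \<open>y\<close> in \<open>Hh\<close>, hence lies in \<open>P'\<close>,
  against primeness.\<close>

lemma Hh_prime_contains:
  assumes P': "prime_s_ideal Q Hh P'" "P' \<noteq> {}"
  shows "\<exists>P\<in>X. \<exists>i<s P. PP P i \<subseteq> P'"
proof (rule ccontr)
  assume no: "\<not> ?thesis"
  note pr = Hh_primeD[OF P'(1)]
  obtain y where y: "y \<in> P'" using P'(2) by blast
  have yH: "y \<in> Hh" using pr(1) y by blast
  note yc = Hh_carrier[OF yH]
  define T where "T = Sigma {P \<in> X. y \<notin> DU P} (\<lambda>P. {..<s P})"
  have fin: "finite T" unfolding T_def using finite_not_DU[OF yc] by (intro finite_SigmaI) auto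
  have prod: "\<exists>c\<in>Hh. c \<notin> P' \<and> (\<forall>(P, i)\<in>T'. 0 < w P i c)" if "finite T'" "T' \<subseteq> Sigma X (\<lambda>P. {..<s P})" for T'
    using that
  proof (induction T' rule: finite_induct)
    case empty
    show ?case using Hh_one pr(4) by blast
  next
    case (insert t T')
    then obtain c where c: "c \<in> Hh" "c \<notin> P'" "\<forall>(P, i)\<in>T'. 0 < w P i c" by auto
    obtain P i where t: "t = (P, i)" "P \<in> X" "i < s P" using insert.prems by auto
    obtain z where z: "z \<in> PP P i" "z \<notin> P'" using no t(2,3) by blast
    have zH: "z \<in> Hh" "0 < w P i z" using z(1) unfolding PP_def by blast+
    have "c \<otimes> z \<notin> P'" using pr(3)[OF c(1) zH(1)] c(2) z(2) by blast
    moreover have "0 < w P' j (c \<otimes> z)" if Pj: "(P', j) \<in> insert t T'" for P' j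
    proof -
      have P': "P' \<in> X" "j < s P'" using Pj insert.prems by auto
      have eq: "w P' j (c \<otimes> z) = w P' j c + w P' j z" by (rule w_mult[OF P' Hh_carrier[OF c(1)] Hh_carrier[OF zH(1)]])
      have nn: "0 \<le> w P' j c" "0 \<le> w P' j z" using c(1) zH(1) P' unfolding Hh_iff by blast+
      show ?thesis
      proof (cases "(P', j) \<in> T'")
        case True
        then have "0 < w P' j c" using c(3) by blast
        then show ?thesis unfolding eq using nn(2) by linarith
      next
        case False
        then have "0 < w P' j z" using Pj t(1) zH(2) by simp
        then show ?thesis unfolding eq using nn(1) by linarith
      qed
    qed
    ultimately show ?case using Hh_mult[OF c(1) zH(1)] by (intro bexI[of _ "c \<otimes> z"]) auto
  qed
  obtain c where c: "c \<in> Hh" "c \<notin> P'" "\<forall>(P, i)\<in>T. 0 < w P i c"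
    using prod[OF fin] unfolding T_def by blast
  note cc = Hh_carrier[OF c(1)]
  have pow: "c [^] n \<in> Hh \<and> c [^] n \<notin> P'" for n :: nat
    by (induction n) (use pr(3,4) c(1,2) Hh_one Hh_mult in auto)
  define n where "n = nat (\<Sum>(P, i)\<in>T. w P i y)"
  have nn: "0 \<le> w P i y" if "(P, i) \<in> T" for P i using yH that unfolding Hh_iff T_def by blast
  then have sum: "0 \<le> (\<Sum>(P, i)\<in>T. w P i y)" by (intro sum_nonneg) auto
  have le: "w P i y \<le> int n" if Pi: "(P, i) \<in> T" for P i
  proof -
    have "(\<lambda>(P, i). w P i y) (P, i) \<le> (\<Sum>(P, i)\<in>T. w P i y)" by (rule member_le_sum[OF Pi _ fin]) (use nn in auto)
    then show ?thesis unfolding n_def using sum by simp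
  qed
  have "c [^] n \<otimes> inv y \<in> Hh"
    unfolding Hh_iff
  proof (intro conjI ballI allI impI)
    show "c [^] n \<otimes> inv y \<in> carrier Q" using cc yc by simp
    fix P i assume P: "P \<in> X" "i < s P"
    have eq: "w P i (c [^] n \<otimes> inv y) = int n * w P i c - w P i y"
      using w_mult[OF P, of "c [^] n" "inv y"] w_pow[OF P cc] w_inv[OF P yc] cc yc by simp
    show "0 \<le> w P i (c [^] n \<otimes> inv y)"
    proof (cases "(P, i) \<in> T")
      case True
      then have "0 < w P i c" using c(3) by blast
      then have "int n * 1 \<le> int n * w P i c" by (intro mult_left_mono) auto
      then show ?thesis unfolding eq using le[OF True] by linarith
    next
      case False
      then have "w P i y = 0" using P w_DU[OF P(1) _ P(2)] unfolding T_def by auto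
      moreover have "0 \<le> w P i c" using c(1) P unfolding Hh_iff by blast
      ultimately show ?thesis unfolding eq by simp
    qed
  qed
  then have "y \<otimes> (c [^] n \<otimes> inv y) \<in> P'" by (rule pr(2)[OF y])
  moreover have "y \<otimes> (c [^] n \<otimes> inv y) = c [^] n"
    using div_mult[of "c [^] n" y] m_comm[of "c [^] n \<otimes> inv y" y] cc yc by simp
  ultimately show False using pow by simp
qed

text \<open>Over different minimal primes of \<open>H\<close> the contractions are incomparable.
  Over the same one, an element of value 0 at index \<open>j\<close> and value 1 at the other
  indices, made global by \<open>approximation\<close>, separates the centres.\<close>

lemma PP_subset:
  assumes P: "P \<in> X" "i < s P" "P' \<in> X" "j < s P'" "PP P i \<subseteq> PP P' j"
  shows "P = P' \<and> i = j"
proof (rule ccontr)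
  assume ne: "\<not> ?thesis"
  show False
  proof (cases "P = P'")
    case False
    obtain c where c: "c \<in> P" "c \<notin> P'" by (rule prime_not_subset[OF P(1,3) False])
    have "c \<in> PP P i \<inter> H" unfolding PP_Int_H[OF P(1,2)] by (rule c(1))
    then have "c \<in> PP P' j \<inter> H" using P(5) by blast
    then show False using c(2) unfolding PP_Int_H[OF P(3,4)] by blast
  next
    case True
    then have ij: "i \<noteq> j" using ne by blast
    obtain u where u: "u \<in> carrier Q" "\<forall>k<s P. w P k u = (if k = j then 0 else 1)"
      using w_surj[OF P(1), of "\<lambda>k. if k = j then 0 else 1"] by blast
    obtain y where y: "y \<in> carrier Q" "y \<otimes> inv (if P = P then u else \<one>) \<in> DU P" "\<forall>P'\<in>X. y \<otimes> inv (if P' = P then u else \<one>) \<in> D P'"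
      by (rule approximation[OF fam_single[OF u(1), of P] P(1)])
    have eq: "w P k y = w P k u" if k: "k < s P" for k
      by (rule w_DU_eq[OF P(1) k y(1) u(1)]) (use y(2) in simp)
    have "y \<in> Hh" unfolding Hh_iff
    proof (intro conjI ballI allI impI y(1))
      fix P' k assume P': "P' \<in> X" "k < s P'"
      show "0 \<le> w P' k y"
      proof (cases "P' = P")
        case True
        then show ?thesis using P'(2) eq[of k] u(2) by simp
      next
        case False
        then have "y \<in> D P'" using bspec[OF y(3) P'(1)] y(1) by simp
        then show ?thesis using w_D[OF P'(1) _ P'(2)] by blast
      qed
    qed
    then have "y \<in> PP P i" unfolding PP_def using eq[OF P(2)] u(2) P(2) ij by simp
    then have "0 < w P' j y" using P(5) unfolding PP_def by blast
    moreover have "w P' j y = 0" using eq[of j] u(2) P(4) True by simp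
    ultimately show False by simp
  qed
qed

lemma Hh_minimal_primes: "minimal_primes Q Hh = {PP P i | P i. P \<in> X \<and> i < s P}"
proof (intro subset_antisym subsetI)
  fix P' assume P': "P' \<in> minimal_primes Q Hh"
  then have pr: "prime_s_ideal Q Hh P'" "P' \<noteq> {}"
    "\<And>P. prime_s_ideal Q Hh P \<Longrightarrow> P \<noteq> {} \<Longrightarrow> P \<subseteq> P' \<Longrightarrow> P = P'" unfolding minimal_primes_def by blast+
  obtain P i where P: "P \<in> X" "i < s P" "PP P i \<subseteq> P'" using Hh_prime_contains[OF pr(1,2)] by blast
  have "PP P i = P'" by (rule pr(3)[OF PP_prime[OF P(1,2)] PP_nonempty[OF P(1,2)] P(3)])
  then show "P' \<in> {PP P i | P i. P \<in> X \<and> i < s P}" using P(1,2) by blast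
next
  fix P' assume "P' \<in> {PP P i | P i. P \<in> X \<and> i < s P}"
  then obtain P i where P: "P \<in> X" "i < s P" and P': "P' = PP P i" by blast
  have "R = PP P i" if R: "prime_s_ideal Q Hh R" "R \<noteq> {}" "R \<subseteq> PP P i" for R
  proof -
    obtain P1 j where P1: "P1 \<in> X" "j < s P1" "PP P1 j \<subseteq> R" using Hh_prime_contains[OF R(1,2)] by blast
    have "P1 = P \<and> j = i" by (rule PP_subset[OF P1(1,2) P]) (use P1(3) R(3) in blast)
    then show ?thesis using P1(3) R(3) by blast
  qed
  then show "P' \<in> minimal_primes Q Hh" unfolding P' minimal_primes_def
    using PP_prime[OF P] PP_nonempty[OF P] by blast
qed

lemma contraction_bij_iff: "bij_betw (\<lambda>P. P \<inter> H) (minimal_primes Q Hh) X \<longleftrightarrow> (\<forall>P\<in>X. s P = 1)"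
proof
  assume bij: "bij_betw (\<lambda>P. P \<inter> H) (minimal_primes Q Hh) X"
  show "\<forall>P\<in>X. s P = 1"
  proof (rule ballI, rule ccontr)
    fix P assume P: "P \<in> X" "s P \<noteq> 1"
    then have s: "0 < s P" "1 < s P" using s_pos[OF P(1)] by simp_all
    have "PP P 0 = PP P 1"
    proof (rule inj_onD[OF bij_betw_imp_inj_on[OF bij]])
      show "PP P 0 \<inter> H = PP P 1 \<inter> H" unfolding PP_Int_H[OF P(1) s(1)] PP_Int_H[OF P(1) s(2)] ..
      show "PP P 0 \<in> minimal_primes Q Hh" "PP P 1 \<in> minimal_primes Q Hh"
        unfolding Hh_minimal_primes using P(1) s by blast+
    qed
    then show False using PP_subset[OF P(1) s(1) P(1) s(2)] by simp
  qed
next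
  assume s1: "\<forall>P\<in>X. s P = 1"
  have eq: "minimal_primes Q Hh = (\<lambda>P. PP P 0) ` X"
  proof (intro subset_antisym subsetI)
    fix R assume "R \<in> minimal_primes Q Hh"
    then obtain P i where "P \<in> X" "i < s P" "R = PP P i" unfolding Hh_minimal_primes by blast
    then show "R \<in> (\<lambda>P. PP P 0) ` X" using s1 by simp
  qed (use s_pos in \<open>auto simp: Hh_minimal_primes\<close>)
  have "PP P 0 \<inter> H = P" if "P \<in> X" for P by (rule PP_Int_H[OF that s_pos[OF that]])
  then show "bij_betw (\<lambda>P. P \<inter> H) (minimal_primes Q Hh) X"
    unfolding eq by (intro bij_betw_byWitness[where f' = "\<lambda>P. PP P 0"]) auto
qed

end

section \<open>Classes of prime ideals\<close>

context weakly_krull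
begin

text \<open>An element of the conductor outside \<open>P\<close> is a unit at \<open>P\<close>.
  Approximating \<open>x\<close> at \<open>P\<close> by an element \<open>y\<close> of
  \<open>Hh\<close> and multiplying \<open>y\<close> into \<open>H\<close> shows that the local
  monoid contains everything with nonnegative values.\<close>

lemma D_if_conductor:
  assumes P: "P \<in> X" "\<not> conductor Q H \<subseteq> P" and x: "x \<in> carrier Q" "\<forall>i<s P. 0 \<le> w P i x"
  shows "x \<in> D P"
proof -
  obtain f where f: "f \<in> conductor Q H" "f \<notin> P" using P(2) by blast
  have fc: "f \<in> carrier Q" and fH: "\<And>y. y \<in> Hh \<Longrightarrow> f \<otimes> y \<in> H"
    using f(1) unfolding conductor_def colon_def l_coset_def by blast+
  have "f \<in> H" using fH[OF Hh_one] fc by simp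
  then have fU: "f \<in> DU P" using H_DU_iff[OF P(1)] f(2) by blast
  obtain y where y: "y \<in> carrier Q" "y \<otimes> inv (if P = P then x else \<one>) \<in> DU P" "\<forall>P'\<in>X. y \<otimes> inv (if P' = P then x else \<one>) \<in> D P'"
    by (rule approximation[OF fam_single[OF x(1), of P] P(1)])
  have yx: "y \<otimes> inv x \<in> DU P" using y(2) by simp
  have "y \<in> Hh" unfolding Hh_iff
  proof (intro conjI ballI allI impI y(1))
    fix P' k assume P': "P' \<in> X" "k < s P'"
    show "0 \<le> w P' k y"
    proof (cases "P' = P")
      case True
      then show ?thesis using w_DU_eq[OF P(1) _ y(1) x(1) yx] P'(2) x(2) by simp
    next
      case False
      then have "y \<in> D P'" using bspec[OF y(3) P'(1)] y(1) by simp
      then show ?thesis using w_D[OF P'(1) _ P'(2)] by blast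
    qed
  qed
  then have fy: "f \<otimes> y \<in> D P" using fH H_D[OF P(1)] by blast
  have "(y \<otimes> f) \<otimes> inv f \<in> D P"
    using D_mult[OF P(1) fy DU_D[OF DU_inv[OF fU]]] m_comm[OF fc y(1)] by simp
  then have "y \<in> D P" using mult_div[OF y(1) fc] by simp
  then have "y \<otimes> inv (y \<otimes> inv x) \<in> D P" by (rule D_mult[OF P(1) _ DU_D[OF DU_inv[OF yx]]])
  moreover have "y \<otimes> inv (y \<otimes> inv x) = (x \<otimes> y) \<otimes> inv y"
    unfolding inv_div[OF y(1) x(1)] using m_lcomm[OF y(1) x(1)] m_assoc[OF x(1) y(1)] y(1) by simp
  ultimately show ?thesis using mult_div[OF x(1) y(1)] by simp
qed

text \<open>Here \<open>D P\<close> consists of all elements with nonnegative values. Rank at least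
  2 is impossible, since values 0 and 1 could not occur together in \<open>D P\<close>. In rank 1
  all elements of value 0 are units, so a \<open>P\<close>-primary ideal is determined by its value,
  and \<open>P\<close> is the one of value 1.\<close>

lemma free_prime:
  assumes P: "P \<in> X" "\<not> conductor Q H \<subseteq> P"
  shows "J.free P \<and> J.unif P = P"
proof -
  note D = D_if_conductor[OF P]
  have s1: "s P = 1"
  proof (rule ccontr)
    assume "s P \<noteq> 1"
    then have s2: "1 < s P" using s_pos[OF P(1)] by simp
    obtain u where u: "u \<in> carrier Q" "\<forall>i<s P. w P i u = (if i = 0 then 0 else 1)"
      using w_surj[OF P(1), of "\<lambda>i. if i = 0 then 0 else 1"] by blast
    have uD: "u \<in> D P" by (rule D[OF u(1)]) (use u(2) in simp)
    have "u \<in> DU P" using D_unit_or_pos[OF P(1) uD] u(2) s_pos[OF P(1)] by simp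
    then have "w P 1 u = 0" by (rule w_DU[OF P(1) _ s2])
    then show False using u(2) s2 by simp
  qed
  have DU0: "x \<in> DU P" if x: "x \<in> carrier Q" "w P 0 x = 0" for x
    using D_unit_or_pos[OF P(1) D[OF x(1)]] x(2) s1 by simp
  have unique: "A = B" if A: "A \<in> J.primary P" and B: "B \<in> J.primary P" and eq: "val P 0 A = val P 0 B" for A B
  proof -
    obtain x where x: "ifam x" "A = idl x" by (rule J_cases[OF J.primary_closed[OF A]])
    obtain y where y: "ifam y" "B = idl y" by (rule J_cases[OF J.primary_closed[OF B]])
    show ?thesis unfolding x(2) y(2)
    proof (rule idl_eqI[OF x(1) y(1)])
      fix P' assume P': "P' \<in> X"
      show "x P' \<otimes> inv (y P') \<in> DU P'"
      proof (cases "P' = P")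
        case True
        note c = ifamD(3)[OF x(1) P(1)] ifamD(3)[OF y(1) P(1)]
        have "w P 0 (x P) = w P 0 (y P)"
          using val_idl[OF x(1) P(1) s_pos[OF P(1)]] val_idl[OF y(1) P(1) s_pos[OF P(1)]] eq unfolding x(2) y(2) by simp
        then have "w P 0 (x P \<otimes> inv (y P)) = 0"
          using w_mult[OF P(1) s_pos[OF P(1)] c(1) inv_closed[OF c(2)]] w_inv[OF P(1) s_pos[OF P(1)] c(2)] by simp
        then show ?thesis unfolding True using c by (intro DU0) auto
      next
        case False
        then have "val P' 0 (idl x) = 0" "val P' 0 (idl y) = 0"
          using A B P' unfolding J.primary_def x(2) y(2) by blast+
        then have "x P' \<in> DU P'" "y P' \<in> DU P'" unfolding val_zero[OF x(1) P'] val_zero[OF y(1) P'] .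
        then show ?thesis by (intro DU_mult[OF P' _ DU_inv])
      qed
    qed
  qed
  have unif: "J.unif P \<in> J.primary P" "val P 0 (J.unif P) = 1"
    using J.unif(1)[OF P(1)] J.unif(2)[OF P(1) s_pos[OF P(1)]] by blast+
  have "x = J.unif P" if x: "x \<in> J.atoms_at P" for x
  proof -
    obtain i where "i < s P" "val P i x = 1" by (rule J.atom_val[OF P(1) x])
    then have "val P 0 x = 1" using s1 by simp
    then show ?thesis using unique[of x "J.unif P"] x unif by simp
  qed
  then have free: "J.free P" unfolding J.free_def using J.unif_atom[OF P(1)] P(1) s1 by blast
  obtain u where u: "u \<in> carrier Q" "\<forall>i<s P. w P i u = 1" using w_surj[OF P(1), of "\<lambda>_. 1"] by blast
  have "u \<in> D P" by (rule D[OF u(1)]) (use u(2) in simp)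
  note i = ifam_single[OF P(1) this]
  \<comment> \<open>For an element of \<open>H\<close>, membership in \<open>P\<close> means
    positive value at \<open>P\<close>, that is, local divisibility by the element \<open>u\<close>
    of value 1.\<close>
  have PI: "P = idl (\<lambda>P'. if P' = P then u else \<one>)"
  proof (intro subset_antisym subsetI)
    fix p assume p: "p \<in> P"
    then have pH: "p \<in> H" using primeD(1)[OF P(1)] by blast
    note pc = H_carrier[OF pH]
    have "p \<otimes> inv (if P' = P then u else \<one>) \<in> D P'" if P': "P' \<in> X" for P'
    proof (cases "P' = P")
      case True
      have "p \<otimes> inv u \<in> D P"
      proof (rule D)
        show "\<forall>i<s P. 0 \<le> w P i (p \<otimes> inv u)"
        proof (intro allI impI)
          fix i assume i: "i < s P"
          show "0 \<le> w P i (p \<otimes> inv u)"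
            using prime_w[OF P(1) p i] w_mult[OF P(1) i pc inv_closed[OF u(1)]] w_inv[OF P(1) i u(1)] u(2) i by simp
        qed
      qed (use pc u(1) in simp)
      then show ?thesis using True by simp
    next
      case False
      then show ?thesis using H_D[OF P' pH] pc by simp
    qed
    then show "p \<in> idl (\<lambda>P'. if P' = P then u else \<one>)" unfolding idl_def using pc by blast
  next
    fix y assume "y \<in> idl (\<lambda>P'. if P' = P then u else \<one>)"
    then have y: "y \<in> carrier Q" "\<And>P'. P' \<in> X \<Longrightarrow> y \<otimes> inv (if P' = P then u else \<one>) \<in> D P'" unfolding idl_def by blast+
    have yu: "y \<otimes> inv u \<in> D P" using y(2)[OF P(1)] by simp
    have "0 \<le> w P 0 (y \<otimes> inv u)" by (rule w_D[OF P(1) yu s_pos[OF P(1)]])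
    then have wy: "1 \<le> w P 0 y"
      using w_mult[OF P(1) s_pos[OF P(1)] y(1) inv_closed[OF u(1)]] w_inv[OF P(1) s_pos[OF P(1)] u(1)] u(2) s_pos[OF P(1)] by simp
    have "y \<in> D P'" if P': "P' \<in> X" for P'
    proof (cases "P' = P")
      case True
      then show ?thesis using w_ge_one_D[OF P(1) y(1)] wy s1 by simp
    next
      case False
      then show ?thesis using y(2)[OF P'] y(1) by simp
    qed
    then have "y \<in> H" unfolding H_iff using y(1) by blast
    moreover have "y \<notin> DU P" using w_DU[OF P(1) _ s_pos[OF P(1)], of y] wy by auto
    ultimately show "y \<in> P" using prime_iff_not_DU[OF P(1)] by blast
  qed
  have "P \<in> carrier J" using idl_J[OF i] unfolding PI[symmetric] .
  moreover have "val P' 0 P = 0" if "P' \<in> X" "P' \<noteq> P" for P'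
    using val_zero[OF i that(1)] DU_one[OF that(1)] that(2) unfolding PI[symmetric] by simp
  moreover have "int (val P 0 P) = 1"
    using val_idl[OF i P(1) s_pos[OF P(1)]] u(2) s_pos[OF P(1)] unfolding PI[symmetric] by simp
  ultimately have "P \<in> J.primary P" "val P 0 P = 1" unfolding J.primary_def by auto
  then have "J.unif P = P" using unique[OF unif(1)] unif(2) by simp
  then show ?thesis using free by blast
qed

lemma J_class_monoid:
  assumes "finite (carrier G)" "\<forall>g\<in>carrier G. \<exists>P\<in>X. \<not> conductor Q H \<subseteq> P \<and> P \<in> g"
  shows "class_monoid J X s val G (v_class Q H)"
proof (intro class_monoid.intro class_monoid_axioms.intro J_primary G_group cl_hom assms(1))
  fix g assume g: "g \<in> carrier G"
  obtain P where P: "P \<in> X" "\<not> conductor Q H \<subseteq> P" "P \<in> g" using assms(2) g by blast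
  have "v_class Q H (J.unif P) = g" using free_prime[OF P(1,2)] class_memD[OF g P(3)] by simp
  then show "\<exists>q. J.free q \<and> v_class Q H (J.unif q) = g" using free_prime[OF P(1,2)] by blast
qed

text \<open>Since the conductor is proper, \<open>Hh\<close> is larger than \<open>H\<close>. In
  rank 1 this yields some \<open>e\<close> of value 0 outside a local monoid; then \<open>u\<close>
  and \<open>e \<otimes> u\<close>, with \<open>u\<close> of value 1, give two different atoms, at
  least one of which is not the uniformizer.\<close>

lemma nontrivial_atom:
  assumes s1: "\<forall>P\<in>X. s P = 1"
  obtains P A where "P \<in> X" "A \<in> J.atoms_at P" "A \<noteq> J.unif P"
proof -
  have "\<exists>P\<in>X. \<exists>e\<in>carrier Q. 0 \<le> w P 0 e \<and> e \<notin> D P"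
  proof (rule ccontr)
    assume no: "\<not> ?thesis"
    have "Hh \<subseteq> H"
    proof
      fix x assume "x \<in> Hh"
      then have "x \<in> carrier Q" "\<forall>P\<in>X. 0 \<le> w P 0 x" unfolding Hh_iff using s_pos by blast+
      then show "x \<in> H" unfolding H_iff using no by blast
    qed
    then have "H \<subseteq> conductor Q H"
      unfolding conductor_def colon_def l_coset_def using H_carrier H_mult by blast
    then show False using conductor_proper by blast
  qed
  then obtain P e where P: "P \<in> X" and e: "e \<in> carrier Q" "0 \<le> w P 0 e" "e \<notin> D P" by blast
  have D1: "x \<in> D P" if "x \<in> carrier Q" "1 \<le> w P 0 x" for x
    by (rule w_ge_one_D[OF P that(1)]) (use that(2) s1 P in simp)
  have e0: "w P 0 e = 0" using D1[OF e(1)] e(2,3) by linarith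
  obtain u where u: "u \<in> carrier Q" "\<forall>i<s P. w P i u = 1" using w_surj[OF P, of "\<lambda>_. 1"] by blast
  have wu: "w P 0 u = 1" using u(2) s_pos[OF P] by blast
  have weu: "w P 0 (e \<otimes> u) = 1" using w_mult[OF P s_pos[OF P] e(1) u(1)] wu e0 by simp
  have ec: "e \<otimes> u \<in> carrier Q" using e(1) u(1) by simp
  have uD: "u \<in> D P" "e \<otimes> u \<in> D P" using D1[OF u(1)] D1[OF ec] wu weu by simp_all
  have atom: "idl (\<lambda>P'. if P' = P then x else \<one>) \<in> J.atoms_at P" if x: "x \<in> D P" "w P 0 x = 1" for x
  proof -
    note i = ifam_single[OF P x(1)]
    have pr: "idl (\<lambda>P'. if P' = P then x else \<one>) \<in> J.primary P"
      unfolding J.primary_def using idl_J[OF i] val_zero[OF i] DU_one by simp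
    have "int (val P 0 (idl (\<lambda>P'. if P' = P then x else \<one>))) = 1" using val_idl[OF i P s_pos[OF P]] x(2) by simp
    then show ?thesis using J.atomI[OF P pr s_pos[OF P]] pr by simp
  qed
  have "idl (\<lambda>P'. if P' = P then e \<otimes> u else \<one>) \<noteq> idl (\<lambda>P'. if P' = P then u else \<one>)"
  proof
    assume "idl (\<lambda>P'. if P' = P then e \<otimes> u else \<one>) = idl (\<lambda>P'. if P' = P then u else \<one>)"
    then have "(e \<otimes> u) \<otimes> inv u \<in> DU P"
      using idl_DU[OF ifam_single[OF P uD(2)] ifam_single[OF P uD(1)] _ P] by simp
    then show False using mult_div[OF e(1) u(1)] DU_D e(3) by simp
  qed
  then show thesis using that[OF P atom[OF uD(1) wu]] that[OF P atom[OF uD(2) weu]] by metis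
qed

lemma colon_Hh:
  assumes x: "fam x" "gen S x"
  shows "colon Q Hh S = {y \<in> carrier Q. \<forall>P\<in>X. \<forall>i<s P. 0 \<le> w P i y + w P i (x P)}"
proof (intro subset_antisym subsetI)
  have c: "S \<subseteq> carrier Q" using x(2) unfolding gen_def by blast
  fix y assume "y \<in> colon Q Hh S"
  then have y: "y \<in> carrier Q" "\<And>t. t \<in> S \<Longrightarrow> y \<otimes> t \<in> Hh" unfolding colon_def l_coset_def by blast+
  have "0 \<le> w P i y + w P i (x P)" if P: "P \<in> X" "i < s P" for P i
  proof -
    obtain t where t: "t \<in> S" "t \<otimes> inv (x P) \<in> DU P" using x(2) P(1) unfolding gen_def by blast
    have tc: "t \<in> carrier Q" using t(1) c by blast
    have "0 \<le> w P i (y \<otimes> t)" using y(2)[OF t(1)] P unfolding Hh_iff by blast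
    then show ?thesis using w_mult[OF P y(1) tc] w_DU_eq[OF P tc fam_carrier[OF x(1) P(1)] t(2)] by simp
  qed
  then show "y \<in> {y \<in> carrier Q. \<forall>P\<in>X. \<forall>i<s P. 0 \<le> w P i y + w P i (x P)}" using y(1) by blast
next
  have c: "S \<subseteq> carrier Q" using x(2) unfolding gen_def by blast
  fix y assume "y \<in> {y \<in> carrier Q. \<forall>P\<in>X. \<forall>i<s P. 0 \<le> w P i y + w P i (x P)}"
  then have y: "y \<in> carrier Q" "\<And>P i. P \<in> X \<Longrightarrow> i < s P \<Longrightarrow> 0 \<le> w P i y + w P i (x P)" by blast+
  have "y \<otimes> t \<in> Hh" if t: "t \<in> S" for t
    unfolding Hh_iff
  proof (intro conjI ballI allI impI)
    have tc: "t \<in> carrier Q" using t c by blast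
    show "y \<otimes> t \<in> carrier Q" using y(1) tc by simp
    fix P i assume P: "P \<in> X" "i < s P"
    have "t \<otimes> inv (x P) \<in> D P" using x(2) t P(1) unfolding gen_def by blast
    from w_D[OF P(1) this P(2)] show "0 \<le> w P i (y \<otimes> t)"
      using w_mult[OF P y(1) tc] w_mult[OF P tc inv_closed[OF fam_carrier[OF x(1) P(1)]]]
        w_inv[OF P fam_carrier[OF x(1) P(1)]] y(2)[OF P] by simp
  qed
  then show "y \<in> colon Q Hh S" unfolding colon_def l_coset_def using y(1) by blast
qed

abbreviation "vh A \<equiv> v_class Q Hh (v_closure Q Hh A)"

text \<open>Over \<open>Hh\<close> only the values of the local generators count, so the extension
  of ideals forgets units of the overmonoid.\<close>

lemma v_closure_Hh_eq:
  assumes "fam x" "fam y" "\<And>P i. P \<in> X \<Longrightarrow> i < s P \<Longrightarrow> w P i (x P) = w P i (y P)"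
  shows "v_closure Q Hh (idl x) = v_closure Q Hh (idl y)"
  unfolding v_closure_def ideal_inv_def colon_Hh[OF assms(1) gen_idl[OF assms(1)]] colon_Hh[OF assms(2) gen_idl[OF assms(2)]]
  using assms(3) by simp

text \<open>A class over \<open>Hh\<close> is written as the plain set of closures of translates;
  equality of classes then reduces to translating sets.\<close>

lemma v_class_Hh: "v_class Q Hh V = (\<lambda>b. v_closure Q Hh ((b <# Hh) <#> V)) ` carrier Q"
  unfolding v_class_def r_coset_def principal_ideals_def frac_v_ideals_def v_mult_def by auto

lemma v_class_Hh_translate:
  assumes "V \<subseteq> carrier Q" "a \<in> carrier Q"
  shows "v_class Q Hh (a <# V) \<subseteq> v_class Q Hh V"
proof
  fix Y assume "Y \<in> v_class Q Hh (a <# V)"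
  then obtain b where b: "b \<in> carrier Q" "Y = v_closure Q Hh ((b <# Hh) <#> (a <# V))"
    unfolding v_class_Hh by (elim imageE) simp
  have eq: "(b \<otimes> h) \<otimes> (a \<otimes> v) = ((b \<otimes> a) \<otimes> h) \<otimes> v" if "h \<in> Hh" "v \<in> V" for h v
  proof -
    have c: "h \<in> carrier Q" "v \<in> carrier Q" using that assms(1) Hh_carrier by blast+
    show ?thesis using b(1) c assms(2) by (simp add: m_ac)
  qed
  have "(b <# Hh) <#> (a <# V) = ((b \<otimes> a) <# Hh) <#> V"
    unfolding set_mult_def l_coset_def using eq by fastforce
  then show "Y \<in> v_class Q Hh V"
    unfolding v_class_Hh b(2) using m_closed[OF b(1) assms(2)] by simp
qed

text \<open>The extended class map is well defined: if \<open>A\<close> is the principal ideal of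
  \<open>a\<close> times \<open>B\<close>, then the closure over \<open>Hh\<close> is translated by
  \<open>a\<close>. One inclusion suffices, as \<open>A\<close> and \<open>B\<close> may be
  exchanged.\<close>

lemma vh_eq:
  assumes A: "A \<in> carrier J" and B: "B \<in> carrier J" and eq: "v_class Q H A = v_class Q H B"
  shows "vh A \<subseteq> vh B"
proof -
  have "A \<in> N #>\<^bsub>F\<^esub> B"
    using F.rcos_self[OF J_sub_F[OF A] N_subgroup] eq unfolding v_class_def by simp
  then obtain a where a: "a \<in> carrier Q" "A = idl (\<lambda>_. a) \<otimes>\<^bsub>F\<^esub> B" unfolding r_coset_def using N_iff by auto
  obtain x where x: "ifam x" "B = idl x" by (rule J_cases[OF B])
  note fa = fam_const[OF a(1)] and fx = ifamD(1)[OF x(1)]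
  have Ax: "A = idl (\<lambda>P. a \<otimes> x P)" unfolding a(2) x(2) by (rule F_mult[OF fa fx])
  note fax = fam_mult[OF fa fx]
  define C where "C = colon Q Hh B"
  have wax: "w P i (a \<otimes> x P) = w P i a + w P i (x P)" if "P \<in> X" "i < s P" for P i
    using w_mult[OF that a(1) fam_carrier[OF fx that(1)]] .
  have CA: "y \<in> colon Q Hh A \<longleftrightarrow> y \<in> carrier Q \<and> y \<otimes> a \<in> C" for y
    unfolding C_def x(2) Ax colon_Hh[OF fx gen_idl[OF fx]] colon_Hh[OF fax gen_idl[OF fax]]
    using w_mult[OF _ _ _ a(1)] wax a(1) by (auto simp: add.assoc)
  have C: "C \<subseteq> carrier Q" unfolding C_def colon_def by blast
  define V where "V = v_closure Q Hh B"
  have V: "V = {z \<in> carrier Q. \<forall>y\<in>C. z \<otimes> y \<in> Hh}"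
    unfolding V_def C_def v_closure_def ideal_inv_def colon_def[of Q Hh "colon Q Hh B"] l_coset_def by blast
  have "v_closure Q Hh A = a <# V"
  proof (intro subset_antisym subsetI)
    fix z assume "z \<in> v_closure Q Hh A"
    then have z: "z \<in> carrier Q" "\<And>y. y \<in> colon Q Hh A \<Longrightarrow> z \<otimes> y \<in> Hh"
      unfolding v_closure_def ideal_inv_def colon_def[of Q Hh "colon Q Hh A"] l_coset_def by blast+
    have "(z \<otimes> inv a) \<otimes> y \<in> Hh" if y: "y \<in> C" for y
    proof -
      have yc: "y \<in> carrier Q" using y C by blast
      have "z \<otimes> (y \<otimes> inv a) \<in> Hh" by (rule z(2)) (use CA[of "y \<otimes> inv a"] div_mult[OF yc a(1)] y yc a(1) in simp)
      moreover have "z \<otimes> (y \<otimes> inv a) = (z \<otimes> inv a) \<otimes> y" using z(1) yc a(1) by (simp add: m_ac)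
      ultimately show ?thesis by simp
    qed
    then have "z \<otimes> inv a \<in> V" unfolding V using z(1) a(1) by simp
    moreover have "z = a \<otimes> (z \<otimes> inv a)" using div_mult[OF z(1) a(1)] m_comm[of "z \<otimes> inv a" a] z(1) a(1) by simp
    ultimately show "z \<in> a <# V" unfolding l_coset_def by blast
  next
    fix z assume "z \<in> a <# V"
    then obtain v where v: "v \<in> V" "z = a \<otimes> v" unfolding l_coset_def by blast
    have vc: "v \<in> carrier Q" using v(1) unfolding V by blast
    have zy: "z \<otimes> y \<in> Hh" if y: "y \<in> colon Q Hh A" for y
    proof -
      have yc: "y \<in> carrier Q" "y \<otimes> a \<in> C" using y CA by blast+
      have "v \<otimes> (y \<otimes> a) \<in> Hh" using v(1) yc(2) unfolding V by blast
      moreover have "v \<otimes> (y \<otimes> a) = z \<otimes> y" unfolding v(2) using vc yc(1) a(1) by (simp add: m_ac)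
      ultimately show ?thesis by simp
    qed
    have "z \<in> carrier Q" unfolding v(2) using a(1) vc by simp
    then show "z \<in> v_closure Q Hh A"
      unfolding v_closure_def ideal_inv_def colon_def[of Q Hh "colon Q Hh A"] l_coset_def using zy by blast
  qed
  moreover have "V \<subseteq> carrier Q" unfolding V by blast
  ultimately show ?thesis using v_class_Hh_translate[OF _ a(1)] unfolding V_def by simp
qed

lemma v_class_map_eq:
  assumes A: "A \<in> carrier J"
  shows "v_class_map Q H (v_class Q H A) = vh A"
  unfolding v_class_map_def
proof (rule the_elem_image_unique)
  show "{Aa \<in> carrier J. v_class Q H Aa = v_class Q H A} \<noteq> {}" using A by blast
  fix B assume "B \<in> {B \<in> carrier J. v_class Q H B = v_class Q H A}"
  then have B: "B \<in> carrier J" "v_class Q H B = v_class Q H A" by blast+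
  show "vh B = vh A" using vh_eq[OF B(1) A B(2)] vh_eq[OF A B(1) B(2)[symmetric]] by blast
qed

text \<open>In rank 1 all atoms at \<open>P\<close> have value 1, so they have the same closure over
  \<open>Hh\<close>; injectivity of the class map then identifies their classes.\<close>

lemma class_atoms_at:
  assumes s1: "\<forall>P\<in>X. s P = 1" and inj: "inj_on (v_class_map Q H) (carrier G)"
    and P: "P \<in> X" and A: "A \<in> J.atoms_at P"
  shows "v_class Q H A = v_class Q H (J.unif P)"
proof -
  define B where "B = J.unif P"
  have B: "B \<in> J.primary P" "val P 0 B = 1"
    unfolding B_def using J.unif(1)[OF P] J.unif(2)[OF P s_pos[OF P]] by blast+
  have A': "A \<in> J.primary P" using A by blast
  obtain i where "i < s P" "val P i A = 1" by (rule J.atom_val[OF P A])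
  then have A1: "val P 0 A = 1" using s1 P by simp
  note c = J.primary_closed[OF A'] J.primary_closed[OF B(1)]
  obtain x where x: "ifam x" "A = idl x" by (rule J_cases[OF c(1)])
  obtain y where y: "ifam y" "B = idl y" by (rule J_cases[OF c(2)])
  have "v_closure Q Hh A = v_closure Q Hh B"
    unfolding x(2) y(2)
  proof (rule v_closure_Hh_eq[OF ifamD(1)[OF x(1)] ifamD(1)[OF y(1)]])
    fix P' i assume P': "P' \<in> X" "i < s P'"
    then have i: "i = 0" using s1 by simp
    have "val P' 0 A = val P' 0 B"
    proof (cases "P' = P")
      case False
      then show ?thesis using A' B(1) P'(1) unfolding J.primary_def by simp
    qed (use A1 B(2) in simp)
    then show "w P' i (x P') = w P' i (y P')"
      using val_idl[OF x(1) P'] val_idl[OF y(1) P'] unfolding i x(2) y(2) by simp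
  qed
  then have "v_class_map Q H (v_class Q H A) = v_class_map Q H (v_class Q H B)"
    unfolding v_class_map_eq[OF c(1)] v_class_map_eq[OF c(2)] by simp
  moreover have "v_class Q H A \<in> carrier G" "v_class Q H B \<in> carrier G"
    using cl_hom c unfolding hom_def by blast+
  ultimately show ?thesis using inj_onD[OF inj] unfolding B_def by blast
qed

end

section \<open>Localizations at minimal primes and the assembly of the results\<close>

context comm_group
begin

lemma minimal_primeD:
  assumes H: "submonoid H G" and P: "P \<in> minimal_primes G H"
  shows "\<one> \<in> H - P" "t \<in> H - P \<Longrightarrow> t' \<in> H - P \<Longrightarrow> t \<otimes> t' \<in> H - P"
proof -
  have "prime_s_ideal G H P" using P unfolding minimal_primes_def by blast
  then have id: "P \<subseteq> H" "P <#> H = P" "P \<noteq> H" "\<And>a b. a \<in> H \<Longrightarrow> b \<in> H \<Longrightarrow> a \<otimes> b \<in> P \<Longrightarrow> a \<in> P \<or> b \<in> P"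
    unfolding prime_s_ideal_def s_ideal_def by blast+
  show "t \<in> H - P \<Longrightarrow> t' \<in> H - P \<Longrightarrow> t \<otimes> t' \<in> H - P" using id(4) submonoid.m_closed[OF H] by blast
  have "\<one> \<notin> P"
  proof
    assume one: "\<one> \<in> P"
    have "h \<in> P" if h: "h \<in> H" for h
    proof -
      have "\<one> \<otimes> h \<in> P" using id(2) one h unfolding set_mult_def by blast
      then show ?thesis using submonoid.subset[OF H] h by auto
    qed
    then show False using id(1,3) by blast
  qed
  then show "\<one> \<in> H - P" using submonoid.one_closed[OF H] by blast
qed

lemma localization_quotients:
  assumes Q: "is_quotient_group G H" and P: "P \<in> minimal_primes G H" and x: "x \<in> carrier G"
  shows "\<exists>a\<in>localization G H P. \<exists>b\<in>localization G H P. x = a \<otimes> inv b"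
proof -
  have H: "submonoid H G" and q: "carrier G = {a \<otimes> inv b | a b. a \<in> H \<and> b \<in> H}"
    using Q unfolding is_quotient_group_def by blast+
  have "h \<in> localization G H P" if h: "h \<in> H" for h
  proof -
    have "h = h \<otimes> inv \<one>" using submonoid.subset[OF H] h by auto
    then show ?thesis unfolding localization_def using minimal_primeD(1)[OF H P] h by blast
  qed
  then show ?thesis using x unfolding q by blast
qed

text \<open>With \<open>T\<close> the product of the denominators of the square and the cube of
  \<open>x\<close>, both the square and the cube of \<open>T \<otimes> x\<close> lie in
  \<open>H\<close>; so \<open>T \<otimes> x\<close> does, and \<open>x\<close> is a fraction with
  denominator \<open>T\<close>.\<close>

lemma localization_seminormal:
  assumes H: "submonoid H G" "seminormal G H" and P: "P \<in> minimal_primes G H"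
  shows "seminormal G (localization G H P)"
  unfolding seminormal_def
proof (intro ballI impI)
  fix x assume x: "x \<in> carrier G" and sq: "x [^] (2::nat) \<in> localization G H P \<and> x [^] (3::nat) \<in> localization G H P"
  obtain a t where a: "a \<in> H" "t \<in> H - P" "x [^] (2::nat) = a \<otimes> inv t" using sq unfolding localization_def by blast
  obtain b u where b: "b \<in> H" "u \<in> H - P" "x [^] (3::nat) = b \<otimes> inv u" using sq unfolding localization_def by blast
  have Hc: "h \<in> carrier G" if "h \<in> H" for h using submonoid.subset[OF H(1)] that by blast
  have tu: "t \<in> H" "u \<in> H" using a(2) b(2) by blast+
  note c = Hc[OF tu(1)] Hc[OF tu(2)]
  have m: "h \<otimes> k \<in> H" if "h \<in> H" "k \<in> H" for h k using submonoid.m_closed[OF H(1) that] .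
  define T where "T = t \<otimes> u"
  have T: "T \<in> H" "T \<in> carrier G" unfolding T_def using m[OF tu] c by simp_all
  have a': "x [^] (2::nat) \<otimes> t = a" and b': "x [^] (3::nat) \<otimes> u = b"
    using div_eq_iff[of "x [^] (2::nat)" a t] div_eq_iff[of "x [^] (3::nat)" b u] a b c Hc x by simp_all
  have "(T \<otimes> x) [^] (2::nat) = (x [^] (2::nat) \<otimes> t) \<otimes> (u \<otimes> T)"
    unfolding nat_pow_distrib[OF T(2) x] using T(2) x c by (simp add: numeral_2_eq_2 T_def m_ac)
  then have two: "(T \<otimes> x) [^] (2::nat) \<in> H" unfolding a' using m[OF a(1) m[OF tu(2) T(1)]] by simp
  have "(T \<otimes> x) [^] (3::nat) = (x [^] (3::nat) \<otimes> u) \<otimes> (t \<otimes> (T \<otimes> T))"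
    unfolding nat_pow_distrib[OF T(2) x] using T(2) x c by (simp add: numeral_3_eq_3 T_def m_ac)
  then have three: "(T \<otimes> x) [^] (3::nat) \<in> H" unfolding b' using m[OF b(1) m[OF tu(1) m[OF T(1) T(1)]]] by simp
  have "T \<otimes> x \<in> H" using H(2) two three T(2) x unfolding seminormal_def by blast
  moreover have "x = (T \<otimes> x) \<otimes> inv T" using mult_div[OF x T(2)] m_comm[OF T(2) x] by simp
  moreover have "T \<in> H - P" unfolding T_def by (rule minimal_primeD(2)[OF H(1) P a(2) b(2)])
  ultimately show "x \<in> localization G H P" unfolding localization_def by blast
qed

end

lemma weakly_krull_exists:
  assumes Q: "is_quotient_group Q H" and sn: "seminormal Q H" and wk: "weakly_Krull Q H"
    and cond: "conductor Q H \<noteq> {}" "conductor Q H \<subset> H"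
    and fp: "\<forall>P\<in>minimal_primes Q H. finitely_primary Q (localization Q H P) (s P)"
  obtains w where "weakly_krull Q H s w"
proof -
  have cg: "comm_group Q" and H: "submonoid H Q" using Q unfolding is_quotient_group_def by blast+
  have "\<exists>w. primary_valuations Q (localization Q H P) (s P) w" if P: "P \<in> minimal_primes Q H" for P
    by (rule finitely_primary_valuations[OF cg bspec[OF fp P] comm_group.localization_seminormal[OF cg H sn P]
        comm_group.localization_quotients[OF cg Q P]])
  then have "\<forall>P\<in>minimal_primes Q H. \<exists>w. primary_valuations Q (localization Q H P) (s P) w" by blast
  from bchoice[OF this] obtain w where w: "\<forall>P\<in>minimal_primes Q H. primary_valuations Q (localization Q H P) (s P) (w P)" by blast
  have "weakly_krull Q H s w"
  proof (intro weakly_krull.intro weakly_krull_axioms.intro cg H wk cond)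
    fix x assume "x \<in> carrier Q"
    then show "\<exists>a\<in>H. \<exists>b\<in>H. x = a \<otimes>\<^bsub>Q\<^esub> inv\<^bsub>Q\<^esub> b" using Q unfolding is_quotient_group_def by blast
  next
    fix P assume "P \<in> minimal_primes Q H"
    then show "primary_valuations Q (localization Q H P) (s P) (w P)" "0 < s P"
      using w fp unfolding finitely_primary_def by auto
  qed
  then show thesis by (rule that)
qed

theorem theorem5p8:
  fixes Q :: "('a, 'b) monoid_scheme" and H :: "'a set" and s :: "'a set \<Rightarrow> nat"
  assumes "is_quotient_group Q H"
    and "seminormal Q H"
    and "v_noetherian Q H"
    and "weakly_Krull Q H"
    and "conductor Q H \<noteq> {}"
    and "conductor Q H \<subset> H"
    and "\<forall>P\<in>minimal_primes Q H. finitely_primary Q (localization Q H P) (s P)"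
  shows
    "let \<pi> = (\<lambda>P. P \<inter> H);
         \<pi>_bijective =
           bij_betw \<pi> (minimal_primes Q (complete_int_closure Q H)) (minimal_primes Q H);
         I = inv_v_ideals Q H;
         M = submon Q H;
         G = v_class_group Q H
     in
       (\<pi>_bijective \<longrightarrow> catenary_degree I = 2)
       \<and>
       (\<not> \<pi>_bijective \<longrightarrow>
          (\<forall>k\<ge>2. unions_of_lengths I k = {2..}) \<and>
          delta_set I = {1} \<and>
          catenary_degree I = 3 \<and>
          adj_catenary_degree I = 3 \<and>
          ((\<exists>!P. P \<in> minimal_primes Q H \<and> s P > 1) \<longrightarrow> mon_catenary_degree I = 3) \<and>
          (\<not> (\<exists>!P. P \<in> minimal_primes Q H \<and> s P > 1) \<longrightarrow> mon_catenary_degree I = 5))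
       \<and>
       (finite (carrier G) \<and>
        (\<forall>g\<in>carrier G. \<exists>P\<in>minimal_primes Q H. \<not> conductor Q H \<subseteq> P \<and> P \<in> g) \<longrightarrow>
          (\<pi>_bijective \<longrightarrow>
             (\<forall>k\<ge>2. \<exists>a b. unions_of_lengths M k = {a..b}) \<and>
             (v_class_map Q H \<in> iso G (v_class_group Q (complete_int_closure Q H)) \<longrightarrow>
                (\<exists>\<theta>. transfer_hom M (zero_sum_sequences G) \<theta> \<and>
                      catenary_in_fibres M (zero_sum_sequences G) \<theta> \<le> 2) \<and>
                length_sets M = length_sets (zero_sum_sequences G) \<and>
                (card (carrier G) \<ge> 3 \<longrightarrow>
                   catenary_degree M = catenary_degree (zero_sum_sequences G) \<and>
                   mon_catenary_degree M = mon_catenary_degree (zero_sum_sequences G))))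
          \<and>
          (\<not> \<pi>_bijective \<longrightarrow>
             (\<forall>l\<ge>2. \<forall>k\<in>{2, 3}.
                l \<in> unions_of_lengths M k \<or> l + 1 \<in> unions_of_lengths M k) \<and>
             (\<forall>k\<ge>4. {4..} \<subseteq> unions_of_lengths M k \<and> unions_of_lengths M k \<subseteq> {2..})))"
proof -
  obtain w where "weakly_krull Q H s w" by (rule weakly_krull_exists[OF assms(1,2,4-7)])
  then interpret W: weakly_krull Q H s w .
  let ?X = "minimal_primes Q H"
  let ?I = "inv_v_ideals Q H"
  let ?M = "submon Q H"
  let ?G = "v_class_group Q H"
  let ?bij = "bij_betw (\<lambda>P. P \<inter> H) (minimal_primes Q (complete_int_closure Q H)) ?X"
  have rank_one: "?bij \<longleftrightarrow> (\<forall>P\<in>?X. s P = 1)" by (rule W.contraction_bij_iff)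
  have rank_two: "\<exists>P\<in>?X. 2 \<le> s P" if no: "\<not> ?bij"
  proof -
    obtain P where P: "P \<in> ?X" "s P \<noteq> 1" using no unfolding rank_one by blast
    then have "2 \<le> s P" using W.s_pos[OF P(1)] by linarith
    then show ?thesis using P(1) by blast
  qed
  have one: "catenary_degree ?I = 2" if bij: ?bij
  proof -
    have s1: "\<forall>P\<in>?X. s P = 1" using bij rank_one by blast
    obtain P A where "P \<in> ?X" "A \<in> W.J.atoms_at P" "A \<noteq> W.J.unif P" by (rule W.nontrivial_atom[OF s1])
    then show ?thesis by (rule W.J.catenary_degree_eq_two[OF s1])
  qed
  have two: "(\<forall>k\<ge>2. unions_of_lengths ?I k = {2..}) \<and> delta_set ?I = {1} \<and>
      catenary_degree ?I = 3 \<and> adj_catenary_degree ?I = 3 \<and>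
      ((\<exists>!P. P \<in> ?X \<and> s P > 1) \<longrightarrow> mon_catenary_degree ?I = 3) \<and>
      (\<not> (\<exists>!P. P \<in> ?X \<and> s P > 1) \<longrightarrow> mon_catenary_degree ?I = 5)" if no: "\<not> ?bij"
  proof -
    obtain P where P: "P \<in> ?X" "2 \<le> s P" using rank_two[OF no] by blast
    have three: "mon_catenary_degree ?I = 3" if ex1: "\<exists>!P. P \<in> ?X \<and> s P > 1"
    proof (rule W.J.mon_catenary_degree_eq_three[OF P])
      fix P' assume P': "P' \<in> ?X" "2 \<le> s P'"
      show "P' = P" by (rule ex1E[OF ex1]) (use P P' in \<open>metis Suc_1 Suc_le_eq\<close>)
    qed
    have five: "mon_catenary_degree ?I = 5" if nex1: "\<not> (\<exists>!P. P \<in> ?X \<and> s P > 1)"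
    proof -
      have "\<exists>P'. P' \<in> ?X \<and> 1 < s P' \<and> P \<noteq> P'"
      proof (rule ccontr)
        assume "\<not> ?thesis"
        then have "\<exists>!P. P \<in> ?X \<and> s P > 1" using P by (intro ex1I[of _ P]) auto
        then show False using nex1 by blast
      qed
      then obtain P' where P': "P' \<in> ?X" "1 < s P'" "P \<noteq> P'" by blast
      have "2 \<le> s P'" using P'(2) by simp
      then show ?thesis by (rule W.J.mon_catenary_degree_eq_five[OF P P'(1) _ P'(3)])
    qed
    show ?thesis
      using W.J.unions_of_lengths_eq[OF P] W.J.delta_set_eq[OF P] W.J.catenary_degree_eq_three[OF P]
        W.J.adj_catenary_degree_eq_three[OF P] three five by blast
  qed
  have classes: "(?bij \<longrightarrow>
             (\<forall>k\<ge>2. \<exists>a b. unions_of_lengths ?M k = {a..b}) \<and>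
             (v_class_map Q H \<in> iso ?G (v_class_group Q (complete_int_closure Q H)) \<longrightarrow>
                (\<exists>\<theta>. transfer_hom ?M (zero_sum_sequences ?G) \<theta> \<and>
                      catenary_in_fibres ?M (zero_sum_sequences ?G) \<theta> \<le> 2) \<and>
                length_sets ?M = length_sets (zero_sum_sequences ?G) \<and>
                (card (carrier ?G) \<ge> 3 \<longrightarrow>
                   catenary_degree ?M = catenary_degree (zero_sum_sequences ?G) \<and>
                   mon_catenary_degree ?M = mon_catenary_degree (zero_sum_sequences ?G))))
          \<and>
          (\<not> ?bij \<longrightarrow>
             (\<forall>l\<ge>2. \<forall>k\<in>{2, 3}.
                l \<in> unions_of_lengths ?M k \<or> l + 1 \<in> unions_of_lengths ?M k) \<and>
             (\<forall>k\<ge>4. {4..} \<subseteq> unions_of_lengths ?M k \<and> unions_of_lengths ?M k \<subseteq> {2..}))"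
    if fin: "finite (carrier ?G)" "\<forall>g\<in>carrier ?G. \<exists>P\<in>?X. \<not> conductor Q H \<subseteq> P \<and> P \<in> g"
  proof -
    interpret C: class_monoid ?I ?X s W.val ?G "v_class Q H" by (rule W.J_class_monoid[OF fin])
    let ?\<phi> = "\<lambda>h. h <#\<^bsub>Q\<^esub> H"
    note red = W.principal_reduction[OF C.K.reduced_monoid_axioms]
    note U = C.unions_of_lengths_reduction[OF red]
    have interval: "\<exists>a b. unions_of_lengths ?M k = {a..b}" if bij: ?bij for k
    proof -
      have s1: "\<forall>P\<in>?X. s P = 1" using bij rank_one by blast
      obtain a b where "{l. C.lengths_meet k l} = {a..b}" by (rule C.lengths_meet_interval[OF s1])
      then show ?thesis unfolding U by blast
    qed
    have transfer: "(\<exists>\<theta>. transfer_hom ?M (zero_sum_sequences ?G) \<theta> \<and>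
          catenary_in_fibres ?M (zero_sum_sequences ?G) \<theta> \<le> 2) \<and>
        length_sets ?M = length_sets (zero_sum_sequences ?G) \<and>
        (card (carrier ?G) \<ge> 3 \<longrightarrow>
           catenary_degree ?M = catenary_degree (zero_sum_sequences ?G) \<and>
           mon_catenary_degree ?M = mon_catenary_degree (zero_sum_sequences ?G))"
      if bij: ?bij and iso: "v_class_map Q H \<in> iso ?G (v_class_group Q (complete_int_closure Q H))"
    proof -
      have s1: "\<forall>P\<in>?X. s P = 1" using bij rank_one by blast
      have inj: "inj_on (v_class_map Q H) (carrier ?G)" using iso unfolding iso_def bij_betw_def by blast
      interpret T: trivial_unit_classes ?I ?X s W.val ?G "v_class Q H"
        by (intro trivial_unit_classes.intro trivial_unit_classes_axioms.intro C.class_monoid_axioms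
            bspec[OF s1] W.class_atoms_at[OF s1 inj])
      show ?thesis
        using T.transfer_hom_shape[OF red] T.catenary_in_fibres_le[OF red] T.length_sets_B_eq[OF red]
          T.catenary_degree_B_eq[OF red] by blast
    qed
    have short: "l \<in> unions_of_lengths ?M k \<or> l + 1 \<in> unions_of_lengths ?M k"
      if no: "\<not> ?bij" and l: "2 \<le> l" and k: "k \<in> {2, 3}" for k l
    proof -
      obtain P where P: "P \<in> ?X" "2 \<le> s P" using rank_two[OF no] by blast
      have "k = 2 \<or> k = 3" using k by simp
      from C.lengths_meet_two_or_three[OF P l this] show ?thesis unfolding U by simp
    qed
    have long: "{4..} \<subseteq> unions_of_lengths ?M k \<and> unions_of_lengths ?M k \<subseteq> {2..}"
      if no: "\<not> ?bij" and k: "4 \<le> k" for k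
    proof -
      obtain P where P: "P \<in> ?X" "2 \<le> s P" using rank_two[OF no] by blast
      show ?thesis unfolding U using C.lengths_meet_ge_four[OF P k] C.lengths_meet_ge_two[of k] k by auto
    qed
    show ?thesis using interval transfer short long by blast
  qed
  show ?thesis unfolding Let_def using one two classes by blast
qed

end
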